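(* Let $Y$ be a compact hyperbolic Riemann surface, let $y\in Y$ and $r>0$, and let $\sigma=\sigma(r,y)$ be the geodesic circle of radius $r$ centered at $y$. There exists a constant $C'_\sigma>0$ such that for every eigenfunction $\phi_i$ of the Laplace-Beltrami operator on $Y$ with $\|\phi_i\|_{L^2(Y)}=1$ and eigenvalue $\mu_i>0$, $$p^\sigma(\phi_i)=\int_\sigma|\phi_i|^2\,d\sigma\leq C'_\sigma\cdot\mu_i^{\frac16}.$$
   Context: $Y$ is a compact connected Riemann surface with a Riemannian metric of constant curvature $-1$ and volume element $dv$; $\Delta\geq 0$ is the non-negative Laplace-Beltrami operator, $\Delta\phi_i=\mu_i\phi_i$, and $\phi_i$ has norm one in $L^2(Y,dv)$. For an orthonormal basis $u_1,u_2$ of $T_yY$, the geodesic circle $\sigma(r,y)$ is the closed curve $t_\sigma(\theta)=\exp_y\big(r(\cos(2\pi\theta)u_1+\sin(2\pi\theta)u_2)\big)$, $0\le\theta<1$ (for $r$ smaller than the injectivity radius at $y$ it is the set of points at distance $r$ from $y$). Here $d\sigma$ is the line element along this parametrized curve, so $\int_\sigma f\,d\sigma=2\pi\sinh(r)\int_0^1 f(t_\sigma(\theta))\,d\theta$. *)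

theory Defs
  imports "HOL-Analysis.Analysis"
begin

text \<open>A chart is an open set together with a complex coordinate on it (irrelevant outside the set).
  A surface carries an atlas and, for every chart \<open>c\<close>, the factor \<open>\<rho> = density Y c\<close> such that the
  Riemannian metric is \<open>\<rho>(z)\<^sup>2 |dz|\<^sup>2\<close> in the coordinate \<open>z\<close> of \<open>c\<close>.\<close>

type_synonym 'a chart = "'a set \<times> ('a \<Rightarrow> complex)"

abbreviation chart_dom :: "'a chart \<Rightarrow> 'a set" where "chart_dom c \<equiv> fst c"
abbreviation coord :: "'a chart \<Rightarrow> 'a \<Rightarrow> complex" where "coord c \<equiv> snd c"
abbreviation chart_im :: "'a chart \<Rightarrow> complex set" where "chart_im c \<equiv> coord c ` chart_dom c"

definition param :: "'a chart \<Rightarrow> complex \<Rightarrow> 'a"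
  where "param c = the_inv_into (chart_dom c) (coord c)"

definition transition :: "'a chart \<Rightarrow> 'a chart \<Rightarrow> complex \<Rightarrow> complex"
  where "transition c d = coord d \<circ> param c"

record 'a surface =
  atlas :: "'a chart set"
  density :: "'a chart \<Rightarrow> complex \<Rightarrow> real"

definition charts_at :: "'a surface \<Rightarrow> 'a \<Rightarrow> 'a chart set"
  where "charts_at Y p = {c \<in> atlas Y. p \<in> chart_dom c}"

definition some_chart :: "'a surface \<Rightarrow> 'a \<Rightarrow> 'a chart"
  where "some_chart Y p = (SOME c. c \<in> charts_at Y p)"

definition partial_x :: "(complex \<Rightarrow> 'b::real_normed_vector) \<Rightarrow> complex \<Rightarrow> 'b"
  where "partial_x f z = vector_derivative (\<lambda>t. f (z + complex_of_real t)) (at 0)"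

definition partial_y :: "(complex \<Rightarrow> 'b::real_normed_vector) \<Rightarrow> complex \<Rightarrow> 'b"
  where "partial_y f z = vector_derivative (\<lambda>t. f (z + \<i> * complex_of_real t)) (at 0)"

definition flat_laplacian :: "(complex \<Rightarrow> 'b::real_normed_vector) \<Rightarrow> complex \<Rightarrow> 'b"
  where "flat_laplacian f z = partial_x (partial_x f) z + partial_y (partial_y f) z"

text \<open>The Wirtinger derivative \<open>\<partial>/\<partial>z = (\<partial>/\<partial>x - \<i> \<partial>/\<partial>y)/2\<close> of a real-valued function.\<close>

definition wirtinger :: "(complex \<Rightarrow> real) \<Rightarrow> complex \<Rightarrow> complex"
  where "wirtinger f z = (complex_of_real (partial_x f z) - \<i> * complex_of_real (partial_y f z)) / 2"

text \<open>Real differentiability of class \<open>C\<^sup>k\<close>; only meant for open sets.\<close>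

fun Ck_on :: "nat \<Rightarrow> complex set \<Rightarrow> (complex \<Rightarrow> 'b::real_normed_vector) \<Rightarrow> bool" where
  "Ck_on 0 S f \<longleftrightarrow> continuous_on S f"
| "Ck_on (Suc k) S f \<longleftrightarrow>
     (\<forall>z\<in>S. f differentiable (at z)) \<and> Ck_on k S (partial_x f) \<and> Ck_on k S (partial_y f)"

definition smooth_on :: "complex set \<Rightarrow> (complex \<Rightarrow> 'b::real_normed_vector) \<Rightarrow> bool"
  where "smooth_on S f \<longleftrightarrow> (\<forall>k. Ck_on k S f)"

text \<open>The Gaussian curvature of \<open>\<rho>\<^sup>2 |dz|\<^sup>2\<close> is \<open>- (\<Delta> ln \<rho>) / \<rho>\<^sup>2\<close> with the flat Laplacian \<open>\<Delta>\<close>.\<close>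

definition curvature :: "(complex \<Rightarrow> real) \<Rightarrow> complex \<Rightarrow> real"
  where "curvature \<rho> z = - flat_laplacian (\<lambda>w. ln (\<rho> w)) z / (\<rho> z)\<^sup>2"

locale compact_riemann_surface =
  fixes Y :: "'a::t2_space surface"
  assumes compact: "compact (UNIV :: 'a set)"
    and connected: "connected (UNIV :: 'a set)"
    and covering: "(\<Union>c\<in>atlas Y. chart_dom c) = UNIV"
    and open_dom: "c \<in> atlas Y \<Longrightarrow> open (chart_dom c)"
    and open_im: "c \<in> atlas Y \<Longrightarrow> open (chart_im c)"
    and homeo: "c \<in> atlas Y \<Longrightarrow> homeomorphism (chart_dom c) (chart_im c) (coord c) (param c)"
    and holomorphic_transition:
      "c \<in> atlas Y \<Longrightarrow> d \<in> atlas Y \<Longrightarrow>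
        transition c d holomorphic_on coord c ` (chart_dom c \<inter> chart_dom d)"

locale compact_hyperbolic_surface = compact_riemann_surface +
  assumes density_pos: "c \<in> atlas Y \<Longrightarrow> z \<in> chart_im c \<Longrightarrow> density Y c z > 0"
    and density_smooth: "c \<in> atlas Y \<Longrightarrow> smooth_on (chart_im c) (density Y c)"
    and density_transition:
      "c \<in> atlas Y \<Longrightarrow> d \<in> atlas Y \<Longrightarrow> z \<in> coord c ` (chart_dom c \<inter> chart_dom d) \<Longrightarrow>
        density Y c z = density Y d (transition c d z) * cmod (deriv (transition c d) z)"
    and curvature_minus_one:
      "c \<in> atlas Y \<Longrightarrow> z \<in> chart_im c \<Longrightarrow> curvature (density Y c) z = -1"

text \<open>The Riemannian volume is the unique Borel measure that equals \<open>\<rho>\<^sup>2 dx dy\<close> in every chart.\<close>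

definition volume_measure :: "'a::t2_space surface \<Rightarrow> 'a measure \<Rightarrow> bool"
  where "volume_measure Y dv \<longleftrightarrow> sets dv = sets borel \<and>
    (\<forall>c\<in>atlas Y. \<forall>B\<in>sets borel. B \<subseteq> chart_dom c \<longrightarrow>
      emeasure dv B =
        (\<integral>\<^sup>+ z. ennreal ((density Y c z)\<^sup>2) * indicator (coord c ` B) z \<partial>lborel))"

definition L2_norm_on :: "'a measure \<Rightarrow> ('a \<Rightarrow> complex) \<Rightarrow> real"
  where "L2_norm_on dv f = sqrt (\<integral>p. (cmod (f p))\<^sup>2 \<partial>dv)"

definition smooth_function :: "'a surface \<Rightarrow> ('a \<Rightarrow> complex) \<Rightarrow> bool"
  where "smooth_function Y f \<longleftrightarrow> (\<forall>c\<in>atlas Y. smooth_on (chart_im c) (f \<circ> param c))"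

text \<open>The non-negative operator. On a surface with conformal metric the local expression does not
  depend on the chart, so an arbitrary chart around the point is used.\<close>

definition laplace_beltrami :: "'a surface \<Rightarrow> ('a \<Rightarrow> complex) \<Rightarrow> 'a \<Rightarrow> complex"
  where "laplace_beltrami Y f p =
    (let c = some_chart Y p; z = coord c p
     in - flat_laplacian (f \<circ> param c) z / complex_of_real ((density Y c z)\<^sup>2))"

definition eigenfunction :: "'a surface \<Rightarrow> ('a \<Rightarrow> complex) \<Rightarrow> real \<Rightarrow> bool"
  where "eigenfunction Y f \<mu> \<longleftrightarrow> smooth_function Y f \<and>
    (\<exists>p. f p \<noteq> 0) \<and> (\<forall>p. laplace_beltrami Y f p = complex_of_real \<mu> * f p)"

text \<open>A tangent vector at \<open>p\<close> is given by its component in each chart around \<open>p\<close>, the components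
  being related by the derivatives of the transition maps.\<close>

definition tangent_vector :: "'a surface \<Rightarrow> 'a \<Rightarrow> ('a chart \<Rightarrow> complex) \<Rightarrow> bool"
  where "tangent_vector Y p v \<longleftrightarrow>
    (\<forall>c\<in>charts_at Y p. \<forall>d\<in>charts_at Y p.
       v d = deriv (transition c d) (coord c p) * v c)"

text \<open>The value does not depend on the chart around \<open>p\<close>.\<close>

definition tangent_inner ::
    "'a surface \<Rightarrow> 'a \<Rightarrow> ('a chart \<Rightarrow> complex) \<Rightarrow> ('a chart \<Rightarrow> complex) \<Rightarrow> real"
  where "tangent_inner Y p u v =
    (let c = some_chart Y p in (density Y c (coord c p))\<^sup>2 * (u c \<bullet> v c))"

definition orthonormal_basis ::
    "'a surface \<Rightarrow> 'a \<Rightarrow> ('a chart \<Rightarrow> complex) \<Rightarrow> ('a chart \<Rightarrow> complex) \<Rightarrow> bool"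
  where "orthonormal_basis Y p u1 u2 \<longleftrightarrow>
    tangent_vector Y p u1 \<and> tangent_vector Y p u2 \<and>
    tangent_inner Y p u1 u1 = 1 \<and> tangent_inner Y p u2 u2 = 1 \<and> tangent_inner Y p u1 u2 = 0"

definition velocity :: "(real \<Rightarrow> 'a) \<Rightarrow> real \<Rightarrow> 'a chart \<Rightarrow> complex"
  where "velocity \<gamma> t c = vector_derivative (coord c \<circ> \<gamma>) (at t)"

text \<open>The only independent Christoffel symbol of \<open>\<rho>\<^sup>2 |dz|\<^sup>2\<close> in complex notation is
  \<open>\<Gamma>\<^sup>z\<^sub>z\<^sub>z = 2 \<partial>(ln \<rho>)/\<partial>z\<close>, so the geodesic equation reads \<open>z'' + 2 \<partial>(ln \<rho>)/\<partial>z (z')\<^sup>2 = 0\<close>.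
  Geodesics are not required to have unit speed.\<close>

definition geodesic :: "'a::t2_space surface \<Rightarrow> (real \<Rightarrow> 'a) \<Rightarrow> bool"
  where "geodesic Y \<gamma> \<longleftrightarrow> continuous_on UNIV \<gamma> \<and>
    (\<forall>t. \<forall>c\<in>charts_at Y (\<gamma> t).
       (coord c \<circ> \<gamma>) differentiable (at t) \<and>
       ((\<lambda>s. velocity \<gamma> s c) has_vector_derivative
          - 2 * wirtinger (\<lambda>w. ln (density Y c w)) (coord c (\<gamma> t)) * (velocity \<gamma> t c)\<^sup>2) (at t))"

definition exp_map :: "'a::t2_space surface \<Rightarrow> 'a \<Rightarrow> ('a chart \<Rightarrow> complex) \<Rightarrow> 'a"
  where "exp_map Y p v = (THE q. \<exists>\<gamma>. geodesic Y \<gamma> \<and> \<gamma> 0 = p \<and>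
    (\<forall>c\<in>charts_at Y p. velocity \<gamma> 0 c = v c) \<and> \<gamma> 1 = q)"

definition geodesic_circle ::
    "'a::t2_space surface \<Rightarrow> real \<Rightarrow> 'a \<Rightarrow> ('a chart \<Rightarrow> complex) \<Rightarrow> ('a chart \<Rightarrow> complex) \<Rightarrow>
      real \<Rightarrow> 'a"
  where "geodesic_circle Y r y u1 u2 \<theta> =
    exp_map Y y (\<lambda>c. complex_of_real r *
      (complex_of_real (cos (2 * pi * \<theta>)) * u1 c + complex_of_real (sin (2 * pi * \<theta>)) * u2 c))"

text \<open>The integral of \<open>f\<close> with respect to the line element along a curve parametrized by \<open>[0,1]\<close>.
  On a geodesic circle of radius \<open>r\<close> in curvature \<open>-1\<close> the speed is \<open>2 \<pi> sinh r\<close>.\<close>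

definition speed :: "'a surface \<Rightarrow> (real \<Rightarrow> 'a) \<Rightarrow> real \<Rightarrow> real"
  where "speed Y \<gamma> t = sqrt (tangent_inner Y (\<gamma> t) (velocity \<gamma> t) (velocity \<gamma> t))"

definition line_integral :: "'a surface \<Rightarrow> (real \<Rightarrow> 'a) \<Rightarrow> ('a \<Rightarrow> real) \<Rightarrow> real"
  where "line_integral Y \<gamma> f = integral {0..1} (\<lambda>t. f (\<gamma> t) * speed Y \<gamma> t)"

end

theory Submission
  imports Defs "HOL-Complex_Analysis.Complex_Analysis"
begin

text \<open>The Liouville equation says that every point has a neighbourhood isometric to a piece of the
  Poincare disc; by compactness these isometries exist on discs of a uniform size, so the one at
  \<open>y\<close> continues to a local isometry \<open>\<Phi>\<close> of the whole disc into \<open>Y\<close>. It sends radii to geodesics, and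
  \<open>\<sigma>\<close> becomes a Euclidean circle. In the logarithmic polar coordinate \<open>x + \<i> y\<close> of the disc the
  eigenvalue equation for \<open>\<phi> \<circ> \<Phi>\<close> separates: the Fourier coefficients in \<open>y\<close> are bounded solutions of
  \<open>a'' = (n\<^sup>2 - \<mu> / sinh\<^sup>2 x) a\<close> on \<open>x < 0\<close>. The worst case is a turning point at the radius of
  \<open>\<sigma>\<close>, where the solution behaves like an Airy function at scale \<open>\<mu>\<^sup>-\<^sup>1\<^sup>/\<^sup>3\<close>; uniformly in \<open>n\<close>
  one gets \<open>\<bar>a(x\<^sub>0)\<bar>\<^sup>2 \<le> C \<mu>\<^sup>1\<^sup>/\<^sup>6 \<integral> \<bar>a\<bar>\<^sup>2\<close> over a fixed interval. Summing over \<open>n\<close> by Parseval on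
  \<open>\<sigma>\<close> and by Bessel on the annulus bounds \<open>p\<^sup>\<sigma>(\<phi>)\<close> by the \<open>L\<^sup>2\<close> norm of \<open>\<phi> \<circ> \<Phi>\<close> on a compact set,
  hence by that of \<open>\<phi>\<close>. The ODE estimate needs \<open>\<mu>\<close> bounded away from zero, which follows from a Harnack
  argument: for small \<open>\<mu>\<close> an eigenfunction normalized to have maximum 1 is positive, which is impossible
  at its minimum.\<close>

section \<open>Wirtinger calculus for smooth functions\<close>

text \<open>On the disc the circle is always embedded; the price is that the lift counts parts of
  \<open>Y\<close> several times, and this multiplicity is absorbed by the constant of a measure
  comparison over a compact annulus. The exponent comes from a single mode: with Q ~ \<mu> (x - x1)
  near a turning point, the equation a'' = - Q a has natural length \<mu>^(-1/3), so Q ~ \<mu>^(2/3)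
  there, and the WKB amplitude |a|^2 ~ Q^(-1/2) is \<mu>^(-1/3), against \<mu>^(-1/2) in the
  oscillating region; the quotient is \<mu>^(1/6). To see this without special functions one needs
  an energy that stays monotone across the Airy zone. Uniformity in the angular frequency is
  essential, because the modes are added afterwards. The radial reduction serves three times: mode n
  for the main estimate, mode 0 for mean values, mode 1 for a gradient bound; the last two carry the
  Harnack argument. A change of \<open>u1\<close>, \<open>u2\<close> only rotates or reflects the
  angle, so one constant serves all bases.\<close>

lemma partial_x_eq:
  assumes "(f has_derivative D) (at z)"
  shows "partial_x f z = D 1"
proof -
  have "((\<lambda>t::real. z + complex_of_real t) has_derivative (\<lambda>t. complex_of_real t)) (at 0)"
    by (auto intro!: derivative_eq_intros)
  from has_derivative_compose[OF this, of f D] assms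
  have *: "((\<lambda>t. f (z + complex_of_real t)) has_derivative (\<lambda>t. D (complex_of_real t))) (at 0)" by simp
  interpret bounded_linear D using assms by (rule has_derivative_bounded_linear)
  have "(\<lambda>t. D (complex_of_real t)) = (\<lambda>t. t *\<^sub>R D 1)"
    by (simp add: of_real_def scaleR)
  with * show ?thesis unfolding partial_x_def
    by (intro vector_derivative_at) (simp add: has_vector_derivative_def)
qed

lemma partial_y_eq:
  assumes "(f has_derivative D) (at z)"
  shows "partial_y f z = D \<i>"
proof -
  have "((\<lambda>t::real. z + \<i> * complex_of_real t) has_derivative (\<lambda>t. \<i> * complex_of_real t)) (at 0)"
    by (auto intro!: derivative_eq_intros)
  from has_derivative_compose[OF this, of f D] assms
  have *: "((\<lambda>t. f (z + \<i> * complex_of_real t)) has_derivative (\<lambda>t. D (\<i> * complex_of_real t))) (at 0)" by simp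
  interpret bounded_linear D using assms by (rule has_derivative_bounded_linear)
  have "(\<lambda>t. D (\<i> * complex_of_real t)) = (\<lambda>t. t *\<^sub>R D \<i>)"
    by (metis (no_types, lifting) mult.commute of_real_def scaleR scaleR_conv_of_real)
  with * show ?thesis unfolding partial_y_def
    by (intro vector_derivative_at) (simp add: has_vector_derivative_def)
qed

lemma has_derivative_partials:
  assumes "f differentiable (at z)"
  shows "(f has_derivative (\<lambda>h. Re h *\<^sub>R partial_x f z + Im h *\<^sub>R partial_y f z)) (at z)"
proof -
  obtain D where D: "(f has_derivative D) (at z)" using assms unfolding differentiable_def by blast
  interpret bounded_linear D using D by (rule has_derivative_bounded_linear)
  have "D h = Re h *\<^sub>R D 1 + Im h *\<^sub>R D \<i>" for h
  proof -
    have "h = Re h *\<^sub>R 1 + Im h *\<^sub>R \<i>" by (simp add: complex_eq_iff)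
    then show ?thesis by (metis add scaleR)
  qed
  then have "D = (\<lambda>h. Re h *\<^sub>R D 1 + Im h *\<^sub>R D \<i>)" by blast
  with D show ?thesis by (simp add: partial_x_eq[OF D] partial_y_eq[OF D])
qed

section \<open>Locality and closure properties of C^k functions on open sets\<close>

text \<open>\<open>partial_x\<close> and \<open>partial_y\<close> are total functions built on
  \<open>vector_derivative\<close>, so expressions known only on an open set, such as local
  coordinate expressions, have to be compared through their germs.\<close>

lemma vector_derivative_cong_open:
  fixes f g :: "complex \<Rightarrow> 'b::real_normed_vector"
  assumes "open S" "z \<in> S" "\<And>w. w \<in> S \<Longrightarrow> f w = g w" "isCont k (0::real)" "k 0 = z"
  shows "vector_derivative (\<lambda>t. f (k t)) (at 0) = vector_derivative (\<lambda>t. g (k t)) (at 0)"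
proof (rule vector_derivative_cong_eq)
  have "eventually (\<lambda>w. w \<in> S) (nhds z)" using assms by (simp add: eventually_nhds_in_open)
  then have "eventually (\<lambda>t. k t \<in> S) (nhds 0)"
    using assms(4,5) unfolding isCont_def tendsto_at_iff_tendsto_nhds by (auto simp: filterlim_iff)
  then show "\<forall>\<^sub>F x in nhds 0. x \<in> UNIV \<longrightarrow> f (k x) = g (k x)"
    by eventually_elim (use assms(3) in auto)
qed (auto)

lemma partial_cong_open:
  assumes "open S" "z \<in> S" "\<And>w. w \<in> S \<Longrightarrow> f w = g w"
  shows "partial_x f z = partial_x g z" "partial_y f z = partial_y g z"
  unfolding partial_x_def partial_y_def
  by (rule vector_derivative_cong_open[OF assms]; auto intro!: continuous_intros)+

lemma Ck_on_cong:
  assumes "open S" "\<And>w. w \<in> S \<Longrightarrow> f w = g w" "Ck_on k S f"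
  shows "Ck_on k S g"
  using assms(2,3)
proof (induction k arbitrary: f g)
  case 0
  then show ?case by (simp cong: continuous_on_cong)
next
  case (Suc k)
  have "g differentiable (at z)" if "z \<in> S" for z
  proof -
    have "f differentiable (at z)" using Suc.prems(2) that by simp
    then obtain D where "(f has_derivative D) (at z)" unfolding differentiable_def by blast
    then have "(g has_derivative D) (at z)"
      using has_derivative_transform_within_open[OF _ assms(1) that Suc.prems(1)] by auto
    then show ?thesis unfolding differentiable_def by blast
  qed
  then show ?case using Suc.prems partial_cong_open[OF assms(1) _ Suc.prems(1)]
     Suc.IH[of "partial_x f" "partial_x g"] Suc.IH[of "partial_y f" "partial_y g"] by auto
qed

lemma Ck_on_imp_continuous: "Ck_on k S f \<Longrightarrow> continuous_on S f"
proof (cases k)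
  case (Suc j)
  assume "Ck_on k S f"
  then have "\<forall>z\<in>S. f differentiable (at z)" using Suc by simp
  then show ?thesis
    by (simp add: differentiable_imp_continuous_on differentiable_on_def differentiable_at_withinI)
qed simp

lemma Ck_on_Suc_imp: "Ck_on (Suc k) S f \<Longrightarrow> Ck_on k S f"
proof (induction k arbitrary: f)
  case 0
  show ?case using Ck_on_imp_continuous[OF 0] by simp
next
  case (Suc k)
  have d: "\<forall>z\<in>S. f differentiable (at z)" and "Ck_on (Suc k) S (partial_x f)" "Ck_on (Suc k) S (partial_y f)"
    using Suc.prems by simp_all
  then have "Ck_on k S (partial_x f)" "Ck_on k S (partial_y f)" by (blast intro: Suc.IH)+
  with d show ?case unfolding Ck_on.simps by blast
qed

lemma Ck_on_subset: "Ck_on k S f \<Longrightarrow> T \<subseteq> S \<Longrightarrow> Ck_on k T f"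
  by (induction k arbitrary: f) (auto intro: continuous_on_subset)

lemma Ck_on_differentiable: "Ck_on k S f \<Longrightarrow> k > 0 \<Longrightarrow> z \<in> S \<Longrightarrow> f differentiable (at z)"
  by (cases k) auto

text \<open>The induction step shared by the closure lemmas below: once a derivative is exhibited,
  C^(k+1) reduces to C^k for its values at \<open>1\<close> and \<open>\<i>\<close>, which are the
  partial derivatives.\<close>

lemma Ck_on_SucI:
  assumes "open S" "\<And>z. z \<in> S \<Longrightarrow> (f has_derivative D z) (at z)"
    "Ck_on k S (\<lambda>z. D z 1)" "Ck_on k S (\<lambda>z. D z \<i>)"
  shows "Ck_on (Suc k) S f"
  using assms(2) partial_x_eq[OF assms(2)] partial_y_eq[OF assms(2)]
    Ck_on_cong[OF assms(1) _ assms(3), of "partial_x f"] Ck_on_cong[OF assms(1) _ assms(4), of "partial_y f"]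
  by (auto simp: differentiable_def)

lemma Ck_on_const: "Ck_on k S (\<lambda>_. c)"
proof (induction k arbitrary: c)
  case (Suc k)
  have "partial_x (\<lambda>_::complex. c) = (\<lambda>_. 0)" "partial_y (\<lambda>_::complex. c) = (\<lambda>_. 0)"
    by (rule ext; subst partial_x_eq partial_y_eq, rule has_derivative_const, simp)+
  then show ?case using Suc[of 0] by simp
qed simp

lemma Ck_on_add:
  assumes "open S" "Ck_on k S f" "Ck_on k S g"
  shows "Ck_on k S (\<lambda>z. f z + g z)"
  using assms(2,3)
proof (induction k arbitrary: f g)
  case (Suc k)
  show ?case
    by (rule Ck_on_SucI[OF assms(1) has_derivative_add[OF has_derivative_partials has_derivative_partials]])
      (use Suc in auto)
qed (auto intro: continuous_intros)

text \<open>The product rule expresses the partial derivatives by the same bilinear form, with one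
  factor differentiated and the other weakened to C^k. One induction then covers products and scalar
  multiples alike.\<close>

lemma Ck_on_bilinear:
  assumes "open S" "bounded_bilinear B" "Ck_on k S f" "Ck_on k S g"
  shows "Ck_on k S (\<lambda>z. B (f z) (g z))"
  using assms(3,4)
proof (induction k arbitrary: f g)
  case 0
  then show ?case using bounded_bilinear.continuous_on[OF assms(2)] by simp
next
  case (Suc k)
  note fg = Suc.prems[THEN Ck_on_Suc_imp]
  interpret bounded_bilinear B by fact
  show ?case
    by (rule Ck_on_SucI[OF assms(1) FDERIV[OF has_derivative_partials has_derivative_partials]])
      (use Suc fg in \<open>auto intro!: Ck_on_add[OF assms(1)]\<close>)
qed

lemmas Ck_on_mult = Ck_on_bilinear[OF _ bounded_bilinear_mult]
lemmas Ck_on_scaleR = Ck_on_bilinear[OF _ bounded_bilinear_scaleR]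

lemma Ck_on_linear:
  assumes "open S" "bounded_linear L" "Ck_on k S f"
  shows "Ck_on k S (\<lambda>z. L (f z))"
  using assms(3)
proof (induction k arbitrary: f)
  case 0
  then show ?case using bounded_linear.continuous_on[OF assms(2)] by simp
next
  case (Suc k)
  interpret bounded_linear L by fact
  show ?case
    by (rule Ck_on_SucI[OF assms(1) has_derivative[OF has_derivative_partials]])
      (use Suc in auto)
qed

lemma Ck_on_diff:
  fixes f :: "complex \<Rightarrow> 'b::real_normed_vector"
  assumes "open S" "Ck_on k S f" "Ck_on k S g"
  shows "Ck_on k S (\<lambda>z. f z - g z)"
  using Ck_on_add[OF assms(1,2) Ck_on_linear[OF assms(1) bounded_linear_minus[OF bounded_linear_ident] assms(3)]] by simp

lemma Ck_on_holomorphic: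
  assumes "open S" "f holomorphic_on S"
  shows "Ck_on k S f"
  using assms(2)
proof (induction k arbitrary: f)
  case 0
  then show ?case by (simp add: holomorphic_on_imp_continuous_on)
next
  case (Suc k)
  have d: "(f has_derivative (*) (deriv f z)) (at z)" if "z \<in> S" for z
    using holomorphic_derivI[OF Suc.prems assms(1) that] by (simp add: has_field_derivative_def)
  have "deriv f holomorphic_on S" using Suc.prems assms(1) by (rule holomorphic_deriv)
  then show ?case
    by (intro Ck_on_SucI[OF assms(1) d]) (auto intro!: Suc.IH holomorphic_intros)
qed

text \<open>By the chain rule the partial derivatives are those of \<open>f\<close>, again composed
  with \<open>h\<close>, with coefficients the real and imaginary parts of multiples of
  \<open>deriv h\<close>. The induction hypothesis handles the former, holomorphy the
  latter.\<close>

lemma Ck_on_compose_holomorphic: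
  fixes f :: "complex \<Rightarrow> 'b::real_normed_vector"
  assumes S: "open S" and T: "open T" and h: "h holomorphic_on S" and sub: "h ` S \<subseteq> T" and f: "Ck_on k T f"
  shows "Ck_on k S (\<lambda>z. f (h z))"
  using f
proof (induction k arbitrary: f)
  case 0
  have "continuous_on S h" using h by (rule holomorphic_on_imp_continuous_on)
  then show ?case using 0 continuous_on_compose2[OF _ _ sub] by auto
next
  case (Suc k)
  have dh: "(h has_derivative (*) (deriv h z)) (at z)" if "z \<in> S" for z
    using holomorphic_derivI[OF h S that] by (simp add: has_field_derivative_def)
  have df: "((\<lambda>z. f (h z)) has_derivative (\<lambda>w. Re (deriv h z * w) *\<^sub>R partial_x f (h z) + Im (deriv h z * w) *\<^sub>R partial_y f (h z))) (at z)"
    if "z \<in> S" for z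
    by (rule has_derivative_compose[OF dh[OF that] has_derivative_partials]) (use Suc.prems sub that in auto)
  have "deriv h holomorphic_on S" using h S by (rule holomorphic_deriv)
  then have c: "Ck_on k S (\<lambda>z. deriv h z * c)" for c
    by (intro Ck_on_holomorphic[OF S] holomorphic_on_mult holomorphic_on_const)
  note c1 = Ck_on_linear[OF S bounded_linear_Re c] Ck_on_linear[OF S bounded_linear_Im c]
  have p: "Ck_on k S (\<lambda>z. partial_x f (h z))" "Ck_on k S (\<lambda>z. partial_y f (h z))"
    using Suc.prems by (auto intro: Suc.IH)
  show ?case
    by (rule Ck_on_SucI[OF S df]; (assumption | intro Ck_on_add[OF S] Ck_on_scaleR[OF S] c1 p))
qed

text \<open>The derivative is again built from \<open>inverse (f z)\<close>, only one order of
  smoothness lower, so the induction runs on \<open>k\<close> alone with \<open>f\<close>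
  fixed.\<close>

lemma Ck_on_inverse:
  fixes f :: "complex \<Rightarrow> real"
  assumes S: "open S" and nz: "\<And>z. z \<in> S \<Longrightarrow> f z \<noteq> 0" and f: "Ck_on k S f"
  shows "Ck_on k S (\<lambda>z. inverse (f z))"
  using f
proof (induction k)
  case 0
  then show ?case using nz by (auto intro!: continuous_intros)
next
  case (Suc k)
  have IH: "Ck_on k S (\<lambda>z. inverse (f z))" using Suc Ck_on_Suc_imp by blast
  have d: "((\<lambda>z. inverse (f z)) has_derivative (\<lambda>h. (Re h *\<^sub>R partial_x f z + Im h *\<^sub>R partial_y f z) * (- (inverse (f z) * inverse (f z))))) (at z)" if "z \<in> S" for z
    by (rule has_derivative_eq_rhs[OF Deriv.has_derivative_inverse[where f=f, OF nz[OF that] has_derivative_partials]])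
      (use Suc.prems that in \<open>auto simp: mult_ac fun_eq_iff\<close>)
  have "Ck_on k S (\<lambda>z. partial_x f z * (- (inverse (f z) * inverse (f z))))"
    "Ck_on k S (\<lambda>z. partial_y f z * (- (inverse (f z) * inverse (f z))))"
    using Suc.prems by (auto intro!: Ck_on_mult[OF S] IH Ck_on_linear[OF S bounded_linear_minus[OF bounded_linear_ident]])
  then show ?case by (intro Ck_on_SucI[OF S d]) auto
qed

lemma Ck_on_ln:
  fixes f :: "complex \<Rightarrow> real"
  assumes S: "open S" and nz: "\<And>z. z \<in> S \<Longrightarrow> f z > 0" and f: "Ck_on k S f"
  shows "Ck_on k S (\<lambda>z. ln (f z))"
proof (cases k)
  case 0
  have "f z \<noteq> 0" if "z \<in> S" for z using nz[OF that] by simp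
  with 0 show ?thesis using f by (auto intro!: continuous_intros)
next
  case (Suc j)
  have I: "Ck_on j S (\<lambda>z. inverse (f z))" using f Suc Ck_on_Suc_imp nz
    by (intro Ck_on_inverse[OF S]) force+
  have d: "((\<lambda>z. ln (f z)) has_derivative (\<lambda>h. (Re h *\<^sub>R partial_x f z + Im h *\<^sub>R partial_y f z) * inverse (f z))) (at z)" if "z \<in> S" for z
    by (rule has_derivative_eq_rhs[OF has_derivative_ln[where g=f, OF nz[OF that] has_derivative_partials]])
      (use f Suc that in \<open>auto simp: mult_ac\<close>)
  show ?thesis unfolding Suc
    by (rule Ck_on_SucI[OF S d]) (use f Suc in \<open>auto intro!: Ck_on_mult[OF S] I\<close>)
qed

section \<open>Symmetry of second derivatives\<close>

lemma clairaut_real: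
  fixes f :: "complex \<Rightarrow> real"
  assumes S: "open S" and z: "z \<in> S" and f: "Ck_on 2 S f"
  shows "partial_x (partial_y f) z = partial_y (partial_x f) z"
proof -
  have f2: "Ck_on (Suc (Suc 0)) S f" using f by (simp add: numeral_2_eq_2)
  let ?a = "partial_x (partial_y f)" and ?b = "partial_y (partial_x f)"
  obtain e where e: "e > 0" "ball z e \<subseteq> S" using S z openE by blast
  have dx: "((\<lambda>t. g (w + complex_of_real t)) has_real_derivative partial_x g (w + of_real t)) (at t)"
    if "g differentiable (at (w + of_real t))" for g :: "complex \<Rightarrow> real" and w t
  proof -
    have "((\<lambda>t::real. w + complex_of_real t) has_derivative (\<lambda>t. complex_of_real t)) (at t)"
      by (auto intro!: derivative_eq_intros)
    from has_derivative_compose[OF this has_derivative_partials[OF that]]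
    show ?thesis by (simp add: has_field_derivative_def mult_commute_abs)
  qed
  have dy: "((\<lambda>t. g (w + \<i> * complex_of_real t)) has_real_derivative partial_y g (w + \<i> * of_real t)) (at t)"
    if "g differentiable (at (w + \<i> * of_real t))" for g :: "complex \<Rightarrow> real" and w t
  proof -
    have "((\<lambda>t::real. w + \<i> * complex_of_real t) has_derivative (\<lambda>t. \<i> * complex_of_real t)) (at t)"
      by (auto intro!: derivative_eq_intros)
    from has_derivative_compose[OF this has_derivative_partials[OF that]]
    show ?thesis by (simp add: has_field_derivative_def mult_commute_abs)
  qed
  have inS: "z + of_real p + \<i> * of_real q \<in> S" if "0 \<le> p" "p \<le> s" "0 \<le> q" "q \<le> s" "s < e/2" for p q s
  proof -
    have "norm (complex_of_real p + \<i> * of_real q) \<le> norm (complex_of_real p) + norm (\<i> * complex_of_real q)" by (rule norm_triangle_ineq)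
    also have "... < e" using that by (simp add: norm_mult)
    finally have "dist z (z + of_real p + \<i> * of_real q) < e" by (metis add.assoc add_diff_cancel_left' dist_commute dist_norm)
    then show ?thesis using e by auto
  qed
  have inS2: "z + of_real p \<in> S" "z + \<i> * of_real p \<in> S" "z + \<i> * of_real q + of_real p \<in> S"
    if "0 \<le> p" "p \<le> s" "0 \<le> q" "q \<le> s" "s < e/2" for p q s
    using inS[of p s q] inS[of p s 0] inS[of 0 s p] that by (auto simp: add_ac)
  have diff: "g differentiable (at w)" if "w \<in> S" "g \<in> {f, partial_x f, partial_y f}" for g w
    using f2 that by auto
  \<comment> \<open>The second difference over a square of side \<open>s\<close> is evaluated by the
    mean value theorem in both orders of the variables. Each order yields a value of one mixed
    derivative somewhere in the square; continuity at \<open>z\<close> then lets \<open>s\<close>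
    tend to 0.\<close>
  have key: "\<exists>p q p' q'. 0 < p \<and> p < s \<and> 0 < q \<and> q < s \<and> 0 < p' \<and> p' < s \<and> 0 < q' \<and> q' < s \<and>
      ?b (z + of_real p + \<i> * of_real q) = ?a (z + of_real p' + \<i> * of_real q')" if s: "0 < s" "s < e/2" for s
  proof -
    define A where "A = f (z + of_real s + \<i> * of_real s) - f (z + of_real s) - f (z + \<i> * of_real s) + f z"
    have "\<exists>p. 0 < p \<and> p < s \<and> ((\<lambda>t. f ((z + \<i> * of_real s) + of_real t) - f (z + of_real t)) s - (\<lambda>t. f ((z + \<i> * of_real s) + of_real t) - f (z + of_real t)) 0 = (s - 0) * (partial_x f ((z + \<i> * of_real s) + of_real p) - partial_x f (z + of_real p)))"
      by (rule MVT2[OF s(1)]; intro DERIV_diff dx diff inS2[of _ s s]; use s in simp)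
    then obtain p where p: "0 < p" "p < s" "A = s * (partial_x f ((z + of_real p) + \<i> * of_real s) - partial_x f (z + of_real p))"
      unfolding A_def by (auto simp: algebra_simps)
    have "\<exists>q. 0 < q \<and> q < s \<and> ((\<lambda>t. partial_x f ((z + of_real p) + \<i> * of_real t)) s - (\<lambda>t. partial_x f ((z + of_real p) + \<i> * of_real t)) 0 = (s - 0) * ?b ((z + of_real p) + \<i> * of_real q))"
      by (rule MVT2[OF s(1)]; intro dy diff inS[of _ s]; use s p in simp)
    then obtain q where q: "0 < q" "q < s" "A = s * (s * ?b ((z + of_real p) + \<i> * of_real q))"
      using p by auto
    have "\<exists>p. 0 < p \<and> p < s \<and> ((\<lambda>t. f ((z + of_real s) + \<i> * of_real t) - f (z + \<i> * of_real t)) s - (\<lambda>t. f ((z + of_real s) + \<i> * of_real t) - f (z + \<i> * of_real t)) 0 = (s - 0) * (partial_y f ((z + of_real s) + \<i> * of_real p) - partial_y f (z + \<i> * of_real p)))"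
      by (rule MVT2[OF s(1)]; intro DERIV_diff dy diff inS[of _ s] inS2[of _ s s]; use s in simp)
    then obtain q' where q': "0 < q'" "q' < s" "A = s * (partial_y f ((z + \<i> * of_real q') + of_real s) - partial_y f (z + \<i> * of_real q'))"
      unfolding A_def by (auto simp: algebra_simps)
    have "\<exists>q. 0 < q \<and> q < s \<and> ((\<lambda>t. partial_y f ((z + \<i> * of_real q') + of_real t)) s - (\<lambda>t. partial_y f ((z + \<i> * of_real q') + of_real t)) 0 = (s - 0) * ?a ((z + \<i> * of_real q') + of_real q))"
      by (rule MVT2[OF s(1)]; intro dx diff inS2[of _ s]; use s q' in simp)
    then obtain p' where p': "0 < p'" "p' < s" "A = s * (s * ?a ((z + \<i> * of_real q') + of_real p'))"
      using q' by auto
    have "?b (z + of_real p + \<i> * of_real q) = ?a (z + of_real p' + \<i> * of_real q')"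
      using q(3) p'(3) s by (simp add: add_ac)
    with p(1,2) q(1,2) p'(1,2) q'(1,2) show ?thesis by blast
  qed
  have ca: "isCont ?a z" and cb: "isCont ?b z" using f2 S z by (auto simp: continuous_on_eq_continuous_at)
  have "\<bar>?a z - ?b z\<bar> < \<epsilon>" if eps: "\<epsilon> > 0" for \<epsilon>
  proof -
    obtain d1 where d1: "d1 > 0" "\<And>w. dist w z < d1 \<Longrightarrow> dist (?a w) (?a z) < \<epsilon>/2"
      using ca half_gt_zero[OF eps] unfolding continuous_at_eps_delta by blast
    obtain d2 where d2: "d2 > 0" "\<And>w. dist w z < d2 \<Longrightarrow> dist (?b w) (?b z) < \<epsilon>/2"
      using cb half_gt_zero[OF eps] unfolding continuous_at_eps_delta by blast
    define s where "s = min (e/4) (min (d1/2) (d2/2))"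
    have s: "0 < s" "s < e/2" using e d1 d2 by (auto simp: s_def)
    obtain p q p' q' where pq: "0 < p" "p < s" "0 < q" "q < s" "0 < p'" "p' < s" "0 < q'" "q' < s"
      "?b (z + of_real p + \<i> * of_real q) = ?a (z + of_real p' + \<i> * of_real q')" using key[OF s] by blast
    have nn: "dist (z + of_real p + \<i> * of_real q) z < 2 * s" if "0 < p" "p < s" "0 < q" "q < s" for p q
    proof -
      have "norm (complex_of_real p + \<i> * of_real q) \<le> norm (complex_of_real p) + norm (\<i> * complex_of_real q)" by (rule norm_triangle_ineq)
      also have "... < 2 * s" using that by (simp add: norm_mult)
      finally show ?thesis by (simp add: dist_norm algebra_simps)
    qed
    have "dist (?a (z + of_real p' + \<i> * of_real q')) (?a z) < \<epsilon>/2"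
      by (rule d1) (use nn[of p' q'] pq s_def in auto)
    moreover have "dist (?b (z + of_real p + \<i> * of_real q)) (?b z) < \<epsilon>/2"
      by (rule d2) (use nn[of p q] pq s_def in auto)
    ultimately show ?thesis using pq(9) unfolding dist_real_def by linarith
  qed
  then show ?thesis by (metis abs_le_zero_iff eq_iff_diff_eq_0 not_less order_less_irrefl zero_less_abs_iff)
qed

section \<open>Wirtinger derivatives, and the Laplacian under holomorphic maps\<close>

definition dz :: "(complex \<Rightarrow> complex) \<Rightarrow> complex \<Rightarrow> complex"
  where "dz f z = (partial_x f z - \<i> * partial_y f z) / 2"

definition dzb :: "(complex \<Rightarrow> complex) \<Rightarrow> complex \<Rightarrow> complex"
  where "dzb f z = (partial_x f z + \<i> * partial_y f z) / 2"

text \<open>The real derivative in the form \<open>a * h + b * cnj h\<close>: sum, product and chain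
  rules become complex algebra, and \<open>b = 0\<close> is the Cauchy-Riemann equation.\<close>

definition has_wirtinger :: "(complex \<Rightarrow> complex) \<Rightarrow> complex \<Rightarrow> complex \<Rightarrow> complex \<Rightarrow> bool"
  where "has_wirtinger f a b z \<longleftrightarrow> (f has_derivative (\<lambda>h. a * h + b * cnj h)) (at z)"

lemma has_wirtingerI:
  assumes "f differentiable (at z)"
  shows "has_wirtinger f (dz f z) (dzb f z) z"
  unfolding has_wirtinger_def
  by (rule has_derivative_eq_rhs[OF has_derivative_partials[OF assms]])
    (auto simp: dz_def dzb_def fun_eq_iff complex_eq_iff field_simps)

lemma has_wirtinger_partials:
  assumes "has_wirtinger f a b z"
  shows "partial_x f z = a + b" "partial_y f z = \<i> * (a - b)"
  using assms partial_x_eq partial_y_eq unfolding has_wirtinger_def by (force simp: algebra_simps)+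

lemma has_wirtinger_unique:
  assumes "has_wirtinger f a b z"
  shows "dz f z = a" "dzb f z = b"
  using has_wirtinger_partials[OF assms] by (auto simp: dz_def dzb_def complex_eq_iff field_simps)

lemma has_wirtinger_add: "has_wirtinger f a b z \<Longrightarrow> has_wirtinger g c d z \<Longrightarrow>
    has_wirtinger (\<lambda>z. f z + g z) (a + c) (b + d) z"
  unfolding has_wirtinger_def by (drule (1) has_derivative_add) (simp add: algebra_simps)

lemma has_wirtinger_diff: "has_wirtinger f a b z \<Longrightarrow> has_wirtinger g c d z \<Longrightarrow>
    has_wirtinger (\<lambda>z. f z - g z) (a - c) (b - d) z"
  unfolding has_wirtinger_def by (drule (1) has_derivative_diff) (simp add: algebra_simps)

lemma has_wirtinger_mult: "has_wirtinger f a b z \<Longrightarrow> has_wirtinger g c d z \<Longrightarrow>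
    has_wirtinger (\<lambda>z. f z * g z) (a * g z + f z * c) (b * g z + f z * d) z"
  unfolding has_wirtinger_def by (drule (1) has_derivative_mult) (simp add: algebra_simps)

lemma has_wirtinger_cnj: "has_wirtinger f a b z \<Longrightarrow> has_wirtinger (\<lambda>z. cnj (f z)) (cnj b) (cnj a) z"
  unfolding has_wirtinger_def by (drule has_derivative_cnj) (simp add: algebra_simps)

lemma has_wirtinger_field: "(f has_field_derivative a) (at z) \<Longrightarrow> has_wirtinger f a 0 z"
  unfolding has_wirtinger_def has_field_derivative_def by simp

lemma has_wirtinger_imp_field: "has_wirtinger f a 0 z \<Longrightarrow> (f has_field_derivative a) (at z)"
  unfolding has_wirtinger_def has_field_derivative_def by simp

lemma has_wirtinger_const: "has_wirtinger (\<lambda>_. c) 0 0 z"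
  by (simp add: has_wirtinger_field)

lemma has_wirtinger_compose_field:
  assumes "(h has_field_derivative d) (at z)" "has_wirtinger f a b (h z)"
  shows "has_wirtinger (\<lambda>z. f (h z)) (a * d) (b * cnj d) z"
  using has_derivative_compose[of h "(*) d" z UNIV f "\<lambda>h. a * h + b * cnj h"] assms
  unfolding has_wirtinger_def has_field_derivative_def by (simp add: mult_ac)

lemma has_wirtinger_cong_open:
  assumes "open S" "z \<in> S" "\<And>w. w \<in> S \<Longrightarrow> f w = g w" "has_wirtinger f a b z"
  shows "has_wirtinger g a b z"
  using has_derivative_transform_within_open[OF assms(4)[unfolded has_wirtinger_def] assms(1,2,3)] by (simp add: has_wirtinger_def)

lemma dz_cong_open:
  assumes "open S" "z \<in> S" "\<And>w. w \<in> S \<Longrightarrow> f w = g w"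
  shows "dz f z = dz g z" "dzb f z = dzb g z"
  using partial_cong_open[OF assms] by (simp_all add: dz_def dzb_def)

lemma Ck_on_dz:
  assumes "open S" "Ck_on (Suc k) S f"
  shows "Ck_on k S (dz f)" "Ck_on k S (dzb f)"
proof -
  have "Ck_on k S (\<lambda>z. (1/2) * (partial_x f z - \<i> * partial_y f z))"
    "Ck_on k S (\<lambda>z. (1/2) * (partial_x f z + \<i> * partial_y f z))"
    using assms(2) by (intro Ck_on_mult[OF assms(1)] Ck_on_add[OF assms(1)] Ck_on_diff[OF assms(1)] Ck_on_const; simp)+
  moreover have "dz f = (\<lambda>z. (1/2) * (partial_x f z - \<i> * partial_y f z))"
    "dzb f = (\<lambda>z. (1/2) * (partial_x f z + \<i> * partial_y f z))" by (auto simp: dz_def dzb_def fun_eq_iff)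
  ultimately show "Ck_on k S (dz f)" "Ck_on k S (dzb f)" by simp_all
qed

lemma partial_linear:
  assumes "bounded_linear L" "f differentiable (at z)"
  shows "partial_x (\<lambda>z. L (f z)) z = L (partial_x f z)" "partial_y (\<lambda>z. L (f z)) z = L (partial_y f z)"
  using partial_x_eq[OF bounded_linear.has_derivative[OF assms(1) has_derivative_partials[OF assms(2)]]]
    partial_y_eq[OF bounded_linear.has_derivative[OF assms(1) has_derivative_partials[OF assms(2)]]] by simp_all

text \<open>Reduced to the real case by composing with \<open>Re\<close> and \<open>Im\<close>,
  which commute with partial derivatives.\<close>

lemma clairaut:
  fixes f :: "complex \<Rightarrow> complex"
  assumes S: "open S" and z: "z \<in> S" and f: "Ck_on 2 S f"
  shows "partial_x (partial_y f) z = partial_y (partial_x f) z"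
proof -
  have f2: "Ck_on (Suc (Suc 0)) S f" using f by (simp add: numeral_2_eq_2)
  have *: "L (partial_x (partial_y f) z) = L (partial_y (partial_x f) z)" if L: "bounded_linear (L :: complex \<Rightarrow> real)" for L
  proof -
    have "L (partial_x (partial_y f) z) = partial_x (\<lambda>z. L (partial_y f z)) z"
      using f2 z by (subst partial_linear[OF L]) auto
    also have "\<dots> = partial_x (partial_y (\<lambda>z. L (f z))) z"
      by (rule partial_cong_open[OF S z]) (use f2 partial_linear[OF L] in auto)
    also have "\<dots> = partial_y (partial_x (\<lambda>z. L (f z))) z"
      by (rule clairaut_real[OF S z Ck_on_linear[OF S L f]])
    also have "\<dots> = partial_y (\<lambda>z. L (partial_x f z)) z"
      by (rule partial_cong_open[OF S z]) (use f2 partial_linear[OF L] in auto)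
    also have "\<dots> = L (partial_y (partial_x f) z)"
      using f2 z by (subst partial_linear[OF L]) auto
    finally show ?thesis .
  qed
  show ?thesis using *[OF bounded_linear_Re] *[OF bounded_linear_Im] by (simp add: complex_eq_iff)
qed

text \<open>Expanding the two first-order operators leaves the mixed derivatives with opposite
  signs, and these cancel by symmetry.\<close>

lemma dz_dzb_flat_laplacian:
  assumes S: "open S" and z: "z \<in> S" and f: "Ck_on 2 S f"
  shows "dz (dzb f) z = flat_laplacian f z / 4" "dzb (dz f) z = flat_laplacian f z / 4"
proof -
  have f2: "Ck_on (Suc (Suc 0)) S f" using f by (simp add: numeral_2_eq_2)
  have d: "(partial_x f) differentiable (at z)" "(partial_y f) differentiable (at z)" using f2 z by auto
  note w = has_wirtingerI[OF d(1)] has_wirtingerI[OF d(2)]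
  have c: "has_wirtinger (\<lambda>_. k) 0 0 z" for k by (rule has_wirtinger_const)
  have e: "dzb f = (\<lambda>z. (1/2) * (partial_x f z + \<i> * partial_y f z))" "dz f = (\<lambda>z. (1/2) * (partial_x f z - \<i> * partial_y f z))"
    by (simp_all add: dz_def[abs_def] dzb_def[abs_def])
  have "dz (dzb f) z = (1/2) * (dz (partial_x f) z + \<i> * dz (partial_y f) z)"
    unfolding e(1) by (subst has_wirtinger_unique(1)[OF has_wirtinger_mult[OF c has_wirtinger_add[OF w(1) has_wirtinger_mult[OF c w(2)]]]]) simp
  then show "dz (dzb f) z = flat_laplacian f z / 4"
    using clairaut[OF S z f] by (simp add: dz_def[of "partial_x f"] dz_def[of "partial_y f"] flat_laplacian_def field_simps)
  have "dzb (dz f) z = (1/2) * (dzb (partial_x f) z - \<i> * dzb (partial_y f) z)"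
    unfolding e(2) by (subst has_wirtinger_unique(2)[OF has_wirtinger_mult[OF c has_wirtinger_diff[OF w(1) has_wirtinger_mult[OF c w(2)]]]]) simp
  moreover have "dzb (partial_x f) z - \<i> * dzb (partial_y f) z = flat_laplacian f z / 2"
    using clairaut[OF S z f] by (simp add: dzb_def flat_laplacian_def field_simps)
  ultimately show "dzb (dz f) z = flat_laplacian f z / 4" by simp
qed

text \<open>In the form 4 \<open>dz\<close> \<open>dzb\<close> of the Laplacian, \<open>dzb\<close>
  brings out the factor \<open>cnj (deriv h)\<close>, which is antiholomorphic and hence a constant
  for \<open>dz\<close>; the latter contributes \<open>deriv h\<close>. This covariance makes the
  eigenvalue equation independent of charts.\<close>

lemma flat_laplacian_compose_holomorphic:
  fixes f :: "complex \<Rightarrow> complex"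
  assumes S: "open S" and T: "open T" and h: "h holomorphic_on S" and sub: "h ` S \<subseteq> T" and f: "Ck_on 2 T f" and z: "z \<in> S"
  shows "flat_laplacian (\<lambda>z. f (h z)) z = of_real ((cmod (deriv h z))\<^sup>2) * flat_laplacian f (h z)"
proof -
  have f2: "Ck_on (Suc (Suc 0)) T f" using f by (simp add: numeral_2_eq_2)
  have dh: "(h has_field_derivative deriv h w) (at w)" if "w \<in> S" for w
    using holomorphic_derivI[OF h S that] .
  have fh: "Ck_on 2 S (\<lambda>z. f (h z))" by (rule Ck_on_compose_holomorphic[OF S T h sub f])
  have "has_wirtinger (\<lambda>z. f (h z)) (dz f (h w) * deriv h w) (dzb f (h w) * cnj (deriv h w)) w" if "w \<in> S" for w
    by (rule has_wirtinger_compose_field[OF dh[OF that] has_wirtingerI]) (use f2 sub that in auto)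
  then have 1: "dzb (\<lambda>z. f (h z)) w = dzb f (h w) * cnj (deriv h w)" if "w \<in> S" for w
    using that has_wirtinger_unique(2) by blast
  have "dzb f differentiable (at (h z))"
    by (rule Ck_on_differentiable[OF Ck_on_dz(2)[OF T f2]]) (use sub z in auto)
  note 2 = has_wirtinger_compose_field[OF dh[OF z] has_wirtingerI[OF this]]
  have "(deriv h has_field_derivative deriv (deriv h) z) (at z)"
    by (rule holomorphic_derivI[OF holomorphic_deriv[OF h S] S z])
  note 3 = has_wirtinger_mult[OF 2 has_wirtinger_cnj[OF has_wirtinger_field[OF this]]]
  have "dz (dzb (\<lambda>z. f (h z))) z = dz (\<lambda>w. dzb f (h w) * cnj (deriv h w)) z"
    by (rule dz_cong_open(1)[OF S z 1])
  also have "\<dots> = dz (dzb f) (h z) * deriv h z * cnj (deriv h z)"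
    using has_wirtinger_unique(1)[OF 3] by simp
  finally show ?thesis
    using dz_dzb_flat_laplacian(1)[OF S z fh] dz_dzb_flat_laplacian(1)[OF T _ f, of "h z"] sub z
    by (auto simp: complex_norm_square mult_ac simp del: of_real_power)
qed

section \<open>The radial equation near a turning point\<close>

text \<open>A negative slope at \<open>x\<close> would by convexity persist to the left, and
  \<open>f\<close> would exceed \<open>B\<close> towards minus infinity. Boundedness of a function
  at the centre of a disc enters the radial equations in this way, since the logarithmic radius
  tends to minus infinity there.\<close>

lemma convex_bounded_above_deriv_nonneg:
  fixes f f' f'' :: "real \<Rightarrow> real"
  assumes d1: "\<And>x. x \<le> b \<Longrightarrow> (f has_real_derivative f' x) (at x)"
    and d2: "\<And>x. x \<le> b \<Longrightarrow> (f' has_real_derivative f'' x) (at x)"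
    and nn: "\<And>x. x \<le> b \<Longrightarrow> f'' x \<ge> 0" and B: "\<And>x. x \<le> b \<Longrightarrow> f x \<le> B"
    and x: "x \<le> b"
  shows "f' x \<ge> 0"
proof (rule ccontr)
  assume "\<not> f' x \<ge> 0"
  define m where "m = - f' x"
  have m: "m > 0" using \<open>\<not> f' x \<ge> 0\<close> by (simp add: m_def)
  \<comment> \<open>Far enough to the left for a slope of at most \<open>- m\<close> to lift
    \<open>f\<close> above \<open>B\<close> by at least 1.\<close>
  define y where "y = x - (\<bar>B - f x\<bar> + 1) / m"
  have y: "y < x" using m by (simp add: y_def)
  have "\<exists>z. y < z \<and> z < x \<and> f x - f y = (x - y) * f' z"
    by (rule MVT2[OF y]) (use d1 x in auto)
  then obtain z where z: "y < z" "z < x" "f x - f y = (x - y) * f' z" by blast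
  have "f' z \<le> f' x"
  proof (rule DERIV_nonneg_imp_nondecreasing[of z x f'])
    fix w assume "z \<le> w" "w \<le> x"
    then show "\<exists>y. (f' has_real_derivative y) (at w) \<and> 0 \<le> y" using d2[of w] nn[of w] x by auto
  qed (use z in simp)
  then have "(x - y) * f' z \<le> (x - y) * (- m)" using y by (intro mult_left_mono) (auto simp: m_def)
  also have "\<dots> = - (\<bar>B - f x\<bar> + 1)" using m by (simp add: y_def)
  finally have "f y \<ge> f x + \<bar>B - f x\<bar> + 1" using z(3) by linarith
  moreover have "f y \<le> B" using B y x by simp
  ultimately show False by linarith
qed

text \<open>The scale is \<open>m = \<mu>\<^sup>1\<^sup>/\<^sup>6\<close>: the left side has order \<open>m\<^sup>5\<close> and the right side order \<open>m\<^sup>6\<close>, so the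
  quotient gives the factor \<open>m\<close>. The starting point \<open>x1\<close> lies on the oscillating side (\<open>Q \<ge> 0\<close>), possibly
  at the turning point itself.\<close>

lemma airy_amplitude:
  fixes Q Q' a a' :: "real \<Rightarrow> real"
  assumes pos: "d > 0" "c > 0" "B \<ge> 0" "m > 0" "k > 0"
    and k: "c * k ^ 3 = 15/16"
    and dQ: "\<And>x. x1 \<le> x \<Longrightarrow> x \<le> x1 + d \<Longrightarrow> (Q has_real_derivative Q' x) (at x)"
    and mono: "\<And>x y. x1 \<le> x \<Longrightarrow> x \<le> y \<Longrightarrow> y \<le> x1 + d \<Longrightarrow> Q' x \<le> Q' y"
    and Q'l: "\<And>x. x1 \<le> x \<Longrightarrow> x \<le> x1 + d \<Longrightarrow> c * m ^ 6 \<le> Q' x"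
    and Q'u: "\<And>x. x1 \<le> x \<Longrightarrow> x \<le> x1 + d \<Longrightarrow> Q' x \<le> K * m ^ 6"
    and Q0: "Q x1 \<ge> 0" and QB: "Q x1 \<le> B * Q' x1"
    and da: "\<And>x. x1 \<le> x \<Longrightarrow> x \<le> x1 + d \<Longrightarrow> (a has_real_derivative a' x) (at x)"
    and da': "\<And>x. x1 \<le> x \<Longrightarrow> x \<le> x1 + d \<Longrightarrow> (a' has_real_derivative - Q x * a x) (at x)"
  shows "min (5/16 / sqrt (2*k) ^ 5) (c * sqrt (k/2)) * m ^ 5 * (a x1)\<^sup>2 * (d ^ 5 / 30)
    \<le> (2 * d^4 * (sqrt (d + B + k / m\<^sup>2) * (K * m ^ 6)) + 13 * d\<^sup>2 * (m / sqrt k)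
        + 3/2 * d^3 * (m / sqrt k)^3 + 9/8 * d^4 * (m / sqrt k)^5) * integral {x1..x1+d} (\<lambda>x. (a x)\<^sup>2)"
proof -
  \<comment> \<open>\<open>x1 - \<beta>\<close> is the zero of the tangent of \<open>Q\<close> at
    \<open>x1\<close>, an explicit substitute for the turning point.\<close>
  define \<beta> where "\<beta> = Q x1 / Q' x1"
  define \<eta> where "\<eta> = k / m\<^sup>2"
  have \<eta>: "\<eta> > 0" using pos by (simp add: \<eta>_def)
  have cm: "c * m ^ 6 > 0" using pos by simp
  have Q'p: "Q' x > 0" if "x1 \<le> x" "x \<le> x1 + d" for x using Q'l[OF that] cm by linarith
  have Q'1: "Q' x1 > 0" using Q'p pos by simp
  have \<beta>0: "\<beta> \<ge> 0" "\<beta> \<le> B" using Q0 QB Q'1 by (auto simp: \<beta>_def divide_simps)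
  have Q1: "Q x1 = \<beta> * Q' x1" using Q'1 by (simp add: \<beta>_def)
  define G where "G x = x - x1 + \<beta> + \<eta>" for x
  define u where "u x = 1 / sqrt (G x)" for x
  have G\<eta>: "G x \<ge> \<eta>" if "x1 \<le> x" for x using that \<beta>0 by (simp add: G_def)
  have Gp: "G x > 0" if "x1 \<le> x" for x using G\<eta>[OF that] \<eta> by linarith
  have up: "u x > 0" if "x1 \<le> x" for x using Gp[OF that] by (simp add: u_def)
  have uG: "(u x)\<^sup>2 * G x = 1" if "x1 \<le> x" for x using Gp[OF that] by (simp add: u_def power_divide)
  have du: "(u has_real_derivative - 1/2 * (u x)^3) (at x)" if "x1 \<le> x" for x
  proof -
    have "((\<lambda>x. 1 / sqrt (G x)) has_real_derivative - 1/2 * (1 / sqrt (G x))^3) (at x)"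
      unfolding G_def using Gp[OF that] unfolding G_def
      by (auto intro!: derivative_eq_intros simp: field_simps power3_eq_cube)
    then show ?thesis by (simp add: u_def[abs_def])
  qed
  \<comment> \<open>\<open>Q\<close> is convex, so from the substitute turning point onwards it has
    risen by no more than the distance times the final slope \<open>Q' x\<close>.\<close>
  have QG: "Q x \<le> (G x - \<eta>) * Q' x" if x: "x1 \<le> x" "x \<le> x1 + d" for x
  proof -
    have "Q x \<le> Q x1 + (x - x1) * Q' x"
    proof (cases "x = x1")
      case False
      then have "\<exists>z. x1 < z \<and> z < x \<and> Q x - Q x1 = (x - x1) * Q' z"
        using x by (intro MVT2) (auto intro!: dQ)
      then obtain z where z: "x1 < z" "z < x" "Q x - Q x1 = (x - x1) * Q' z" by blast
      have "(x - x1) * Q' z \<le> (x - x1) * Q' x" using z x mono[of z x] by (intro mult_left_mono) auto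
      with z show ?thesis by linarith
    qed simp
    also have "Q x1 \<le> \<beta> * Q' x" unfolding Q1 using mono[of x1 x] x \<beta>0 by (intro mult_left_mono) auto
    finally show ?thesis by (simp add: G_def algebra_simps)
  qed
  have cm\<eta>: "c * m ^ 6 * \<eta> ^ 3 = 15/16" using k pos by (simp add: \<eta>_def power_divide)
  txt \<open>\<open>u\<^sup>2\<close> is the inverse distance to the turning point, cut off at the Airy scale \<open>\<eta>\<close>. The
    lower order terms of the energy \<open>H\<close> are chosen so that its derivative contains neither \<open>a'\<^sup>2\<close> nor
    \<open>a a'\<close>; \<open>k\<close> is chosen so that the remaining coefficient of \<open>a\<^sup>2\<close> is nonnegative.\<close>
  define H where "H x = u x * ((a' x)\<^sup>2 + Q x * (a x)\<^sup>2) + 1/2 * (u x)^3 * a x * a' x + 3/8 * (u x)^5 * (a x)\<^sup>2" for x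
  have dH: "(H has_real_derivative u x * (Q' x - (u x)\<^sup>2 * Q x - 15/16 * (u x)^6) * (a x)\<^sup>2) (at x)"
    if x: "x1 \<le> x" "x \<le> x1 + d" for x
    unfolding H_def[abs_def]
    by (rule derivative_eq_intros du[OF x(1)] dQ[OF x] da[OF x] da'[OF x] refl)+ (simp add: algebra_simps power_numeral_reduce)
  have Hpos: "u x * (Q' x - (u x)\<^sup>2 * Q x - 15/16 * (u x)^6) * (a x)\<^sup>2 \<ge> 0" if x: "x1 \<le> x" "x \<le> x1 + d" for x
  proof -
    have "(u x)\<^sup>2 * Q x \<le> (u x)\<^sup>2 * ((G x - \<eta>) * Q' x)" using QG[OF x] by (intro mult_left_mono) auto
    also have "\<dots> = Q' x - (u x)\<^sup>2 * \<eta> * Q' x" using uG[OF x(1)] by (simp add: algebra_simps)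
    finally have 1: "Q' x - (u x)\<^sup>2 * Q x \<ge> (u x)\<^sup>2 * \<eta> * Q' x" by linarith
    have "(u x)\<^sup>2 * \<eta> \<le> (u x)\<^sup>2 * G x" using G\<eta>[OF x(1)] by (intro mult_left_mono) auto
    then have u\<eta>: "(u x)\<^sup>2 * \<eta> \<le> 1" using uG[OF x(1)] by simp
    have "((u x)\<^sup>2 * \<eta>)\<^sup>2 \<le> 1" using u\<eta> \<eta> by (simp add: power_le_one)
    then have "15/16 * (((u x)\<^sup>2 * \<eta>)\<^sup>2 * (u x)\<^sup>2) \<le> 15/16 * (1 * (u x)\<^sup>2)" by (intro mult_left_mono mult_right_mono) auto
    moreover have "(u x)\<^sup>2 * \<eta> * Q' x \<ge> (u x)\<^sup>2 * \<eta> * (c * m^6)" using Q'l[OF x] \<eta> by (intro mult_left_mono) auto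
    moreover have "(u x)\<^sup>2 * \<eta> * (c * m^6) * \<eta>\<^sup>2 = 15/16 * (u x)\<^sup>2" using cm\<eta> by (simp add: power_numeral_reduce mult_ac)
    moreover have "15/16 * (u x)^6 * \<eta>\<^sup>2 = 15/16 * (((u x)\<^sup>2 * \<eta>)\<^sup>2 * (u x)\<^sup>2)" by (simp add: power_numeral_reduce)
    moreover have "15/16 * (((u x)\<^sup>2 * \<eta>)\<^sup>2 * (u x)\<^sup>2) \<le> 15/16 * (u x)\<^sup>2"
      using \<open>15/16 * (((u x)\<^sup>2 * \<eta>)\<^sup>2 * (u x)\<^sup>2) \<le> 15/16 * (1 * (u x)\<^sup>2)\<close> by simp
    ultimately have "15/16 * (u x)^6 * \<eta>\<^sup>2 \<le> (u x)\<^sup>2 * \<eta> * (c * m^6) * \<eta>\<^sup>2" by linarith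
    then have "15/16 * (u x)^6 \<le> (u x)\<^sup>2 * \<eta> * (c * m^6)" using \<eta> by simp
    with 1 \<open>(u x)\<^sup>2 * \<eta> * Q' x \<ge> (u x)\<^sup>2 * \<eta> * (c * m^6)\<close> have "Q' x - (u x)\<^sup>2 * Q x - 15/16 * (u x)^6 \<ge> 0" by linarith
    then show ?thesis using up[OF x(1)] by simp
  qed
  have Hmono: "H x1 \<le> H x" if x: "x1 \<le> x" "x \<le> x1 + d" for x
    by (rule DERIV_nonneg_imp_nondecreasing[OF x(1)]) (use dH Hpos x in \<open>meson order_trans\<close>)
  define c1 where "c1 = min (5/16 / sqrt (2*k) ^ 5) (c * sqrt (k/2))"
  \<comment> \<open>Completing the square removes the cross term and turns the coefficient 3/8 into
    3/8 - 1/16 = 5/16.\<close>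
  have H1: "c1 * m ^ 5 * (a x1)\<^sup>2 \<le> H x1"
  proof -
    define v where "v = u x1"
    have v: "v > 0" using up by (simp add: v_def)
    have "H x1 = v * (a' x1 + 1/4 * v\<^sup>2 * a x1)\<^sup>2 + v * (Q x1 + 5/16 * v^4) * (a x1)\<^sup>2"
      by (simp add: H_def v_def[symmetric] algebra_simps power_numeral_reduce)
    then have "H x1 \<ge> v * (Q x1 + 5/16 * v^4) * (a x1)\<^sup>2" using v by simp
    moreover have "v * (Q x1 + 5/16 * v^4) \<ge> c1 * m ^ 5"
    \<comment> \<open>Within the Airy scale \<open>u\<close> itself is at least of order
      \<open>m\<close>, and the term in \<open>v ^ 5\<close> gives \<open>m ^ 5\<close>. Further
      away the potential term \<open>v * Q x1 = v * \<beta> * Q' x1\<close> takes over, with \<beta>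
      above the cutoff \<eta>.\<close>
    proof (cases "\<beta> \<le> \<eta>")
      case True
      have "sqrt (\<beta> + \<eta>) \<le> sqrt (2 * k / m\<^sup>2)" using True by (intro real_sqrt_le_mono) (simp add: \<eta>_def)
      also have "\<dots> = sqrt (2 * k) / m" using pos by (simp add: real_sqrt_divide)
      finally have "m / sqrt (2 * k) \<le> v" using pos \<eta> \<beta>0 by (simp add: v_def u_def G_def field_simps)
      then have "(m / sqrt (2 * k)) ^ 5 \<le> v ^ 5" using pos by (intro power_mono) auto
      then have "5/16 / sqrt (2*k) ^ 5 * m ^ 5 \<le> 5/16 * v ^ 5" by (simp add: power_divide)
      moreover have "c1 * m ^ 5 \<le> 5/16 / sqrt (2*k) ^ 5 * m ^ 5" using pos by (intro mult_right_mono) (auto simp: c1_def)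
      moreover have "v * (Q x1 + 5/16 * v^4) = v * Q x1 + 5/16 * v ^ 5" by (simp add: algebra_simps power_numeral_reduce)
      moreover have "v * Q x1 \<ge> 0" using v Q0 by simp
      ultimately show ?thesis by linarith
    next
      case False
      then have b: "\<beta> > 0" "\<eta> \<le> \<beta>" using \<eta> by auto
      have "\<beta> + \<eta> \<le> 2 * \<beta>" using b by simp
      then have "sqrt (\<beta> + \<eta>) \<le> sqrt (2 * \<beta>)" by (rule real_sqrt_le_mono)
      then have v1: "v \<ge> 1 / sqrt (2 * \<beta>)" using b \<eta> by (auto simp: v_def u_def G_def intro!: divide_left_mono mult_pos_pos)
      have "sqrt (k/2) / m = sqrt (\<eta> / 2)" using pos by (simp add: \<eta>_def real_sqrt_divide real_sqrt_mult)
      also have "\<dots> \<le> sqrt (\<beta> / 2)" using b by simp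
      also have "\<dots> = \<beta> / sqrt \<beta> / sqrt 2" using b by (simp add: real_div_sqrt real_sqrt_divide)
      also have "\<dots> = 1 / sqrt (2 * \<beta>) * \<beta>" by (simp add: real_sqrt_mult mult.commute)
      also have "\<dots> \<le> v * \<beta>" using v1 b by (intro mult_right_mono) auto
      finally have "sqrt (k/2) / m * (c * m ^ 6) \<le> v * \<beta> * (c * m ^ 6)" using cm by (intro mult_right_mono) auto
      also have "\<dots> \<le> v * \<beta> * Q' x1" using Q'l[of x1] pos v b by (intro mult_left_mono) auto
      finally have "c * sqrt (k/2) * m ^ 5 \<le> v * Q x1" using pos by (simp add: Q1 power_numeral_reduce mult_ac)
      moreover have "c1 * m ^ 5 \<le> c * sqrt (k/2) * m ^ 5" using pos by (intro mult_right_mono) (auto simp: c1_def)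
      moreover have "v * (Q x1 + 5/16 * v^4) = v * Q x1 + 5/16 * v ^ 5" by (simp add: algebra_simps power_numeral_reduce)
      moreover have "v ^ 5 \<ge> 0" using v by simp
      ultimately show ?thesis by linarith
    qed
    then have "c1 * m ^ 5 * (a x1)\<^sup>2 \<le> v * (Q x1 + 5/16 * v^4) * (a x1)\<^sup>2" by (rule mult_right_mono) simp
    ultimately show ?thesis by linarith
  qed
  \<comment> \<open>The double zeros at both ends make \<open>bump\<close> and \<open>bump1\<close>
    vanish there, so \<open>V\<close> leaves no boundary terms.\<close>
  define bump where "bump x = (x - x1)\<^sup>2 * (x1 + d - x)\<^sup>2" for x
  define bump1 where "bump1 x = 2 * (x - x1) * (x1 + d - x) * (d - 2 * (x - x1))" for x
  define bump2 where "bump2 x = 2 * d\<^sup>2 - 12 * d * (x - x1) + 12 * (x - x1)\<^sup>2" for x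
  have dbump: "(bump has_real_derivative bump1 x) (at x)" "(bump1 has_real_derivative bump2 x) (at x)" for x
    unfolding bump_def[abs_def] bump1_def[abs_def] bump2_def
    by (auto intro!: derivative_eq_intros simp: algebra_simps power2_eq_square)
  define R where "R x = 2 * bump x * u x * Q x + 1/2 * bump2 x * u x - 3/4 * bump1 x * (u x)^3 + 9/8 * bump x * (u x)^5" for x
  txt \<open>Integrating by parts against a bump function trades the \<open>a'\<^sup>2\<close> in the energy for \<open>a\<^sup>2\<close>.\<close>
  define V where "V x = bump x * u x * a x * a' x - 1/2 * bump1 x * u x * (a x)\<^sup>2 + 1/2 * bump x * (u x)^3 * (a x)\<^sup>2" for x
  have dV: "(V has_real_derivative bump x * H x - R x * (a x)\<^sup>2) (at x)" if x: "x1 \<le> x" "x \<le> x1 + d" for x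
    unfolding V_def[abs_def]
    by (rule derivative_eq_intros du[OF x(1)] dbump da[OF x] da'[OF x] refl)+
      (simp add: H_def R_def algebra_simps power_numeral_reduce)
  have "((\<lambda>x. bump x * H x - R x * (a x)\<^sup>2) has_integral (V (x1 + d) - V x1)) {x1..x1+d}"
    using pos dV by (intro fundamental_theorem_of_calculus)
      (auto simp: has_real_derivative_iff_has_vector_derivative[symmetric] intro: has_field_derivative_at_within)
  moreover have "V (x1 + d) - V x1 = 0" by (simp add: V_def bump_def bump1_def)
  ultimately have I1: "((\<lambda>x. bump x * H x - R x * (a x)\<^sup>2) has_integral 0) {x1..x1+d}" by simp
  define X where "X x = (x - x1)^3 * d\<^sup>2 / 3 - (x - x1)^4 * d / 2 + (x - x1)^5 / 5" for x
  have dX: "(X has_real_derivative bump x) (at x)" for x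
    unfolding X_def[abs_def] bump_def
    by (auto intro!: derivative_eq_intros simp: field_simps power_numeral_reduce)
  have "(bump has_integral (X (x1 + d) - X x1)) {x1..x1+d}"
    using pos dX by (intro fundamental_theorem_of_calculus)
      (auto simp: has_real_derivative_iff_has_vector_derivative[symmetric] intro: has_field_derivative_at_within)
  \<comment> \<open>The beta integral B(3, 3) = 1/30, scaled to length \<open>d\<close>.\<close>
  moreover have "X (x1 + d) - X x1 = d ^ 5 / 30" by (simp add: X_def power_numeral_reduce)
  ultimately have I2: "(bump has_integral (d ^ 5 / 30)) {x1..x1+d}" by simp
  have "continuous_on {x1..x1+d} a"
    by (intro continuous_at_imp_continuous_on ballI DERIV_isCont) (auto intro: da)
  then have int: "(\<lambda>x. (a x)\<^sup>2) integrable_on {x1..x1+d}"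
    by (intro integrable_continuous_real continuous_intros)
  define M where "M = 2 * d^4 * (sqrt (d + B + k / m\<^sup>2) * (K * m ^ 6)) + 13 * d\<^sup>2 * (m / sqrt k)
        + 3/2 * d^3 * (m / sqrt k)^3 + 9/8 * d^4 * (m / sqrt k)^5"
  have RM: "R x \<le> M" if x: "x1 \<le> x" "x \<le> x1 + d" for x
  proof -
    define t where "t = x - x1"
    have t: "0 \<le> t" "t \<le> d" using x by (auto simp: t_def)
    have bumpt: "bump x = t\<^sup>2 * (d - t)\<^sup>2" "bump1 x = 2 * t * (d - t) * (d - 2 * t)" "bump2 x = 2 * d\<^sup>2 - 12 * d * t + 12 * t\<^sup>2"
      by (auto simp: bump_def bump1_def bump2_def t_def algebra_simps)
    have tt: "t\<^sup>2 \<le> d\<^sup>2" "(d - t)\<^sup>2 \<le> d\<^sup>2" using t by (auto intro!: power_mono)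
    have "t\<^sup>2 * (d - t)\<^sup>2 \<le> d\<^sup>2 * d\<^sup>2" by (intro mult_mono tt) auto
    then have b0: "0 \<le> bump x" "bump x \<le> d^4" by (auto simp: bumpt power_numeral_reduce)
    have "\<bar>bump1 x\<bar> = 2 * (t * (d - t) * \<bar>d - 2 * t\<bar>)" using t by (simp add: bumpt abs_mult)
    also have "\<dots> \<le> 2 * (d * d * d)" using t by (intro mult_left_mono mult_mono) auto
    finally have b1: "- bump1 x \<le> 2 * d ^ 3" by (simp add: power_numeral_reduce)
    have "12 * d * t \<ge> 0" using t pos by simp
    then have b2: "bump2 x \<le> 26 * d\<^sup>2" using tt zero_le_power2[of d] unfolding bumpt by linarith
    define v where "v = u x"
    have v: "v > 0" using up x by (simp add: v_def)
    have "sqrt \<eta> \<le> sqrt (G x)" using G\<eta>[OF x(1)] by simp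
    then have "v \<le> 1 / sqrt \<eta>" using \<eta> Gp[OF x(1)] by (simp add: v_def u_def frac_le)
    also have "\<dots> = m / sqrt k" using pos by (simp add: \<eta>_def real_sqrt_divide)
    finally have vm: "v \<le> m / sqrt k" .
    \<comment> \<open>The only contribution of order \<open>m ^ 6\<close>: \<open>v * G x\<close> is
      \<open>sqrt (G x)\<close>, which stays bounded, while \<open>Q'\<close> has order
      \<open>m ^ 6\<close>. The other terms of \<open>R\<close> contain at most the fifth power of
      \<open>v\<close>, hence have order at most \<open>m ^ 5\<close>.\<close>
    have uQ: "v * Q x \<le> sqrt (d + B + k / m\<^sup>2) * (K * m ^ 6)"
    proof -
      have "Q x \<le> G x * Q' x" using QG[OF x] mult_pos_pos[OF \<eta> Q'p[OF x]] unfolding left_diff_distrib by linarith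
      then have "v * Q x \<le> v * (G x * Q' x)" using v by (intro mult_left_mono) auto
      also have "\<dots> = G x / sqrt (G x) * Q' x" by (simp add: v_def u_def)
      also have "\<dots> = sqrt (G x) * Q' x" using Gp[OF x(1)] by (simp add: real_div_sqrt)
      also have "\<dots> \<le> sqrt (d + B + k / m\<^sup>2) * (K * m ^ 6)"
        using x \<beta>0 Q'u[OF x] Q'p[OF x] pos by (intro mult_mono real_sqrt_le_mono) (auto simp: G_def \<eta>_def)
      finally show ?thesis .
    qed
    have "K * m ^ 6 > 0" using Q'u[OF x] Q'p[OF x] by linarith
    then have K0: "K > 0" using pos by (simp add: zero_less_mult_iff)
    have "bump x * (v * Q x) \<le> d^4 * (sqrt (d + B + k / m\<^sup>2) * (K * m ^ 6))"
    proof -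
      have "bump x * (v * Q x) \<le> bump x * (sqrt (d + B + k / m\<^sup>2) * (K * m ^ 6))" using uQ b0 by (intro mult_left_mono) auto
      also have "\<dots> \<le> d^4 * (sqrt (d + B + k / m\<^sup>2) * (K * m ^ 6))" using b0 K0 pos by (intro mult_right_mono mult_nonneg_nonneg) auto
      finally show ?thesis .
    qed
    moreover have "bump2 x * v \<le> 26 * d\<^sup>2 * (m / sqrt k)"
      using b2 v vm order_trans[OF mult_right_mono[OF b2, of v] mult_left_mono[OF vm, of "26 * d\<^sup>2"]] by simp
    moreover have "- bump1 x * v^3 \<le> 2 * d ^ 3 * (m / sqrt k)^3"
      using b1 v pos order_trans[OF mult_right_mono[OF b1, of "v^3"] mult_left_mono[OF power_mono[OF vm, of 3], of "2 * d^3"]] by simp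
    moreover have "bump x * v^5 \<le> d ^ 4 * (m / sqrt k)^5"
      using b0 v pos order_trans[OF mult_right_mono[OF b0(2), of "v^5"] mult_left_mono[OF power_mono[OF vm, of 5], of "d^4"]] by simp
    ultimately show ?thesis unfolding R_def M_def v_def[symmetric] by (simp add: algebra_simps)
  qed
  \<comment> \<open>Under the integral \<open>H\<close> is replaced by its smallest value
    \<open>H x1\<close>, and \<open>R\<close> by its upper bound \<open>M\<close>; the comparison
    with \<open>I1\<close> then isolates \<open>H x1\<close>.\<close>
  have I3: "((\<lambda>x. bump x * H x1 - M * (a x)\<^sup>2) has_integral (d ^ 5 / 30 * H x1 - M * integral {x1..x1+d} (\<lambda>x. (a x)\<^sup>2))) {x1..x1+d}"
    by (intro has_integral_diff has_integral_mult_left has_integral_mult_right I2 integrable_integral int)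
  have "d ^ 5 / 30 * H x1 - M * integral {x1..x1+d} (\<lambda>x. (a x)\<^sup>2) \<le> 0"
  proof (rule has_integral_le[OF I3 I1])
    fix x assume x: "x \<in> {x1..x1+d}"
    have "bump x * H x1 \<le> bump x * H x" using Hmono[of x] x by (intro mult_left_mono) (auto simp: bump_def)
    moreover have "R x * (a x)\<^sup>2 \<le> M * (a x)\<^sup>2" using RM[of x] x by (intro mult_right_mono) auto
    ultimately show "bump x * H x1 - M * (a x)\<^sup>2 \<le> bump x * H x - R x * (a x)\<^sup>2" by linarith
  qed
  moreover have "c1 * m ^ 5 * (a x1)\<^sup>2 * (d ^ 5 / 30) \<le> H x1 * (d ^ 5 / 30)" using H1 pos by (intro mult_right_mono) auto
  ultimately show ?thesis unfolding c1_def[symmetric] M_def[symmetric] by (simp add: mult.commute)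
qed

section \<open>The hyperbolic weight and the uniform radial bound\<close>

text \<open>The square of the conformal factor of the Poincare metric in the logarithmic coordinate:
  with disc variable \<open>exp (x + i y)\<close> and \<open>x < 0\<close>, mode \<open>n\<close> of
  an eigenfunction has potential \<open>n^2 - \<mu> * hyp_weight x\<close>.\<close>

definition hyp_weight :: "real \<Rightarrow> real"
  where "hyp_weight x = 1 / (sinh x)\<^sup>2"

definition hyp_weight' :: "real \<Rightarrow> real"
  where "hyp_weight' x = - 2 * cosh x / (sinh x)^3"

lemma hyp_weight_pos: "x < 0 \<Longrightarrow> hyp_weight x > 0"
  by (simp add: hyp_weight_def)

lemma hyp_weight'_pos: "x < 0 \<Longrightarrow> hyp_weight' x > 0"
  by (simp add: hyp_weight'_def divide_pos_neg)

lemma DERIV_hyp_weight: "x < 0 \<Longrightarrow> (hyp_weight has_real_derivative hyp_weight' x) (at x)"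
  unfolding hyp_weight_def[abs_def] hyp_weight'_def
  by (auto intro!: derivative_eq_intros simp: divide_simps power_numeral_reduce)

text \<open>Positivity of this second derivative is the convexity that the amplitude estimate asks
  of its potential.\<close>

lemma DERIV_hyp_weight':
  assumes "x < 0"
  shows "(hyp_weight' has_real_derivative 4 * hyp_weight x + 6 * (hyp_weight x)\<^sup>2) (at x)"
proof -
  define s where "s = sinh x"
  have s: "s \<noteq> 0" using assms by (simp add: s_def)
  have "(hyp_weight' has_real_derivative (- 2 * s * s^3 + 2 * cosh x * (3 * s\<^sup>2 * cosh x)) / (s^3)\<^sup>2) (at x)"
    unfolding hyp_weight'_def[abs_def] s_def
    by (rule derivative_eq_intros refl | use assms in simp)+
  moreover have "(- 2 * s * s^3 + 2 * cosh x * (3 * s\<^sup>2 * cosh x)) / (s^3)\<^sup>2 = 4 * hyp_weight x + 6 * (hyp_weight x)\<^sup>2"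
  proof -
    have "(- 2 * s * s^3 + 2 * cosh x * (3 * s\<^sup>2 * cosh x)) = 4 * s^4 + 6 * s^2"
    proof -
      have "(- 2 * s * s^3 + 2 * cosh x * (3 * s\<^sup>2 * cosh x)) = - 2 * s^4 + 6 * s\<^sup>2 * (cosh x)\<^sup>2"
        by (simp add: power_numeral_reduce)
      also have "(cosh x)\<^sup>2 = s\<^sup>2 + 1" using cosh_square_eq[of x] by (simp add: s_def)
      finally show ?thesis by (simp add: power_numeral_reduce algebra_simps)
    qed
    then show ?thesis unfolding hyp_weight_def s_def[symmetric] using s
      by (simp add: field_simps power_numeral_reduce)
  qed
  ultimately show ?thesis by simp
qed

lemma hyp_weight_mono: "x \<le> y \<Longrightarrow> y < 0 \<Longrightarrow> hyp_weight x \<le> hyp_weight y"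
  by (rule DERIV_nonneg_imp_nondecreasing[of x y hyp_weight])
    (auto intro!: exI DERIV_hyp_weight less_imp_le hyp_weight'_pos)

lemma hyp_weight'_mono: "x \<le> y \<Longrightarrow> y < 0 \<Longrightarrow> hyp_weight' x \<le> hyp_weight' y"
proof (rule DERIV_nonneg_imp_nondecreasing[of x y hyp_weight'])
  fix z assume "x \<le> y" "y < 0" "z \<le> y"
  then have "z < 0" by simp
  from DERIV_hyp_weight'[OF this] hyp_weight_pos[OF this]
  show "\<exists>d. (hyp_weight' has_real_derivative d) (at z) \<and> 0 \<le> d" by fastforce
qed auto

text \<open>The interval has length \<open>2 * d\<close> so that a turning point in its first half
  leaves room \<open>d\<close> to its right for the amplitude estimate. Left of the turning point
  \<open>a^2\<close> increases, hence the value at \<open>x0\<close> is dominated by the one at the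
  turning point; if the first half lies entirely on that side, it is dominated by all values there.
  The constant is the same for all frequencies \<open>N\<close>.\<close>

lemma radial_amplitude_bound:
  fixes x0 d m0 :: real
  assumes d: "d > 0" and x0d: "x0 + 2 * d < 0" and m0: "m0 > 0"
  obtains C where "C > 0"
    "\<And>m N a a' A. m \<ge> m0 \<Longrightarrow> (\<And>x. x < 0 \<Longrightarrow> (a has_real_derivative a' x) (at x)) \<Longrightarrow>
      (\<And>x. x < 0 \<Longrightarrow> (a' has_real_derivative (N - m ^ 6 * hyp_weight x) * a x) (at x)) \<Longrightarrow>
      (\<And>x. x \<le> x0 + 2 * d \<Longrightarrow> \<bar>a x\<bar> \<le> A) \<Longrightarrow> N \<ge> 0 \<Longrightarrow>
      (a x0)\<^sup>2 \<le> C * m * integral {x0..x0 + 2 * d} (\<lambda>x. (a x)\<^sup>2)"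
proof -
  \<comment> \<open>\<open>c\<close> and \<open>K\<close> are the extreme values of
    \<open>hyp_weight'\<close> on the interval, \<open>B\<close> bounds \<open>Q / Q'\<close> there
    because \<open>N \<ge> 0\<close>, and \<open>k\<close> solves
    \<open>c * k ^ 3 = 15/16\<close>.\<close>
  define c where "c = hyp_weight' x0"
  define K where "K = hyp_weight' (x0 + 2 * d)"
  define B where "B = hyp_weight (x0 + 2 * d) / c"
  define k where "k = root 3 (15 / (16 * c))"
  have c: "c > 0" and K: "K > 0" using d x0d by (auto simp: c_def K_def intro!: hyp_weight'_pos)
  have B: "B > 0" using c hyp_weight_pos[OF x0d] by (simp add: B_def)
  have k: "k > 0" using c by (simp add: k_def)
  have k3: "c * k ^ 3 = 15/16" using c by (simp add: k_def field_simps)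
  define L where "L = min (5/16 / sqrt (2*k) ^ 5) (c * sqrt (k/2)) * (d ^ 5 / 30)"
  define M where "M = 2 * d^4 * (sqrt (d + B + k / m0\<^sup>2) * K) + 13 * d\<^sup>2 * (1 / m0 ^ 5 / sqrt k)
        + 3/2 * d^3 * (1 / m0^3 / sqrt k ^ 3) + 9/8 * d^4 * (1 / m0 / sqrt k ^ 5)"
  \<comment> \<open>The first summand serves a turning point within reach, the second its absence;
    in the latter case \<open>m \<ge> m0\<close> turns a constant into a multiple of
    \<open>m\<close>.\<close>
  define C where "C = M / L + 1 / (d * m0)"
  have L: "L > 0" using d c k by (simp add: L_def)
  have "d + B + k / m0\<^sup>2 > 0" using d B k m0 by (intro add_pos_pos divide_pos_pos) auto
  then have M: "M > 0" unfolding M_def using d c k m0 K by (intro add_pos_pos mult_pos_pos divide_pos_pos) auto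
  have C: "C > 0" unfolding C_def using L M d m0 by (intro add_pos_pos divide_pos_pos) auto
  show ?thesis
  proof (rule that[OF C])
    fix m N A :: real and a a' :: "real \<Rightarrow> real"
    assume m: "m \<ge> m0" and da: "\<And>x. x < 0 \<Longrightarrow> (a has_real_derivative a' x) (at x)"
      and da': "\<And>x. x < 0 \<Longrightarrow> (a' has_real_derivative (N - m ^ 6 * hyp_weight x) * a x) (at x)"
      and A: "\<And>x. x \<le> x0 + 2 * d \<Longrightarrow> \<bar>a x\<bar> \<le> A" and N: "N \<ge> 0"
    define Q where "Q x = m ^ 6 * hyp_weight x - N" for x
    have mp: "m > 0" using m m0 by simp
    have Qm: "Q x \<le> Q y" if "x \<le> y" "y < 0" for x y
      unfolding Q_def using hyp_weight_mono[OF that] mp by (simp add: mult_left_mono)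
    have dQ: "(Q has_real_derivative m ^ 6 * hyp_weight' x) (at x)" if "x < 0" for x
      unfolding Q_def[abs_def] using that by (auto intro!: derivative_eq_intros DERIV_hyp_weight)
    have da'': "(a' has_real_derivative - Q x * a x) (at x)" if "x < 0" for x
      using da'[OF that] by (simp add: Q_def)
    have cont: "continuous_on {s..t} (\<lambda>x. (a x)\<^sup>2)" if "t < 0" for s t
      by (intro continuous_on_power continuous_at_imp_continuous_on ballI DERIV_isCont) (use that in \<open>auto intro: da\<close>)
    have int: "(\<lambda>x. (a x)\<^sup>2) integrable_on {s..t}" if "t < 0" for s t
      by (intro integrable_continuous_real cont that)
    have sub: "integral {s..t} (\<lambda>x. (a x)\<^sup>2) \<le> integral {x0..x0 + 2 * d} (\<lambda>x. (a x)\<^sup>2)" if "x0 \<le> s" "t \<le> x0 + 2 * d" for s t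
      using that x0d by (intro integral_subset_le int) auto
    \<comment> \<open>Where \<open>Q \<le> 0\<close>, the second derivative
      \<open>2 a'^2 - 2 Q a^2\<close> of \<open>a^2\<close> is nonnegative; being bounded towards
      minus infinity, \<open>a^2\<close> must increase.\<close>
    have grow: "(a x)\<^sup>2 \<le> (a z)\<^sup>2" if "x \<le> z" "z \<le> x0 + 2 * d" "Q z \<le> 0" for x z
    proof (rule DERIV_nonneg_imp_nondecreasing[OF that(1)])
      fix w assume w: "x \<le> w" "w \<le> z"
      have neg: "w < 0" if "w \<le> z" for w using that \<open>z \<le> x0 + 2 * d\<close> x0d by simp
      have "2 * a w * a' w \<ge> 0"
      proof (rule convex_bounded_above_deriv_nonneg[of z "\<lambda>x. (a x)\<^sup>2" "\<lambda>x. 2 * a x * a' x" "\<lambda>x. 2 * (a' x)\<^sup>2 - 2 * Q x * (a x)\<^sup>2" "A\<^sup>2"])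
        fix x assume x: "x \<le> z"
        show "((\<lambda>x. (a x)\<^sup>2) has_real_derivative 2 * a x * a' x) (at x)"
          using da[OF neg[OF x]] by (auto intro!: derivative_eq_intros)
        show "((\<lambda>x. 2 * a x * a' x) has_real_derivative 2 * (a' x)\<^sup>2 - 2 * Q x * (a x)\<^sup>2) (at x)"
          using da[OF neg[OF x]] da''[OF neg[OF x]] by (auto intro!: derivative_eq_intros simp: algebra_simps power2_eq_square)
        have "Q x \<le> 0" using Qm[OF x neg] that by simp
        then have "Q x * (a x)\<^sup>2 \<le> 0" by (simp add: mult_nonpos_nonneg)
        then show "0 \<le> 2 * (a' x)\<^sup>2 - 2 * Q x * (a x)\<^sup>2" using zero_le_power2[of "a' x"] by linarith
        have "\<bar>a x\<bar> \<le> A" using A x that by simp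
        then show "(a x)\<^sup>2 \<le> A\<^sup>2" by (metis abs_ge_zero power2_abs power_mono)
      qed (use w in auto)
      then show "\<exists>y. ((\<lambda>x. (a x)\<^sup>2) has_real_derivative y) (at w) \<and> 0 \<le> y"
        using da[OF neg[OF w(2)]] by (auto intro!: exI[of _ "2 * a w * a' w"] derivative_eq_intros)
    qed
    let ?I = "integral {x0..x0 + 2 * d} (\<lambda>x. (a x)\<^sup>2)"
    have I0: "?I \<ge> 0" by (rule integral_nonneg) (use int x0d in auto)
    have CmI: "M / L * m * ?I \<le> C * m * ?I" "1 / (d * m0) * m * ?I \<le> C * m * ?I"
    proof -
      have "C * m * ?I = M / L * m * ?I + 1 / (d * m0) * m * ?I" by (simp add: C_def distrib_right)
      moreover have "M / L * m * ?I \<ge> 0" "1 / (d * m0) * m * ?I \<ge> 0" using I0 mp L M d m0 by simp_all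
      ultimately show "M / L * m * ?I \<le> C * m * ?I" "1 / (d * m0) * m * ?I \<le> C * m * ?I" by linarith+
    qed
    show "(a x0)\<^sup>2 \<le> C * m * ?I"
    proof (cases "Q (x0 + d) \<le> 0")
      case True
      have "integral {x0..x0 + d} (\<lambda>x. (a x0)\<^sup>2) \<le> integral {x0..x0 + d} (\<lambda>x. (a x)\<^sup>2)"
      proof (rule integral_le)
        fix x assume x: "x \<in> {x0..x0 + d}"
        have "Q x \<le> 0" using Qm[of x "x0 + d"] x x0d d True by force
        then show "(a x0)\<^sup>2 \<le> (a x)\<^sup>2" using grow[of x0 x] x d by simp
      qed (use int x0d d in auto)
      also have "\<dots> \<le> ?I" using d by (intro sub) auto
      finally have "d * (a x0)\<^sup>2 \<le> ?I" using d by simp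
      then have "(a x0)\<^sup>2 \<le> 1 / d * ?I" using d by (simp add: field_simps)
      also have "\<dots> \<le> 1 / (d * m0) * m * ?I" using I0 m m0 d by (intro mult_right_mono) (auto simp: field_simps)
      finally show ?thesis using CmI by linarith
    next
      case False
      \<comment> \<open>Either \<open>x0\<close> lies on the oscillating side already, or the
        intermediate value theorem gives a zero of \<open>Q\<close>, up to which \<open>a^2\<close>
        has grown.\<close>
      obtain x1 where x1: "x0 \<le> x1" "x1 \<le> x0 + d" "Q x1 \<ge> 0" "(a x0)\<^sup>2 \<le> (a x1)\<^sup>2"
      proof (cases "Q x0 \<ge> 0")
        case True
        then show ?thesis using that[of x0] d by simp
      next
        case nq: False
        have "\<exists>x\<ge>x0. x \<le> x0 + d \<and> Q x = 0"
        proof (rule IVT')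
          show "continuous_on {x0..x0 + d} Q"
            by (intro continuous_at_imp_continuous_on ballI DERIV_isCont[OF dQ]) (use d x0d in auto)
        qed (use nq False d in auto)
        then obtain x where "x \<ge> x0" "x \<le> x0 + d" "Q x = 0" by blast
        then show ?thesis using that[of x] grow[of x0 x] d by simp
      qed
      have neg: "x < 0" if "x \<le> x1 + d" for x using that x1 x0d by simp
      have "min (5/16 / sqrt (2*k) ^ 5) (c * sqrt (k/2)) * m ^ 5 * (a x1)\<^sup>2 * (d ^ 5 / 30)
        \<le> (2 * d^4 * (sqrt (d + B + k / m\<^sup>2) * (K * m ^ 6)) + 13 * d\<^sup>2 * (m / sqrt k)
        + 3/2 * d^3 * (m / sqrt k)^3 + 9/8 * d^4 * (m / sqrt k)^5) * integral {x1..x1+d} (\<lambda>x. (a x)\<^sup>2)"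
      proof (rule airy_amplitude[OF d c less_imp_le[OF B] mp k k3 dQ _ _ _ x1(3) _ da da''])
        fix x assume "x1 \<le> x" "x \<le> x1 + d"
        then have x: "x0 \<le> x" "x \<le> x0 + 2 * d" using x1 by auto
        show "c * m ^ 6 \<le> m ^ 6 * hyp_weight' x" using hyp_weight'_mono[OF x(1)] x x0d mp by (simp add: c_def mult_left_mono mult.commute)
        show "m ^ 6 * hyp_weight' x \<le> K * m ^ 6" using hyp_weight'_mono[OF x(2)] x x0d mp by (simp add: K_def mult_left_mono mult.commute)
      next
        fix x y assume "x1 \<le> x" "x \<le> y" "y \<le> x1 + d"
        then show "m ^ 6 * hyp_weight' x \<le> m ^ 6 * hyp_weight' y" using hyp_weight'_mono[of x y] neg mp by (simp add: mult_left_mono)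
      next
        have "Q x1 \<le> m ^ 6 * hyp_weight (x0 + 2 * d)"
          unfolding Q_def using hyp_weight_mono[of x1 "x0 + 2 * d"] x1 d x0d N mp
          by (smt (verit) mult_left_mono zero_less_power)
        also have "\<dots> = B * (m ^ 6 * c)" using c by (simp add: B_def)
        also have "\<dots> \<le> B * (m ^ 6 * hyp_weight' x1)" using hyp_weight'_mono[OF x1(1)] neg[of x1] d mp B
          by (intro mult_left_mono) (auto simp: c_def)
        finally show "Q x1 \<le> B * (m ^ 6 * hyp_weight' x1)" .
      qed (use neg in auto)
      then have 1: "L * m ^ 5 * (a x1)\<^sup>2 \<le> (2 * d^4 * (sqrt (d + B + k / m\<^sup>2) * (K * m ^ 6)) + 13 * d\<^sup>2 * (m / sqrt k)
        + 3/2 * d^3 * (m / sqrt k)^3 + 9/8 * d^4 * (m / sqrt k)^5) * integral {x1..x1+d} (\<lambda>x. (a x)\<^sup>2)" (is "_ \<le> ?M * _")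
        by (simp add: L_def mult_ac)
      have "?M \<le> M * m ^ 6"
      proof -
        \<comment> \<open>Lower powers of \<open>m\<close> are absorbed into \<open>m ^ 6\<close> at
          the price of powers of \<open>m0\<close>; a positive lower bound for the eigenvalues is
          indispensable here.\<close>
        have e: "m ^ i \<le> m ^ 6 / m0 ^ (6 - i)" if "i \<le> 6" for i
        proof -
          have "m ^ i * m0 ^ (6 - i) \<le> m ^ i * m ^ (6 - i)" using m m0 mp by (intro mult_left_mono power_mono) auto
          also have "\<dots> = m ^ 6" using that by (simp flip: power_add)
          finally show ?thesis using m0 by (simp add: field_simps)
        qed
        have "k / m\<^sup>2 \<le> k / m0\<^sup>2" using k m m0 by (intro divide_left_mono power_mono mult_pos_pos) auto
        then have "sqrt (d + B + k / m\<^sup>2) \<le> sqrt (d + B + k / m0\<^sup>2)" by simp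
        then have "2 * d^4 * (sqrt (d + B + k / m\<^sup>2) * (K * m ^ 6)) \<le> 2 * d^4 * (sqrt (d + B + k / m0\<^sup>2) * (K * m ^ 6))"
          using d K mp by (intro mult_left_mono mult_right_mono) auto
        moreover have "13 * d\<^sup>2 * (m / sqrt k) \<le> 13 * d\<^sup>2 * (m ^ 6 / m0 ^ 5 / sqrt k)"
          using e[of 1] d k by (intro mult_left_mono divide_right_mono) auto
        moreover have "3/2 * d^3 * (m / sqrt k)^3 \<le> 3/2 * d^3 * (m ^ 6 / m0 ^ 3 / sqrt k ^ 3)"
          unfolding power_divide using e[of 3] d k by (intro mult_left_mono divide_right_mono) auto
        moreover have "9/8 * d^4 * (m / sqrt k)^5 \<le> 9/8 * d^4 * (m ^ 6 / m0 / sqrt k ^ 5)"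
          unfolding power_divide using e[of 5] d k by (intro mult_left_mono divide_right_mono) auto
        ultimately show ?thesis unfolding M_def by (simp add: algebra_simps)
      qed
      then have "?M * integral {x1..x1+d} (\<lambda>x. (a x)\<^sup>2) \<le> M * m ^ 6 * integral {x1..x1+d} (\<lambda>x. (a x)\<^sup>2)"
        by (intro mult_right_mono integral_nonneg) (use int neg in auto)
      also have "\<dots> \<le> M * m ^ 6 * ?I" using M mp x1 by (intro mult_left_mono sub) auto
      finally have "L * m ^ 5 * (a x1)\<^sup>2 \<le> M * m ^ 6 * ?I" using 1 by linarith
      then have "m ^ 5 * (L * (a x1)\<^sup>2) \<le> m ^ 5 * (M * m * ?I)" by (simp add: power_numeral_reduce mult_ac)
      then have "L * (a x1)\<^sup>2 \<le> M * m * ?I" using mp by simp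
      then have "(a x1)\<^sup>2 \<le> M / L * m * ?I" using L by (simp add: field_simps)
      then show ?thesis using CmI x1 by linarith
    qed
  qed
qed

section \<open>Fourier coefficients on the circle\<close>

text \<open>Unnormalized: the pure mode \<open>cis (n y)\<close> has coefficient
  \<open>2 * pi\<close>, which accounts for the factors \<open>2 * pi\<close> in the identities
  below.\<close>

definition fourier :: "int \<Rightarrow> (real \<Rightarrow> complex) \<Rightarrow> complex"
  where "fourier n g = integral {0..2*pi} (\<lambda>y. g y * cis (- (of_int n * y)))"

lemma has_integral_cis:
  "((\<lambda>y. cis (of_int n * y)) has_integral (if n = 0 then of_real (2 * pi) else 0)) {0..2*pi}"
proof (cases "n = 0")
  case True
  then show ?thesis using has_integral_const_real[of "1::complex" 0 "2*pi"] by (simp add: scaleR_conv_of_real)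
next
  case False
  define F where "F z = exp (\<i> * of_int n * z) / (\<i> * of_int n)" for z :: complex
  have F: "F (of_real y) = cis (of_int n * y) / (\<i> * of_int n)" for y
    by (simp add: F_def cis_conv_exp mult.assoc)
  have "((\<lambda>y. F (of_real y)) has_vector_derivative cis (of_int n * y)) (at y within {0..2*pi})" for y :: real
  proof (rule has_vector_derivative_real_field)
    have "(F has_field_derivative exp (\<i> * of_int n * of_real y)) (at (of_real y))"
      unfolding F_def[abs_def] using False by (auto intro!: derivative_eq_intros)
    then show "(F has_field_derivative cis (of_int n * y)) (at (of_real y))" by (simp add: cis_conv_exp mult.assoc)
  qed
  then have "((\<lambda>y. cis (of_int n * y)) has_integral (F (of_real (2*pi)) - F (of_real 0))) {0..2*pi}"
    by (intro fundamental_theorem_of_calculus) auto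
  moreover have "F (of_real (2*pi)) - F (of_real 0) = 0"
    unfolding F using cis_multiple_2pi[of "of_int n"] by (simp add: mult_ac)
  ultimately show ?thesis using False by simp
qed

lemma fourier_cis:
  "fourier n (\<lambda>y. cis (of_int k * y)) = (if n = k then of_real (2 * pi) else 0)"
proof -
  have "cis (of_int k * y) * cis (- (of_int n * y)) = cis (of_int (k - n) * y)" for y
    by (simp add: cis_mult algebra_simps)
  then show ?thesis unfolding fourier_def using has_integral_cis[of "k - n"] by (auto simp: integral_unique)
qed

lemma continuous_on_cis_linear [continuous_intros]: "continuous_on S (\<lambda>y. cis (a * y))"
  by (intro continuous_intros)

lemma fourier_add:
  assumes "continuous_on {0..2*pi} f" "continuous_on {0..2*pi} g"
  shows "fourier n (\<lambda>y. f y + g y) = fourier n f + fourier n g"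
  unfolding fourier_def distrib_right
  by (rule integral_add) (auto intro!: integrable_continuous_real continuous_intros assms)

lemma fourier_cmult: "fourier n (\<lambda>y. c * f y) = c * fourier n f"
  unfolding fourier_def by (simp add: mult.assoc)

lemma fourier_sub_cmult:
  assumes "continuous_on {0..2*pi} f" "continuous_on {0..2*pi} g"
  shows "fourier n (\<lambda>y. f y - c * g y) = fourier n f - c * fourier n g"
  using fourier_add[OF assms(1), of "\<lambda>y. - c * g y" n] fourier_cmult[of n "-c" g] assms(2)
  by (simp add: continuous_intros)

lemma cmod_diff_squared: "(cmod (a - b))\<^sup>2 = (cmod a)\<^sup>2 - 2 * Re (cnj b * a) + (cmod b)\<^sup>2"
  unfolding cmod_power2 by (simp add: algebra_simps power2_eq_square)

text \<open>Completion of the square in \<open>d\<close>: the minimum sits at the normalized Fourier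
  coefficient, and the last term is the excess over it.\<close>

lemma integral_sub_mode:
  assumes g: "continuous_on {0..2*pi} g"
  shows "integral {0..2*pi} (\<lambda>y. (cmod (g y - d * cis (of_int n * y)))\<^sup>2)
    = integral {0..2*pi} (\<lambda>y. (cmod (g y))\<^sup>2) - (cmod (fourier n g))\<^sup>2 / (2 * pi)
      + 2 * pi * (cmod (d - fourier n g / of_real (2 * pi)))\<^sup>2"
proof -
  have i: "(\<lambda>y. g y * cis (- (of_int n * y))) integrable_on {0..2*pi}"
    by (intro integrable_continuous_real continuous_intros g)
  have e: "(cmod (g y - d * cis (of_int n * y)))\<^sup>2 = (cmod (g y))\<^sup>2 - 2 * Re (cnj d * (g y * cis (- (of_int n * y)))) + (cmod d)\<^sup>2" for y
    unfolding cmod_diff_squared by (simp add: norm_mult cis_cnj[symmetric] mult_ac)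
  have "((\<lambda>y. (cmod (g y))\<^sup>2 - 2 * Re (cnj d * (g y * cis (- (of_int n * y)))) + (cmod d)\<^sup>2)
     has_integral (integral {0..2*pi} (\<lambda>y. (cmod (g y))\<^sup>2) - 2 * Re (cnj d * fourier n g) + 2 * pi * (cmod d)\<^sup>2)) {0..2*pi}"
    unfolding fourier_def
    by (intro has_integral_add has_integral_diff has_integral_mult_right has_integral_Re integrable_integral i
      integrable_continuous_real continuous_intros g)
     (use has_integral_const_real[of "(cmod d)\<^sup>2" 0 "2*pi"] in simp)
  then have "integral {0..2*pi} (\<lambda>y. (cmod (g y - d * cis (of_int n * y)))\<^sup>2) =
    integral {0..2*pi} (\<lambda>y. (cmod (g y))\<^sup>2) - 2 * Re (cnj d * fourier n g) + 2 * pi * (cmod d)\<^sup>2"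
    unfolding e by (rule integral_unique)
  moreover have "2 * pi * (cmod (d - fourier n g / of_real (2 * pi)))\<^sup>2
      = 2 * pi * (cmod d)\<^sup>2 - 2 * Re (cnj d * fourier n g) + (cmod (fourier n g))\<^sup>2 / (2 * pi)"
  proof -
    have "Re (cnj (fourier n g / of_real (2 * pi)) * d) = Re (cnj d * fourier n g) / (2 * pi)"
      by (simp add: field_simps)
    then show ?thesis unfolding cmod_diff_squared
      by (simp add: norm_divide power_divide power2_eq_square field_simps)
  qed
  ultimately show ?thesis by simp
qed

lemma continuous_on_trig_sum: "continuous_on S (\<lambda>y. \<Sum>n\<in>I. d n * cis (of_int n * y))"
  by (intro continuous_intros)

text \<open>By orthogonality the removal of other modes leaves coefficient \<open>n\<close> alone,
  so modes can be subtracted one at a time.\<close>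

lemma fourier_sub_trig:
  assumes g: "continuous_on {0..2*pi} g" and I: "finite I" and n: "n \<notin> I"
  shows "fourier n (\<lambda>y. g y - (\<Sum>k\<in>I. d k * cis (of_int k * y))) = fourier n g"
  using I n
proof (induction I)
  case (insert k I)
  have "fourier n (\<lambda>y. g y - (\<Sum>k\<in>insert k I. d k * cis (of_int k * y))) =
    fourier n (\<lambda>y. (g y - (\<Sum>k\<in>I. d k * cis (of_int k * y))) - d k * cis (of_int k * y))"
    using insert by (simp add: algebra_simps)
  also have "\<dots> = fourier n (\<lambda>y. (g y - (\<Sum>k\<in>I. d k * cis (of_int k * y)))) - d k * fourier n (\<lambda>y. cis (of_int k * y))"
    by (rule fourier_sub_cmult; intro continuous_intros g continuous_on_trig_sum)
  finally show ?case using insert by (simp add: fourier_cis)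
qed simp

text \<open>An exact defect formula for arbitrary coefficients \<open>d\<close>. The optimal choice
  gives Bessel's inequality; for any other choice the last sum may be dropped, which gives the
  opposite inequality up to the approximation error.\<close>

lemma integral_sub_trig:
  assumes g: "continuous_on {0..2*pi} g" and I: "finite I"
  shows "integral {0..2*pi} (\<lambda>y. (cmod (g y - (\<Sum>n\<in>I. d n * cis (of_int n * y))))\<^sup>2)
    = integral {0..2*pi} (\<lambda>y. (cmod (g y))\<^sup>2) - (\<Sum>n\<in>I. (cmod (fourier n g))\<^sup>2) / (2 * pi)
      + 2 * pi * (\<Sum>n\<in>I. (cmod (d n - fourier n g / of_real (2 * pi)))\<^sup>2)"
  using I
proof (induction I)
  case (insert k I)
  let ?h = "\<lambda>y. g y - (\<Sum>k\<in>I. d k * cis (of_int k * y))"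
  have h: "continuous_on {0..2*pi} ?h" by (intro continuous_intros g continuous_on_trig_sum)
  have "integral {0..2*pi} (\<lambda>y. (cmod (g y - (\<Sum>n\<in>insert k I. d n * cis (of_int n * y))))\<^sup>2)
    = integral {0..2*pi} (\<lambda>y. (cmod (?h y - d k * cis (of_int k * y)))\<^sup>2)"
    using insert by (simp add: algebra_simps)
  also have "\<dots> = integral {0..2*pi} (\<lambda>y. (cmod (?h y))\<^sup>2) - (cmod (fourier k ?h))\<^sup>2 / (2 * pi)
      + 2 * pi * (cmod (d k - fourier k ?h / of_real (2 * pi)))\<^sup>2"
    by (rule integral_sub_mode[OF h])
  also have "fourier k ?h = fourier k g" using insert by (intro fourier_sub_trig g) auto
  finally show ?case using insert by (simp add: algebra_simps add_divide_distrib)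
qed simp

lemma bessel:
  assumes g: "continuous_on {0..2*pi} g" and I: "finite I"
  shows "(\<Sum>n\<in>I. (cmod (fourier n g))\<^sup>2) \<le> 2 * pi * integral {0..2*pi} (\<lambda>y. (cmod (g y))\<^sup>2)"
proof -
  define d where "d n = fourier n g / of_real (2 * pi)" for n
  have "0 \<le> integral {0..2*pi} (\<lambda>y. (cmod (g y - (\<Sum>n\<in>I. d n * cis (of_int n * y))))\<^sup>2)"
    by (rule integral_nonneg) (auto intro!: integrable_continuous_real continuous_intros g continuous_on_trig_sum)
  then have "(\<Sum>n\<in>I. (cmod (fourier n g))\<^sup>2) / (2 * pi) \<le> integral {0..2*pi} (\<lambda>y. (cmod (g y))\<^sup>2)"
    unfolding integral_sub_trig[OF g I] by (simp add: d_def)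
  then show ?thesis by (simp add: field_simps)
qed

section \<open>Trigonometric polynomials and the approximate Parseval inequality\<close>

text \<open>Negative frequencies are collected into one factor \<open>cis (- N y)\<close> in front
  of a polynomial in \<open>cis y\<close>, so that sums and products reduce to polynomial
  arithmetic.\<close>

definition trig_poly :: "(real \<Rightarrow> complex) \<Rightarrow> bool"
  where "trig_poly g \<longleftrightarrow> (\<exists>N P. \<forall>y. g y = cis (- (real N * y)) * poly P (cis y))"

lemma trig_poly_const: "trig_poly (\<lambda>_. c)"
  unfolding trig_poly_def by (intro exI[of _ 0] exI[of _ "[:c:]"]) simp

lemma trig_poly_mult:
  assumes "trig_poly f" "trig_poly g"
  shows "trig_poly (\<lambda>y. f y * g y)"
proof -
  obtain N P M R where *: "\<And>y. f y = cis (- (real N * y)) * poly P (cis y)" "\<And>y. g y = cis (- (real M * y)) * poly R (cis y)"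
    using assms unfolding trig_poly_def by metis
  have "f y * g y = cis (- (real (N + M) * y)) * poly (P * R) (cis y)" for y
  proof -
    have "cis (- (real (N + M) * y)) = cis (- (real N * y)) * cis (- (real M * y))"
      by (simp add: cis_mult algebra_simps)
    then show ?thesis by (simp add: * mult_ac)
  qed
  then show ?thesis unfolding trig_poly_def by blast
qed

lemma trig_poly_add:
  assumes "trig_poly f" "trig_poly g"
  shows "trig_poly (\<lambda>y. f y + g y)"
proof -
  obtain N P M R where *: "\<And>y. f y = cis (- (real N * y)) * poly P (cis y)" "\<And>y. g y = cis (- (real M * y)) * poly R (cis y)"
    using assms unfolding trig_poly_def by metis
  have "f y + g y = cis (- (real (N + M) * y)) * poly (P * monom 1 M + R * monom 1 N) (cis y)" for y
  proof -
    have "cis (- (real (N + M) * y)) * cis y ^ M = cis (- (real N * y))"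
      "cis (- (real (N + M) * y)) * cis y ^ N = cis (- (real M * y))"
      by (simp_all add: Complex.DeMoivre cis_mult algebra_simps)
    then have "cis (- (real N * y)) * poly P (cis y) = cis (- (real (N + M) * y)) * (poly P (cis y) * cis y ^ M)"
      "cis (- (real M * y)) * poly R (cis y) = cis (- (real (N + M) * y)) * (poly R (cis y) * cis y ^ N)"
      by (metis mult.assoc mult.commute)+
    then show ?thesis by (simp only: * poly_add poly_mult poly_monom distrib_left mult_1)
  qed
  then show ?thesis unfolding trig_poly_def by blast
qed

lemma trig_poly_cos: "trig_poly (\<lambda>y. of_real (cos y))"
  unfolding trig_poly_def
proof (intro exI allI)
  fix y
  show "complex_of_real (cos y) = cis (- (real 1 * y)) * poly [:1/2, 0, 1/2:] (cis y)"
    using sin_cos_squared_add3[of y] by (simp add: complex_eq_iff algebra_simps)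
qed

lemma trig_poly_sin: "trig_poly (\<lambda>y. of_real (sin y))"
  unfolding trig_poly_def
proof (intro exI allI)
  fix y
  show "complex_of_real (sin y) = cis (- (real 1 * y)) * poly [:\<i>/2, 0, -\<i>/2:] (cis y)"
    using sin_cos_squared_add3[of y] by (simp add: complex_eq_iff algebra_simps)
qed

lemma trig_poly_real_polynomial_function:
  assumes "real_polynomial_function p"
  shows "trig_poly (\<lambda>y. of_real (p (cis y)))"
  using assms
proof (induction p)
  case (linear f)
  interpret bounded_linear f by fact
  have "f (cis y) = cos y * f 1 + sin y * f \<i>" for y
  proof -
    have "cis y = cos y *\<^sub>R 1 + sin y *\<^sub>R \<i>" by (simp add: complex_eq_iff)
    then show ?thesis by (simp only: add scaleR) simp
  qed
  moreover have "trig_poly (\<lambda>y. of_real (cos y) * of_real (f 1) + of_real (sin y) * of_real (f \<i>))"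
    by (intro trig_poly_add trig_poly_mult trig_poly_const trig_poly_sin trig_poly_cos)
  ultimately show ?case by simp
qed (auto intro: trig_poly_add trig_poly_mult trig_poly_const)

lemma trig_poly_sum:
  assumes "trig_poly g"
  obtains I d where "finite I" "\<And>y. g y = (\<Sum>n\<in>I. d n * cis (of_int n * y))"
proof -
  obtain N P where g: "\<And>y. g y = cis (- (real N * y)) * poly P (cis y)"
    using assms unfolding trig_poly_def by metis
  define I where "I = (\<lambda>k. int k - int N) ` {..degree P}"
  have inj: "inj_on (\<lambda>k. int k - int N) {..degree P}" by (auto simp: inj_on_def)
  have "g y = (\<Sum>n\<in>I. coeff P (nat (n + int N)) * cis (of_int n * y))" for y
    unfolding g I_def poly_altdef sum.reindex[OF inj] sum_distrib_left
    by (intro sum.cong refl) (simp add: Complex.DeMoivre cis_mult algebra_simps mult.left_commute[of _ "coeff P _"])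
  then show ?thesis using that[of I "\<lambda>n. coeff P (nat (n + int N))"] by (simp add: I_def)
qed

text \<open>Only the half of Parseval that bounds the circle mean by coefficients is used, so
  finitely many modes and an error \<epsilon> suffice. Stone-Weierstrass is applied on the circle as
  a subset of the plane, which makes the approximants periodic by themselves.\<close>

lemma parseval_approx:
  assumes G: "continuous_on (sphere 0 1) G" and e: "\<epsilon> > 0"
  shows "\<exists>I. finite I \<and> integral {0..2*pi} (\<lambda>y. (cmod (G (cis y)))\<^sup>2)
    \<le> (\<Sum>n\<in>I. (cmod (fourier n (\<lambda>y. G (cis y))))\<^sup>2) / (2 * pi) + \<epsilon>"
proof -
  \<comment> \<open>Chosen so that the squared error \<open>4 * \<delta>^2\<close> integrates over
    length \<open>2 * pi\<close> to exactly \<epsilon>.\<close>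
  define \<delta> where "\<delta> = sqrt (\<epsilon> / (8 * pi))"
  have \<delta>: "\<delta> > 0" using e by (simp add: \<delta>_def)
  obtain p1 where p1: "real_polynomial_function p1" "\<And>x. x \<in> sphere 0 1 \<Longrightarrow> \<bar>Re (G x) - p1 x\<bar> < \<delta>"
    using Stone_Weierstrass_real_polynomial_function[OF compact_sphere _ \<delta>, of 0 1 "\<lambda>x. Re (G x)"] G by (auto intro!: continuous_intros)
  obtain p2 where p2: "real_polynomial_function p2" "\<And>x. x \<in> sphere 0 1 \<Longrightarrow> \<bar>Im (G x) - p2 x\<bar> < \<delta>"
    using Stone_Weierstrass_real_polynomial_function[OF compact_sphere _ \<delta>, of 0 1 "\<lambda>x. Im (G x)"] G by (auto intro!: continuous_intros)
  define q where "q y = of_real (p1 (cis y)) + of_real (p2 (cis y)) * \<i>" for y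
  have "trig_poly q" unfolding q_def[abs_def]
    by (intro trig_poly_add trig_poly_mult trig_poly_const trig_poly_real_polynomial_function p1 p2)
  then obtain I d where I: "finite I" and q: "\<And>y. q y = (\<Sum>n\<in>I. d n * cis (of_int n * y))"
    using trig_poly_sum by blast
  let ?g = "\<lambda>y. G (cis y)"
  have g: "continuous_on {0..2*pi} ?g"
    by (rule continuous_on_compose2[OF G]) (auto intro!: continuous_intros)
  have close: "(cmod (?g y - q y))\<^sup>2 \<le> 4 * \<delta>\<^sup>2" for y
  proof -
    have "cmod (?g y - q y) \<le> \<bar>Re (?g y - q y)\<bar> + \<bar>Im (?g y - q y)\<bar>" by (rule cmod_le)
    also have "\<dots> \<le> 2 * \<delta>" using p1(2)[of "cis y"] p2(2)[of "cis y"] by (simp add: q_def)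
    finally have "(cmod (?g y - q y))\<^sup>2 \<le> (2 * \<delta>)\<^sup>2" by (intro power_mono) auto
    then show ?thesis by (simp add: power_mult_distrib)
  qed
  have "integral {0..2*pi} (\<lambda>y. (cmod (?g y - q y))\<^sup>2) \<le> integral {0..2*pi} (\<lambda>y. 4 * \<delta>\<^sup>2)"
  proof (rule integral_le)
    show "(\<lambda>y. (cmod (?g y - q y))\<^sup>2) integrable_on {0..2*pi}" unfolding q
      by (intro integrable_continuous_real continuous_intros g continuous_on_trig_sum)
  qed (use close in auto)
  also have "\<dots> = \<epsilon>" using e by (simp add: \<delta>_def)
  finally have "integral {0..2*pi} (\<lambda>y. (cmod (?g y))\<^sup>2) - (\<Sum>n\<in>I. (cmod (fourier n ?g))\<^sup>2) / (2 * pi)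
      + 2 * pi * (\<Sum>n\<in>I. (cmod (d n - fourier n ?g / of_real (2 * pi)))\<^sup>2) \<le> \<epsilon>"
    unfolding q using integral_sub_trig[OF g I, of d] by simp
  moreover have "2 * pi * (\<Sum>n\<in>I. (cmod (d n - fourier n ?g / of_real (2 * pi)))\<^sup>2) \<ge> 0"
    by (intro mult_nonneg_nonneg sum_nonneg) auto
  ultimately have "integral {0..2*pi} (\<lambda>y. (cmod (?g y))\<^sup>2) \<le> (\<Sum>n\<in>I. (cmod (fourier n ?g))\<^sup>2) / (2 * pi) + \<epsilon>" by linarith
  with I show ?thesis by blast
qed

section \<open>Separation of variables in logarithmic polar coordinates\<close>

lemma has_vector_derivative_Complex_x:
  assumes "F differentiable (at (Complex x y))"
  shows "((\<lambda>x. F (Complex x y)) has_vector_derivative partial_x F (Complex x y)) (at x within S)"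
proof -
  have e: "Complex t y = of_real t + of_real y * \<i>" for t by (simp add: complex_eq_iff)
  have "((\<lambda>t. Complex t y) has_derivative of_real) (at x within S)"
    unfolding e by (auto intro!: derivative_eq_intros)
  from has_derivative_compose[OF this has_derivative_partials[OF assms]]
  show ?thesis by (simp add: has_vector_derivative_def)
qed

lemma has_vector_derivative_Complex_y:
  assumes "F differentiable (at (Complex x y))"
  shows "((\<lambda>y. F (Complex x y)) has_vector_derivative partial_y F (Complex x y)) (at y within S)"
proof -
  have e: "Complex x t = of_real x + of_real t * \<i>" for t by (simp add: complex_eq_iff)
  have "((\<lambda>t. Complex x t) has_derivative (\<lambda>t. of_real t * \<i>)) (at y within S)"
    unfolding e by (auto intro!: derivative_eq_intros)
  from has_derivative_compose[OF this has_derivative_partials[OF assms]]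
  show ?thesis by (simp add: has_vector_derivative_def)
qed

lemma continuous_on_Complex [continuous_intros]:
  assumes "continuous_on S f" "continuous_on S g"
  shows "continuous_on S (\<lambda>x. Complex (f x) (g x))"
  unfolding Complex_eq by (intro continuous_intros assms)

lemma fourier_norm_le:
  assumes "continuous_on {0..2*pi} g" "\<And>y. y \<in> {0..2*pi} \<Longrightarrow> cmod (g y) \<le> B"
  shows "cmod (fourier n g) \<le> 2 * pi * B"
proof -
  have "cmod (integral {0..2*pi} (\<lambda>y. g y * cis (- (of_int n * y)))) \<le> integral {0..2*pi} (\<lambda>y. B)"
    by (rule integral_norm_bound_integral)
      (auto intro!: integrable_continuous_real continuous_intros assms simp: norm_mult)
  then show ?thesis by (simp add: fourier_def)
qed

text \<open>A function on a punctured disc, pulled back by \<open>exp\<close>: circles about the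
  centre become vertical segments of one period, and the centre moves to real part minus
  infinity.\<close>

locale periodic_half_plane =
  fixes F :: "complex \<Rightarrow> complex" and b :: real
  assumes C2: "Ck_on 2 {w. Re w < b} F"
    and periodic: "F (w + 2 * pi * \<i>) = F w"
begin

lemma diffs:
  assumes "Re w < b"
  shows "F differentiable (at w)" "partial_x F differentiable (at w)" "partial_y F differentiable (at w)"
  using C2 assms by (auto simp: numeral_2_eq_2)

lemma conts:
  "continuous_on {w. Re w < b} F" "continuous_on {w. Re w < b} (partial_x F)" "continuous_on {w. Re w < b} (partial_y F)"
  "continuous_on {w. Re w < b} (partial_x (partial_x F))" "continuous_on {w. Re w < b} (partial_y (partial_y F))"
  using C2 Ck_on_imp_continuous[OF C2] by (auto simp: numeral_2_eq_2 intro: Ck_on_imp_continuous[of "Suc 0"])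

lemma fourier_deriv:
  assumes d: "\<And>w. Re w < b \<Longrightarrow> G differentiable (at w)"
    and c: "continuous_on {w. Re w < b} (partial_x G)" and x: "x < b"
  shows "((\<lambda>x. fourier n (\<lambda>y. G (Complex x y))) has_vector_derivative fourier n (\<lambda>y. partial_x G (Complex x y))) (at x)"
proof -
  have cG: "continuous_on {w. Re w < b} G"
    using d by (simp add: differentiable_imp_continuous_on differentiable_on_def differentiable_at_withinI)
  have "((\<lambda>x. integral (cbox 0 (2*pi)) (\<lambda>y. G (Complex x y) * cis (- (of_int n * y)))) has_vector_derivative
      integral (cbox 0 (2*pi)) (\<lambda>y. partial_x G (Complex x y) * cis (- (of_int n * y)))) (at x within {..<b})"
  proof (rule leibniz_rule_vector_derivative)
    fix s t :: real assume s: "s \<in> {..<b}"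
    show "((\<lambda>s. G (Complex s t) * cis (- (of_int n * t))) has_vector_derivative partial_x G (Complex s t) * cis (- (of_int n * t))) (at s within {..<b})"
      by (rule has_vector_derivative_mult_left[OF has_vector_derivative_Complex_x[OF d]]) (use s in simp)
  next
    fix s assume s: "s \<in> {..<b}"
    have "continuous_on {0..2*pi} (\<lambda>y. G (Complex s y) * cis (- (of_int n * y)))"
      by (intro continuous_intros continuous_on_compose2[OF cG]) (use s in auto)
    then show "(\<lambda>y. G (Complex s y) * cis (- (of_int n * y))) integrable_on cbox 0 (2*pi)"
      by (simp add: integrable_continuous_real)
  next
    show "continuous_on ({..<b} \<times> cbox 0 (2 * pi)) (\<lambda>(x, t). partial_x G (Complex x t) * cis (- (of_int n * t)))"
      unfolding split_beta
      by (intro continuous_intros continuous_on_compose2[OF c]) auto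
  qed (use x in auto)
  then show ?thesis using x by (simp add: fourier_def at_within_open[of x "{..<b}"])
qed

definition A :: "int \<Rightarrow> real \<Rightarrow> complex" where "A n x = fourier n (\<lambda>y. F (Complex x y))"
definition A' :: "int \<Rightarrow> real \<Rightarrow> complex" where "A' n x = fourier n (\<lambda>y. partial_x F (Complex x y))"

lemma A_deriv: "x < b \<Longrightarrow> (A n has_vector_derivative A' n x) (at x)"
  unfolding A_def[abs_def] A'_def by (rule fourier_deriv) (auto intro: diffs conts)

text \<open>Two integrations by parts in \<open>y\<close> turn the second
  \<open>y\<close>-derivative into multiplication by \<open>- n^2\<close>, the boundary terms
  vanishing by periodicity. The Laplacian stays as a source term, so the same formula covers
  eigenfunctions and functions whose Laplacian is merely bounded.\<close>

lemma A'_deriv: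
  assumes x: "x < b"
  shows "(A' n has_vector_derivative of_int (n\<^sup>2) * A n x + fourier n (\<lambda>y. flat_laplacian F (Complex x y))) (at x)"
proof -
  have "(A' n has_vector_derivative fourier n (\<lambda>y. partial_x (partial_x F) (Complex x y))) (at x)"
    unfolding A'_def[abs_def] by (rule fourier_deriv) (use x in \<open>auto intro: diffs conts\<close>)
  moreover have "fourier n (\<lambda>y. partial_x (partial_x F) (Complex x y)) = of_int (n\<^sup>2) * A n x + fourier n (\<lambda>y. flat_laplacian F (Complex x y))"
  proof -
    define e where "e y = cis (- (of_int n * y))" for y
    have de: "(e has_vector_derivative - \<i> * of_int n * e y) (at y within S)" for y S
    proof -
      have "((\<lambda>z. exp (- \<i> * of_int n * z)) has_field_derivative - \<i> * of_int n * exp (- \<i> * of_int n * of_real y)) (at (of_real y))"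
        by (auto intro!: derivative_eq_intros)
      from has_vector_derivative_real_field[OF this]
      show ?thesis unfolding e_def[abs_def] by (simp add: cis_conv_exp mult.assoc)
    qed
    \<comment> \<open>A primitive in \<open>y\<close> that performs both integrations by parts at
      once: in its derivative the terms with \<open>partial_y F\<close> cancel.\<close>
    define V where "V y = partial_y F (Complex x y) * e y + \<i> * of_int n * (F (Complex x y) * e y)" for y
    have "(V has_vector_derivative partial_y (partial_y F) (Complex x y) * e y + of_int (n\<^sup>2) * (F (Complex x y) * e y)) (at y within S)" for y S
      unfolding V_def[abs_def]
      by (rule has_vector_derivative_eq_rhs[OF has_vector_derivative_add[OF has_vector_derivative_mult[OF has_vector_derivative_Complex_y[OF diffs(3)] de]
          has_vector_derivative_mult_right[OF has_vector_derivative_mult[OF has_vector_derivative_Complex_y[OF diffs(1)] de]]]])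
        (use x in \<open>auto simp: algebra_simps power2_eq_square\<close>)
    then have "((\<lambda>y. partial_y (partial_y F) (Complex x y) * e y + of_int (n\<^sup>2) * (F (Complex x y) * e y)) has_integral (V (2*pi) - V 0)) {0..2*pi}"
      by (intro fundamental_theorem_of_calculus) auto
    moreover have "V (2*pi) = V 0"
    proof -
      have p: "Complex x (2*pi) = Complex x 0 + 2 * pi * \<i>" by (simp add: complex_eq_iff)
      have "partial_y F (w + 2 * pi * \<i>) = partial_y F w" for w
        unfolding partial_y_def using periodic by (simp add: add.assoc add.commute[of "of_real _ * \<i>"] add.left_commute) (metis (no_types, lifting) add.assoc add.commute periodic)
      moreover have "e (2*pi) = e 0" unfolding e_def using cis_multiple_2pi[of "- of_int n"] by (simp add: mult_ac)
      ultimately show ?thesis unfolding V_def p by (simp only: periodic)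
    qed
    ultimately have z: "((\<lambda>y. partial_y (partial_y F) (Complex x y) * e y + of_int (n\<^sup>2) * (F (Complex x y) * e y)) has_integral 0) {0..2*pi}" by simp
    have cc: "continuous_on {0..2*pi} (\<lambda>y. H (Complex x y) * e y)" if "continuous_on {w. Re w < b} H" for H
      unfolding e_def by (intro continuous_intros continuous_on_compose2[OF that]) (use x in auto)
    have i: "((\<lambda>y. H (Complex x y) * e y) has_integral fourier n (\<lambda>y. H (Complex x y))) {0..2*pi}" if "continuous_on {w. Re w < b} H" for H
      using integrable_integral[OF integrable_continuous_real[OF cc[OF that]]] by (simp add: fourier_def e_def)
    have cl: "continuous_on {w. Re w < b} (flat_laplacian F)"
      unfolding flat_laplacian_def[abs_def] by (intro continuous_intros conts)
    have "((\<lambda>y. flat_laplacian F (Complex x y) * e y - (partial_y (partial_y F) (Complex x y) * e y + of_int (n\<^sup>2) * (F (Complex x y) * e y))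
        + of_int (n\<^sup>2) * (F (Complex x y) * e y)) has_integral
        (fourier n (\<lambda>y. flat_laplacian F (Complex x y)) - 0 + of_int (n\<^sup>2) * A n x)) {0..2*pi}"
      unfolding A_def by (intro has_integral_add has_integral_diff has_integral_mult_right z i cl conts)
    then have "((\<lambda>y. partial_x (partial_x F) (Complex x y) * e y) has_integral
        (of_int (n\<^sup>2) * A n x + fourier n (\<lambda>y. flat_laplacian F (Complex x y)))) {0..2*pi}"
      by (simp add: flat_laplacian_def algebra_simps)
    from has_integral_unique[OF this i[OF conts(4)]] show ?thesis by simp
  qed
  ultimately show ?thesis by simp
qed

end

lemma exp_Complex: "exp (Complex x y) = of_real (exp x) * cis y"
  by (simp add: exp_eq_polar)

text \<open>\<open>exp\<close> is holomorphic with derivative of modulus \<open>exp (Re w)\<close>,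
  whose square is the factor in front of the Laplacian.\<close>

lemma logpolar_half_plane:
  assumes f: "Ck_on 2 (ball a R) f" and R: "R > 0"
  shows "periodic_half_plane (\<lambda>w. f (a + exp w)) (ln R)"
    and "\<And>w. Re w < ln R \<Longrightarrow> flat_laplacian (\<lambda>w. f (a + exp w)) w = of_real (exp (2 * Re w)) * flat_laplacian f (a + exp w)"
proof -
  have h: "(\<lambda>w. a + exp w) holomorphic_on {w. Re w < ln R}" by (intro holomorphic_intros)
  have sub: "(\<lambda>w. a + exp w) ` {w. Re w < ln R} \<subseteq> ball a R"
    using R by (auto simp: dist_norm) (metis exp_less_cancel_iff exp_ln)
  show "periodic_half_plane (\<lambda>w. f (a + exp w)) (ln R)"
  proof
    show "Ck_on 2 {w. Re w < ln R} (\<lambda>w. f (a + exp w))"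
      by (rule Ck_on_compose_holomorphic[OF open_halfspace_Re_lt open_ball h sub f])
    show "f (a + exp (w + complex_of_real (2 * pi) * \<i>)) = f (a + exp w)" for w
      by (simp add: exp_add exp_two_pi_i)
  qed
  fix w assume w: "Re w < ln R"
  have "deriv (\<lambda>w. a + exp w) w = exp w" by (rule DERIV_imp_deriv) (auto intro!: derivative_eq_intros)
  then show "flat_laplacian (\<lambda>w. f (a + exp w)) w = of_real (exp (2 * Re w)) * flat_laplacian f (a + exp w)"
    using flat_laplacian_compose_holomorphic[OF open_halfspace_Re_lt open_ball h sub f, of w] w
    by (simp add: exp_double)
qed

lemma has_real_derivative_Re: "(f has_vector_derivative D) F \<Longrightarrow> ((\<lambda>x. Re (f x)) has_real_derivative Re D) F"
  unfolding has_vector_derivative_def has_field_derivative_def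
  by (drule has_derivative_Re) (simp add: mult_commute_abs mult.commute[of _ "Re D"])

lemma has_real_derivative_Im: "(f has_vector_derivative D) F \<Longrightarrow> ((\<lambda>x. Im (f x)) has_real_derivative Im D) F"
  unfolding has_vector_derivative_def has_field_derivative_def
  by (drule has_derivative_Im) (simp add: mult_commute_abs mult.commute[of _ "Im D"])

lemma continuous_on_circle:
  assumes "continuous_on (ball a R) f" "0 < r" "r < R"
  shows "continuous_on S (\<lambda>y. f (a + of_real r * cis y))"
  by (rule continuous_on_compose2[OF assms(1)]) (use assms in \<open>auto intro!: continuous_intros simp: dist_norm norm_mult\<close>)

lemma fourier_0_const: "fourier 0 (\<lambda>_. c) = of_real (2 * pi) * c"
  by (simp add: fourier_def scaleR_conv_of_real)

section \<open>Mean value and gradient estimates\<close>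

text \<open>Mode 0 has as second derivative in the logarithmic radius the mean of the Laplacian, so
  after a quadratic correction the mean is monotone in the radius; its limit at radius 0 is the
  value at the centre. Negative \<kappa> serves in the Harnack estimate, positive \<kappa> at a
  minimum of an eigenfunction.\<close>

lemma circle_mean_le:
  assumes f: "Ck_on 2 (ball a R) f" and r: "0 < r" "r < R"
    and lap: "\<And>z. z \<in> ball a R \<Longrightarrow> Re (flat_laplacian f z) \<le> - 4 * \<kappa>"
  shows "Re (fourier 0 (\<lambda>y. f (a + of_real r * cis y))) \<le> 2 * pi * (Re (f a) - \<kappa> * r\<^sup>2)"
proof -
  define F where "F = (\<lambda>w. f (a + exp w))"
  have R: "R > 0" using r by simp
  interpret periodic_half_plane F "ln R" using logpolar_half_plane(1)[OF f R] by (simp add: F_def)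
  have lapF: "flat_laplacian F w = of_real (exp (2 * Re w)) * flat_laplacian f (a + exp w)" if "Re w < ln R" for w
    using logpolar_half_plane(2)[OF f R that] by (simp add: F_def)
  have cf: "continuous_on (ball a R) f" using f by (rule Ck_on_imp_continuous)
  have Feq: "F (Complex x y) = f (a + of_real (exp x) * cis y)" for x y by (simp add: F_def exp_Complex)
  have lnr: "ln r < ln R" using r by simp
  have inb: "a + exp (Complex x y) \<in> ball a R" if "x < ln R" for x y
    using that R by (simp add: dist_norm) (metis exp_less_cancel_iff exp_ln)
  \<comment> \<open>Minus the mode 0 of the difference between \<open>f\<close> and the model
    \<open>- \<kappa> |z - a|^2\<close>, whose Laplacian is the constant
    \<open>- 4 * \<kappa>\<close>. It is convex in \<open>x\<close> and bounded above to the left,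
    hence nondecreasing.\<close>
  define h where "h x = - Re (A 0 x) - 2 * pi * \<kappa> * exp (2 * x)" for x
  define h' where "h' x = - Re (A' 0 x) - 4 * pi * \<kappa> * exp (2 * x)" for x
  define h'' where "h'' x = - Re (fourier 0 (\<lambda>y. flat_laplacian F (Complex x y))) - 8 * pi * \<kappa> * exp (2 * x)" for x
  have e: "((\<lambda>x. k * exp (2 * x)) has_real_derivative 2 * k * exp (2 * x)) (at x)" for k x :: real
    by (auto intro!: derivative_eq_intros)
  have dh: "(h has_real_derivative h' x) (at x)" if "x \<le> ln r" for x
    unfolding h_def[abs_def] h'_def
    by (rule DERIV_cong[OF DERIV_diff[OF DERIV_minus[OF has_real_derivative_Re[OF A_deriv]] e]]) (use that lnr in auto)
  have dh': "(h' has_real_derivative h'' x) (at x)" if "x \<le> ln r" for x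
    unfolding h'_def[abs_def] h''_def
    by (rule DERIV_cong[OF DERIV_diff[OF DERIV_minus[OF has_real_derivative_Re[OF A'_deriv]] e]]) (use that lnr in auto)
  have h''0: "h'' x \<ge> 0" if x: "x \<le> ln r" for x
  proof -
    have x': "x < ln R" using x lnr by simp
    have cl: "continuous_on {w. Re w < ln R} (flat_laplacian F)"
      unfolding flat_laplacian_def[abs_def] by (intro continuous_intros conts)
    have c: "continuous_on {0..2*pi} (\<lambda>y. flat_laplacian F (Complex x y))"
      by (rule continuous_on_compose2[OF cl]) (use x' in \<open>auto intro!: continuous_intros\<close>)
    have "((\<lambda>y. Re (flat_laplacian F (Complex x y))) has_integral Re (fourier 0 (\<lambda>y. flat_laplacian F (Complex x y)))) {0..2*pi}"
      unfolding fourier_def using integrable_integral[OF integrable_continuous_real[OF c]] by (auto intro!: has_integral_Re)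
    moreover have "((\<lambda>y. - 4 * \<kappa> * exp (2 * x)) has_integral (2 * pi * (- 4 * \<kappa> * exp (2 * x)))) {0..2*pi}"
      using has_integral_const_real[of "- 4 * \<kappa> * exp (2 * x)" 0 "2*pi"] by simp
    ultimately have "Re (fourier 0 (\<lambda>y. flat_laplacian F (Complex x y))) \<le> 2 * pi * (- 4 * \<kappa> * exp (2 * x))"
    proof (rule has_integral_le)
      fix y :: real
      have "Re (flat_laplacian F (Complex x y)) = exp (2 * x) * Re (flat_laplacian f (a + exp (Complex x y)))"
        using lapF[of "Complex x y"] x' by simp
      also have "\<dots> \<le> exp (2 * x) * (- 4 * \<kappa>)" by (intro mult_left_mono lap inb x') auto
      finally show "Re (flat_laplacian F (Complex x y)) \<le> - 4 * \<kappa> * exp (2 * x)" by (simp add: mult_ac)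
    qed
    then show ?thesis by (simp add: h''_def)
  qed
  have cA: "continuous_on {0..2*pi} (\<lambda>y. F (Complex x y))" if "x < ln R" for x
    unfolding Feq by (rule continuous_on_circle[OF cf]) (use that R in auto, metis exp_less_cancel_iff exp_ln)
  have "compact (cball a r)" "cball a r \<subseteq> ball a R" using r by auto
  then have "bounded (f ` cball a r)" using cf by (meson compact_continuous_image compact_imp_bounded continuous_on_subset)
  then obtain B where B: "\<And>z. z \<in> cball a r \<Longrightarrow> cmod (f z) \<le> B" unfolding bounded_iff ball_simps by blast
  have hb: "h x \<le> 2 * pi * B + 2 * pi * \<bar>\<kappa>\<bar> * r\<^sup>2" if x: "x \<le> ln r" for x
  proof -
    have er: "exp x \<le> r" using x r by (metis exp_le_cancel_iff exp_ln)
    have "cmod (A 0 x) \<le> 2 * pi * B" unfolding A_def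
      by (rule fourier_norm_le) (use cA x lnr in \<open>auto simp: Feq dist_norm norm_mult er intro!: B\<close>)
    moreover have "- Re (A 0 x) \<le> cmod (A 0 x)" using abs_Re_le_cmod[of "A 0 x"] by linarith
    moreover have "- \<kappa> * exp (2 * x) \<le> \<bar>\<kappa>\<bar> * r\<^sup>2"
    proof -
      have "- \<kappa> * exp (2 * x) \<le> \<bar>\<kappa>\<bar> * exp (2 * x)" by (intro mult_right_mono) auto
      also have "\<dots> \<le> \<bar>\<kappa>\<bar> * r\<^sup>2" using er by (intro mult_left_mono) (auto simp: exp_double intro!: power_mono)
      finally show ?thesis .
    qed
    then have "2 * pi * (- \<kappa> * exp (2 * x)) \<le> 2 * pi * (\<bar>\<kappa>\<bar> * r\<^sup>2)" by (intro mult_left_mono) auto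
    ultimately show ?thesis by (simp add: h_def)
  qed
  have h'0: "h' x \<ge> 0" if "x \<le> ln r" for x
    by (rule convex_bounded_above_deriv_nonneg[of "ln r" h h' h'', OF dh dh' h''0 hb that]) auto
  have mono: "h t \<le> h (ln r)" if "t \<le> ln r" for t
    by (rule DERIV_nonneg_imp_nondecreasing[OF that]) (use dh h'0 in blast)
  have "Re (A 0 (ln r)) + 2 * pi * \<kappa> * r\<^sup>2 \<le> 2 * pi * Re (f a) + \<epsilon>" if \<epsilon>: "\<epsilon> > 0" for \<epsilon>
  proof -
    have "isCont f a" using cf R by (simp add: continuous_on_eq_continuous_at)
    then obtain \<delta> where \<delta>: "\<delta> > 0" "\<And>z. dist z a < \<delta> \<Longrightarrow> dist (f z) (f a) < \<epsilon> / (4 * pi)"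
      unfolding continuous_at_eps_delta using \<epsilon> by (metis divide_pos_pos mult_pos_pos pi_gt_zero zero_less_numeral)
    \<comment> \<open>Three demands on the small radius: continuity of \<open>f\<close> at
      \<open>a\<close>, comparability with \<open>r\<close>, and a quadratic correction of at most
      \<epsilon>/2.\<close>
    define \<rho> where "\<rho> = min (min (\<delta>/2) r) (sqrt (\<epsilon> / (4 * pi * (\<bar>\<kappa>\<bar> + 1))))"
    have \<rho>: "\<rho> > 0" "\<rho> < \<delta>" "\<rho> \<le> r" using \<delta> r \<epsilon> by (auto simp: \<rho>_def)
    have "\<rho> \<le> sqrt (\<epsilon> / (4 * pi * (\<bar>\<kappa>\<bar> + 1)))" by (simp add: \<rho>_def)
    then have "\<rho>\<^sup>2 \<le> (sqrt (\<epsilon> / (4 * pi * (\<bar>\<kappa>\<bar> + 1))))\<^sup>2" using \<rho> by (intro power_mono) auto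
    also have "\<dots> = \<epsilon> / (4 * pi * (\<bar>\<kappa>\<bar> + 1))" using \<epsilon> by simp
    finally have \<rho>2: "\<rho>\<^sup>2 * (4 * pi * (\<bar>\<kappa>\<bar> + 1)) \<le> \<epsilon>" by (simp add: pos_le_divide_eq)
    have "\<bar>\<kappa>\<bar> * \<rho>\<^sup>2 * (4 * pi) \<le> \<rho>\<^sup>2 * (4 * pi * (\<bar>\<kappa>\<bar> + 1))" by (simp add: algebra_simps)
    then have k\<rho>: "\<bar>\<kappa>\<bar> * \<rho>\<^sup>2 * (4 * pi) \<le> \<epsilon>" using \<rho>2 by linarith
    have "ln \<rho> \<le> ln r" using \<rho> r by simp
    then have "h (ln \<rho>) \<le> h (ln r)" by (rule mono)
    then have 1: "Re (A 0 (ln r)) + 2 * pi * \<kappa> * r\<^sup>2 \<le> Re (A 0 (ln \<rho>)) + 2 * pi * \<kappa> * \<rho>\<^sup>2"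
      using r \<rho> by (simp add: h_def exp_double)
    have cc: "continuous_on {0..2*pi} (\<lambda>y. f (a + of_real \<rho> * cis y))"
      by (rule continuous_on_circle[OF cf]) (use \<rho> r in auto)
    have "A 0 (ln \<rho>) - of_real (2 * pi) * f a = fourier 0 (\<lambda>y. f (a + of_real \<rho> * cis y) - 1 * f a)"
      using fourier_sub_cmult[OF cc continuous_on_const, of 0 1 "f a"] \<rho> by (simp add: A_def Feq fourier_0_const)
    also have "cmod \<dots> \<le> 2 * pi * (\<epsilon> / (4 * pi))"
      by (rule fourier_norm_le) (use \<delta>(2) \<rho> cc in \<open>auto intro!: continuous_intros less_imp_le simp: dist_norm norm_mult\<close>)
    finally have "cmod (A 0 (ln \<rho>) - of_real (2 * pi) * f a) \<le> \<epsilon> / 2" by simp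
    then have "Re (A 0 (ln \<rho>)) \<le> 2 * pi * Re (f a) + \<epsilon> / 2"
      using abs_Re_le_cmod[of "A 0 (ln \<rho>) - of_real (2 * pi) * f a"] by simp
    moreover have "2 * pi * \<kappa> * \<rho>\<^sup>2 \<le> \<epsilon> / 2"
    proof -
      have "\<kappa> * \<rho>\<^sup>2 * (4 * pi) \<le> \<bar>\<kappa>\<bar> * \<rho>\<^sup>2 * (4 * pi)" by (intro mult_right_mono) auto
      then have "\<kappa> * \<rho>\<^sup>2 * (4 * pi) \<le> \<epsilon>" using k\<rho> by linarith
      then show ?thesis by (simp add: mult_ac)
    qed
    ultimately show ?thesis using 1 by linarith
  qed
  then have "Re (A 0 (ln r)) + 2 * pi * \<kappa> * r\<^sup>2 \<le> 2 * pi * Re (f a)" by (rule field_le_epsilon)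
  then show ?thesis using r by (simp add: A_def Feq algebra_simps)
qed

lemma norm_diff_le_of_deriv_le:
  fixes f :: "real \<Rightarrow> complex"
  assumes "s \<le> t" "\<And>x. s \<le> x \<Longrightarrow> x \<le> t \<Longrightarrow> (f has_vector_derivative f' x) (at x)"
    "\<And>x. s \<le> x \<Longrightarrow> x \<le> t \<Longrightarrow> (\<phi> has_real_derivative \<phi>' x) (at x)"
    "\<And>x. s \<le> x \<Longrightarrow> x \<le> t \<Longrightarrow> cmod (f' x) \<le> \<phi>' x"
  shows "cmod (f t - f s) \<le> \<phi> t - \<phi> s"
proof (cases "s = t")
  case False
  show ?thesis
  proof (rule differentiable_bound_general)
    show "continuous_on {s..t} f" using assms(2)
      by (auto intro!: continuous_at_imp_continuous_on has_vector_derivative_continuous)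
    show "continuous_on {s..t} \<phi>" using assms(3)
      by (auto intro!: continuous_at_imp_continuous_on DERIV_isCont)
  next
    fix x assume "s < x" "x < t"
    then show "(f has_vector_derivative f' x) (at x)" "(\<phi> has_vector_derivative \<phi>' x) (at x)" "cmod (f' x) \<le> \<phi>' x"
      using assms(2-4)[of x] by (auto simp: has_real_derivative_iff_has_vector_derivative)
  qed (use assms False in auto)
qed simp

text \<open>On a circle of small radius \<rho>, mode 1 of \<open>f\<close> is
  \<open>2 * pi * \<rho> * dz f a\<close> to first order. The operator A'' - A factors into
  first-order ones; integrating both from the centre outwards controls the change of A / \<rho> up
  to radius \<open>r\<close> by the Laplacian alone.\<close>

lemma dz_bound:
  assumes f: "Ck_on 2 (ball a R) f" and r: "0 < r" "r < R"
    and B: "\<And>z. z \<in> ball a R \<Longrightarrow> cmod (f z) \<le> B"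
    and M: "\<And>z. z \<in> ball a R \<Longrightarrow> cmod (flat_laplacian f z) \<le> M"
  shows "cmod (dz f a) \<le> B / r + M * r / 3"
proof -
  define F where "F = (\<lambda>w. f (a + exp w))"
  have R: "R > 0" using r by simp
  interpret periodic_half_plane F "ln R" using logpolar_half_plane(1)[OF f R] by (simp add: F_def)
  have lapF: "flat_laplacian F w = of_real (exp (2 * Re w)) * flat_laplacian f (a + exp w)" if "Re w < ln R" for w
    using logpolar_half_plane(2)[OF f R that] by (simp add: F_def)
  have cf: "continuous_on (ball a R) f" using f by (rule Ck_on_imp_continuous)
  have Feq: "F (Complex x y) = f (a + of_real (exp x) * cis y)" for x y by (simp add: F_def exp_Complex)
  have lnr: "ln r < ln R" using r by simp
  have inb: "a + exp w \<in> ball a R" if "Re w < ln R" for w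
    using that R by (simp add: dist_norm) (metis exp_less_cancel_iff exp_ln)
  have f2: "Ck_on (Suc (Suc 0)) (ball a R) f" using f by (simp add: numeral_2_eq_2)
  define L where "L x = fourier 1 (\<lambda>y. flat_laplacian F (Complex x y))" for x
  have Lb: "cmod (L x) \<le> 2 * pi * (M * exp (2 * x))" if x: "x < ln R" for x
    unfolding L_def
  proof (rule fourier_norm_le)
    have cl: "continuous_on {w. Re w < ln R} (flat_laplacian F)"
      unfolding flat_laplacian_def[abs_def] by (intro continuous_intros conts)
    show "continuous_on {0..2*pi} (\<lambda>y. flat_laplacian F (Complex x y))"
      by (rule continuous_on_compose2[OF cl]) (use x in \<open>auto intro!: continuous_intros\<close>)
    show "cmod (flat_laplacian F (Complex x y)) \<le> M * exp (2 * x)" for y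
      using lapF[of "Complex x y"] M[OF inb[of "Complex x y"]] x by (simp add: norm_mult mult.commute)
  qed
  have cA: "continuous_on {0..2*pi} (\<lambda>y. F (Complex x y))" if "x < ln R" for x
    unfolding Feq by (rule continuous_on_circle[OF cf]) (use that R in auto, metis exp_less_cancel_iff exp_ln)
  have Ab: "cmod (A 1 x) \<le> 2 * pi * B" if "x < ln R" for x unfolding A_def
    by (rule fourier_norm_le) (use cA that B inb in \<open>auto simp: F_def\<close>)
  have B0: "B \<ge> 0" using B[of a] R norm_ge_zero[of "f a"] by (simp del: norm_ge_zero)
  have M0: "M \<ge> 0" using M[of a] R norm_ge_zero[of "flat_laplacian f a"] by (simp del: norm_ge_zero)
  \<comment> \<open>A qualitative bound, uniform in \<open>x\<close>, whose purpose is to make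
    \<open>D\<close> tend to 0 at the centre.\<close>
  obtain N where N: "\<And>x. x \<le> ln r \<Longrightarrow> cmod (A' 1 x) \<le> N"
  proof -
    have "compact (cball a r)" "cball a r \<subseteq> ball a R" using r by auto
    moreover have "continuous_on (ball a R) (dz f)" "continuous_on (ball a R) (dzb f)"
      by (rule Ck_on_imp_continuous[OF Ck_on_dz(1)[OF open_ball f2]], rule Ck_on_imp_continuous[OF Ck_on_dz(2)[OF open_ball f2]])
    ultimately have "bounded (dz f ` cball a r)" "bounded (dzb f ` cball a r)"
      by (meson compact_continuous_image compact_imp_bounded continuous_on_subset)+
    then obtain N1 N2 where N12: "\<And>z. z \<in> cball a r \<Longrightarrow> cmod (dz f z) \<le> N1" "\<And>z. z \<in> cball a r \<Longrightarrow> cmod (dzb f z) \<le> N2"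
      unfolding bounded_iff ball_simps by blast
    have "cmod (A' 1 x) \<le> 2 * pi * (N1 * r + N2 * r)" if x: "x \<le> ln r" for x
      unfolding A'_def
    proof (rule fourier_norm_le)
      have x': "x < ln R" using x lnr by simp
      show "continuous_on {0..2*pi} (\<lambda>y. partial_x F (Complex x y))"
        by (rule continuous_on_compose2[OF conts(2)]) (use x' in \<open>auto intro!: continuous_intros\<close>)
      fix y :: real
      let ?w = "Complex x y"
      have b: "a + exp ?w \<in> ball a R" using inb x' by simp
      have er: "exp x \<le> r" using x r by (metis exp_le_cancel_iff exp_ln)
      have "((\<lambda>w. a + exp w) has_field_derivative exp ?w) (at ?w)" by (auto intro!: derivative_eq_intros)
      then have "has_wirtinger F (dz f (a + exp ?w) * exp ?w) (dzb f (a + exp ?w) * cnj (exp ?w)) ?w"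
        unfolding F_def by (rule has_wirtinger_compose_field) (use f2 b in \<open>auto intro!: has_wirtingerI\<close>)
      then have "partial_x F ?w = dz f (a + exp ?w) * exp ?w + dzb f (a + exp ?w) * cnj (exp ?w)"
        by (rule has_wirtinger_partials)
      also have "cmod \<dots> \<le> cmod (dz f (a + exp ?w)) * exp x + cmod (dzb f (a + exp ?w)) * exp x"
        by (rule order_trans[OF norm_triangle_ineq]) (simp add: norm_mult)
      also have "\<dots> \<le> N1 * r + N2 * r"
        using N12[of "a + exp ?w"] er r by (intro add_mono mult_mono) (auto simp: dist_norm intro: order_trans[OF norm_ge_zero])
      finally show "cmod (partial_x F ?w) \<le> N1 * r + N2 * r" .
    qed
    then show ?thesis by (rule that)
  qed
  \<comment> \<open>First factor of A'' - A: the derivative of \<open>D\<close> is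
    \<open>exp x\<close> times the source \<open>L\<close>.\<close>
  define D where "D x = of_real (exp x) * (A' 1 x - A 1 x)" for x
  have e1: "((\<lambda>x. complex_of_real (exp x)) has_vector_derivative of_real (exp x)) (at x)" for x
    by (rule has_vector_derivative_of_real) (auto intro!: derivative_eq_intros simp flip: has_real_derivative_iff_has_vector_derivative)
  have dD: "(D has_vector_derivative of_real (exp x) * L x) (at x)" if "x < ln R" for x
    unfolding D_def[abs_def]
    by (rule has_vector_derivative_eq_rhs[OF has_vector_derivative_mult[OF e1
        has_vector_derivative_diff[OF A'_deriv[OF that] A_deriv[OF that]]]]) (simp add: L_def algebra_simps)
  have Dd: "cmod (D x - D t) \<le> 2 * pi * M / 3 * exp (3 * x) - 2 * pi * M / 3 * exp (3 * t)" if "t \<le> x" "x < ln R" for x t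
  proof (rule norm_diff_le_of_deriv_le[OF that(1) dD])
    fix s assume s: "t \<le> s" "s \<le> x"
    show "((\<lambda>x. 2 * pi * M / 3 * exp (3 * x)) has_real_derivative 2 * pi * M * exp (3 * s)) (at s)"
      by (auto intro!: derivative_eq_intros)
    have "cmod (of_real (exp s) * L s) \<le> exp s * (2 * pi * (M * exp (2 * s)))"
      using Lb[of s] s that by (simp add: norm_mult)
    also have "\<dots> = 2 * pi * M * exp (3 * s)" by (simp flip: exp_add)
    finally show "cmod (of_real (exp s) * L s) \<le> 2 * pi * M * exp (3 * s)" .
  qed (use that in auto)
  have Dt: "cmod (D t) \<le> exp t * (N + 2 * pi * B)" if "t \<le> ln r" for t
  proof -
    have "cmod (A' 1 t - A 1 t) \<le> N + 2 * pi * B"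
      using N[OF that] Ab[of t] that lnr norm_triangle_ineq4[of "A' 1 t" "A 1 t"] by simp
    then show ?thesis by (simp add: D_def norm_mult)
  qed
  have Db: "cmod (D x) \<le> 2 * pi * M / 3 * exp (3 * x)" if x: "x \<le> ln r" for x
  proof (rule field_le_epsilon)
    fix \<epsilon> :: real assume \<epsilon>: "\<epsilon> > 0"
    have N0: "N + 2 * pi * B \<ge> 0" using N[OF x] order_trans[OF norm_ge_zero] B0 by (smt (verit) mult_nonneg_nonneg pi_ge_zero)
    define t where "t = min x (ln (\<epsilon> / (N + 2 * pi * B + 1)))"
    have t: "t \<le> x" by (simp add: t_def)
    have "exp t \<le> \<epsilon> / (N + 2 * pi * B + 1)" using \<epsilon> N0 exp_le_cancel_iff[of t "ln (\<epsilon> / (N + 2 * pi * B + 1))"] by (simp add: t_def)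
    then have "exp t * (N + 2 * pi * B + 1) \<le> \<epsilon>" using N0 by (simp add: pos_le_divide_eq)
    then have "exp t * (N + 2 * pi * B) \<le> \<epsilon>" by (simp add: algebra_simps) (smt (verit) exp_gt_zero)
    then have "cmod (D t) \<le> \<epsilon>" using Dt[of t] t x by linarith
    moreover have "cmod (D x) \<le> cmod (D x - D t) + cmod (D t)" using norm_triangle_ineq[of "D x - D t" "D t"] by simp
    moreover have "0 \<le> 2 * pi * M / 3 * exp (3 * t)" using M0 by simp
    ultimately show "cmod (D x) \<le> 2 * pi * M / 3 * exp (3 * x) + \<epsilon>" using Dd[OF t] x lnr by linarith
  qed
  \<comment> \<open>Second factor: mode 1 divided by the radius, with derivative
    \<open>exp (- 2 * x) * D x\<close>. Its limit at the centre is
    \<open>2 * pi * dz f a\<close>.\<close>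
  define c where "c x = of_real (exp (- x)) * A 1 x" for x
  have e2: "((\<lambda>x. complex_of_real (exp (- x))) has_vector_derivative - of_real (exp (- x))) (at x)" for x
    by (rule has_vector_derivative_eq_rhs[OF has_vector_derivative_of_real])
      (auto intro!: derivative_eq_intros simp flip: has_real_derivative_iff_has_vector_derivative)
  have dc: "(c has_vector_derivative of_real (exp (- 2 * x)) * D x) (at x)" if "x < ln R" for x
  proof -
    have "of_real (exp (- x)) * A' 1 x + - of_real (exp (- x)) * A 1 x = of_real (exp (- 2 * x)) * D x"
    proof -
      have "exp (- 2 * x) * exp x = exp (- x)" by (simp flip: exp_add)
      then have "complex_of_real (exp (- 2 * x)) * of_real (exp x) = of_real (exp (- x))" by (metis of_real_mult)
      then show ?thesis by (simp only: D_def mult.assoc[symmetric]) (simp add: algebra_simps)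
    qed
    then show ?thesis unfolding c_def[abs_def]
      using has_vector_derivative_mult[OF e2 A_deriv[OF that, of 1]] by simp
  qed
  have cd: "cmod (c x - c t) \<le> 2 * pi * M / 3 * exp x - 2 * pi * M / 3 * exp t" if "t \<le> x" "x \<le> ln r" for x t
  proof (rule norm_diff_le_of_deriv_le[OF that(1) dc])
    fix s assume s: "t \<le> s" "s \<le> x"
    show "((\<lambda>x. 2 * pi * M / 3 * exp x) has_real_derivative 2 * pi * M / 3 * exp s) (at s)"
      by (auto intro!: derivative_eq_intros)
    have "cmod (of_real (exp (- 2 * s)) * D s) \<le> exp (- 2 * s) * (2 * pi * M / 3 * exp (3 * s))"
      using Db[of s] s that by (simp add: norm_mult)
    also have "\<dots> = 2 * pi * M / 3 * (exp (- 2 * s) * exp (3 * s))" by simp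
    also have "exp (- 2 * s) * exp (3 * s) = exp s" by (simp flip: exp_add)
    finally show "cmod (of_real (exp (- 2 * s)) * D s) \<le> 2 * pi * M / 3 * exp s" .
  qed (use that lnr in auto)
  have lim: "2 * pi * cmod (dz f a) \<le> cmod (c (ln r)) + 2 * pi * M / 3 * r + \<epsilon>" if \<epsilon>: "\<epsilon> > 0" for \<epsilon>
  proof -
    have "(f has_derivative (\<lambda>h. dz f a * h + dzb f a * cnj h)) (at a)"
      using has_wirtingerI[of f a] f2 R by (simp add: has_wirtinger_def)
    then obtain \<delta> where \<delta>: "\<delta> > 0" "\<And>z. cmod (z - a) < \<delta> \<Longrightarrow>
        cmod (f z - f a - (dz f a * (z - a) + dzb f a * cnj (z - a))) \<le> \<epsilon> / (2 * pi) * cmod (z - a)"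
      using \<epsilon> unfolding has_derivative_at_alt by (metis divide_pos_pos mult_pos_pos pi_gt_zero zero_less_numeral)
    define \<rho> where "\<rho> = min (\<delta>/2) r"
    have \<rho>: "\<rho> > 0" "\<rho> < \<delta>" "\<rho> \<le> r" using \<delta> r by (auto simp: \<rho>_def)
    have cc: "continuous_on {0..2*pi} (\<lambda>y. f (a + of_real \<rho> * cis y))"
      by (rule continuous_on_circle[OF cf]) (use \<rho> r in auto)
    \<comment> \<open>The Taylor remainder on the circle, with the constant, \<open>dz\<close> and
      \<open>dzb\<close> parts written as modes 0, 1 and -1; \<open>fourier 1\<close> sees only the
      middle one.\<close>
    define E where "E y = f (a + of_real \<rho> * cis y) - f a * cis (of_int 0 * y) - (dz f a * of_real \<rho>) * cis (of_int 1 * y)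
       - (dzb f a * of_real \<rho>) * cis (of_int (-1) * y)" for y
    have "fourier 1 E = A 1 (ln \<rho>) - f a * fourier 1 (\<lambda>y. cis (of_int 0 * y)) - (dz f a * of_real \<rho>) * fourier 1 (\<lambda>y. cis (of_int 1 * y))
       - (dzb f a * of_real \<rho>) * fourier 1 (\<lambda>y. cis (of_int (-1) * y))"
      unfolding E_def[abs_def] using \<rho>
      by (subst fourier_sub_cmult, (intro continuous_intros cc)+)+ (simp add: A_def Feq)
    then have fE: "fourier 1 E = A 1 (ln \<rho>) - of_real (2 * pi * \<rho>) * dz f a"
      unfolding fourier_cis by simp
    have "cmod (fourier 1 E) \<le> 2 * pi * (\<epsilon> / (2 * pi) * \<rho>)"
    proof (rule fourier_norm_le)
      show "continuous_on {0..2*pi} E" unfolding E_def[abs_def] by (intro continuous_intros cc)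
      fix y :: real
      have "E y = f (a + of_real \<rho> * cis y) - f a - (dz f a * ((a + of_real \<rho> * cis y) - a) + dzb f a * cnj ((a + of_real \<rho> * cis y) - a))"
        by (simp add: E_def cis_cnj)
      then show "cmod (E y) \<le> \<epsilon> / (2 * pi) * \<rho>"
        using \<delta>(2)[of "a + of_real \<rho> * cis y"] \<rho> by (simp add: norm_mult)
    qed
    then have "cmod (A 1 (ln \<rho>) - of_real (2 * pi * \<rho>) * dz f a) \<le> \<epsilon> * \<rho>" by (simp add: fE)
    moreover have "A 1 (ln \<rho>) - of_real (2 * pi * \<rho>) * dz f a = of_real \<rho> * (c (ln \<rho>) - of_real (2 * pi) * dz f a)"
      using \<rho> by (simp add: c_def exp_minus field_simps)
    ultimately have "\<rho> * cmod (c (ln \<rho>) - of_real (2 * pi) * dz f a) \<le> \<rho> * \<epsilon>"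
      using \<rho> by (simp add: norm_mult mult.commute)
    then have 1: "cmod (of_real (2 * pi) * dz f a - c (ln \<rho>)) \<le> \<epsilon>" using \<rho> by (simp add: norm_minus_commute)
    have 2: "cmod (c (ln r) - c (ln \<rho>)) \<le> 2 * pi * M / 3 * r - 2 * pi * M / 3 * \<rho>"
      using cd[of "ln \<rho>" "ln r"] \<rho> r by simp
    have "2 * pi * cmod (dz f a) = cmod (of_real (2 * pi) * dz f a)" by (simp add: norm_mult)
    also have "\<dots> \<le> cmod (c (ln \<rho>)) + \<epsilon>" using 1 norm_triangle_ineq2[of "of_real (2 * pi) * dz f a" "c (ln \<rho>)"] by linarith
    also have "cmod (c (ln \<rho>)) \<le> cmod (c (ln r)) + cmod (c (ln r) - c (ln \<rho>))"
      using norm_triangle_ineq2[of "c (ln \<rho>)" "c (ln r)"] by (simp add: norm_minus_commute)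
    finally have "2 * pi * cmod (dz f a) \<le> cmod (c (ln r)) + cmod (c (ln r) - c (ln \<rho>)) + \<epsilon>" by simp
    moreover have "0 \<le> 2 * pi * M / 3 * \<rho>" using M0 \<rho> by simp
    ultimately show ?thesis using 2 by linarith
  qed
  have "2 * pi * cmod (dz f a) \<le> cmod (c (ln r)) + 2 * pi * M / 3 * r" using lim by (rule field_le_epsilon)
  moreover have "cmod (c (ln r)) \<le> 2 * pi * B / r"
    using Ab[of "ln r"] r lnr by (simp add: c_def norm_mult norm_divide exp_minus field_simps)
  ultimately have "2 * pi * cmod (dz f a) \<le> 2 * pi * (B / r + M * r / 3)" by (simp add: algebra_simps)
  then show ?thesis by simp
qed

text \<open>Complex conjugation exchanges \<open>dz\<close> and \<open>dzb\<close> and commutes with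
  the Laplacian.\<close>

lemma dzb_bound:
  assumes f: "Ck_on 2 (ball a R) f" and r: "0 < r" "r < R"
    and B: "\<And>z. z \<in> ball a R \<Longrightarrow> cmod (f z) \<le> B"
    and M: "\<And>z. z \<in> ball a R \<Longrightarrow> cmod (flat_laplacian f z) \<le> M"
  shows "cmod (dzb f a) \<le> B / r + M * r / 3"
proof -
  let ?g = "\<lambda>z. cnj (f z)"
  have f2: "Ck_on (Suc (Suc 0)) (ball a R) f" using f by (simp add: numeral_2_eq_2)
  have d: "dz ?g z = cnj (dzb f z)" "dzb ?g z = cnj (dz f z)" if "z \<in> ball a R" for z
    using has_wirtinger_unique[OF has_wirtinger_cnj[OF has_wirtingerI[of f z]]] f2 that by auto
  have g: "Ck_on 2 (ball a R) ?g" by (rule Ck_on_linear[OF open_ball bounded_linear_cnj f])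
  have "flat_laplacian ?g z = cnj (flat_laplacian f z)" if z: "z \<in> ball a R" for z
  proof -
    have "dz f differentiable (at z)"
      by (rule Ck_on_differentiable[OF Ck_on_dz(1)[OF open_ball f2]]) (use z in auto)
    have "flat_laplacian ?g z / 4 = dz (dzb ?g) z" using dz_dzb_flat_laplacian(1)[OF open_ball z g] by simp
    also have "\<dots> = dz (\<lambda>z. cnj (dz f z)) z" by (rule dz_cong_open(1)[OF open_ball z d(2)])
    also have "\<dots> = cnj (dzb (dz f) z)"
      by (rule has_wirtinger_unique(1)[OF has_wirtinger_cnj[OF has_wirtingerI]]) fact
    also have "\<dots> = cnj (flat_laplacian f z) / 4" unfolding dz_dzb_flat_laplacian(2)[OF open_ball z f] by simp
    finally show ?thesis by simp
  qed
  then have "cmod (dz ?g a) \<le> B / r + M * r / 3"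
    by (intro dz_bound[OF g r]) (use B M in auto)
  then show ?thesis using d(1)[of a] r by simp
qed

section \<open>Liouville's theorem on metrics of curvature minus one\<close>

text \<open>Comparison of coefficients in w'' = - q w, with initial value \<open>a\<close> and
  initial derivative \<open>b\<close>.\<close>

fun ode_coeff :: "(nat \<Rightarrow> complex) \<Rightarrow> complex \<Rightarrow> complex \<Rightarrow> nat \<Rightarrow> complex" where
  "ode_coeff q a b 0 = a"
| "ode_coeff q a b (Suc 0) = b"
| "ode_coeff q a b (Suc (Suc n)) = - (\<Sum>k\<le>n. q k * ode_coeff q a b (n - k)) / (of_nat (Suc n) * of_nat (Suc (Suc n)))"

text \<open>The convolution with \<open>q\<close> is compared with a geometric series:
  \<open>L \<ge> 2 / s\<close> makes the ratio at most 1/2 and the sum at most 2, and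
  \<open>L^2 \<ge> 2 K\<close> pays for this over the two index steps of the recursion. The
  denominators are estimated from below by 1.\<close>

lemma ode_coeff_bound:
  assumes q: "\<And>k. cmod (q k) \<le> K * (1 / s) ^ k" and s: "s > 0" and K: "K \<ge> 0"
    and L: "L \<ge> 1" "L \<ge> 2 / s" "L\<^sup>2 \<ge> 2 * K" and A: "A \<ge> cmod a" "A \<ge> cmod b"
  shows "cmod (ode_coeff q a b n) \<le> A * L ^ n"
proof (induction n rule: less_induct)
  case (less n)
  have A0: "A \<ge> 0" using A(1) norm_ge_zero[of a] by linarith
  consider "n = 0" | "n = Suc 0" | m where "n = Suc (Suc m)" by (metis not0_implies_Suc)
  then show ?case
  proof cases
    case 2
    then show ?thesis using A L A0 by (auto intro: order_trans[OF _ mult_left_mono[of 1 L A]])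
  next
    case (3 m)
    have sL: "1 / (s * L) \<le> 1 / 2" using L s by (simp add: field_simps)
    have "cmod (\<Sum>k\<le>m. q k * ode_coeff q a b (m - k)) \<le> (\<Sum>k\<le>m. K * A * L ^ m * (1/2) ^ k)"
    proof (rule sum_norm_le)
      fix k assume k: "k \<in> {..m}"
      have "cmod (q k * ode_coeff q a b (m - k)) \<le> (K * (1 / s) ^ k) * (A * L ^ (m - k))"
        unfolding norm_mult using q less.IH[of "m - k"] 3 s K by (intro mult_mono) auto
      also have "\<dots> = K * A * L ^ m * (1 / (s * L)) ^ k"
      proof -
        have "L ^ m = L ^ (m - k) * L ^ k" using k by (simp flip: power_add)
        then show ?thesis using L by (simp add: power_mult_distrib power_divide field_simps)
      qed
      also have "\<dots> \<le> K * A * L ^ m * (1 / 2) ^ k" using sL K A0 L s by (intro mult_left_mono power_mono) auto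
      finally show "cmod (q k * ode_coeff q a b (m - k)) \<le> K * A * L ^ m * (1 / 2) ^ k" .
    qed
    also have "\<dots> = K * A * L ^ m * (\<Sum>k\<le>m. (1/2) ^ k)" by (simp add: sum_distrib_left)
    also have "\<dots> \<le> K * A * L ^ m * 2"
    proof -
      have "(\<Sum>k\<le>m. (1/2::real) ^ k) \<le> 2" unfolding sum_gp0 by (simp add: field_simps)
      then show ?thesis using K A0 L by (intro mult_left_mono) auto
    qed
    also have "\<dots> = (2 * K) * (A * L ^ m)" by simp
    also have "\<dots> \<le> L\<^sup>2 * (A * L ^ m)" using L A0 by (intro mult_right_mono) auto
    finally have 1: "cmod (\<Sum>k\<le>m. q k * ode_coeff q a b (m - k)) \<le> A * L ^ n"
      using 3 by (simp add: power_numeral_reduce mult_ac)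
    have "cmod (ode_coeff q a b n) = cmod (\<Sum>k\<le>m. q k * ode_coeff q a b (m - k)) / (real (Suc m) * real (Suc (Suc m)))"
      by (simp only: 3 ode_coeff.simps norm_divide norm_minus_cancel norm_mult norm_of_nat)
    also have "\<dots> \<le> cmod (\<Sum>k\<le>m. q k * ode_coeff q a b (m - k)) / 1"
    proof (rule divide_left_mono)
      have "1 * 1 \<le> real (Suc m) * real (Suc (Suc m))" by (rule mult_mono) auto
      then show "1 \<le> real (Suc m) * real (Suc (Suc m))" by simp
    qed auto
    finally show ?thesis using 1 by simp
  qed (use A in simp)
qed

lemma holomorphic_ode_exists:
  assumes G: "G holomorphic_on ball z0 R" and R: "R > 0"
  obtains e w w' where "e > 0" "e \<le> R" "w z0 = a" "w' z0 = b"
    "\<And>z. z \<in> ball z0 e \<Longrightarrow> (w has_field_derivative w' z) (at z)"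
    "\<And>z. z \<in> ball z0 e \<Longrightarrow> (w' has_field_derivative - G z * w z) (at z)"
proof -
  define Q where "Q = fps_expansion G z0"
  have cr: "fps_conv_radius Q \<ge> ereal R"
    unfolding Q_def by (rule conv_radius_fps_expansion) (use G in \<open>simp add: eball_ereal\<close>)
  have evQ: "eval_fps Q (z - z0) = G z" if "z \<in> ball z0 R" for z
    unfolding Q_def by (rule eval_fps_expansion[of G z0 "ereal R"]) (use G that in \<open>auto simp: eball_ereal dist_norm norm_minus_commute\<close>)
  \<comment> \<open>Strictly inside the disc of convergence, so that the terms of the expansion of
    \<open>G\<close> are bounded; this gives the geometric coefficient bound without contour
    integrals.\<close>
  define s where "s = R / 2"
  have s: "s > 0" "s < R" using R by (auto simp: s_def)
  have "ereal s < fps_conv_radius Q" using cr s by (meson ereal_less_eq(3) less_ereal.simps(1) order_less_le_trans)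
  then have "summable (\<lambda>n. norm (fps_nth Q n * of_real s ^ n))"
    unfolding fps_conv_radius_def by (intro abs_summable_in_conv_radius) (use s in auto)
  then have "bounded (range (\<lambda>n. norm (fps_nth Q n * of_real s ^ n)))"
    by (intro summable_imp_bounded)
  then obtain K where K: "\<And>n. norm (fps_nth Q n * of_real s ^ n) \<le> K" by (auto simp: bounded_iff)
  have K0: "K \<ge> 0" using K[of 0] norm_ge_zero order_trans by blast
  have q: "cmod (fps_nth Q k) \<le> K * (1 / s) ^ k" for k
    using K[of k] s by (simp add: norm_mult norm_power field_simps)
  define L where "L = max 1 (max (2 / s) (2 * K))"
  have L: "L \<ge> 1" "L \<ge> 2 / s" "L\<^sup>2 \<ge> 2 * K"
  proof -
    show "L \<ge> 1" "L \<ge> 2 / s" by (auto simp: L_def)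
    have "2 * K \<le> L * 1" by (simp add: L_def)
    also have "\<dots> \<le> L * L" by (intro mult_left_mono) (auto simp: L_def)
    finally show "L\<^sup>2 \<ge> 2 * K" by (simp add: power2_eq_square)
  qed
  define A where "A = max (cmod a) (cmod b)"
  define W where "W = Abs_fps (ode_coeff (fps_nth Q) a b)"
  have Wb: "cmod (fps_nth W n) \<le> A * L ^ n" for n
    unfolding W_def using ode_coeff_bound[OF q s(1) K0 L, of a A b n] by (simp add: A_def)
  have "summable (\<lambda>n. fps_nth W n * of_real (1 / (2 * L)) ^ n)"
  proof (rule summable_comparison_test')
    show "summable (\<lambda>n. A * (1/2) ^ n)" by (intro summable_mult summable_geometric) auto
    fix n
    have "norm (fps_nth W n * of_real (1 / (2 * L)) ^ n) = cmod (fps_nth W n) * (1 / (2 * L)) ^ n"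
      using L by (simp add: norm_mult norm_power norm_divide)
    also have "\<dots> \<le> A * L ^ n * (1 / (2 * L)) ^ n" using Wb L by (intro mult_right_mono) auto
    also have "\<dots> = A * (1 / 2) ^ n" using L by (simp add: power_divide power_mult_distrib)
    finally show "norm (fps_nth W n * of_real (1 / (2 * L)) ^ n) \<le> A * (1/2) ^ n" .
  qed
  then have "fps_conv_radius W \<ge> norm (complex_of_real (1 / (2 * L)))"
    unfolding fps_conv_radius_def by (rule conv_radius_geI)
  then have crW: "fps_conv_radius W \<ge> ereal (1 / (2 * L))" using L by (simp add: norm_divide)
  have eq: "fps_deriv (fps_deriv W) = - (Q * W)"
  proof (rule fps_ext)
    fix n
    have "fps_nth (fps_deriv (fps_deriv W)) n = of_nat (Suc n) * of_nat (Suc (Suc n)) * fps_nth W (Suc (Suc n))"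
      by (simp add: algebra_simps)
    also have "\<dots> = - (\<Sum>k\<le>n. fps_nth Q k * fps_nth W (n - k))"
    proof -
      have "of_nat (Suc n) * of_nat (Suc (Suc n)) \<noteq> (0::complex)" by (simp del: of_nat_Suc)
      then show ?thesis by (simp add: W_def del: of_nat_Suc)
    qed
    also have "\<dots> = fps_nth (- (Q * W)) n" by (simp add: fps_mult_nth atMost_atLeast0)
    finally show "fps_nth (fps_deriv (fps_deriv W)) n = fps_nth (- (Q * W)) n" .
  qed
  define e where "e = min R (1 / (2 * L))"
  have e: "e > 0" "e \<le> R" using R L by (auto simp: e_def)
  have rad: "ereal (norm (z - z0)) < fps_conv_radius W" "ereal (norm (z - z0)) < fps_conv_radius Q" "z \<in> ball z0 R" if "z \<in> ball z0 e" for z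
  proof -
    have "norm (z - z0) < 1 / (2 * L)" "norm (z - z0) < R" using that by (auto simp: e_def dist_norm norm_minus_commute)
    then show "ereal (norm (z - z0)) < fps_conv_radius W" "ereal (norm (z - z0)) < fps_conv_radius Q" "z \<in> ball z0 R"
      using crW cr by (auto simp: dist_norm norm_minus_commute intro: less_le_trans[OF _ crW] less_le_trans[OF _ cr])
  qed
  have rad': "ereal (norm (z - z0)) < fps_conv_radius (fps_deriv W)" if "z \<in> ball z0 e" for z
    using rad(1)[OF that] fps_conv_radius_deriv[of W] by simp
  have sh: "((\<lambda>z. f (z - z0)) has_field_derivative d) (at z)" if "(f has_field_derivative d) (at (z - z0))" for f d z
  proof -
    have "((\<lambda>z. z - z0) has_field_derivative 1) (at z)" by (auto intro!: derivative_eq_intros)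
    from DERIV_chain2[where g = "\<lambda>z. z - z0" and x = z and f = f and Da = d, OF that this] show ?thesis by simp
  qed
  show ?thesis
  proof (rule that[OF e, of "\<lambda>z. eval_fps W (z - z0)" "\<lambda>z. eval_fps (fps_deriv W) (z - z0)"])
    show "eval_fps W (z0 - z0) = a" "eval_fps (fps_deriv W) (z0 - z0) = b"
      by (simp_all add: eval_fps_at_0 W_def)
    fix z assume z: "z \<in> ball z0 e"
    show "((\<lambda>z. eval_fps W (z - z0)) has_field_derivative eval_fps (fps_deriv W) (z - z0)) (at z)"
      by (rule sh, rule has_field_derivative_eval_fps) (use rad[OF z] in auto)
    have "eval_fps (fps_deriv (fps_deriv W)) (z - z0) = - G z * eval_fps W (z - z0)"
      unfolding eq using rad[OF z] evQ[of z] by (subst eval_fps_minus) (auto simp: eval_fps_mult fps_conv_radius_mult intro: less_le_trans[OF _ fps_conv_radius_mult])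
    then show "((\<lambda>z. eval_fps (fps_deriv W) (z - z0)) has_field_derivative - G z * eval_fps W (z - z0)) (at z)"
      using sh[OF has_field_derivative_eval_fps[of "z - z0" "fps_deriv W" UNIV]] rad'[OF z] by simp
  qed
qed

section \<open>Conformal metrics of curvature minus one on plane domains\<close>

text \<open>Half the Christoffel symbol: twice this function is the connection coefficient in the
  geodesic equation.\<close>

definition log_density_dz :: "(complex \<Rightarrow> real) \<Rightarrow> complex \<Rightarrow> complex"
  where "log_density_dz \<rho> = dz (\<lambda>z. of_real (ln (\<rho> z)))"

locale hyperbolic_density =
  fixes S :: "complex set" and \<rho> :: "complex \<Rightarrow> real"
  assumes S: "open S" and pos: "z \<in> S \<Longrightarrow> \<rho> z > 0" and smooth: "smooth_on S \<rho>"
    and curv: "z \<in> S \<Longrightarrow> curvature \<rho> z = -1"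
begin

abbreviation W where "W \<equiv> log_density_dz \<rho>"
abbreviation r where "r \<equiv> \<lambda>z. complex_of_real (\<rho> z)"

lemma Ck_ln: "Ck_on k S (\<lambda>z. ln (\<rho> z))"
  using smooth pos by (intro Ck_on_ln S) (auto simp: smooth_on_def)

lemma Ck_u: "Ck_on k S (\<lambda>z. complex_of_real (ln (\<rho> z)))"
  by (rule Ck_on_linear[OF S bounded_linear_of_real Ck_ln])

lemma Ck_W: "Ck_on k S W"
  unfolding log_density_dz_def by (rule Ck_on_dz(1)[OF S Ck_u])

lemma ln_diff: "z \<in> S \<Longrightarrow> (\<lambda>z. ln (\<rho> z)) differentiable (at z)"
  using Ck_on_differentiable[OF Ck_ln[of 1]] by simp

lemma partial_u:
  assumes "z \<in> S"
  shows "partial_x (\<lambda>z. complex_of_real (ln (\<rho> z))) z = of_real (partial_x (\<lambda>z. ln (\<rho> z)) z)"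
    "partial_y (\<lambda>z. complex_of_real (ln (\<rho> z))) z = of_real (partial_y (\<lambda>z. ln (\<rho> z)) z)"
  using partial_linear[OF bounded_linear_of_real ln_diff[OF assms]] by auto

lemma wirtinger_eq_conn: "z \<in> S \<Longrightarrow> wirtinger (\<lambda>w. ln (\<rho> w)) z = W z"
  by (simp add: wirtinger_def log_density_dz_def dz_def partial_u)

lemma wirt_u: "z \<in> S \<Longrightarrow> has_wirtinger (\<lambda>z. complex_of_real (ln (\<rho> z))) (W z) (cnj (W z)) z"
  using has_wirtingerI[OF Ck_on_differentiable[OF Ck_u[of 1]], of z]
  by (simp add: log_density_dz_def dz_def dzb_def partial_u)

text \<open>Curvature -1 in the form of the Liouville equation. Its Wirtinger version,
  \<open>dzb W\<close> equal to a quarter of the squared density, is how the curvature is used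
  afterwards.\<close>

lemma flat_laplacian_u: "z \<in> S \<Longrightarrow> flat_laplacian (\<lambda>z. complex_of_real (ln (\<rho> z))) z = (r z)\<^sup>2"
proof -
  assume z: "z \<in> S"
  have p: "Ck_on (Suc (Suc 0)) S (\<lambda>z. ln (\<rho> z))" by (rule Ck_ln)
  have "flat_laplacian (\<lambda>z. complex_of_real (ln (\<rho> z))) z = of_real (flat_laplacian (\<lambda>z. ln (\<rho> z)) z)"
    unfolding flat_laplacian_def
    using partial_cong_open(1)[OF S z, of "partial_x (\<lambda>z. complex_of_real (ln (\<rho> z)))", OF partial_u(1)]
      partial_cong_open(2)[OF S z, of "partial_y (\<lambda>z. complex_of_real (ln (\<rho> z)))", OF partial_u(2)]
      partial_linear(1)[OF bounded_linear_of_real[where 'a=complex], of "partial_x (\<lambda>z. ln (\<rho> z))" z]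
      partial_linear(2)[OF bounded_linear_of_real[where 'a=complex], of "partial_y (\<lambda>z. ln (\<rho> z))" z] p z by simp
  also have "flat_laplacian (\<lambda>z. ln (\<rho> z)) z = (\<rho> z)\<^sup>2"
    using curv[OF z] pos[OF z] by (simp add: curvature_def field_simps)
  finally show ?thesis by simp
qed

lemma wirt_r: "z \<in> S \<Longrightarrow> has_wirtinger r (W z * r z) (cnj (W z) * r z) z"
proof -
  assume z: "z \<in> S"
  have "((\<lambda>z. exp (complex_of_real (ln (\<rho> z)))) has_derivative
    (\<lambda>h. exp (of_real (ln (\<rho> z))) * (W z * h + cnj (W z) * cnj h))) (at z)"
    using has_derivative_compose[OF wirt_u[OF z, unfolded has_wirtinger_def] DERIV_exp[unfolded has_field_derivative_def]]
    by simp
  moreover have ex: "exp (complex_of_real (ln (\<rho> w))) = r w" if "w \<in> S" for w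
    using pos[OF that] by (simp add: exp_of_real)
  ultimately have "has_wirtinger (\<lambda>z. exp (complex_of_real (ln (\<rho> z)))) (W z * r z) (cnj (W z) * r z) z"
    using z by (simp add: has_wirtinger_def algebra_simps)
  then show ?thesis
    by (rule has_wirtinger_cong_open[OF S z, rotated]) (use ex in simp)
qed

lemma dzb_W: "z \<in> S \<Longrightarrow> dzb W z = (r z)\<^sup>2 / 4"
  using dz_dzb_flat_laplacian(2)[OF S _ Ck_u, of z] flat_laplacian_u by (simp add: log_density_dz_def)

lemma wirt_W: "z \<in> S \<Longrightarrow> has_wirtinger W (dz W z) ((r z)\<^sup>2 / 4) z"
  using has_wirtingerI[OF Ck_on_differentiable[OF Ck_W[of 1]], of z] by (simp add: dzb_W)

text \<open>The Schwarzian of the metric, holomorphic because the curvature is constant. The isometry is a quotient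
  of two solutions of \<open>w'' = - G w\<close>.\<close>

definition G where "G z = dz W z - (W z)\<^sup>2"

text \<open>As \<open>dz\<close> and \<open>dzb\<close> commute on \<open>W\<close>,
  \<open>dzb (dz W)\<close> is \<open>dz\<close> of \<open>r^2 / 4\<close>, that is
  \<open>W * r^2 / 2\<close>; and \<open>dzb\<close> of \<open>W^2\<close> has the same
  value.\<close>

lemma holomorphic_G: "G holomorphic_on S"
proof -
  have "\<exists>d. (G has_field_derivative d) (at z)" if z: "z \<in> S" for z
  proof -
    have 1: "has_wirtinger (dz W) (dz (dz W) z) (dzb (dz W) z) z"
      by (rule has_wirtingerI, rule Ck_on_differentiable[OF Ck_on_dz(1)[OF S Ck_W[of "Suc 1"]]]) (use z in auto)
    have "dzb (dz W) z = dz (dzb W) z" unfolding dz_dzb_flat_laplacian[OF S z Ck_W] ..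
    also have "\<dots> = dz (\<lambda>z. (1/4) * (r z * r z)) z"
      by (rule dz_cong_open(1)[OF S z]) (simp add: dzb_W power2_eq_square)
    also have "\<dots> = W z * (r z)\<^sup>2 / 2"
      using has_wirtinger_unique(1)[OF has_wirtinger_mult[OF has_wirtinger_const[of "1/4"] has_wirtinger_mult[OF wirt_r[OF z] wirt_r[OF z]]]]
      by (simp add: power2_eq_square algebra_simps)
    finally have 2: "dzb (dz W) z = W z * (r z)\<^sup>2 / 2" .
    have "has_wirtinger (\<lambda>z. dz W z - W z * W z) (dz (dz W) z - (dz W z * W z + W z * dz W z))
        (W z * (r z)\<^sup>2 / 2 - ((r z)\<^sup>2 / 4 * W z + W z * ((r z)\<^sup>2 / 4))) z"
      using has_wirtinger_diff[OF 1 has_wirtinger_mult[OF wirt_W[OF z] wirt_W[OF z]]] unfolding 2 .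
    then have "has_wirtinger G (dz (dz W) z - (dz W z * W z + W z * dz W z)) 0 z"
      by (simp add: G_def[abs_def] power2_eq_square)
    then show ?thesis using has_wirtinger_imp_field by blast
  qed
  then show ?thesis by (meson holomorphic_on_def field_differentiable_def field_differentiable_at_within)
qed

end

lemma wronskian_const:
  assumes "convex B" "open B"
    and "\<And>z. z \<in> B \<Longrightarrow> (x has_field_derivative x' z) (at z)" "\<And>z. z \<in> B \<Longrightarrow> (x' has_field_derivative - G z * x z) (at z)"
    and "\<And>z. z \<in> B \<Longrightarrow> (y has_field_derivative y' z) (at z)" "\<And>z. z \<in> B \<Longrightarrow> (y' has_field_derivative - G z * y z) (at z)"
    and "z \<in> B" "z0 \<in> B"
  shows "x z * y' z - x' z * y z = x z0 * y' z0 - x' z0 * (y z0 :: complex)"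
proof -
  have "\<exists>c. \<forall>z\<in>B. x z * y' z - x' z * y z = c"
  proof (rule has_field_derivative_zero_constant[OF assms(1)])
    fix z assume z: "z \<in> B"
    show "((\<lambda>z. x z * y' z - x' z * y z) has_field_derivative 0) (at z within B)"
      using DERIV_diff[OF DERIV_mult[OF assms(3,6)[OF z]] DERIV_mult[OF assms(4,5)[OF z]]]
      by (auto intro: has_field_derivative_at_within simp: algebra_simps)
  qed
  then show ?thesis using assms(7,8) by metis
qed

text \<open>For a solution \<open>w\<close> the function \<open>cnj ((w' + W * w) / r)\<close> is
  holomorphic and solves the same equation, which gives a conjugate-linear map on solutions. For a
  suitable basis it exchanges \<open>w1\<close> and \<open>w2\<close> up to the factor 1/2. Inserted
  into the Wronskian this yields |w2|^2 - |w1|^2 = 2 / \<rho>, so the quotient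
  \<open>w1 / w2\<close> maps into the disc and pulls the Poincare metric back to \<rho>.\<close>

theorem (in hyperbolic_density) liouville:
  assumes z0: "z0 \<in> S"
  obtains e f where "e > 0" "ball z0 e \<subseteq> S" "f holomorphic_on ball z0 e" "f z0 = 0"
    "\<And>z. z \<in> ball z0 e \<Longrightarrow> cmod (f z) < 1"
    "\<And>z. z \<in> ball z0 e \<Longrightarrow> \<rho> z = 2 * cmod (deriv f z) / (1 - (cmod (f z))\<^sup>2)"
proof -
  obtain R where R: "R > 0" "ball z0 R \<subseteq> S" using S z0 openE by blast
  have G: "G holomorphic_on ball z0 R" using holomorphic_G R(2) by (rule holomorphic_on_subset)
  \<comment> \<open>With \<open>w1\<close> vanishing at \<open>z0\<close>, the identity |w2|^2 -
    |w1|^2 = 2 / \<rho> forces |w2| = \<beta> there. The choice \<open>w2' = - W * w2\<close> at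
    \<open>z0\<close> expresses that the companion of \<open>w2\<close> vanishes at
    \<open>z0\<close>, as \<open>w1\<close> does.\<close>
  define \<beta> where "\<beta> = sqrt (2 / \<rho> z0)"
  have \<beta>: "\<beta> > 0" using pos[OF z0] by (simp add: \<beta>_def)
  have \<beta>2: "\<beta> * \<beta> * \<rho> z0 = 2" using pos[OF z0] by (simp add: \<beta>_def)
  have "complex_of_real (\<beta> * \<beta> * \<rho> z0) = 2" unfolding \<beta>2 by simp
  then have c\<beta>2: "complex_of_real \<beta> * of_real \<beta> * r z0 = 2" by simp
  obtain e1 w1 w1' where w1: "e1 > 0" "e1 \<le> R" "w1 z0 = 0" "w1' z0 = of_real (1 / \<beta>)"
    "\<And>z. z \<in> ball z0 e1 \<Longrightarrow> (w1 has_field_derivative w1' z) (at z)"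
    "\<And>z. z \<in> ball z0 e1 \<Longrightarrow> (w1' has_field_derivative - G z * w1 z) (at z)"
    using holomorphic_ode_exists[OF G R(1)] by blast
  obtain e2 w2 w2' where w2: "e2 > 0" "e2 \<le> R" "w2 z0 = of_real \<beta>" "w2' z0 = - W z0 * of_real \<beta>"
    "\<And>z. z \<in> ball z0 e2 \<Longrightarrow> (w2 has_field_derivative w2' z) (at z)"
    "\<And>z. z \<in> ball z0 e2 \<Longrightarrow> (w2' has_field_derivative - G z * w2 z) (at z)"
    using holomorphic_ode_exists[OF G R(1)] by blast
  define e where "e = min e1 e2"
  define B where "B = ball z0 e"
  have e: "e > 0" and sub: "B \<subseteq> S" using w1 w2 R by (auto simp: e_def B_def)
  have B: "convex B" "open B" "z0 \<in> B" using e by (auto simp: B_def)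
  note d1 = w1(5,6) and d2 = w2(5,6)
  have d1: "(w1 has_field_derivative w1' z) (at z)" "(w1' has_field_derivative - G z * w1 z) (at z)"
    and d2: "(w2 has_field_derivative w2' z) (at z)" "(w2' has_field_derivative - G z * w2 z) (at z)" if "z \<in> B" for z
    using w1(5,6) w2(5,6) that by (auto simp: B_def e_def)
  have wr: "w1' z * w2 z - w1 z * w2' z = 1" if "z \<in> B" for z
    using wronskian_const[OF B(1,2) d1 d2 that B(3)] w1 w2 \<beta> by (simp add: field_simps)
  define v where "v z = inverse (r z)" for z
  have rn: "r z \<noteq> 0" if "z \<in> B" for z using pos[of z] sub that by auto
  have wv: "has_wirtinger v (- W z * v z) (- cnj (W z) * v z) z" if "z \<in> B" for z
  proof -
    have "z \<in> S" using that sub by auto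
    have "((\<lambda>z. inverse (r z)) has_derivative (\<lambda>h. - (inverse (r z) * (W z * r z * h + cnj (W z) * r z * cnj h) * inverse (r z)))) (at z)"
      by (rule Deriv.has_derivative_inverse) (use rn[OF that] wirt_r[OF \<open>z \<in> S\<close>] in \<open>auto simp: has_wirtinger_def\<close>)
    then show ?thesis unfolding has_wirtinger_def v_def[abs_def]
      by (rule has_derivative_eq_rhs) (use rn[OF that] in \<open>auto simp: fun_eq_iff field_simps\<close>)
  qed
  have main: "cnj (v z * (w' z + W z * w z)) = X z / 2"
    if w: "\<And>z. z \<in> B \<Longrightarrow> (w has_field_derivative w' z) (at z)" "\<And>z. z \<in> B \<Longrightarrow> (w' has_field_derivative - G z * w z) (at z)"
    and X: "\<And>z. z \<in> B \<Longrightarrow> (X has_field_derivative X' z) (at z)" "\<And>z. z \<in> B \<Longrightarrow> (X' has_field_derivative - G z * X z) (at z)"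
    and i1: "cnj (v z0 * (w' z0 + W z0 * w z0)) = X z0 / 2"
    and i2: "- W z0 * (X z0 / 2) + r z0 * cnj (w z0) / 4 = X' z0 / 2"
    and z: "z \<in> B" for w w' X X' z
  proof -
    define A where "A z = v z * (w' z + W z * w z)" for z
    define C where "C z = cnj (A z)" for z
    define P where "P z = - W z * C z + r z * cnj (w z) / 4" for z
    \<comment> \<open>The \<open>dz\<close> part vanishes because \<open>w'' = - G w\<close> cancels
      against \<open>dz W - W^2 = G\<close>; thus \<open>A\<close> is antiholomorphic and its
      conjugate \<open>C\<close> holomorphic.\<close>
    have wA: "has_wirtinger A 0 (cnj (P z)) z" if z: "z \<in> B" for z
    proof -
      have zS: "z \<in> S" using z sub by auto
      have "has_wirtinger A (- W z * v z * (w' z + W z * w z) + v z * (- G z * w z + (dz W z * w z + W z * w' z)))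
          (- cnj (W z) * v z * (w' z + W z * w z) + v z * (0 + ((r z)\<^sup>2 / 4 * w z + W z * 0))) z" (is "has_wirtinger _ ?l ?m _")
        unfolding A_def[abs_def]
        by (intro has_wirtinger_mult has_wirtinger_add wv wirt_W zS z has_wirtinger_field w)
      moreover have "?l = 0"
        by (simp add: G_def algebra_simps power2_eq_square)
      moreover have "?m = cnj (P z)"
        using rn[OF z] by (simp add: P_def C_def A_def v_def field_simps power2_eq_square)
      ultimately show ?thesis by (simp only:)
    qed
    have dC: "(C has_field_derivative P z) (at z)" if z: "z \<in> B" for z
      using has_wirtinger_imp_field[of C "P z" z] has_wirtinger_cnj[OF wA[OF z]] by (simp add: C_def[abs_def])
    have dP: "(P has_field_derivative - G z * C z) (at z)" if z: "z \<in> B" for z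
    proof (rule has_wirtinger_imp_field)
      have zS: "z \<in> S" using z sub by auto
      note wc = has_wirtinger_cnj[OF has_wirtinger_field[OF w(1)[OF z]]]
      have "has_wirtinger (\<lambda>z. (1/4) * (r z * cnj (w z)) - W z * C z)
         ((0 * (r z * cnj (w z)) + (1/4) * (W z * r z * cnj (w z) + r z * cnj 0)) - (dz W z * C z + W z * P z))
         ((0 * (r z * cnj (w z)) + (1/4) * (cnj (W z) * r z * cnj (w z) + r z * cnj (w' z))) - ((r z)\<^sup>2 / 4 * C z + W z * 0)) z"
        by (intro has_wirtinger_diff has_wirtinger_mult has_wirtinger_const wirt_r wirt_W zS wc has_wirtinger_field dC z)
      moreover have "(\<lambda>z. (1/4) * (r z * cnj (w z)) - W z * C z) = P" by (simp add: P_def fun_eq_iff)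
      moreover have "(0 * (r z * cnj (w z)) + (1/4) * (W z * r z * cnj (w z) + r z * cnj 0)) - (dz W z * C z + W z * P z) = - G z * C z"
        by (simp add: G_def P_def algebra_simps power2_eq_square)
      moreover have "(0 * (r z * cnj (w z)) + (1/4) * (cnj (W z) * r z * cnj (w z) + r z * cnj (w' z))) - ((r z)\<^sup>2 / 4 * C z + W z * 0) = 0"
        using rn[OF z] by (simp add: C_def A_def v_def field_simps power2_eq_square)
      ultimately show "has_wirtinger P (- G z * C z) 0 z" by (simp only:)
    qed
    define x where "x z = C z - X z / 2" for z
    define x' where "x' z = P z - X' z / 2" for z
    have dx: "(x has_field_derivative x' z) (at z)" "(x' has_field_derivative - G z * x z) (at z)" if z: "z \<in> B" for z
      unfolding x_def[abs_def] x'_def[abs_def]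
      using dC[OF z] dP[OF z] X[OF z] by (auto intro!: derivative_eq_intros simp: algebra_simps)
    have C0: "C z0 = X z0 / 2" using i1 by (simp add: C_def A_def)
    have x0: "x z0 = 0" "x' z0 = 0" using i2 unfolding x_def x'_def P_def C0 by auto
    have "x z * w1' z - x' z * w1 z = 0" using wronskian_const[OF B(1,2) dx d1 z B(3)] x0 by simp
    moreover have "x z * w2' z - x' z * w2 z = 0" using wronskian_const[OF B(1,2) dx d2 z B(3)] x0 by simp
    \<comment> \<open>The difference \<open>x\<close> has zero Wronskian with both basis solutions,
      whose own Wronskian is 1; linear algebra leaves only \<open>x = 0\<close>.\<close>
    moreover have "x z = (x z * w1' z - x' z * w1 z) * w2 z - (x z * w2' z - x' z * w2 z) * w1 z"
    proof -
      have "x z = x z * (w1' z * w2 z - w1 z * w2' z)" using wr[OF z] by simp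
      then show ?thesis by (simp add: algebra_simps)
    qed
    ultimately have "x z = 0" by simp
    then show ?thesis by (simp add: x_def C_def A_def)
  qed
  have r\<beta>: "inverse (r z0) = of_real \<beta> * of_real \<beta> / 2" using c\<beta>2 rn[OF B(3)] by (simp add: field_simps)
  have A1: "cnj (v z * (w1' z + W z * w1 z)) = w2 z / 2" if "z \<in> B" for z
  proof (rule main[OF d1 d2 _ _ that])
    show "cnj (v z0 * (w1' z0 + W z0 * w1 z0)) = w2 z0 / 2"
      using \<beta> unfolding v_def r\<beta> by (simp add: w1 w2)
    show "- W z0 * (w2 z0 / 2) + r z0 * cnj (w1 z0) / 4 = w2' z0 / 2" by (simp add: w1 w2)
  qed
  have A2: "cnj (v z * (w2' z + W z * w2 z)) = w1 z / 2" if "z \<in> B" for z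
  proof (rule main[OF d2 d1 _ _ that])
    show "cnj (v z0 * (w2' z0 + W z0 * w2 z0)) = w1 z0 / 2" by (simp add: w1 w2)
    show "- W z0 * (w1 z0 / 2) + r z0 * cnj (w2 z0) / 4 = w1' z0 / 2"
      using \<beta> c\<beta>2 by (simp add: w1 w2 field_simps)
  qed
  have key: "(cmod (w2 z))\<^sup>2 - (cmod (w1 z))\<^sup>2 = 2 / \<rho> z" if z: "z \<in> B" for z
  proof -
    have "v z = v z * (w1' z * w2 z - w1 z * w2' z)" using wr[OF z] by simp
    also have "\<dots> = (v z * (w1' z + W z * w1 z)) * w2 z - (v z * (w2' z + W z * w2 z)) * w1 z"
      by (simp add: algebra_simps)
    also have "v z * (w1' z + W z * w1 z) = cnj (w2 z) / 2" using arg_cong[OF A1[OF z], of cnj] by simp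
    also have "v z * (w2' z + W z * w2 z) = cnj (w1 z) / 2" using arg_cong[OF A2[OF z], of cnj] by simp
    also have "cnj (w2 z) / 2 * w2 z - cnj (w1 z) / 2 * w1 z = of_real (((cmod (w2 z))\<^sup>2 - (cmod (w1 z))\<^sup>2) / 2)"
      by (simp add: complex_norm_square diff_divide_distrib mult.commute del: of_real_power)
    finally have "complex_of_real (inverse (\<rho> z)) = of_real (((cmod (w2 z))\<^sup>2 - (cmod (w1 z))\<^sup>2) / 2)" by (simp add: v_def)
    then have "inverse (\<rho> z) = ((cmod (w2 z))\<^sup>2 - (cmod (w1 z))\<^sup>2) / 2" by (rule of_real_eq_iff[THEN iffD1])
    then show ?thesis by (simp add: field_simps)
  qed
  have w2n: "w2 z \<noteq> 0" "cmod (w1 z) < cmod (w2 z)" if z: "z \<in> B" for z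
  proof -
    have "2 / \<rho> z > 0" using pos[of z] z sub by auto
    then have "(cmod (w1 z))\<^sup>2 < (cmod (w2 z))\<^sup>2" using key[OF z] by linarith
    then show "cmod (w1 z) < cmod (w2 z)" by (rule power2_less_imp_less) simp
    then show "w2 z \<noteq> 0" by auto
  qed
  define f where "f z = w1 z / w2 z" for z
  have df: "(f has_field_derivative 1 / (w2 z)\<^sup>2) (at z)" if z: "z \<in> B" for z
    using DERIV_divide[OF d1(1)[OF z] d2(1)[OF z] w2n(1)[OF z]] wr[OF z] by (simp add: f_def[abs_def] power2_eq_square)
  show ?thesis
  proof (rule that[OF e, of f])
    show "ball z0 e \<subseteq> S" using sub by (simp add: B_def)
    show "f holomorphic_on ball z0 e" using df unfolding B_def
      by (meson holomorphic_on_def field_differentiable_def field_differentiable_at_within)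
    show "f z0 = 0" by (simp add: f_def w1)
    fix z assume "z \<in> ball z0 e"
    then have z: "z \<in> B" by (simp add: B_def)
    show "cmod (f z) < 1" using w2n[OF z] by (simp add: f_def norm_divide)
    have "1 - (cmod (f z))\<^sup>2 = ((cmod (w2 z))\<^sup>2 - (cmod (w1 z))\<^sup>2) / (cmod (w2 z))\<^sup>2"
      using w2n[OF z] by (simp add: f_def norm_divide power_divide field_simps)
    moreover have "cmod (deriv f z) = 1 / (cmod (w2 z))\<^sup>2"
      using DERIV_imp_deriv[OF df[OF z]] by (simp add: norm_divide norm_power)
    ultimately show "\<rho> z = 2 * cmod (deriv f z) / (1 - (cmod (f z))\<^sup>2)"
      using w2n[OF z] key[OF z] by simp
  qed
qed

section \<open>Local isometries from the disc\<close>

text \<open>Gronwall in both time directions: \<open>exp (- C * t) * E t\<close> is nonincreasing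
  and \<open>exp (C * t) * E t\<close> nondecreasing, so the zero at \<open>s\<close> spreads to
  either side.\<close>

lemma gronwall_zero:
  fixes E E' :: "real \<Rightarrow> real"
  assumes d: "\<And>t. t \<in> {a..b} \<Longrightarrow> (E has_real_derivative E' t) (at t)"
    and bd: "\<And>t. t \<in> {a..b} \<Longrightarrow> \<bar>E' t\<bar> \<le> C * E t" and nn: "\<And>t. t \<in> {a..b} \<Longrightarrow> E t \<ge> 0"
    and s: "s \<in> {a..b}" "E s = 0" and t: "t \<in> {a..b}"
  shows "E t = 0"
proof -
  have e: "((\<lambda>t. exp (k * t)) has_real_derivative k * exp (k * t)) (at t)" for k t :: real
    by (auto intro!: derivative_eq_intros)
  have 1: "exp (- C * t) * E t \<le> exp (- C * s) * E s" if "s \<le> t"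
  proof (rule DERIV_nonpos_imp_nonincreasing[OF that])
    fix x assume x: "s \<le> x" "x \<le> t"
    then have xi: "x \<in> {a..b}" using s t by auto
    have "((\<lambda>t. exp (- C * t) * E t) has_real_derivative exp (- C * x) * (E' x - C * E x)) (at x)"
      by (rule DERIV_cong[OF DERIV_mult[OF e d[OF xi]]]) (simp add: algebra_simps)
    moreover have "exp (- C * x) * (E' x - C * E x) \<le> 0"
      using bd[OF xi] by (intro mult_nonneg_nonpos) auto
    ultimately show "\<exists>y. ((\<lambda>t. exp (- C * t) * E t) has_real_derivative y) (at x) \<and> y \<le> 0" by blast
  qed
  have 2: "exp (C * t) * E t \<le> exp (C * s) * E s" if "t \<le> s"
  proof (rule DERIV_nonneg_imp_nondecreasing[OF that])
    fix x assume x: "t \<le> x" "x \<le> s"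
    then have xi: "x \<in> {a..b}" using s t by auto
    have "((\<lambda>t. exp (C * t) * E t) has_real_derivative exp (C * x) * (E' x + C * E x)) (at x)"
      by (rule DERIV_cong[OF DERIV_mult[OF e d[OF xi]]]) (simp add: algebra_simps)
    moreover have "exp (C * x) * (E' x + C * E x) \<ge> 0"
      using bd[OF xi] by (intro mult_nonneg_nonneg) auto
    ultimately show "\<exists>y. ((\<lambda>t. exp (C * t) * E t) has_real_derivative y) (at x) \<and> 0 \<le> y" by blast
  qed
  have "E t \<le> 0"
    using 1 2 s(2) by (cases "s \<le> t") (auto simp: mult_le_0_iff)
  with nn[OF t] show ?thesis by simp
qed

text \<open>One normal form for two uses: \<open>k = 1\<close> and \<alpha> = 0 is the geodesic
  equation in a chart; complex \<open>k\<close> with \<alpha> = 2 cnj z / (1 - |z|^2) is a local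
  isometry along a segment with direction \<open>k\<close>. The energy of the difference obeys a
  linear inequality since \<open>W\<close> is Lipschitz and the velocities are bounded on the
  compact interval.\<close>

lemma second_order_ode_unique:
  fixes z1 z2 v1 v2 \<alpha> :: "real \<Rightarrow> complex"
  assumes dz: "\<And>t. t \<in> {a..b} \<Longrightarrow> (z1 has_vector_derivative k * v1 t) (at t)"
      "\<And>t. t \<in> {a..b} \<Longrightarrow> (z2 has_vector_derivative k * v2 t) (at t)"
    and dv: "\<And>t. t \<in> {a..b} \<Longrightarrow> (v1 has_vector_derivative k * (\<alpha> t * v1 t - 2 * W (z1 t) * (v1 t)\<^sup>2)) (at t)"
      "\<And>t. t \<in> {a..b} \<Longrightarrow> (v2 has_vector_derivative k * (\<alpha> t * v2 t - 2 * W (z2 t) * (v2 t)\<^sup>2)) (at t)"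
    and K: "\<And>t. t \<in> {a..b} \<Longrightarrow> z1 t \<in> K" "\<And>t. t \<in> {a..b} \<Longrightarrow> z2 t \<in> K"
    and W: "\<And>x y. x \<in> K \<Longrightarrow> y \<in> K \<Longrightarrow> cmod (W x - W y) \<le> L * cmod (x - y)" "\<And>x. x \<in> K \<Longrightarrow> cmod (W x) \<le> N"
    and \<alpha>: "continuous_on {a..b} \<alpha>"
    and s: "s \<in> {a..b}" "z1 s = z2 s" "v1 s = v2 s" and t: "t \<in> {a..b}"
  shows "z1 t = z2 t"
proof -
  have cv: "continuous_on {a..b} v1" "continuous_on {a..b} v2"
    by (intro continuous_at_imp_continuous_on ballI has_vector_derivative_continuous[OF dv(1)] has_vector_derivative_continuous[OF dv(2)]; assumption)+
  have "bounded (v1 ` {a..b})" "bounded (v2 ` {a..b})" "bounded (\<alpha> ` {a..b})"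
    using cv \<alpha> by (auto intro!: compact_imp_bounded compact_continuous_image)
  then obtain M1 M2 M3 where M: "\<And>t. t \<in> {a..b} \<Longrightarrow> cmod (v1 t) \<le> M1" "\<And>t. t \<in> {a..b} \<Longrightarrow> cmod (v2 t) \<le> M2"
      "\<And>t. t \<in> {a..b} \<Longrightarrow> cmod (\<alpha> t) \<le> M3"
    unfolding bounded_iff ball_simps by blast
  define L' where "L' = \<bar>L\<bar>"
  define N' where "N' = \<bar>N\<bar>"
  define P where "P = M3 + 2 * N' * (M1 + M2)"
  define R where "R = 2 * L' * M1\<^sup>2"
  have M0: "M1 \<ge> 0" "M2 \<ge> 0" "M3 \<ge> 0" using M[OF s(1)] norm_ge_zero order_trans by blast+
  have LN: "L' \<ge> 0" "N' \<ge> 0" by (auto simp: L'_def N'_def)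
  define x where "x t = z1 t - z2 t" for t
  define y where "y t = v1 t - v2 t" for t
  define y' where "y' t = (\<alpha> t * v1 t - 2 * W (z1 t) * (v1 t)\<^sup>2) - (\<alpha> t * v2 t - 2 * W (z2 t) * (v2 t)\<^sup>2)" for t
  have dx: "(x has_vector_derivative k * y t) (at t)" if "t \<in> {a..b}" for t
    unfolding x_def[abs_def] y_def right_diff_distrib by (rule has_vector_derivative_diff[OF dz[OF that]])
  have dy: "(y has_vector_derivative k * y' t) (at t)" if "t \<in> {a..b}" for t
    unfolding y_def[abs_def] y'_def right_diff_distrib[of k "\<alpha> t * v1 t - 2 * W (z1 t) * (v1 t)\<^sup>2"] by (rule has_vector_derivative_diff[OF dv[OF that]])
  have y'b: "cmod (y' t) \<le> P * cmod (y t) + R * cmod (x t)" if t: "t \<in> {a..b}" for t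
  proof -
    \<comment> \<open>Every summand contains exactly one difference: \<open>y\<close>, or
      \<open>W (z1 t) - W (z2 t)\<close>; the quadratic term is split through v1^2 - v2^2 = (v1 +
      v2) (v1 - v2).\<close>
    have "y' t = \<alpha> t * y t - 2 * ((W (z1 t) - W (z2 t)) * (v1 t)\<^sup>2 + W (z2 t) * ((v1 t + v2 t) * y t))"
      by (simp add: y'_def y_def algebra_simps power2_eq_square)
    also have "cmod \<dots> \<le> cmod (\<alpha> t) * cmod (y t) + 2 * (cmod (W (z1 t) - W (z2 t)) * (cmod (v1 t))\<^sup>2 + cmod (W (z2 t)) * (cmod (v1 t + v2 t) * cmod (y t)))"
      by (rule order_trans[OF norm_triangle_ineq4])
        (simp add: norm_mult norm_power, rule order_trans[OF norm_triangle_ineq], simp add: norm_mult norm_power)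
    also have "\<dots> \<le> M3 * cmod (y t) + 2 * ((L' * cmod (x t)) * M1\<^sup>2 + N' * ((M1 + M2) * cmod (y t)))"
    proof -
      have "cmod (W (z1 t) - W (z2 t)) \<le> L' * cmod (x t)"
        using order_trans[OF W(1)[OF K[OF t]] mult_right_mono[OF abs_ge_self norm_ge_zero]] by (simp add: L'_def x_def)
      moreover have "cmod (W (z2 t)) \<le> N'" using W(2)[OF K(2)[OF t]] by (simp add: N'_def)
      moreover have "cmod (v1 t + v2 t) \<le> M1 + M2" using M[OF t] norm_triangle_ineq[of "v1 t" "v2 t"] by linarith
      moreover have "(cmod (v1 t))\<^sup>2 \<le> M1\<^sup>2" using M[OF t] by (intro power_mono) auto
      ultimately show ?thesis using M[OF t] M0 LN
        by (intro add_mono mult_left_mono mult_mono mult_right_mono) auto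
    qed
    finally show ?thesis by (simp add: P_def R_def algebra_simps)
  qed
  define E where "E t = (cmod (x t))\<^sup>2 + (cmod (y t))\<^sup>2" for t
  define E' where "E' t = 2 * (x t \<bullet> (k * y t)) + 2 * (y t \<bullet> (k * y' t))" for t
  have sq: "((\<lambda>t. (cmod (f t))\<^sup>2) has_real_derivative 2 * (f t \<bullet> f')) (at t)" if "(f has_vector_derivative f') (at t)"
    for f :: "real \<Rightarrow> complex" and f' t
    using that unfolding has_vector_derivative_def has_field_derivative_def power2_norm_eq_inner
    by (auto intro!: derivative_eq_intros simp: inner_commute algebra_simps)
  have "E t = 0"
  proof (rule gronwall_zero[where E = E and E' = E' and C = "cmod k * (1 + 2 * P + R)", OF _ _ _ s(1) _ t])
    fix t assume t: "t \<in> {a..b}"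
    show "(E has_real_derivative E' t) (at t)"
      unfolding E_def[abs_def] E'_def by (intro DERIV_add sq dx dy t)
    have PR: "P \<ge> 0" "R \<ge> 0" using M0 LN by (auto simp: P_def R_def)
    define X where "X = cmod (x t)"
    define Y where "Y = cmod (y t)"
    have XY: "X \<ge> 0" "Y \<ge> 0" "2 * X * Y \<le> X\<^sup>2 + Y\<^sup>2" using sum_squares_bound[of X Y] by (auto simp: X_def Y_def)
    have "\<bar>E' t\<bar> \<le> 2 * (cmod (x t) * (cmod k * cmod (y t))) + 2 * (cmod (y t) * (cmod k * cmod (y' t)))"
      using Cauchy_Schwarz_ineq2[of "x t" "k * y t"] Cauchy_Schwarz_ineq2[of "y t" "k * y' t"]
      by (simp add: E'_def norm_mult)
    also have "\<dots> \<le> 2 * (X * (cmod k * Y)) + 2 * (Y * (cmod k * (P * Y + R * X)))"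
      using mult_left_mono[OF mult_left_mono[OF y'b[OF t] norm_ge_zero[of k]] norm_ge_zero[of "y t"]] unfolding X_def Y_def by linarith
    also have "\<dots> = cmod k * ((1 + R) * (2 * X * Y) + 2 * P * Y\<^sup>2)" by (simp add: algebra_simps power2_eq_square)
    also have "\<dots> \<le> cmod k * ((1 + R) * (X\<^sup>2 + Y\<^sup>2) + 2 * P * (X\<^sup>2 + Y\<^sup>2))"
      using XY PR by (intro mult_left_mono add_mono) auto
    also have "\<dots> = cmod k * (1 + 2 * P + R) * E t" by (simp add: E_def X_def Y_def algebra_simps)
    finally show "\<bar>E' t\<bar> \<le> cmod k * (1 + 2 * P + R) * E t" .
    show "E t \<ge> 0" by (simp add: E_def)
  qed (use s in \<open>simp add: E_def x_def y_def\<close>)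
  then show ?thesis by (simp add: E_def x_def add_nonneg_eq_0_iff)
qed

lemma (in hyperbolic_density) W_lipschitz:
  assumes "p \<in> S"
  obtains e L N where "e > 0" "ball p e \<subseteq> S"
    "\<And>x y. x \<in> ball p e \<Longrightarrow> y \<in> ball p e \<Longrightarrow> cmod (W x - W y) \<le> L * cmod (x - y)"
    "\<And>x. x \<in> ball p e \<Longrightarrow> cmod (W x) \<le> N"
proof -
  obtain e where e: "e > 0" "cball p e \<subseteq> S" using S assms open_contains_cball by blast
  have c: "continuous_on S W" "continuous_on S (dz W)" "continuous_on S (dzb W)"
    using Ck_on_imp_continuous[OF Ck_W] Ck_on_imp_continuous[OF Ck_on_dz(1)[OF S Ck_W[of "Suc 0"]]]
      Ck_on_imp_continuous[OF Ck_on_dz(2)[OF S Ck_W[of "Suc 0"]]] by auto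
  then have "bounded (W ` cball p e)" "bounded (dz W ` cball p e)" "bounded (dzb W ` cball p e)"
    using e by (auto intro!: compact_imp_bounded compact_continuous_image intro: continuous_on_subset)
  then obtain N M1 M2 where M: "\<And>t. t \<in> cball p e \<Longrightarrow> cmod (W t) \<le> N" "\<And>t. t \<in> cball p e \<Longrightarrow> cmod (dz W t) \<le> M1"
      "\<And>t. t \<in> cball p e \<Longrightarrow> cmod (dzb W t) \<le> M2"
    unfolding bounded_iff ball_simps by blast
  show ?thesis
  proof (rule that[of e "M1 + M2" N])
    fix x y assume xy: "x \<in> ball p e" "y \<in> ball p e"
    show "cmod (W x - W y) \<le> (M1 + M2) * cmod (x - y)"
    proof (rule differentiable_bound[where S = "ball p e" and f' = "\<lambda>z h. dz W z * h + dzb W z * cnj h"])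
      fix z assume z: "z \<in> ball p e"
      have "z \<in> S" using z e(2) ball_subset_cball by blast
      then have "W differentiable (at z)" using Ck_on_differentiable[OF Ck_W[of 1]] by simp
      from has_wirtingerI[OF this] show "(W has_derivative (\<lambda>h. dz W z * h + dzb W z * cnj h)) (at z within ball p e)"
        unfolding has_wirtinger_def by (rule has_derivative_at_withinI)
      show "onorm (\<lambda>h. dz W z * h + dzb W z * cnj h) \<le> M1 + M2"
      proof (rule onorm_le)
        fix h
        have "cmod (dz W z * h + dzb W z * cnj h) \<le> cmod (dz W z) * cmod h + cmod (dzb W z) * cmod h"
          by (rule order_trans[OF norm_triangle_ineq]) (simp add: norm_mult)
        also have "\<dots> \<le> M1 * cmod h + M2 * cmod h" using M z by (intro add_mono mult_right_mono) auto
        finally show "cmod (dz W z * h + dzb W z * cnj h) \<le> (M1 + M2) * cmod h" by (simp add: algebra_simps)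
      qed
    qed (use xy in auto)
  qed (use e M in auto)
qed

section \<open>The Poincare metric and Moebius maps\<close>

definition disc_density :: "complex \<Rightarrow> real" where "disc_density z = 2 / (1 - (cmod z)\<^sup>2)"

lemma disc_density_pos: "cmod z < 1 \<Longrightarrow> disc_density z > 0"
  using power_strict_mono[of "cmod z" 1 2] by (simp add: disc_density_def)

lemma one_minus_cnj_mult_nonzero: "cmod a < 1 \<Longrightarrow> cmod z < 1 \<Longrightarrow> 1 - cnj a * z \<noteq> 0"
proof
  assume a: "cmod a < 1" "cmod z < 1" and "1 - cnj a * z = 0"
  then have "cmod (cnj a * z) = 1" by simp
  moreover have "cmod (cnj a * z) < 1" using a norm_mult_less[of "cnj a" 1 z 1] by simp
  ultimately show False by simp
qed

lemma Moebius_deriv: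
  assumes "cmod a < 1" "cmod z < 1"
  shows "(Moebius_function t a has_field_derivative exp (\<i> * of_real t) * of_real (1 - (cmod a)\<^sup>2) / (1 - cnj a * z)\<^sup>2) (at z)"
proof -
  have nz: "1 - cnj a * z \<noteq> 0" using assms by (rule one_minus_cnj_mult_nonzero)
  have "of_real ((cmod a)\<^sup>2) = a * cnj a" by (rule complex_norm_square)
  then have e: "(of_real (1 - (cmod a)\<^sup>2) :: complex) = 1 - a * cnj a" by (simp del: of_real_power)
  define E where "E = exp (\<i> * complex_of_real t)"
  have d: "((\<lambda>z. E * (z - a)) has_field_derivative E) (at z)" "((\<lambda>z. 1 - cnj a * z) has_field_derivative - cnj a) (at z)"
    by (auto intro!: derivative_eq_intros)
  have n: "E * (1 - cnj a * z) - E * (z - a) * (- cnj a) = E * (1 - a * cnj a)" by (simp add: algebra_simps)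
  show ?thesis unfolding Moebius_function_def[abs_def] e E_def[symmetric]
    using DERIV_divide[OF d nz] unfolding n by (simp add: power2_eq_square)
qed

lemma Moebius_norm:
  assumes "cmod a < 1" "cmod z < 1"
  shows "1 - (cmod (Moebius_function t a z))\<^sup>2 = (1 - (cmod a)\<^sup>2) * (1 - (cmod z)\<^sup>2) / (cmod (1 - cnj a * z))\<^sup>2"
proof -
  have nz: "cmod (1 - cnj a * z) \<noteq> 0" using one_minus_cnj_mult_nonzero[OF assms] by simp
  have "(cmod (1 - cnj a * z))\<^sup>2 - (cmod (z - a))\<^sup>2 = (1 - (cmod a)\<^sup>2) * (1 - (cmod z)\<^sup>2)"
    unfolding cmod_power2 by (simp add: algebra_simps power2_eq_square)
  moreover have "cmod (Moebius_function t a z) = cmod (z - a) / cmod (1 - cnj a * z)"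
    by (simp add: Moebius_function_def norm_mult norm_divide)
  ultimately show ?thesis using nz by (simp only: power_divide) (simp add: field_simps)
qed

text \<open>The equality case of Schwarz-Pick: the factor \<open>1 - |a|^2\<close> of the derivative
  cancels against the same factor in \<open>Moebius_norm\<close>.\<close>

lemma Moebius_isometry:
  assumes "cmod a < 1" "cmod z < 1"
  shows "disc_density (Moebius_function t a z) * cmod (exp (\<i> * of_real t) * of_real (1 - (cmod a)\<^sup>2) / (1 - cnj a * z)\<^sup>2) = disc_density z"
proof -
  have nz: "cmod (1 - cnj a * z) \<noteq> 0" using one_minus_cnj_mult_nonzero[OF assms] by simp
  have p: "1 - (cmod a)\<^sup>2 > 0" "1 - (cmod z)\<^sup>2 > 0" using assms by (auto simp: power_less_one_iff abs_square_less_1)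
  have "cmod (of_real (1 - (cmod a)\<^sup>2)) = 1 - (cmod a)\<^sup>2" using p by (simp only: norm_of_real abs_of_pos)
  then have "cmod (exp (\<i> * of_real t) * of_real (1 - (cmod a)\<^sup>2) / (1 - cnj a * z)\<^sup>2) = (1 - (cmod a)\<^sup>2) / (cmod (1 - cnj a * z))\<^sup>2"
    by (simp add: norm_mult norm_divide norm_power del: of_real_diff of_real_power)
  moreover have "2 / (A * Z / D) * (A / D) = 2 / Z" if "A > 0" "Z > 0" "D \<noteq> 0" for A Z D :: real
    using that by (simp add: field_simps)
  ultimately show ?thesis unfolding disc_density_def Moebius_norm[OF assms] using nz p by simp
qed

text \<open>A crude distortion bound, sufficient to see that the automorphism moving
  \<open>a\<close> to 0 maps small Euclidean balls near \<open>a\<close> into a prescribed ball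
  about 0.\<close>

lemma Moebius_norm_le:
  assumes "cmod a < 1" "cmod z < 1"
  shows "cmod (Moebius_function t a z) \<le> cmod (z - a) / (1 - cmod a * cmod z)"
proof -
  have "cmod (cnj a * z) < 1" using assms norm_mult_less[of "cnj a" 1 z 1] by simp
  then have 1: "1 - cmod a * cmod z > 0" by (simp add: norm_mult)
  have "1 - cmod a * cmod z \<le> cmod (1 - cnj a * z)" using norm_triangle_ineq2[of 1 "cnj a * z"] by (simp add: norm_mult)
  then show ?thesis using 1 by (simp add: Moebius_function_def norm_mult norm_divide frac_le)
qed

context compact_hyperbolic_surface
begin

section \<open>Charts and transition maps\<close>

lemma charts_atD: "c \<in> charts_at Y p \<Longrightarrow> c \<in> atlas Y" "c \<in> charts_at Y p \<Longrightarrow> p \<in> chart_dom c"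
  by (auto simp: charts_at_def)

lemma charts_atI: "c \<in> atlas Y \<Longrightarrow> p \<in> chart_dom c \<Longrightarrow> c \<in> charts_at Y p"
  by (auto simp: charts_at_def)

lemma charts_at_nonempty: "\<exists>c. c \<in> charts_at Y p"
  using covering by (auto simp: charts_at_def) (metis UNIV_I UN_E prod.collapse)

lemma some_chart: "some_chart Y p \<in> charts_at Y p"
  unfolding some_chart_def by (rule someI_ex[OF charts_at_nonempty])

lemma param_coord: "c \<in> atlas Y \<Longrightarrow> p \<in> chart_dom c \<Longrightarrow> param c (coord c p) = p"
  using homeo[of c] by (simp add: homeomorphism_def)

lemma coord_param: "c \<in> atlas Y \<Longrightarrow> z \<in> chart_im c \<Longrightarrow> coord c (param c z) = z"
  using homeo[of c] by (auto simp: homeomorphism_def)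

lemma param_in_dom: "c \<in> atlas Y \<Longrightarrow> z \<in> chart_im c \<Longrightarrow> param c z \<in> chart_dom c"
  using homeo[of c] by (auto simp: homeomorphism_def)

lemma continuous_coord: "c \<in> atlas Y \<Longrightarrow> continuous_on (chart_dom c) (coord c)"
  using homeo[of c] by (simp add: homeomorphism_def)

lemma continuous_param: "c \<in> atlas Y \<Longrightarrow> continuous_on (chart_im c) (param c)"
  using homeo[of c] by (simp add: homeomorphism_def)

lemma hyperbolic_density: "c \<in> atlas Y \<Longrightarrow> hyperbolic_density (chart_im c) (density Y c)"
  by standard (use open_im density_pos density_smooth curvature_minus_one in auto)

lemma coord_inj: "c \<in> atlas Y \<Longrightarrow> p \<in> chart_dom c \<Longrightarrow> q \<in> chart_dom c \<Longrightarrow> coord c p = coord c q \<Longrightarrow> p = q"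
  using param_coord by metis

lemma open_transition_dom:
  assumes "c \<in> atlas Y" "d \<in> atlas Y"
  shows "open (coord c ` (chart_dom c \<inter> chart_dom d))"
proof -
  have "open (chart_im c \<inter> param c -` chart_dom d)"
    using continuous_open_preimage[OF continuous_param open_im open_dom] assms by blast
  moreover have "coord c ` (chart_dom c \<inter> chart_dom d) = chart_im c \<inter> param c -` chart_dom d"
  proof (intro equalityI subsetI)
    fix z assume "z \<in> chart_im c \<inter> param c -` chart_dom d"
    then have "z = coord c (param c z)" "param c z \<in> chart_dom c \<inter> chart_dom d"
      using param_in_dom[of c z] coord_param[of c z] assms by auto
    then show "z \<in> coord c ` (chart_dom c \<inter> chart_dom d)" by (rule image_eqI)
  next
    fix z assume "z \<in> coord c ` (chart_dom c \<inter> chart_dom d)"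
    then show "z \<in> chart_im c \<inter> param c -` chart_dom d" using param_coord[OF assms(1)] by auto
  qed
  ultimately show ?thesis by simp
qed

lemma transition_deriv:
  assumes c: "c \<in> charts_at Y p" and d: "d \<in> charts_at Y p"
  shows "(transition c d has_field_derivative deriv (transition c d) (coord c p)) (at (coord c p))"
    "density Y c (coord c p) = density Y d (coord d p) * cmod (deriv (transition c d) (coord c p))"
    "transition c d (coord c p) = coord d p"
proof -
  note a = charts_atD[OF c] charts_atD[OF d]
  have i: "coord c p \<in> coord c ` (chart_dom c \<inter> chart_dom d)" using a by auto
  show "(transition c d has_field_derivative deriv (transition c d) (coord c p)) (at (coord c p))"
    by (rule holomorphic_derivI[OF holomorphic_transition open_transition_dom i]) (use a in auto)
  show t: "transition c d (coord c p) = coord d p" using param_coord a by (simp add: transition_def)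
  show "density Y c (coord c p) = density Y d (coord d p) * cmod (deriv (transition c d) (coord c p))"
    using density_transition[OF _ _ i] a t by simp
qed

lemma chart_nbhd:
  assumes "open U" "continuous_on U \<Phi>" "z \<in> U" "c \<in> charts_at Y (\<Phi> z)"
  obtains e where "e > 0" "ball z e \<subseteq> U" "\<Phi> ` ball z e \<subseteq> chart_dom c"
proof -
  have "open (U \<inter> \<Phi> -` chart_dom c)"
    using continuous_open_preimage[OF assms(2,1) open_dom] charts_atD[OF assms(4)] by blast
  moreover have "z \<in> U \<inter> \<Phi> -` chart_dom c" using assms charts_atD[OF assms(4)] by auto
  ultimately obtain e where "e > 0" "ball z e \<subseteq> U \<inter> \<Phi> -` chart_dom c" by (rule openE)
  then show ?thesis using that[of e] by auto
qed

section \<open>Local isometries from parts of the disc\<close>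

text \<open>Orientation is built in through complex differentiability, which makes the identity
  theorem available. The condition is demanded in every chart around the point, so that any chart
  can be used later; \<open>local_isometryI\<close> derives it from a single one.\<close>

definition local_isometry :: "complex set \<Rightarrow> (complex \<Rightarrow> 'a) \<Rightarrow> bool" where
  "local_isometry U \<Phi> \<longleftrightarrow> open U \<and> U \<subseteq> ball 0 1 \<and> continuous_on U \<Phi> \<and>
    (\<forall>z\<in>U. \<forall>c\<in>charts_at Y (\<Phi> z). \<exists>d. ((\<lambda>w. coord c (\<Phi> w)) has_field_derivative d) (at z) \<and>
        density Y c (coord c (\<Phi> z)) * cmod d = disc_density z)"

lemma local_isometryD:
  assumes "local_isometry U \<Phi>"
  shows "open U" "U \<subseteq> ball 0 1" "continuous_on U \<Phi>"
    "\<And>z c. z \<in> U \<Longrightarrow> c \<in> charts_at Y (\<Phi> z) \<Longrightarrow> \<exists>d. ((\<lambda>w. coord c (\<Phi> w)) has_field_derivative d) (at z) \<and>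
        density Y c (coord c (\<Phi> z)) * cmod d = disc_density z"
  using assms by (auto simp: local_isometry_def)

lemma local_isometryI:
  assumes U: "open U" "U \<subseteq> ball 0 1" "continuous_on U \<Phi>"
    and ex: "\<And>z. z \<in> U \<Longrightarrow> \<exists>c\<in>charts_at Y (\<Phi> z). \<exists>d. ((\<lambda>w. coord c (\<Phi> w)) has_field_derivative d) (at z) \<and>
        density Y c (coord c (\<Phi> z)) * cmod d = disc_density z"
  shows "local_isometry U \<Phi>"
  unfolding local_isometry_def
proof (intro conjI ballI U)
  fix z d assume z: "z \<in> U" and d: "d \<in> charts_at Y (\<Phi> z)"
  obtain c k where c: "c \<in> charts_at Y (\<Phi> z)" and k: "((\<lambda>w. coord c (\<Phi> w)) has_field_derivative k) (at z)"
      "density Y c (coord c (\<Phi> z)) * cmod k = disc_density z" using ex[OF z] by blast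
  obtain e where e: "e > 0" "ball z e \<subseteq> U" "\<Phi> ` ball z e \<subseteq> chart_dom c"
    using chart_nbhd[OF U(1,3) z c] by blast
  note t = transition_deriv[OF c d]
  have "((\<lambda>w. transition c d (coord c (\<Phi> w))) has_field_derivative deriv (transition c d) (coord c (\<Phi> z)) * k) (at z)"
    by (rule DERIV_chain2[OF t(1) k(1)])
  then have "((\<lambda>w. coord d (\<Phi> w)) has_field_derivative deriv (transition c d) (coord c (\<Phi> z)) * k) (at z)"
    by (rule has_field_derivative_transform_within_open[OF _ open_ball, of _ _ _ z e])
      (use e param_coord charts_atD(1)[OF c] in \<open>auto simp: transition_def image_subset_iff\<close>)
  then show "\<exists>k. ((\<lambda>w. coord d (\<Phi> w)) has_field_derivative k) (at z) \<and> density Y d (coord d (\<Phi> z)) * cmod k = disc_density z"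
    using k(2) t(2) by (intro exI conjI) (auto simp: norm_mult mult.assoc)
qed

text \<open>Continuity, derivative and density at a point depend only on the germ of the map there;
  this is the gluing principle of the continuation argument.\<close>

lemma local_isometry_local:
  assumes "\<And>z. z \<in> U \<Longrightarrow> \<exists>V \<Psi>. z \<in> V \<and> V \<subseteq> U \<and> local_isometry V \<Psi> \<and> (\<forall>w\<in>V. \<Phi> w = \<Psi> w)"
  shows "local_isometry U \<Phi>"
proof -
  have op: "open U"
  proof (subst open_subopen, intro ballI)
    fix z assume "z \<in> U"
    from assms[OF this] local_isometryD(1) show "\<exists>T. open T \<and> z \<in> T \<and> T \<subseteq> U" by blast
  qed
  have c: "\<exists>V. open V \<and> z \<in> V \<and> continuous_on V \<Phi>" if "z \<in> U" for z
    using assms[OF that] local_isometryD(1,3) continuous_on_cong by metis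
  have "continuous_on U \<Phi>"
    using c continuous_on_eq_continuous_at op by (metis continuous_at_imp_continuous_on)
  moreover have "U \<subseteq> ball 0 1" using assms local_isometryD(2) by blast
  moreover have "\<exists>d. ((\<lambda>w. coord c (\<Phi> w)) has_field_derivative d) (at z) \<and>
        density Y c (coord c (\<Phi> z)) * cmod d = disc_density z" if z: "z \<in> U" and ch: "c \<in> charts_at Y (\<Phi> z)" for z c
  proof -
    obtain V \<Psi> where V: "z \<in> V" "V \<subseteq> U" "local_isometry V \<Psi>" "\<And>w. w \<in> V \<Longrightarrow> \<Phi> w = \<Psi> w" using assms[OF z] by blast
    obtain d where d: "((\<lambda>w. coord c (\<Psi> w)) has_field_derivative d) (at z)" "density Y c (coord c (\<Psi> z)) * cmod d = disc_density z"
      using local_isometryD(4)[OF V(3,1), of c] ch V(1,4) by auto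
    have "((\<lambda>w. coord c (\<Phi> w)) has_field_derivative d) (at z)"
      by (rule has_field_derivative_transform_within_open[OF d(1) local_isometryD(1)[OF V(3)] V(1)]) (simp add: V(4))
    with d(2) V show ?thesis by auto
  qed
  ultimately show ?thesis using op by (auto simp: local_isometry_def)
qed

lemma local_isometry_subset: "local_isometry U \<Phi> \<Longrightarrow> open V \<Longrightarrow> V \<subseteq> U \<Longrightarrow> local_isometry V \<Phi>"
  unfolding local_isometry_def by (meson continuous_on_subset subset_iff)

lemma local_isometry_compose:
  assumes V: "local_isometry V \<Phi>" and U: "open U" "U \<subseteq> ball 0 1" "h ` U \<subseteq> V"
    and h: "\<And>z. z \<in> U \<Longrightarrow> (h has_field_derivative h' z) (at z)"
      "\<And>z. z \<in> U \<Longrightarrow> disc_density (h z) * cmod (h' z) = disc_density z"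
  shows "local_isometry U (\<lambda>z. \<Phi> (h z))"
proof (rule local_isometryI[OF U(1,2)])
  have "continuous_on U h" using h(1) by (meson DERIV_isCont continuous_at_imp_continuous_on)
  then show "continuous_on U (\<lambda>z. \<Phi> (h z))" using continuous_on_compose2[OF local_isometryD(3)[OF V] _ U(3)] by blast
  fix z assume z: "z \<in> U"
  then have hz: "h z \<in> V" using U by auto
  obtain c where c: "c \<in> charts_at Y (\<Phi> (h z))" using charts_at_nonempty by blast
  obtain d where d: "((\<lambda>w. coord c (\<Phi> w)) has_field_derivative d) (at (h z))"
    "density Y c (coord c (\<Phi> (h z))) * cmod d = disc_density (h z)" using local_isometryD(4)[OF V hz c] by blast
  show "\<exists>c\<in>charts_at Y (\<Phi> (h z)). \<exists>d. ((\<lambda>w. coord c (\<Phi> (h w))) has_field_derivative d) (at z) \<and>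
        density Y c (coord c (\<Phi> (h z))) * cmod d = disc_density z"
  proof (intro bexI[OF _ c] exI conjI)
    show "((\<lambda>w. coord c (\<Phi> (h w))) has_field_derivative d * h' z) (at z)"
      by (rule DERIV_chain2[OF d(1) h(1)[OF z]])
    show "density Y c (coord c (\<Phi> (h z))) * cmod (d * h' z) = disc_density z"
      using d(2) h(2)[OF z] by (simp add: norm_mult mult.assoc[symmetric])
  qed
qed

lemma local_isometry_Moebius:
  assumes "local_isometry V \<Phi>" "cmod a < 1" "open U" "U \<subseteq> ball 0 1" "Moebius_function t a ` U \<subseteq> V"
  shows "local_isometry U (\<lambda>z. \<Phi> (Moebius_function t a z))"
  by (rule local_isometry_compose[OF assms(1,3,4,5) Moebius_deriv[OF assms(2)] Moebius_isometry[OF assms(2)]])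
    (use assms in auto)

text \<open>The inverse of Liouville's map, read in a chart. The points of \<open>V\<close> are
  reached from within radius \<open>s / 3\<close>, which leaves a margin for recentring the disc at
  them.\<close>

lemma local_isometry_local_existence:
  obtains s V \<Phi> where "s > 0" "s < 1" "open V" "p \<in> V" "local_isometry (ball 0 s) \<Phi>"
    "\<And>q. q \<in> V \<Longrightarrow> \<exists>a. cmod a < s / 3 \<and> \<Phi> a = q"
proof -
  obtain c where c: "c \<in> charts_at Y p" using charts_at_nonempty by blast
  note ca = charts_atD[OF c]
  interpret hyperbolic_density "chart_im c" "density Y c" using hyperbolic_density ca by simp
  define zp where "zp = coord c p"
  have zp: "zp \<in> chart_im c" using ca by (simp add: zp_def)
  obtain e f where e: "e > 0" "ball zp e \<subseteq> chart_im c" and f: "f holomorphic_on ball zp e" "f zp = 0"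
    "\<And>z. z \<in> ball zp e \<Longrightarrow> cmod (f z) < 1"
    "\<And>z. z \<in> ball zp e \<Longrightarrow> density Y c z = 2 * cmod (deriv f z) / (1 - (cmod (f z))\<^sup>2)"
    using liouville[OF zp] by metis
  have dnz: "deriv f z \<noteq> 0" if "z \<in> ball zp e" for z
    using f(4)[OF that] pos[of z] e that by auto
  obtain r where r: "r > 0" "ball zp r \<subseteq> ball zp e" "open (f ` ball zp r)" "inj_on f (ball zp r)"
    using has_complex_derivative_locally_invertible[OF f(1) _ open_ball dnz, of zp] e by auto
  have fr: "f holomorphic_on ball zp r" using f(1) r(2) by (rule holomorphic_on_subset)
  obtain g where g: "g holomorphic_on f ` ball zp r" "\<And>z. z \<in> ball zp r \<Longrightarrow> deriv f z * deriv g (f z) = 1"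
    "\<And>z. z \<in> ball zp r \<Longrightarrow> g (f z) = z"
    using holomorphic_has_inverse[OF fr open_ball r(4)] by metis
  have "0 \<in> f ` ball zp r" using f(2) r(1) by (metis centre_in_ball imageI)
  then obtain s0 where s0: "s0 > 0" "ball 0 s0 \<subseteq> f ` ball zp r" using r(3) openE by blast
  define s where "s = min s0 (1/2)"
  have s: "s > 0" "s < 1" "ball 0 s \<subseteq> f ` ball zp r" using s0 by (auto simp: s_def)
  define \<Phi> where "\<Phi> z = param c (g z)" for z
  have g_in: "g z \<in> ball zp r" "f (g z) = z" if "z \<in> ball 0 s" for z
    using that s(3) g(3) by auto
  have gim: "g z \<in> chart_im c" if "z \<in> ball 0 s" for z using g_in[OF that] r(2) e(2) by blast
  have cg: "continuous_on (ball 0 s) g" using g(1) s(3) holomorphic_on_imp_continuous_on continuous_on_subset by blast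
  have co\<Phi>: "coord c (\<Phi> z) = g z" "\<Phi> z \<in> chart_dom c" if "z \<in> ball 0 s" for z
    unfolding \<Phi>_def using gim[OF that] coord_param[OF ca(1)] param_in_dom[OF ca(1)] by auto
  have iso: "local_isometry (ball 0 s) \<Phi>"
  proof (rule local_isometryI)
    show "continuous_on (ball 0 s) \<Phi>" unfolding \<Phi>_def
      by (rule continuous_on_compose2[OF continuous_param[OF ca(1)] cg]) (use gim in auto)
    fix z :: complex assume z: "z \<in> ball 0 s"
    have "(g has_field_derivative deriv g z) (at z)"
      by (rule holomorphic_derivI[OF g(1) r(3)]) (use s(3) z in auto)
    then have d: "((\<lambda>w. coord c (\<Phi> w)) has_field_derivative deriv g z) (at z)"
      by (rule has_field_derivative_transform_within_open[OF _ open_ball z]) (simp add: co\<Phi>)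
    have ge: "g z \<in> ball zp e" using g_in[OF z] r(2) by blast
    have "deriv f (g z) * deriv g z = 1" using g(2)[OF g_in(1)[OF z]] g_in(2)[OF z] by simp
    then have "cmod (deriv f (g z)) * cmod (deriv g z) = 1" by (metis norm_mult norm_one)
    then have "density Y c (coord c (\<Phi> z)) * cmod (deriv g z) = disc_density z"
      using f(4)[OF ge] g_in(2)[OF z] by (simp add: co\<Phi>[OF z] disc_density_def)
    then show "\<exists>c\<in>charts_at Y (\<Phi> z). \<exists>d. ((\<lambda>w. coord c (\<Phi> w)) has_field_derivative d) (at z) \<and>
        density Y c (coord c (\<Phi> z)) * cmod d = disc_density z"
      using d charts_atI[OF ca(1) co\<Phi>(2)[OF z]] by blast
  qed (use s in auto)
  define N where "N = ball zp r \<inter> f -` ball 0 (s/3)"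
  have "open N" unfolding N_def
    by (rule continuous_open_preimage[OF holomorphic_on_imp_continuous_on[OF fr] open_ball open_ball])
  then have V: "open (chart_dom c \<inter> coord c -` N)"
    by (rule continuous_open_preimage[OF continuous_coord[OF ca(1)] open_dom[OF ca(1)]])
  show ?thesis
  proof (rule that[OF s(1,2) V _ iso])
    show "p \<in> chart_dom c \<inter> coord c -` N" using ca r(1) s(1) f(2) by (auto simp: N_def zp_def[symmetric])
    fix q assume q: "q \<in> chart_dom c \<inter> coord c -` N"
    then have "coord c q \<in> ball zp r" "cmod (f (coord c q)) < s/3" by (auto simp: N_def)
    moreover have "\<Phi> (f (coord c q)) = q"
      using q g(3)[OF calculation(1)] param_coord[OF ca(1)] by (simp add: \<Phi>_def)
    ultimately show "\<exists>a. cmod a < s / 3 \<and> \<Phi> a = q" by blast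
  qed
qed

text \<open>A disc automorphism taking 0 to \<open>a\<close> recentres the isometry at any point of
  \<open>V\<close>, with one radius for all of \<open>V\<close>; a finite subcover gives one radius
  for all of \<open>Y\<close>. This uniform radius takes the place of completeness.\<close>

lemma local_isometry_uniform_existence:
  obtains s where "s > 0" "s < 1" "\<And>q. \<exists>\<Phi>. local_isometry (ball 0 s) \<Phi> \<and> \<Phi> 0 = q"
proof -
  define good where "good s q \<longleftrightarrow> (\<exists>\<Phi>. local_isometry (ball 0 s) \<Phi> \<and> \<Phi> 0 = q)" for s q
  have "\<exists>V s. open V \<and> p \<in> V \<and> 0 < s \<and> s < 1 \<and> (\<forall>q\<in>V. good s q)" for p
  proof -
    obtain s V \<Phi> where s: "s > 0" "s < 1" "open V" "p \<in> V" "local_isometry (ball 0 s) \<Phi>"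
      "\<And>q. q \<in> V \<Longrightarrow> \<exists>a. cmod a < s / 3 \<and> \<Phi> a = q" using local_isometry_local_existence by blast
    have "good (s/3) q" if q: "q \<in> V" for q
    proof -
      obtain a where a: "cmod a < s/3" "\<Phi> a = q" using s(6)[OF q] by blast
      have a1: "cmod (-a) < 1" using a s by simp
      have sub: "Moebius_function 0 (-a) ` ball 0 (s/3) \<subseteq> ball 0 s"
      proof (intro subsetI, elim imageE)
        fix w z assume z: "z \<in> ball 0 (s/3)" and w: "w = Moebius_function 0 (-a) z"
        have "cmod w \<le> cmod (z + a) / (1 - cmod a * cmod z)"
          unfolding w using Moebius_norm_le[OF a1, of z 0] z s by simp
        also have "\<dots> < s"
        \<comment> \<open>The numerator is at most \<open>2 s / 3\<close>, the denominator at least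
          8/9.\<close>
        proof -
          have 1: "cmod a * cmod z \<le> (1/3) * (1/3)" using a z s by (intro mult_mono) auto
          have "cmod (z + a) \<le> 2 / 3 * s" using norm_triangle_ineq[of z a] z a by simp
          also have "\<dots> < (1 - cmod a * cmod z) * s" using 1 s by (intro mult_strict_right_mono) auto
          finally show ?thesis using 1 by (simp add: pos_divide_less_eq mult.commute)
        qed
        finally show "w \<in> ball 0 s" by simp
      qed
      have "local_isometry (ball 0 (s/3)) (\<lambda>z. \<Phi> (Moebius_function 0 (-a) z))"
        by (rule local_isometry_Moebius[OF s(5) a1 _ _ sub]) (use s in auto)
      then show ?thesis unfolding good_def using a(2) Moebius_function_of_zero[of 0 "-a"]
        by (intro exI[of _ "\<lambda>z. \<Phi> (Moebius_function 0 (-a) z)"] conjI) simp_all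
    qed
    then show ?thesis using s by (intro exI[of _ V] exI[of _ "s/3"]) auto
  qed
  then obtain V s where V: "\<And>p. open (V p)" "\<And>p. p \<in> V p" "\<And>p. 0 < s p" "\<And>p. s p < (1::real)" "\<And>p q. q \<in> V p \<Longrightarrow> good (s p) q"
    by metis
  have "UNIV \<subseteq> \<Union>(range V)" using V(2) by blast
  then obtain P where P: "finite P" "UNIV \<subseteq> (\<Union>p\<in>P. V p)"
    using compactE_image[OF compact, of UNIV V] V(1) by metis
  define m where "m = Min (s ` P)"
  have ne: "P \<noteq> {}" using P(2) by auto
  have m: "m > 0" "\<And>p. p \<in> P \<Longrightarrow> m \<le> s p" unfolding m_def using P ne V by auto
  have m1: "m < 1" using ne m(2) V(4) by (meson all_not_in_conv le_less_trans)
  show ?thesis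
  proof (rule that[OF m(1) m1])
    fix q
    obtain p where p: "p \<in> P" "q \<in> V p" using P(2) by blast
    then obtain \<Phi> where "local_isometry (ball 0 (s p)) \<Phi>" "\<Phi> 0 = q" using V(5) unfolding good_def by blast
    then show "\<exists>\<Phi>. local_isometry (ball 0 m) \<Phi> \<and> \<Phi> 0 = q" using local_isometry_subset m(2)[OF p(1)] by (metis open_ball subset_ball)
  qed
qed

lemma local_isometry_holomorphic:
  assumes "local_isometry U \<Phi>" "V \<subseteq> U" "\<Phi> ` V \<subseteq> chart_dom c" "c \<in> atlas Y"
  shows "(\<lambda>w. coord c (\<Phi> w)) holomorphic_on V"
proof -
  have "\<exists>d. ((\<lambda>w. coord c (\<Phi> w)) has_field_derivative d) (at z)" if "z \<in> V" for z
    using local_isometryD(4)[OF assms(1), of z c] charts_atI[OF assms(4)] assms that by blast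
  then show ?thesis by (meson holomorphic_on_def field_differentiable_def field_differentiable_at_within)
qed

section \<open>Rigidity of local isometries\<close>

text \<open>Connectedness is applied to agreement near a point. Where the two values differ,
  Hausdorff neighbourhoods exclude agreement nearby; where they coincide, a common chart reduces the
  question to the identity theorem for holomorphic functions.\<close>

lemma local_isometry_identity:
  assumes U: "connected U" "local_isometry U \<Phi>1" "local_isometry U \<Phi>2"
    and N: "open N" "a \<in> N" "N \<subseteq> U" "\<And>w. w \<in> N \<Longrightarrow> \<Phi>1 w = \<Phi>2 w"
    and b: "b \<in> U"
  shows "\<Phi>1 b = \<Phi>2 b"
proof -
  have oU: "open U" using local_isometryD(1)[OF U(2)] .
  define P where "P z \<longleftrightarrow> (\<exists>N. open N \<and> z \<in> N \<and> N \<subseteq> U \<and> (\<forall>w\<in>N. \<Phi>1 w = \<Phi>2 w))" for z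
  have "P b"
  proof (rule connected_induction_simple[OF U(1) _ b])
    show "a \<in> U" "P a" unfolding P_def using N by auto
    fix z assume z: "z \<in> U"
    show "\<exists>T. openin (top_of_set U) T \<and> z \<in> T \<and> (\<forall>x\<in>T. \<forall>y\<in>T. P x \<longrightarrow> P y)"
    proof (cases "\<Phi>1 z = \<Phi>2 z")
      case False
      then obtain A B where AB: "open A" "open B" "\<Phi>1 z \<in> A" "\<Phi>2 z \<in> B" "A \<inter> B = {}" using hausdorff[OF False] by blast
      define T where "T = (U \<inter> \<Phi>1 -` A) \<inter> (U \<inter> \<Phi>2 -` B)"
      have "open T" unfolding T_def
        using continuous_open_preimage[OF local_isometryD(3)[OF U(2)] oU AB(1)] continuous_open_preimage[OF local_isometryD(3)[OF U(3)] oU AB(2)] by blast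
      moreover have "\<not> P x" if "x \<in> T" for x using that AB(5) by (auto simp: P_def T_def)
      moreover have zT: "z \<in> T" "T \<subseteq> U" using z AB by (auto simp: T_def)
      ultimately have "openin (top_of_set U) T" by (simp add: openin_open_eq[OF oU])
      then show ?thesis using zT(1) \<open>\<And>x. x \<in> T \<Longrightarrow> \<not> P x\<close> by blast
    next
      case True
      obtain c where c: "c \<in> charts_at Y (\<Phi>1 z)" using charts_at_nonempty by blast
      note ca = charts_atD[OF c]
      obtain e1 where e1: "e1 > 0" "ball z e1 \<subseteq> U" "\<Phi>1 ` ball z e1 \<subseteq> chart_dom c"
        using chart_nbhd[OF oU local_isometryD(3)[OF U(2)] z c] by blast
      obtain e2 where e2: "e2 > 0" "ball z e2 \<subseteq> U" "\<Phi>2 ` ball z e2 \<subseteq> chart_dom c"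
        using chart_nbhd[OF oU local_isometryD(3)[OF U(3)] z, of c] c True by auto
      define T where "T = ball z (min e1 e2)"
      have T: "open T" "z \<in> T" "T \<subseteq> U" "connected T" "\<Phi>1 ` T \<subseteq> chart_dom c" "\<Phi>2 ` T \<subseteq> chart_dom c"
        using e1 e2 by (auto simp: T_def)
      have hol: "(\<lambda>w. coord c (\<Phi>1 w)) holomorphic_on T" "(\<lambda>w. coord c (\<Phi>2 w)) holomorphic_on T"
        using local_isometry_holomorphic[OF U(2) T(3,5) ca(1)] local_isometry_holomorphic[OF U(3) T(3,6) ca(1)] by auto
      have "P y" if x: "x \<in> T" "P x" and y: "y \<in> T" for x y
      proof -
        obtain N where N: "open N" "x \<in> N" "N \<subseteq> U" "\<And>w. w \<in> N \<Longrightarrow> \<Phi>1 w = \<Phi>2 w" using x unfolding P_def by blast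
        have "coord c (\<Phi>1 w) = coord c (\<Phi>2 w)" if w: "w \<in> T" for w
          by (rule analytic_continuation_open[of "N \<inter> T" T, OF _ T(1) _ T(4) _ hol _ w]) (use N T x in auto)
        then have "\<Phi>1 w = \<Phi>2 w" if w: "w \<in> T" for w using coord_inj[OF ca(1)] T w by blast
        then show "P y" unfolding P_def using T y by blast
      qed
      moreover have "openin (top_of_set U) T" using T(1,3) by (simp add: openin_open_eq[OF oU])
      ultimately show ?thesis using T(2) by blast
    qed
  qed
  then show ?thesis by (auto simp: P_def)
qed


text \<open>The isometry condition says that the squared density at \<open>h\<close>, times |h'|^2
  (1 - |z|^2)^2, is constant. Applying \<open>dz\<close> treats \<open>cnj (deriv h)\<close> as a
  constant and leaves a second-order equation containing the connections of the disc and of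
  \<open>Y\<close>.\<close>

lemma local_isometry_second_order:
  assumes U: "local_isometry U \<Phi>" and V: "open V" "V \<subseteq> U" "\<Phi> ` V \<subseteq> chart_dom c" and c: "c \<in> atlas Y" and z: "z \<in> V"
  defines "h \<equiv> (\<lambda>w. coord c (\<Phi> w))"
  shows "(h has_field_derivative deriv h z) (at z)"
    "(deriv h has_field_derivative (2 * cnj z / (1 - z * cnj z)) * deriv h z - 2 * log_density_dz (density Y c) (h z) * (deriv h z)\<^sup>2) (at z)"
    "density Y c (h z) * cmod (deriv h z) = disc_density z"
proof -
  interpret hyperbolic_density "chart_im c" "density Y c" by (rule hyperbolic_density[OF c])
  have hol: "h holomorphic_on V" unfolding h_def by (rule local_isometry_holomorphic[OF U V(2,3) c])
  have dh: "(h has_field_derivative deriv h w) (at w)" if "w \<in> V" for w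
    using holomorphic_derivI[OF hol V(1) that] .
  have dh': "(deriv h has_field_derivative deriv (deriv h) w) (at w)" if "w \<in> V" for w
    using holomorphic_derivI[OF holomorphic_deriv[OF hol V(1)] V(1) that] .
  have iso: "density Y c (h w) * cmod (deriv h w) = disc_density w" if w: "w \<in> V" for w
  proof -
    obtain d where d: "(h has_field_derivative d) (at w)" "density Y c (h w) * cmod d = disc_density w"
      using local_isometryD(4)[OF U, of w c] V c w charts_atI[OF c] unfolding h_def by blast
    then show ?thesis using DERIV_imp_deriv[OF d(1)] by simp
  qed
  have him: "h w \<in> chart_im c" if "w \<in> V" for w using that V unfolding h_def by blast
  have disc: "cmod w < 1" if "w \<in> V" for w using that V local_isometryD(2)[OF U] by auto
  define D where "D w = 1 - w * cnj w" for w
  have Dr: "D w = of_real (1 - (cmod w)\<^sup>2)" for w unfolding D_def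
    by (simp add: complex_norm_square del: of_real_power)
  have Dn: "D w \<noteq> 0" if "w \<in> V" for w
  proof -
    have "(cmod w)\<^sup>2 < 1" using disc[OF that] by (simp add: abs_square_less_1)
    then show ?thesis unfolding Dr of_real_eq_0_iff by simp
  qed
  have rn: "r (h w) \<noteq> 0" if "w \<in> V" for w using pos[OF him[OF that]] by simp
  have hn: "deriv h w \<noteq> 0" if "w \<in> V" for w
    using iso[OF that] disc_density_pos[OF disc[OF that]] by auto
  \<comment> \<open>Written as a product of complex factors instead of a squared norm, so that the
    Wirtinger product rule applies factor by factor.\<close>
  define X where "X w = (r (h w) * r (h w)) * ((deriv h w * cnj (deriv h w)) * (D w * D w))" for w
  have X4: "X w = 4" if w: "w \<in> V" for w
  proof -
    have hh: "deriv h w * cnj (deriv h w) = of_real ((cmod (deriv h w))\<^sup>2)" by (rule complex_norm_square[symmetric])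
    have "X w = of_real ((density Y c (h w) * density Y c (h w)) * ((cmod (deriv h w))\<^sup>2 * ((1 - (cmod w)\<^sup>2) * (1 - (cmod w)\<^sup>2))))"
      by (simp only: X_def Dr hh of_real_mult)
    also have "\<dots> = of_real ((density Y c (h w) * cmod (deriv h w) * (1 - (cmod w)\<^sup>2))\<^sup>2)"
      by (simp only: power2_eq_square mult_ac)
    also have "density Y c (h w) * cmod (deriv h w) * (1 - (cmod w)\<^sup>2) = 2"
    proof -
      have "2 / t * t = 2" if "t \<noteq> 0" for t :: real using that by simp
      then show ?thesis using Dn[OF w] unfolding iso[OF w] disc_density_def Dr of_real_eq_0_iff by blast
    qed
    finally show ?thesis by simp
  qed
  have wD: "has_wirtinger D (0 - (1 * cnj z + z * 0)) (0 - (0 * cnj z + z * 1)) z"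
    unfolding D_def[abs_def]
    using has_wirtinger_diff[OF has_wirtinger_const[of 1] has_wirtinger_mult[OF has_wirtinger_field[OF DERIV_ident] has_wirtinger_cnj[OF has_wirtinger_field[OF DERIV_ident]]]]
    by simp
  note wr = has_wirtinger_compose_field[OF dh[OF z] wirt_r[OF him[OF z]]]
  note wh = has_wirtinger_field[OF dh'[OF z]]
  have "dz X z = dz (\<lambda>_. 4) z" by (rule dz_cong_open(1)[OF V(1) z X4])
  also have "\<dots> = 0" by (rule has_wirtinger_unique(1)[OF has_wirtinger_const])
  finally have "dz X z = 0" .
  moreover have "dz X z = (r (h z) * r (h z) * cnj (deriv h z) * D z) *
      (2 * W (h z) * (deriv h z)\<^sup>2 * D z + deriv (deriv h) z * D z - 2 * deriv h z * cnj z)"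
    unfolding X_def[abs_def]
    by (subst has_wirtinger_unique(1)[OF has_wirtinger_mult[OF has_wirtinger_mult[OF wr wr]
        has_wirtinger_mult[OF has_wirtinger_mult[OF wh has_wirtinger_cnj[OF wh]] has_wirtinger_mult[OF wD wD]]]])
      (simp add: algebra_simps power2_eq_square)
  ultimately have "2 * W (h z) * (deriv h z)\<^sup>2 * D z + deriv (deriv h) z * D z - 2 * deriv h z * cnj z = 0"
    using rn[OF z] hn[OF z] Dn[OF z] by simp
  then have "deriv (deriv h) z = (2 * cnj z / D z) * deriv h z - 2 * W (h z) * (deriv h z)\<^sup>2"
    using Dn[OF z] by (simp add: field_simps)
  then show "(deriv h has_field_derivative (2 * cnj z / (1 - z * cnj z)) * deriv h z - 2 * W (h z) * (deriv h z)\<^sup>2) (at z)"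
    using dh'[OF z] by (simp add: D_def)
  show "(h has_field_derivative deriv h z) (at z)" by (rule dh[OF z])
  show "density Y c (h z) * cmod (deriv h z) = disc_density z" by (rule iso[OF z])
qed

text \<open>On each segment issuing from \<open>a\<close>, the coordinate expression and its
  derivative solve the equation of \<open>local_isometry_second_order\<close>, so a common value and
  derivative at \<open>a\<close> determine the map nearby.\<close>

lemma local_isometry_jet_unique:
  assumes U: "local_isometry U \<Phi>1" "local_isometry U \<Phi>2" and a: "a \<in> U" "\<Phi>1 a = \<Phi>2 a" and c: "c \<in> charts_at Y (\<Phi>1 a)"
    and d: "((\<lambda>w. coord c (\<Phi>1 w)) has_field_derivative d) (at a)" "((\<lambda>w. coord c (\<Phi>2 w)) has_field_derivative d) (at a)"
  obtains e where "e > 0" "ball a e \<subseteq> U" "\<And>w. w \<in> ball a e \<Longrightarrow> \<Phi>1 w = \<Phi>2 w"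
proof -
  note ca = charts_atD[OF c]
  interpret hyperbolic_density "chart_im c" "density Y c" by (rule hyperbolic_density[OF ca(1)])
  define p where "p = coord c (\<Phi>1 a)"
  have p: "p \<in> chart_im c" using ca by (simp add: p_def)
  obtain e L N where e: "e > 0" "ball p e \<subseteq> chart_im c"
    and WL: "\<And>x y. x \<in> ball p e \<Longrightarrow> y \<in> ball p e \<Longrightarrow> cmod (W x - W y) \<le> L * cmod (x - y)"
    and WN: "\<And>x. x \<in> ball p e \<Longrightarrow> cmod (W x) \<le> N" using W_lipschitz[OF p] by blast
  define h1 where "h1 w = coord c (\<Phi>1 w)" for w
  define h2 where "h2 w = coord c (\<Phi>2 w)" for w
  obtain e1 where e1: "e1 > 0" "ball a e1 \<subseteq> U" "\<Phi>1 ` ball a e1 \<subseteq> chart_dom c"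
    using chart_nbhd[OF local_isometryD(1,3)[OF U(1)] a(1) c] by blast
  obtain e2 where e2: "e2 > 0" "ball a e2 \<subseteq> U" "\<Phi>2 ` ball a e2 \<subseteq> chart_dom c"
    using chart_nbhd[OF local_isometryD(1,3)[OF U(2)] a(1)] c a(2) by metis
  define T0 where "T0 = ball a (min e1 e2)"
  have T0: "open T0" "T0 \<subseteq> U" "\<Phi>1 ` T0 \<subseteq> chart_dom c" "\<Phi>2 ` T0 \<subseteq> chart_dom c" "a \<in> T0"
    using e1 e2 by (auto simp: T0_def)
  note s1 = local_isometry_second_order[OF U(1) T0(1,2,3) ca(1), folded h1_def]
  note s2 = local_isometry_second_order[OF U(2) T0(1,2,4) ca(1), folded h2_def]
  have "continuous_on T0 h1" "continuous_on T0 h2"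
    using s1(1) s2(1) by (meson DERIV_isCont continuous_at_imp_continuous_on)+
  then have "open ((T0 \<inter> h1 -` ball p e) \<inter> (T0 \<inter> h2 -` ball p e))"
    using T0(1) by (intro open_Int continuous_open_preimage) auto
  moreover have "a \<in> (T0 \<inter> h1 -` ball p e) \<inter> (T0 \<inter> h2 -` ball p e)"
    using T0(5) e(1) a(2) by (auto simp: h1_def h2_def p_def)
  ultimately obtain \<epsilon> where \<epsilon>: "\<epsilon> > 0" "ball a \<epsilon> \<subseteq> (T0 \<inter> h1 -` ball p e) \<inter> (T0 \<inter> h2 -` ball p e)"
    by (rule openE)
  have "h1 w = h2 w" if w: "w \<in> ball a \<epsilon>" for w
  proof -
    define \<zeta> where "\<zeta> = w - a"
    define l where "l t = a + of_real t * \<zeta>" for t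
    have lb: "l t \<in> ball a \<epsilon>" if "t \<in> {0..1}" for t
    proof -
      have "dist a (l t) = \<bar>t\<bar> * cmod \<zeta>" by (simp add: l_def dist_norm norm_mult)
      also have "\<dots> \<le> 1 * cmod \<zeta>" using that by (intro mult_right_mono) auto
      also have "\<dots> < \<epsilon>" using w by (simp add: \<zeta>_def dist_norm norm_minus_commute)
      finally show ?thesis by simp
    qed
    have lT: "l t \<in> T0" "h1 (l t) \<in> ball p e" "h2 (l t) \<in> ball p e" if "t \<in> {0..1}" for t
      using lb[OF that] \<epsilon>(2) by auto
    have dl: "(l has_vector_derivative \<zeta>) (at t)" for t
      unfolding l_def[abs_def] by (auto intro!: derivative_eq_intros simp: has_vector_derivative_def scaleR_conv_of_real)
    have cmp: "((\<lambda>t. f (l t)) has_vector_derivative \<zeta> * k) (at t)" if "(f has_field_derivative k) (at (l t))" for f k t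
      using field_vector_diff_chain_at[OF dl that] by (simp add: o_def)
    have "h1 (l 1) = h2 (l 1)"
    proof (rule second_order_ode_unique[where a = 0 and b = 1 and k = \<zeta> and s = 0 and t = 1 and W = W and K = "ball p e" and L = L and N = N
          and \<alpha> = "\<lambda>t. 2 * cnj (l t) / (1 - l t * cnj (l t))" and ?v1.0 = "\<lambda>t. deriv h1 (l t)" and ?v2.0 = "\<lambda>t. deriv h2 (l t)"])
      show "((\<lambda>t. h1 (l t)) has_vector_derivative \<zeta> * deriv h1 (l t)) (at t)" if "t \<in> {0..1}" for t
        by (rule cmp[OF s1(1)[OF lT(1)[OF that]]])
      show "((\<lambda>t. h2 (l t)) has_vector_derivative \<zeta> * deriv h2 (l t)) (at t)" if "t \<in> {0..1}" for t
        by (rule cmp[OF s2(1)[OF lT(1)[OF that]]])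
      show "((\<lambda>t. deriv h1 (l t)) has_vector_derivative \<zeta> * (2 * cnj (l t) / (1 - l t * cnj (l t)) * deriv h1 (l t) - 2 * W (h1 (l t)) * (deriv h1 (l t))\<^sup>2)) (at t)"
        if "t \<in> {0..1}" for t by (rule cmp[OF s1(2)[OF lT(1)[OF that]]])
      show "((\<lambda>t. deriv h2 (l t)) has_vector_derivative \<zeta> * (2 * cnj (l t) / (1 - l t * cnj (l t)) * deriv h2 (l t) - 2 * W (h2 (l t)) * (deriv h2 (l t))\<^sup>2)) (at t)"
        if "t \<in> {0..1}" for t by (rule cmp[OF s2(2)[OF lT(1)[OF that]]])
      have ln: "1 - l t * cnj (l t) \<noteq> 0" if "t \<in> {0..1}" for t
      proof -
        have "cmod (l t) < 1" using lT(1)[OF that] T0(2) local_isometryD(2)[OF U(1)] by auto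
        from one_minus_cnj_mult_nonzero[OF this this] show ?thesis by (simp add: mult.commute)
      qed
      show "continuous_on {0..1} (\<lambda>t. 2 * cnj (l t) / (1 - l t * cnj (l t)))"
        using ln unfolding l_def by (intro continuous_intros) auto
      show "h1 (l 0) = h2 (l 0)" using a(2) by (simp add: l_def h1_def h2_def)
      show "deriv h1 (l 0) = deriv h2 (l 0)"
        using DERIV_imp_deriv[OF d(1)] DERIV_imp_deriv[OF d(2)] by (simp add: l_def h1_def[abs_def] h2_def[abs_def])
    qed (use lT WL WN in auto)
    then show ?thesis by (simp add: l_def \<zeta>_def)
  qed
  moreover have "w \<in> T0" if "w \<in> ball a \<epsilon>" for w using that \<epsilon>(2) by auto
  ultimately have "\<Phi>1 w = \<Phi>2 w" if "w \<in> ball a \<epsilon>" for w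
    using that T0 coord_inj[OF ca(1), of "\<Phi>1 w" "\<Phi>2 w"] by (auto simp: h1_def h2_def image_subset_iff)
  moreover have "ball a \<epsilon> \<subseteq> U" using \<epsilon>(2) T0(2) by auto
  ultimately show ?thesis using that[OF \<epsilon>(1)] by blast
qed

section \<open>Continuation to the whole disc\<close>

text \<open>An isometric disc of the uniform radius \<open>s\<close> is placed at
  \<open>\<Phi> a\<close> for a point \<open>a\<close> slightly inside the circle near
  \<open>z0\<close>, and turned until its derivative at \<open>a\<close> is that of \<Phi>. For |a|
  < R the automorphism moving \<open>a\<close> to 0 distorts by at most 1 / (1 - R), so a ball of
  diameter \<open>s * (1 - R)\<close> fits; this fixes \<delta>.\<close>

lemma local_isometry_extend_point:
  assumes s: "s > 0" "s < 1" "\<And>q. \<exists>\<Phi>. local_isometry (ball 0 s) \<Phi> \<and> \<Phi> 0 = q"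
    and R: "0 < R" "R < 1" and \<Phi>: "local_isometry (ball 0 R) \<Phi>" and z0: "cmod z0 = R"
  defines "\<delta> \<equiv> s * (1 - R) / 2"
  shows "\<exists>\<Psi>. local_isometry (ball z0 \<delta>) \<Psi> \<and> (\<forall>z\<in>ball z0 \<delta> \<inter> ball 0 R. \<Psi> z = \<Phi> z)"
proof -
  have \<delta>: "\<delta> > 0" using s R by (simp add: \<delta>_def)
  have "s * (1 - R) \<le> 1 * (1 - R)" using s R by (intro mult_right_mono) auto
  then have \<delta>R: "\<delta> \<le> (1 - R) / 2" by (simp add: \<delta>_def)
  have sub1: "ball z0 \<delta> \<subseteq> ball 0 1"
  proof
    fix z assume "z \<in> ball z0 \<delta>"
    then have "cmod (z - z0) < \<delta>" by (simp add: dist_norm norm_minus_commute)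
    then show "z \<in> ball 0 1" using norm_triangle_ineq[of "z - z0" z0] z0 \<delta>R R by simp
  qed
  \<comment> \<open>Small enough to keep \<open>a\<close> within \<delta> of \<open>z0\<close>, as
    their distance is \<open>\<eta> * R\<close>.\<close>
  define \<eta> where "\<eta> = min (1/2) (\<delta> / (2 * R))"
  have \<eta>: "\<eta> > 0" "\<eta> < 1" using \<delta> R by (auto simp: \<eta>_def)
  have "\<eta> * R \<le> \<delta> / (2 * R) * R" using R by (intro mult_right_mono) (auto simp: \<eta>_def)
  then have \<eta>R: "\<eta> * R < \<delta>" using R \<delta> by simp
  define a where "a = of_real (1 - \<eta>) * z0"
  have na: "cmod a = (1 - \<eta>) * R" using \<eta> z0 by (simp add: a_def norm_mult del: of_real_diff)
  have aR: "cmod a < R" unfolding na using \<eta> R by simp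
  have a1: "cmod a < 1" using aR R by simp
  have "z0 - a = of_real \<eta> * z0" by (simp add: a_def algebra_simps)
  then have az: "cmod (z0 - a) < \<delta>" using \<eta>R \<eta> z0 by (simp add: norm_mult)
  obtain \<Phi>q where \<Phi>q: "local_isometry (ball 0 s) \<Phi>q" "\<Phi>q 0 = \<Phi> a" using s(3) by blast
  have Ms: "Moebius_function t a ` ball z0 \<delta> \<subseteq> ball 0 s" for t
  proof (intro subsetI, elim imageE)
    fix w z assume z: "z \<in> ball z0 \<delta>" and w: "w = Moebius_function t a z"
    have z1: "cmod z < 1" using z sub1 by auto
    have "cmod (z - a) \<le> cmod (z - z0) + cmod (z0 - a)" using norm_triangle_ineq[of "z - z0" "z0 - a"] by simp
    also have "\<dots> < 2 * \<delta>" using z az by (simp add: dist_norm norm_minus_commute)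
    also have "\<dots> = s * (1 - R)" by (simp add: \<delta>_def)
    finally have 1: "cmod (z - a) < s * (1 - R)" .
    have "cmod a * cmod z \<le> R * 1" using aR z1 R by (intro mult_mono) auto
    then have 2: "1 - R \<le> 1 - cmod a * cmod z" by simp
    have "cmod w \<le> cmod (z - a) / (1 - cmod a * cmod z)" unfolding w by (rule Moebius_norm_le[OF a1 z1])
    also have "\<dots> \<le> cmod (z - a) / (1 - R)" using 2 R by (intro divide_left_mono) auto
    also have "\<dots> < s" using 1 R by (simp add: pos_divide_less_eq)
    finally show "w \<in> ball 0 s" by simp
  qed
  have iso: "local_isometry (ball z0 \<delta>) (\<lambda>z. \<Phi>q (Moebius_function t a z))" for t
    by (rule local_isometry_Moebius[OF \<Phi>q(1) a1 open_ball sub1 Ms])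
  obtain c where c: "c \<in> charts_at Y (\<Phi> a)" using charts_at_nonempty by blast
  have aB: "a \<in> ball 0 R" "a \<in> ball z0 \<delta>" using aR az by (auto simp: dist_norm)
  obtain d where d: "((\<lambda>w. coord c (\<Phi> w)) has_field_derivative d) (at a)" "density Y c (coord c (\<Phi> a)) * cmod d = disc_density a"
    using local_isometryD(4)[OF \<Phi> aB(1) c] by blast
  obtain q where q: "((\<lambda>w. coord c (\<Phi>q w)) has_field_derivative q) (at 0)" "density Y c (coord c (\<Phi> a)) * cmod q = disc_density 0"
    using local_isometryD(4)[OF \<Phi>q(1), of 0 c] c \<Phi>q(2) s by auto
  define k where "k = of_real (1 - (cmod a)\<^sup>2) / (1 - cnj a * a)\<^sup>2"
  have M0: "Moebius_function t a a = 0" for t by (rule Moebius_function_eq_zero)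
  have dM: "((\<lambda>w. coord c (\<Phi>q (Moebius_function t a w))) has_field_derivative q * (exp (\<i> * of_real t) * k)) (at a)" for t
  proof -
    have "((\<lambda>w. coord c (\<Phi>q w)) has_field_derivative q) (at (Moebius_function t a a))" using q(1) M0 by simp
    from DERIV_chain2[OF this Moebius_deriv[OF a1 a1]] show ?thesis by (simp add: k_def)
  qed
  have pd: "density Y c (coord c (\<Phi> a)) > 0" using density_pos charts_atD[OF c] by auto
  \<comment> \<open>Both derivatives at \<open>a\<close> scale the same two metrics into each other,
    so their moduli agree and a rotation by some angle \<open>t\<close> is all that is
    missing.\<close>
  have "density Y c (coord c (\<Phi> a)) * cmod (q * k) = disc_density 0 * cmod k" using q(2) by (simp add: norm_mult mult.assoc[symmetric])
  also have "\<dots> = disc_density a" using Moebius_isometry[OF a1 a1, of 0] M0 by (simp add: k_def)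
  finally have qk: "cmod (q * k) = cmod d" using d(2) pd by (metis mult_left_cancel less_irrefl)
  have dn: "d \<noteq> 0" using d(2) disc_density_pos[OF a1] by auto
  then have qkn: "q * k \<noteq> 0" using qk by auto
  define t where "t = Arg (d / (q * k))"
  have "cmod (d / (q * k)) = 1" using qk dn by (simp add: norm_divide)
  then have "d / (q * k) = exp (\<i> * of_real t)" using Arg_eq[of "d / (q * k)"] dn qkn by (simp add: t_def)
  then have dt: "q * (exp (\<i> * of_real t) * k) = d" using qkn by (simp add: field_simps)
  define \<Psi> where "\<Psi> z = \<Phi>q (Moebius_function t a z)" for z
  define B where "B = ball z0 \<delta> \<inter> ball 0 R"
  have B: "open B" "convex B" "a \<in> B" using aB by (auto simp: B_def convex_Int)
  have i1: "local_isometry B \<Psi>" unfolding \<Psi>_def[abs_def] by (rule local_isometry_subset[OF iso B(1)]) (simp add: B_def)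
  have i2: "local_isometry B \<Phi>" by (rule local_isometry_subset[OF \<Phi> B(1)]) (simp add: B_def)
  have "\<Psi> a = \<Phi> a" by (simp add: \<Psi>_def M0 \<Phi>q)
  moreover have "((\<lambda>w. coord c (\<Psi> w)) has_field_derivative d) (at a)" using dM[of t] dt by (simp add: \<Psi>_def)
  ultimately obtain e where e: "e > 0" "ball a e \<subseteq> B" "\<And>w. w \<in> ball a e \<Longrightarrow> \<Psi> w = \<Phi> w"
    using local_isometry_jet_unique[OF i1 i2 B(3), of c d] c d(1) by metis
  have "\<Psi> z = \<Phi> z" if "z \<in> B" for z
    by (rule local_isometry_identity[where a = a, OF convex_connected[OF B(2)] i1 i2 open_ball _ e(2,3) that]) (use e in auto)
  then show ?thesis using iso[of t] unfolding B_def \<Psi>_def[abs_def] by blast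
qed

text \<open>Where two extension balls overlap, the midpoint of their centres lies in both and
  strictly inside the circle. Both extensions equal \<Phi> near it, and the identity theorem on the
  convex intersection makes them agree throughout.\<close>

lemma local_isometry_extend:
  assumes s: "s > 0" "s < 1" "\<And>q. \<exists>\<Phi>. local_isometry (ball 0 s) \<Phi> \<and> \<Phi> 0 = q"
    and R: "0 < R" "R < 1" and \<Phi>: "local_isometry (ball 0 R) \<Phi>"
  shows "\<exists>\<Psi>. local_isometry (ball 0 (R + s * (1 - R) / 2)) \<Psi> \<and> (\<forall>z\<in>ball 0 R. \<Psi> z = \<Phi> z)"
proof -
  define \<delta> where "\<delta> = s * (1 - R) / 2"
  have \<delta>: "\<delta> > 0" using s R by (simp add: \<delta>_def)
  have "\<forall>z0. \<exists>\<Psi>. cmod z0 = R \<longrightarrow> local_isometry (ball z0 \<delta>) \<Psi> \<and> (\<forall>z\<in>ball z0 \<delta> \<inter> ball 0 R. \<Psi> z = \<Phi> z)"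
    using local_isometry_extend_point[OF s R \<Phi>] unfolding \<delta>_def by blast
  then obtain \<Psi> where \<Psi>: "\<And>z0. cmod z0 = R \<Longrightarrow> local_isometry (ball z0 \<delta>) (\<Psi> z0)"
    "\<And>z0 z. cmod z0 = R \<Longrightarrow> z \<in> ball z0 \<delta> \<inter> ball 0 R \<Longrightarrow> \<Psi> z0 z = \<Phi> z" by metis
  have agree: "\<Psi> z1 z = \<Psi> z2 z" if z12: "cmod z1 = R" "cmod z2 = R" and z: "z \<in> ball z1 \<delta>" "z \<in> ball z2 \<delta>" for z1 z2 z
  proof (cases "z1 = z2")
    case False
    define m where "m = (z1 + z2) / 2"
    have d12: "cmod (z1 - z2) < 2 * \<delta>" using z norm_triangle_ineq[of "z1 - z" "z - z2"] by (simp add: dist_norm norm_minus_commute)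
    \<comment> \<open>The parallelogram law puts the midpoint of two distinct points of a circle
      strictly inside it.\<close>
    have "(cmod (z1 + z2))\<^sup>2 + (cmod (z1 - z2))\<^sup>2 = 2 * (cmod z1)\<^sup>2 + 2 * (cmod z2)\<^sup>2"
      unfolding cmod_power2 by (simp add: power2_eq_square algebra_simps)
    moreover have "(cmod (z1 - z2))\<^sup>2 > 0" using False by simp
    moreover have four: "(2::real)\<^sup>2 = 4" by simp
    ultimately have "(cmod (z1 + z2))\<^sup>2 < (2 * R)\<^sup>2" unfolding z12 power_mult_distrib four by linarith
    then have "cmod (z1 + z2) < 2 * R" by (rule power2_less_imp_less) (use R in simp)
    then have m: "m \<in> ball 0 R" by (simp add: m_def norm_divide)
    have "z1 - m = (z1 - z2) / 2" "z2 - m = - ((z1 - z2) / 2)" by (simp_all add: m_def field_simps)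
    then have "cmod (z1 - m) = cmod (z1 - z2) / 2" "cmod (z2 - m) = cmod (z1 - z2) / 2"
      by (simp_all only: norm_minus_cancel norm_divide norm_numeral)
    then have mb: "m \<in> ball z1 \<delta>" "m \<in> ball z2 \<delta>" using d12 by (auto simp: dist_norm)
    define B where "B = ball z1 \<delta> \<inter> ball z2 \<delta>"
    have B: "open B" "convex B" by (auto simp: B_def convex_Int)
    have i: "local_isometry B (\<Psi> z1)" "local_isometry B (\<Psi> z2)"
      using local_isometry_subset[OF \<Psi>(1)[OF z12(1)] B(1)] local_isometry_subset[OF \<Psi>(1)[OF z12(2)] B(1)] by (auto simp: B_def)
    show ?thesis
      by (rule local_isometry_identity[OF convex_connected[OF B(2)] i, of "B \<inter> ball 0 R" m])
        (use B m mb z \<Psi>(2) z12 in \<open>auto simp: B_def\<close>)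
  qed simp
  \<comment> \<open>The radial projection selects the ball that defines the extension at a point
    outside \<open>ball 0 R\<close>; by \<open>agree\<close> any other ball containing the point
    gives the same value.\<close>
  define proj where "proj z = (of_real R / of_real (cmod z)) * z" for z :: complex
  have proj: "cmod (proj z) = R" "z \<in> ball (proj z) \<delta>" if "z \<notin> ball 0 R" "z \<in> ball 0 (R + \<delta>)" for z
  proof -
    have nz: "cmod z \<ge> R" "cmod z < R + \<delta>" "z \<noteq> 0" using that R by auto
    show "cmod (proj z) = R" using nz R by (simp add: proj_def norm_mult norm_divide)
    have "proj z - z = of_real (R / cmod z - 1) * z" by (simp add: proj_def algebra_simps)
    then have "cmod (proj z - z) = \<bar>R / cmod z - 1\<bar> * cmod z" by (simp add: norm_mult del: of_real_diff of_real_divide)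
    also have "\<dots> = \<bar>(R / cmod z - 1) * cmod z\<bar>" by (simp add: abs_mult)
    also have "(R / cmod z - 1) * cmod z = R - cmod z" using nz by (simp add: field_simps)
    finally show "z \<in> ball (proj z) \<delta>" using nz by (simp add: dist_norm)
  qed
  define \<Omega> where "\<Omega> z = (if z \<in> ball 0 R then \<Phi> z else \<Psi> (proj z) z)" for z
  have \<Omega>\<Psi>: "\<Omega> z = \<Psi> z0 z" if "cmod z0 = R" "z \<in> ball z0 \<delta>" "z \<in> ball 0 (R + \<delta>)" for z z0
    using that proj[of z] agree[of "proj z" z0 z] \<Psi>(2)[of z0 z] by (auto simp: \<Omega>_def)
  have "local_isometry (ball 0 (R + \<delta>)) \<Omega>"
  proof (rule local_isometry_local)
    fix z :: complex assume z: "z \<in> ball 0 (R + \<delta>)"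
    show "\<exists>V \<Psi>. z \<in> V \<and> V \<subseteq> ball 0 (R + \<delta>) \<and> local_isometry V \<Psi> \<and> (\<forall>w\<in>V. \<Omega> w = \<Psi> w)"
    proof (cases "z \<in> ball 0 R")
      case True
      then show ?thesis using \<Phi> \<delta> by (intro exI[of _ "ball 0 R"] exI[of _ \<Phi>]) (auto simp: \<Omega>_def)
    next
      case False
      note p = proj[OF False z]
      have "local_isometry (ball (proj z) \<delta> \<inter> ball 0 (R + \<delta>)) (\<Psi> (proj z))"
        by (rule local_isometry_subset[OF \<Psi>(1)[OF p(1)]]) auto
      then show ?thesis using p z \<Omega>\<Psi>[OF p(1)]
        by (intro exI[of _ "ball (proj z) \<delta> \<inter> ball 0 (R + \<delta>)"] exI[of _ "\<Psi> (proj z)"]) auto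
    qed
  qed
  moreover have "\<forall>z\<in>ball 0 R. \<Omega> z = \<Phi> z" by (simp add: \<Omega>_def)
  ultimately show ?thesis unfolding \<delta>_def by blast
qed

text \<open>Each extension fills the fraction \<open>s / 2\<close> of the remaining width
  \<open>1 - R\<close>, so the widths decay geometrically and the radii tend to 1.\<close>

theorem local_isometry_disc:
  obtains \<Phi> where "local_isometry (ball 0 1) \<Phi>" "\<Phi> 0 = y"
proof -
  obtain s where s: "s > 0" "s < 1" "\<And>q. \<exists>\<Phi>. local_isometry (ball 0 s) \<Phi> \<and> \<Phi> 0 = q" using local_isometry_uniform_existence by metis
  define R where "R n = 1 - (1 - s) * (1 - s / 2) ^ n" for n
  have R01: "0 < R n" "R n < 1" for n
  proof -
    have "(1 - s) * (1 - s / 2) ^ n \<le> (1 - s) * 1" using s by (intro mult_left_mono power_le_one) auto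
    then have "(1 - s) * (1 - s / 2) ^ n < 1" by (rule le_less_trans) (use s in simp)
    then show "0 < R n" by (simp only: R_def diff_gt_0_iff_gt)
    show "R n < 1" using s by (simp add: R_def)
  qed
  have RS: "R n + s * (1 - R n) / 2 = R (Suc n)" for n by (simp add: R_def algebra_simps)
  have Rinc: "R n \<le> R (Suc n)" for n using R01[of n] s by (simp flip: RS)
  have "(\<lambda>n. (1 - s / 2) ^ n) \<longlonglongrightarrow> 0" by (rule LIMSEQ_realpow_zero) (use s in auto)
  then have "R \<longlonglongrightarrow> 1 - (1 - s) * 0" unfolding R_def[abs_def]
    by (intro tendsto_diff tendsto_mult tendsto_const)
  then have Rlim: "R \<longlonglongrightarrow> 1" by simp
  have "\<exists>f. \<forall>n. (local_isometry (ball 0 (R n)) (f n) \<and> f n 0 = y) \<and> (\<forall>z\<in>ball 0 (R n). f (Suc n) z = f n z)"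
  proof (rule dependent_nat_choice)
    show "\<exists>x. local_isometry (ball 0 (R 0)) x \<and> x 0 = y" using s(3) by (simp add: R_def)
    fix f n assume f: "local_isometry (ball 0 (R n)) f \<and> f 0 = y"
    obtain g where "local_isometry (ball 0 (R (Suc n))) g" "\<forall>z\<in>ball 0 (R n). g z = f z"
      using local_isometry_extend[OF s R01[of n], of f] f unfolding RS by blast
    then show "\<exists>g. (local_isometry (ball 0 (R (Suc n))) g \<and> g 0 = y) \<and> (\<forall>z\<in>ball 0 (R n). g z = f z)"
      using f R01(1)[of n] by (intro exI[of _ g]) auto
  qed
  then obtain f where f: "\<And>n. local_isometry (ball 0 (R n)) (f n)" "\<And>n. f n 0 = y" "\<And>n z. z \<in> ball 0 (R n) \<Longrightarrow> f (Suc n) z = f n z"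
    by blast
  have mono: "f m z = f n z" if "n \<le> m" "z \<in> ball 0 (R n)" for m n z
    using that(1)
  proof (induction m rule: dec_induct)
    case (step m)
    have "R n \<le> R m" using lift_Suc_mono_le[of R, OF Rinc step(1)] .
    then show ?case using f(3)[of z m] step that(2) by simp
  qed simp
  define N where "N z = (LEAST n. z \<in> ball 0 (R n))" for z :: complex
  define \<Phi> where "\<Phi> z = f (N z) z" for z
  have \<Phi>eq: "\<Phi> z = f n z" if "z \<in> ball 0 (R n)" for z n
  proof -
    have "z \<in> ball 0 (R (N z))" "N z \<le> n" unfolding N_def using that by (auto intro: LeastI Least_le)
    then show ?thesis using mono[of "N z" n z] by (simp add: \<Phi>_def)
  qed
  have "local_isometry (ball 0 1) \<Phi>"
  proof (rule local_isometry_local)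
    fix z :: complex assume "z \<in> ball 0 1"
    then have "eventually (\<lambda>n. R n > cmod z) sequentially" using order_tendstoD(1)[OF Rlim] by simp
    then obtain n where n: "R n > cmod z" by (auto simp: eventually_sequentially)
    show "\<exists>V \<Psi>. z \<in> V \<and> V \<subseteq> ball 0 1 \<and> local_isometry V \<Psi> \<and> (\<forall>w\<in>V. \<Phi> w = \<Psi> w)"
      using n R01(2)[of n] f(1) \<Phi>eq by (intro exI[of _ "ball 0 (R n)"] exI[of _ "f n"]) auto
  qed
  moreover have "\<Phi> 0 = y" using \<Phi>eq[of 0 0] R01(1)[of 0] f(2) by simp
  ultimately show ?thesis using that by blast
qed


section \<open>Geodesics and geodesic circles\<close>

lemma curve_chart_nbhd:
  fixes \<gamma> :: "real \<Rightarrow> 'a"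
  assumes "continuous_on UNIV \<gamma>" "c \<in> charts_at Y (\<gamma> t)"
  obtains e where "e > 0" "\<And>s. \<bar>s - t\<bar> < e \<Longrightarrow> \<gamma> s \<in> chart_dom c"
proof -
  have "open (UNIV \<inter> \<gamma> -` chart_dom c)"
    using continuous_open_preimage[OF assms(1) open_UNIV open_dom] charts_atD[OF assms(2)] by blast
  moreover have "t \<in> UNIV \<inter> \<gamma> -` chart_dom c" using charts_atD[OF assms(2)] by auto
  ultimately obtain e where "e > 0" "ball t e \<subseteq> UNIV \<inter> \<gamma> -` chart_dom c" by (rule openE)
  then show ?thesis using that[of e] by (auto simp: dist_real_def subset_iff abs_minus_commute)
qed

lemma velocity_cong:
  assumes "e > 0" "\<And>s. \<bar>s - t\<bar> < e \<Longrightarrow> \<gamma>1 s = \<gamma>2 s"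
  shows "velocity \<gamma>1 t c = velocity \<gamma>2 t c"
  unfolding velocity_def
proof (rule vector_derivative_cong_eq)
  have "eventually (\<lambda>s. s \<in> ball t e) (nhds t)" using assms(1) by (intro eventually_nhds_in_open) auto
  then show "\<forall>\<^sub>F s in nhds t. s \<in> UNIV \<longrightarrow> (coord c \<circ> \<gamma>1) s = (coord c \<circ> \<gamma>2) s"
    by eventually_elim (use assms(2) in \<open>auto simp: dist_real_def abs_minus_commute\<close>)
qed auto

lemma geodesicD:
  assumes "geodesic Y \<gamma>" "c \<in> charts_at Y (\<gamma> t)"
  shows "((\<lambda>s. coord c (\<gamma> s)) has_vector_derivative velocity \<gamma> t c) (at t)"
    "((\<lambda>s. velocity \<gamma> s c) has_vector_derivative - 2 * log_density_dz (density Y c) (coord c (\<gamma> t)) * (velocity \<gamma> t c)\<^sup>2) (at t)"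
proof -
  interpret hyperbolic_density "chart_im c" "density Y c" by (rule hyperbolic_density[OF charts_atD(1)[OF assms(2)]])
  have "coord c (\<gamma> t) \<in> chart_im c" using charts_atD[OF assms(2)] by simp
  note weq = wirtinger_eq_conn[OF this]
  show "((\<lambda>s. coord c (\<gamma> s)) has_vector_derivative velocity \<gamma> t c) (at t)"
    "((\<lambda>s. velocity \<gamma> s c) has_vector_derivative - 2 * log_density_dz (density Y c) (coord c (\<gamma> t)) * (velocity \<gamma> t c)\<^sup>2) (at t)"
    using assms unfolding geodesic_def
    by (auto simp: velocity_def vector_derivative_works o_def weq[symmetric])
qed

text \<open>The radius \<open>e\<close> works for every starting point \<open>x\<close> of the
  interval and not just for \<open>t\<close>: the connectedness argument starts from whichever point
  is known to agree.\<close>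

lemma geodesic_local_unique:
  assumes g: "geodesic Y \<gamma>1" "geodesic Y \<gamma>2" and t: "\<gamma>1 t = \<gamma>2 t" and c: "c \<in> charts_at Y (\<gamma>1 t)"
  obtains e where "e > 0" "\<And>x y. x \<in> {t - e..t + e} \<Longrightarrow> \<gamma>1 x = \<gamma>2 x \<Longrightarrow> velocity \<gamma>1 x c = velocity \<gamma>2 x c \<Longrightarrow>
      y \<in> {t - e..t + e} \<Longrightarrow> \<gamma>1 y = \<gamma>2 y"
proof -
  note ca = charts_atD[OF c]
  interpret hyperbolic_density "chart_im c" "density Y c" by (rule hyperbolic_density[OF ca(1)])
  define p where "p = coord c (\<gamma>1 t)"
  have p: "p \<in> chart_im c" using ca by (simp add: p_def)
  obtain e L N where e: "e > 0" "ball p e \<subseteq> chart_im c"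
    and WL: "\<And>x y. x \<in> ball p e \<Longrightarrow> y \<in> ball p e \<Longrightarrow> cmod (W x - W y) \<le> L * cmod (x - y)"
    and WN: "\<And>x. x \<in> ball p e \<Longrightarrow> cmod (W x) \<le> N" using W_lipschitz[OF p] by blast
  have cg: "continuous_on UNIV \<gamma>1" "continuous_on UNIV \<gamma>2" using g by (auto simp: geodesic_def)
  obtain e1 where e1: "e1 > 0" "\<And>s. \<bar>s - t\<bar> < e1 \<Longrightarrow> \<gamma>1 s \<in> chart_dom c"
    using curve_chart_nbhd[OF cg(1) c] by blast
  obtain e2 where e2: "e2 > 0" "\<And>s. \<bar>s - t\<bar> < e2 \<Longrightarrow> \<gamma>2 s \<in> chart_dom c"
    using curve_chart_nbhd[OF cg(2), of c t] c t by metis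
  have "isCont (\<lambda>s. coord c (\<gamma>1 s)) t" "isCont (\<lambda>s. coord c (\<gamma>2 s)) t"
    using geodesicD(1)[OF g(1) c] geodesicD(1)[OF g(2), of c t] c t by (auto intro: has_vector_derivative_continuous)
  then obtain d1 d2 where d: "d1 > 0" "d2 > 0" "\<And>s. dist s t < d1 \<Longrightarrow> dist (coord c (\<gamma>1 s)) p < e"
      "\<And>s. dist s t < d2 \<Longrightarrow> dist (coord c (\<gamma>2 s)) p < e"
    using e(1) t unfolding continuous_at_eps_delta p_def by metis
  define \<epsilon> where "\<epsilon> = min (min e1 e2) (min d1 d2) / 2"
  have \<epsilon>: "\<epsilon> > 0" using e1 e2 d by (auto simp: \<epsilon>_def)
  have lt: "\<bar>s - t\<bar> < e1" "\<bar>s - t\<bar> < e2" "dist s t < d1" "dist s t < d2" if "s \<in> {t - \<epsilon>..t + \<epsilon>}" for s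
  proof -
    have "\<bar>s - t\<bar> \<le> \<epsilon>" using that by auto
    moreover have "\<epsilon> < e1" "\<epsilon> < e2" "\<epsilon> < d1" "\<epsilon> < d2" using e1(1) e2(1) d(1,2) by (auto simp: \<epsilon>_def min_def)
    ultimately show "\<bar>s - t\<bar> < e1" "\<bar>s - t\<bar> < e2" "dist s t < d1" "dist s t < d2" unfolding dist_real_def by linarith+
  qed
  have ch: "c \<in> charts_at Y (\<gamma>1 s)" "c \<in> charts_at Y (\<gamma>2 s)" if "s \<in> {t - \<epsilon>..t + \<epsilon>}" for s
    using charts_atI[OF ca(1)] e1(2) e2(2) lt[OF that] by auto
  show ?thesis
  proof (rule that[OF \<epsilon>])
    fix x y assume x: "x \<in> {t - \<epsilon>..t + \<epsilon>}" "\<gamma>1 x = \<gamma>2 x" "velocity \<gamma>1 x c = velocity \<gamma>2 x c" and y: "y \<in> {t - \<epsilon>..t + \<epsilon>}"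
    have "coord c (\<gamma>1 y) = coord c (\<gamma>2 y)"
    proof (rule second_order_ode_unique[where a = "t - \<epsilon>" and b = "t + \<epsilon>" and k = 1 and s = x and t = y and W = W and K = "ball p e" and L = L and N = N
          and \<alpha> = "\<lambda>t. 0" and ?v1.0 = "\<lambda>t. velocity \<gamma>1 t c" and ?v2.0 = "\<lambda>t. velocity \<gamma>2 t c"])
      fix s assume s: "s \<in> {t - \<epsilon>..t + \<epsilon>}"
      show "((\<lambda>s. coord c (\<gamma>1 s)) has_vector_derivative 1 * velocity \<gamma>1 s c) (at s)" using geodesicD(1)[OF g(1) ch(1)[OF s]] by simp
      show "((\<lambda>s. coord c (\<gamma>2 s)) has_vector_derivative 1 * velocity \<gamma>2 s c) (at s)" using geodesicD(1)[OF g(2) ch(2)[OF s]] by simp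
      show "((\<lambda>s. velocity \<gamma>1 s c) has_vector_derivative 1 * (0 * velocity \<gamma>1 s c - 2 * W (coord c (\<gamma>1 s)) * (velocity \<gamma>1 s c)\<^sup>2)) (at s)"
        using geodesicD(2)[OF g(1) ch(1)[OF s]] by simp
      show "((\<lambda>s. velocity \<gamma>2 s c) has_vector_derivative 1 * (0 * velocity \<gamma>2 s c - 2 * W (coord c (\<gamma>2 s)) * (velocity \<gamma>2 s c)\<^sup>2)) (at s)"
        using geodesicD(2)[OF g(2) ch(2)[OF s]] by simp
      show "coord c (\<gamma>1 s) \<in> ball p e" "coord c (\<gamma>2 s) \<in> ball p e" using d(3,4) lt[OF s] by (auto simp: dist_commute)
    qed (use x y WL WN in auto)
    then show "\<gamma>1 y = \<gamma>2 y" using coord_inj[OF ca(1)] charts_atD(2)[OF ch(1)[OF y]] charts_atD(2)[OF ch(2)[OF y]] by blast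
  qed
qed

text \<open>The propagated property is agreement on a neighbourhood in time, because it contains
  equality of the velocities in every chart.\<close>

theorem geodesic_unique:
  assumes g: "geodesic Y \<gamma>1" "geodesic Y \<gamma>2" and 0: "\<gamma>1 0 = \<gamma>2 0"
    and v: "\<And>c. c \<in> charts_at Y (\<gamma>1 0) \<Longrightarrow> velocity \<gamma>1 0 c = velocity \<gamma>2 0 c"
  shows "\<gamma>1 t = \<gamma>2 t"
proof -
  define P where "P t \<longleftrightarrow> (\<exists>e>0. \<forall>s. \<bar>s - t\<bar> < e \<longrightarrow> \<gamma>1 s = \<gamma>2 s)" for t
  have cg: "continuous_on UNIV \<gamma>1" "continuous_on UNIV \<gamma>2" using g by (auto simp: geodesic_def)
  have PI: "P y" if "y \<in> {a<..<b}" "\<And>s. s \<in> {a<..<b} \<Longrightarrow> \<gamma>1 s = \<gamma>2 s" for y a b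
    unfolding P_def using that by (intro exI[of _ "min (y - a) (b - y)"]) (auto simp: abs_if split: if_splits)
  have "P t"
  proof (rule connected_induction_simple[of UNIV 0 t P])
    obtain c where c: "c \<in> charts_at Y (\<gamma>1 0)" using charts_at_nonempty by blast
    obtain e where e: "e > 0" "\<And>x y. x \<in> {0 - e..0 + e} \<Longrightarrow> \<gamma>1 x = \<gamma>2 x \<Longrightarrow> velocity \<gamma>1 x c = velocity \<gamma>2 x c \<Longrightarrow>
      y \<in> {0 - e..0 + e} \<Longrightarrow> \<gamma>1 y = \<gamma>2 y" using geodesic_local_unique[OF g 0 c] by blast
    show "P 0" by (rule PI[of 0 "-e" e]) (use e(1) e(2)[of 0] 0 v[OF c] in auto)
  next
    fix t :: real
    show "\<exists>T. openin (top_of_set UNIV) T \<and> t \<in> T \<and> (\<forall>x\<in>T. \<forall>y\<in>T. P x \<longrightarrow> P y)"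
    proof (cases "\<gamma>1 t = \<gamma>2 t")
      case True
      obtain c where c: "c \<in> charts_at Y (\<gamma>1 t)" using charts_at_nonempty by blast
      obtain e where e: "e > 0" "\<And>x y. x \<in> {t - e..t + e} \<Longrightarrow> \<gamma>1 x = \<gamma>2 x \<Longrightarrow> velocity \<gamma>1 x c = velocity \<gamma>2 x c \<Longrightarrow>
        y \<in> {t - e..t + e} \<Longrightarrow> \<gamma>1 y = \<gamma>2 y" using geodesic_local_unique[OF g True c] by blast
      have "P y" if x: "x \<in> {t - e<..<t + e}" "P x" and y: "y \<in> {t - e<..<t + e}" for x y
      proof (rule PI[OF y])
        fix s assume s: "s \<in> {t - e<..<t + e}"
        obtain \<delta> where \<delta>: "\<delta> > 0" "\<And>s. \<bar>s - x\<bar> < \<delta> \<Longrightarrow> \<gamma>1 s = \<gamma>2 s" using x(2) unfolding P_def by blast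
        have "x \<in> {t - e..t + e}" "s \<in> {t - e..t + e}" using x(1) s by auto
        moreover have "\<gamma>1 x = \<gamma>2 x" using \<delta>(1) \<delta>(2)[of x] by simp
        ultimately show "\<gamma>1 s = \<gamma>2 s" using e(2)[of x s] velocity_cong[of \<delta> x \<gamma>1 \<gamma>2 c, OF \<delta>] by blast
      qed
      moreover have "openin (top_of_set UNIV) {t - e<..<t + e}" "t \<in> {t - e<..<t + e}" using e(1) by simp_all
      ultimately show ?thesis by blast
    next
      case False
      then obtain A B where AB: "open A" "open B" "\<gamma>1 t \<in> A" "\<gamma>2 t \<in> B" "A \<inter> B = {}" using hausdorff[OF False] by blast
      define T where "T = (UNIV \<inter> \<gamma>1 -` A) \<inter> (UNIV \<inter> \<gamma>2 -` B)"
      have "open T" unfolding T_def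
        using continuous_open_preimage[OF cg(1) open_UNIV AB(1)] continuous_open_preimage[OF cg(2) open_UNIV AB(2)] by blast
      moreover have "\<not> P x" if x: "x \<in> T" for x
      proof
        assume "P x"
        then have "\<gamma>1 x = \<gamma>2 x" unfolding P_def by (metis abs_zero diff_self)
        then show False using x AB(5) by (auto simp: T_def)
      qed
      moreover have "t \<in> T" using AB by (auto simp: T_def)
      moreover have "openin (top_of_set UNIV) T" using calculation(1) by simp
      ultimately show ?thesis by blast
    qed
  qed auto
  then show ?thesis unfolding P_def by (metis abs_zero diff_self)
qed

lemma has_real_derivative_imp_complex:
  "(f has_real_derivative d) (at t) \<Longrightarrow> ((\<lambda>t. complex_of_real (f t)) has_vector_derivative of_real d) (at t)"
  by (intro has_vector_derivative_of_real) (simp add: has_real_derivative_iff_has_vector_derivative)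

lemma has_vector_derivative_transform_at:
  fixes f g :: "real \<Rightarrow> complex"
  assumes "(f has_vector_derivative d) (at t)" "e > 0" "\<And>s. \<bar>s - t\<bar> < e \<Longrightarrow> f s = g s"
  shows "(g has_vector_derivative d) (at t)"
  by (rule has_vector_derivative_transform_within_open[OF assms(1) open_ball, of t e])
    (use assms in \<open>auto simp: dist_real_def abs_minus_commute\<close>)

section \<open>Radii of the disc as geodesics, and the exponential map\<close>

text \<open>The curve \<open>tanh (k * t) * u\<close> traverses a diameter of the disc with constant
  hyperbolic speed \<open>2 * |k|\<close>. In the second derivative of its image the disc connection
  from \<open>local_isometry_second_order\<close> cancels the acceleration, and the geodesic
  equation of \<open>Y\<close> remains.\<close>

lemma local_isometry_geodesic:
  fixes k :: real
  assumes \<Phi>: "local_isometry (ball 0 1) \<Phi>" and u: "cmod u = 1"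
  defines "\<gamma> \<equiv> (\<lambda>t. \<Phi> (of_real (tanh (k * t)) * u))"
  shows "geodesic Y \<gamma>"
    "c \<in> charts_at Y (\<Phi> 0) \<Longrightarrow> ((\<lambda>w. coord c (\<Phi> w)) has_field_derivative d) (at 0) \<Longrightarrow> velocity \<gamma> 0 c = d * (of_real k * u)"
proof -
  define \<tau> where "\<tau> t = complex_of_real (tanh (k * t)) * u" for t
  have \<tau>1: "\<tau> t \<in> ball 0 1" for t
    using tanh_real_bounds[of "k * t"] u by (auto simp: \<tau>_def norm_mult)
  define \<tau>' where "\<tau>' t = complex_of_real (k * (1 - (tanh (k * t))\<^sup>2)) * u" for t
  define \<tau>'' where "\<tau>'' t = complex_of_real (- 2 * k\<^sup>2 * tanh (k * t) * (1 - (tanh (k * t))\<^sup>2)) * u" for t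
  have "cosh x \<noteq> 0" for x :: real using cosh_real_pos[of x] by simp
  then have d1: "((\<lambda>t. tanh (k * t)) has_real_derivative k * (1 - (tanh (k * t))\<^sup>2)) (at t)" for t
    by (auto intro!: derivative_eq_intros simp: algebra_simps)
  have d2: "((\<lambda>t. k * (1 - (tanh (k * t))\<^sup>2)) has_real_derivative - 2 * k\<^sup>2 * tanh (k * t) * (1 - (tanh (k * t))\<^sup>2)) (at t)" for t
    by (rule derivative_eq_intros d1 refl)+ (simp add: algebra_simps power2_eq_square)
  have d\<tau>: "(\<tau> has_vector_derivative \<tau>' t) (at t)" for t
    unfolding \<tau>_def[abs_def] \<tau>'_def by (rule has_vector_derivative_mult_left[OF has_real_derivative_imp_complex[OF d1]])
  have d\<tau>': "(\<tau>' has_vector_derivative \<tau>'' t) (at t)" for t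
    unfolding \<tau>'_def[abs_def] \<tau>''_def by (rule has_vector_derivative_mult_left[OF has_real_derivative_imp_complex[OF d2]])
  have \<gamma>\<tau>: "\<gamma> t = \<Phi> (\<tau> t)" for t by (simp add: \<gamma>_def \<tau>_def)
  have c\<tau>: "continuous_on UNIV \<tau>"
    by (intro continuous_at_imp_continuous_on ballI has_vector_derivative_continuous[OF d\<tau>])
  have c\<gamma>: "continuous_on UNIV \<gamma>" unfolding \<gamma>\<tau>
    by (rule continuous_on_compose2[OF local_isometryD(3)[OF \<Phi>] c\<tau>]) (use \<tau>1 in auto)
  have uu: "u * cnj u = 1" using u complex_norm_square[of u] by simp
  have key: "\<exists>e>0. (\<forall>s. \<bar>s - t\<bar> < e \<longrightarrow> ((\<lambda>s. coord c (\<gamma> s)) has_vector_derivative deriv (\<lambda>w. coord c (\<Phi> w)) (\<tau> s) * \<tau>' s) (at s)) \<and>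
      ((\<lambda>s. deriv (\<lambda>w. coord c (\<Phi> w)) (\<tau> s) * \<tau>' s) has_vector_derivative
        - 2 * log_density_dz (density Y c) (coord c (\<gamma> t)) * (deriv (\<lambda>w. coord c (\<Phi> w)) (\<tau> t) * \<tau>' t)\<^sup>2) (at t)"
    if c: "c \<in> charts_at Y (\<gamma> t)" for t c
  proof -
    define h where "h w = coord c (\<Phi> w)" for w
    obtain e where e: "e > 0" "ball (\<tau> t) e \<subseteq> ball 0 1" "\<Phi> ` ball (\<tau> t) e \<subseteq> chart_dom c"
      using chart_nbhd[OF local_isometryD(1,3)[OF \<Phi>] \<tau>1] c unfolding \<gamma>\<tau> by blast
    note so = local_isometry_second_order[OF \<Phi> open_ball e(2,3) charts_atD(1)[OF c], folded h_def]
    have "isCont \<tau> t" by (rule has_vector_derivative_continuous[OF d\<tau>])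
    then obtain \<delta> where \<delta>: "\<delta> > 0" "\<And>s. dist s t < \<delta> \<Longrightarrow> dist (\<tau> s) (\<tau> t) < e"
      unfolding continuous_at_eps_delta using e(1) by blast
    have inb: "\<tau> s \<in> ball (\<tau> t) e" if "\<bar>s - t\<bar> < \<delta>" for s
      using \<delta>(2)[of s] that by (simp add: dist_real_def dist_commute)
    have 1: "((\<lambda>s. h (\<tau> s)) has_vector_derivative deriv h (\<tau> s) * \<tau>' s) (at s)" if "\<bar>s - t\<bar> < \<delta>" for s
      using field_vector_diff_chain_at[OF d\<tau> so(1)[OF inb[OF that]]] by (simp add: o_def mult.commute)
    have tt: "\<tau> t \<in> ball (\<tau> t) e" using e(1) by simp
    define q where "q = (2 * cnj (\<tau> t) / (1 - \<tau> t * cnj (\<tau> t)))"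
    define w where "w = log_density_dz (density Y c) (h (\<tau> t))"
    have 2: "((\<lambda>s. deriv h (\<tau> s)) has_vector_derivative \<tau>' t * (q * deriv h (\<tau> t) - 2 * w * (deriv h (\<tau> t))\<^sup>2)) (at t)"
      using field_vector_diff_chain_at[OF d\<tau> so(2)[OF tt]] by (simp add: o_def q_def w_def)
    define T where "T = complex_of_real (tanh (k * t))"
    \<comment> \<open>The geodesic equation of the disc itself; \<open>q\<close> is twice
      \<open>dz\<close> of the logarithm of \<open>disc_density\<close>.\<close>
    have \<tau>q: "\<tau>'' t + q * (\<tau>' t)\<^sup>2 = 0"
    proof -
      have "(tanh (k * t))\<^sup>2 < 1" using tanh_real_bounds[of "k * t"] by (auto simp: abs_square_less_1)
      then have "1 - (tanh (k * t))\<^sup>2 \<noteq> 0" by simp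
      then have T1: "1 - T\<^sup>2 \<noteq> 0" unfolding T_def by (metis of_real_1 of_real_diff of_real_eq_0_iff of_real_power)
      have tv: "\<tau> t * cnj (\<tau> t) = T\<^sup>2" using uu by (simp add: \<tau>_def T_def power2_eq_square mult_ac)
      have "q * (\<tau>' t)\<^sup>2 = 2 * T * cnj u / (1 - T\<^sup>2) * (of_real k * (1 - T\<^sup>2) * u)\<^sup>2"
        unfolding q_def tv by (simp add: \<tau>_def \<tau>'_def T_def)
      also have "\<dots> = 2 * T * (of_real k)\<^sup>2 * (1 - T\<^sup>2) * u * (u * cnj u)"
        using T1 by (simp add: field_simps power2_eq_square)
      also have "\<dots> = - \<tau>'' t" unfolding uu by (simp add: \<tau>''_def T_def)
      finally show ?thesis by simp
    qed
    have "((\<lambda>s. deriv h (\<tau> s) * \<tau>' s) has_vector_derivative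
        (deriv h (\<tau> t) * \<tau>'' t + \<tau>' t * (q * deriv h (\<tau> t) - 2 * w * (deriv h (\<tau> t))\<^sup>2) * \<tau>' t)) (at t)"
      by (rule has_vector_derivative_mult[OF 2 d\<tau>'])
    also have "deriv h (\<tau> t) * \<tau>'' t + \<tau>' t * (q * deriv h (\<tau> t) - 2 * w * (deriv h (\<tau> t))\<^sup>2) * \<tau>' t
       = deriv h (\<tau> t) * (\<tau>'' t + q * (\<tau>' t)\<^sup>2) - 2 * w * (deriv h (\<tau> t) * \<tau>' t)\<^sup>2"
      by (simp add: algebra_simps power2_eq_square)
    also have "\<dots> = - 2 * w * (deriv h (\<tau> t) * \<tau>' t)\<^sup>2" unfolding \<tau>q by simp
    finally show ?thesis using \<delta>(1) 1 by (intro exI[of _ \<delta>]) (simp add: h_def[abs_def] \<gamma>\<tau> w_def)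
  qed
  show "geodesic Y \<gamma>"
    unfolding geodesic_def
  proof (intro conjI allI ballI)
    show "continuous_on UNIV \<gamma>" by (rule c\<gamma>)
    fix t c assume c: "c \<in> charts_at Y (\<gamma> t)"
    interpret hyperbolic_density "chart_im c" "density Y c" by (rule hyperbolic_density[OF charts_atD(1)[OF c]])
    define V where "V s = deriv (\<lambda>w. coord c (\<Phi> w)) (\<tau> s) * \<tau>' s" for s
    obtain e where e: "e > 0" "\<And>s. \<bar>s - t\<bar> < e \<Longrightarrow> ((\<lambda>s. coord c (\<gamma> s)) has_vector_derivative V s) (at s)"
      "(V has_vector_derivative - 2 * W (coord c (\<gamma> t)) * (V t)\<^sup>2) (at t)"
      using key[OF c] unfolding V_def by blast
    have vel: "V s = velocity \<gamma> s c" if "\<bar>s - t\<bar> < e" for s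
      using vector_derivative_at[OF e(2)[OF that]] by (simp add: velocity_def o_def)
    show "(coord c \<circ> \<gamma>) differentiable (at t)"
      using e(2)[of t] e(1) by (auto simp: o_def has_vector_derivative_def differentiable_def)
    have "coord c (\<gamma> t) \<in> chart_im c" using charts_atD[OF c] by simp
    then show "((\<lambda>s. velocity \<gamma> s c) has_vector_derivative
          - 2 * wirtinger (\<lambda>w. ln (density Y c w)) (coord c (\<gamma> t)) * (velocity \<gamma> t c)\<^sup>2) (at t)"
      using has_vector_derivative_transform_at[OF e(3,1) vel] vel[of t] e(1) by (simp add: wirtinger_eq_conn)
  qed
  assume c: "c \<in> charts_at Y (\<Phi> 0)" and d: "((\<lambda>w. coord c (\<Phi> w)) has_field_derivative d) (at 0)"
  have "((\<lambda>w. coord c (\<Phi> w)) has_field_derivative d) (at (\<tau> 0))" using d by (simp add: \<tau>_def)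
  from field_vector_diff_chain_at[OF d\<tau> this]
  have "((\<lambda>s. coord c (\<gamma> s)) has_vector_derivative \<tau>' 0 * d) (at 0)" by (simp add: o_def \<gamma>\<tau>)
  from vector_derivative_at[OF this] show "velocity \<gamma> 0 c = d * (of_real k * u)"
    by (simp add: velocity_def o_def \<tau>'_def mult_ac)
qed

text \<open>The image of a radius is one geodesic with the prescribed initial data, and uniqueness
  makes the definite description in \<open>exp_map\<close> refer to its end point.\<close>

lemma exp_map_eq:
  assumes \<Phi>: "local_isometry (ball 0 1) \<Phi>" "\<Phi> 0 = y" and u: "cmod u = 1"
    and v: "\<And>c d. c \<in> charts_at Y y \<Longrightarrow> ((\<lambda>w. coord c (\<Phi> w)) has_field_derivative d) (at 0) \<Longrightarrow> v c = d * (of_real k * u)"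
  shows "exp_map Y y v = \<Phi> (of_real (tanh k) * u)"
proof -
  define \<gamma> where "\<gamma> t = \<Phi> (of_real (tanh (k * t)) * u)" for t
  have g: "geodesic Y \<gamma>" unfolding \<gamma>_def[abs_def] by (rule local_isometry_geodesic[OF \<Phi>(1) u])
  have vel: "velocity \<gamma> 0 c = v c" if c: "c \<in> charts_at Y y" for c
  proof -
    have "c \<in> charts_at Y (\<Phi> 0)" using c \<Phi>(2) by simp
    then obtain d where d: "((\<lambda>w. coord c (\<Phi> w)) has_field_derivative d) (at 0)" using local_isometryD(4)[OF \<Phi>(1), of 0 c] by auto
    show ?thesis using local_isometry_geodesic(2)[OF \<Phi>(1) u _ d, of k] v[OF c d] c \<Phi>(2) by (simp add: \<gamma>_def[abs_def])
  qed
  show ?thesis unfolding exp_map_def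
  proof (rule the_equality)
    show "\<exists>\<gamma>. geodesic Y \<gamma> \<and> \<gamma> 0 = y \<and> (\<forall>c\<in>charts_at Y y. velocity \<gamma> 0 c = v c) \<and> \<gamma> 1 = \<Phi> (of_real (tanh k) * u)"
      using g vel \<Phi>(2) by (intro exI[of _ \<gamma>]) (simp add: \<gamma>_def)
    fix q assume "\<exists>\<gamma>. geodesic Y \<gamma> \<and> \<gamma> 0 = y \<and> (\<forall>c\<in>charts_at Y y. velocity \<gamma> 0 c = v c) \<and> \<gamma> 1 = q"
    then obtain \<gamma>2 where \<gamma>2: "geodesic Y \<gamma>2" "\<gamma>2 0 = y" "\<And>c. c \<in> charts_at Y y \<Longrightarrow> velocity \<gamma>2 0 c = v c" "\<gamma>2 1 = q" by blast
    have "\<gamma>2 1 = \<gamma> 1" by (rule geodesic_unique[OF \<gamma>2(1) g]) (use \<gamma>2 vel \<Phi>(2) in \<open>auto simp: \<gamma>_def\<close>)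
    then show "q = \<Phi> (of_real (tanh k) * u)" using \<gamma>2(4) by (simp add: \<gamma>_def)
  qed
qed

end

text \<open>The lifted circle starts at some angle \<open>b\<close> and, depending on the
  orientation of the basis, runs in direction \<open>s\<close>; the integral over a full period
  depends on neither.\<close>

lemma integral_full_period:
  fixes g :: "real \<Rightarrow> real"
  assumes g: "continuous_on UNIV g" and per: "\<And>y. g (y + 2 * pi) = g y" and s: "s = 1 \<or> s = -1"
  shows "integral {0..1} (\<lambda>t. g (b + s * (2 * pi * t))) = integral {0..2*pi} g / (2 * pi)"
proof -
  \<comment> \<open>A left end point below 0 and below all arguments that occur, so that one
    primitive covers them.\<close>
  define A where "A = - 2 * pi - \<bar>b\<bar> - 1"
  define P where "P x = integral {A..x} g" for x
  have dP: "(P has_real_derivative g x) (at x)" if "x > A" for x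
  proof -
    have "(P has_real_derivative g x) (at x within {A..x + 1})"
      unfolding P_def[abs_def]
      by (rule integral_has_real_derivative) (use that g in \<open>auto intro: continuous_on_subset\<close>)
    moreover have "x \<in> interior {A..x + 1}" using that by simp
    ultimately show ?thesis by (metis at_within_interior)
  qed
  have const: "P (x + 2 * pi) - P x = P (2 * pi) - P 0" if x: "x > A" for x
  proof -
    define a' where "a' = (min x 0 + A) / 2"
    have A0: "A < 0" using pi_gt_zero abs_ge_zero[of b] unfolding A_def by linarith
    have a': "A < a'" "a' < x" "a' < 0" using x A0 by (auto simp: a'_def min_def)
    have "P (x + 2 * pi) - P x = P (0 + 2 * pi) - P 0"
    proof (rule DERIV_isconst3[where f = "\<lambda>x. P (x + 2 * pi) - P x" and a = a' and b = "\<bar>x\<bar> + 1" and x = x and y = 0])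
      fix y assume y: "y \<in> {a'<..<\<bar>x\<bar> + 1}"
      then have yA: "y > A" using a' by auto
      have "y + 2 * pi > A" using yA pi_gt_zero by linarith
      from DERIV_shift[of P "g (y + 2 * pi)" y "2 * pi"] dP[OF this]
      have "((\<lambda>x. P (x + 2 * pi)) has_real_derivative g (y + 2 * pi)) (at y)" by simp
      from DERIV_diff[OF this dP[OF yA]] per[of y]
      show "((\<lambda>x. P (x + 2 * pi) - P x) has_real_derivative 0) (at y)" by simp
    qed (use a' in auto)
    then show ?thesis by simp
  qed
  have "(P has_vector_derivative g x) (at x within S)" if "x \<in> {0..2*pi}" for x S
  proof -
    have "x > A" using that pi_gt_zero abs_ge_zero[of b] unfolding A_def by (simp only: atLeastAtMost_iff) linarith
    from dP[OF this] show ?thesis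
      unfolding has_real_derivative_iff_has_vector_derivative by (rule has_vector_derivative_at_within)
  qed
  then have "(g has_integral (P (2 * pi) - P 0)) {0..2*pi}"
    by (intro fundamental_theorem_of_calculus) auto
  then have I: "integral {0..2*pi} g = P (2 * pi) - P 0" by (rule integral_unique)
  define V where "V t = s * P (b + s * (2 * pi * t)) / (2 * pi)" for t
  have "(V has_real_derivative g (b + s * (2 * pi * t))) (at t)" if t: "t \<in> {0..1}" for t
  proof -
    have "2 * pi * t \<le> 2 * pi * 1" "2 * pi * t \<ge> 0" using t by (auto intro!: mult_left_mono)
    then have "b + s * (2 * pi * t) > A" using s abs_ge_self[of b] abs_ge_minus_self[of b] pi_gt_zero unfolding A_def by (elim disjE; hypsubst; linarith)
    note d = dP[OF this]
    have "((\<lambda>t. b + s * (2 * pi * t)) has_real_derivative s * (2 * pi)) (at t)" by (auto intro!: derivative_eq_intros)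
    from DERIV_chain2[OF d this]
    have "((\<lambda>t. P (b + s * (2 * pi * t))) has_real_derivative g (b + s * (2 * pi * t)) * (s * (2 * pi))) (at t)" .
    then have "((\<lambda>t. s * P (b + s * (2 * pi * t)) / (2 * pi)) has_real_derivative s * (g (b + s * (2 * pi * t)) * (s * (2 * pi))) / (2 * pi)) (at t)"
      by (intro DERIV_cdivide DERIV_cmult)
    moreover have "s * (g (b + s * (2 * pi * t)) * (s * (2 * pi))) / (2 * pi) = g (b + s * (2 * pi * t))" using s by auto
    ultimately show ?thesis by (simp add: V_def[abs_def])
  qed
  then have "(V has_vector_derivative g (b + s * (2 * pi * t))) (at t within {0..1})" if "t \<in> {0..1}" for t
    using that unfolding has_real_derivative_iff_has_vector_derivative by (blast intro: has_vector_derivative_at_within)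
  then have "((\<lambda>t. g (b + s * (2 * pi * t))) has_integral (V 1 - V 0)) {0..1}"
    by (intro fundamental_theorem_of_calculus) simp_all
  moreover have "V 1 - V 0 = (P (2 * pi) - P 0) / (2 * pi)"
  proof -
    have bA: "b > A" "b - 2 * pi > A" using pi_gt_zero abs_ge_minus_self[of b] unfolding A_def by linarith+
    show ?thesis using s
    proof
      assume "s = 1"
      then have "V 1 - V 0 = (P (b + 2 * pi) - P b) / (2 * pi)" by (simp add: V_def diff_divide_distrib)
      then show ?thesis using const[OF bA(1)] by simp
    next
      assume "s = -1"
      then have "V 1 - V 0 = (P (b - 2 * pi + 2 * pi) - P (b - 2 * pi)) / (2 * pi)" by (simp add: V_def diff_divide_distrib)
      then show ?thesis using const[OF bA(2)] by simp
    qed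
  qed
  ultimately show ?thesis unfolding I using integral_unique by metis
qed

context compact_hyperbolic_surface
begin

text \<open>The disc metric has factor 2 at 0, so unit vectors of \<open>Y\<close> correspond to
  vectors of Euclidean length 1/2. The basis may have either orientation, hence the sign
  \<open>s\<close>.\<close>

lemma orthonormal_directions:
  assumes \<Phi>: "local_isometry (ball 0 1) \<Phi>" "\<Phi> 0 = y" and o: "orthonormal_basis Y y u1 u2"
  obtains e s where "cmod e = 1" "s = 1 \<or> s = -1"
    "\<And>c d. c \<in> charts_at Y y \<Longrightarrow> ((\<lambda>w. coord c (\<Phi> w)) has_field_derivative d) (at 0) \<Longrightarrow>
      u1 c = d * (e / 2) \<and> u2 c = d * (of_real s * \<i> * e / 2)"
proof -
  define c where "c = some_chart Y y"
  have c: "c \<in> charts_at Y y" using some_chart by (simp add: c_def)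
  define \<rho> where "\<rho> = density Y c (coord c y)"
  have \<rho>: "\<rho> > 0" using density_pos charts_atD[OF c] by (auto simp: \<rho>_def)
  obtain d where d: "((\<lambda>w. coord c (\<Phi> w)) has_field_derivative d) (at 0)" "\<rho> * cmod d = 2"
    using local_isometryD(4)[OF \<Phi>(1), of 0 c] c \<Phi>(2) by (auto simp: \<rho>_def disc_density_def)
  have d0: "d \<noteq> 0" using d(2) by auto
  define e where "e = 2 * u1 c / d"
  define f where "f = 2 * u2 c / d"
  have ue: "u1 c = d * (e / 2)" "u2 c = d * (f / 2)" using d0 by (auto simp: e_def f_def)
  have n1: "\<rho>\<^sup>2 * (cmod (u1 c))\<^sup>2 = 1" "\<rho>\<^sup>2 * (cmod (u2 c))\<^sup>2 = 1" and n2: "u1 c \<bullet> u2 c = 0"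
    using o \<rho> by (auto simp: orthonormal_basis_def tangent_inner_def Let_def c_def[symmetric] \<rho>_def[symmetric] power2_norm_eq_inner)
  have "(\<rho> * cmod (u1 c))\<^sup>2 = 1" "(\<rho> * cmod (u2 c))\<^sup>2 = 1" using n1 by (auto simp: power_mult_distrib)
  then have n3: "\<rho> * cmod (u1 c) = 1" "\<rho> * cmod (u2 c) = 1" using \<rho> by (auto simp: power2_eq_1_iff) (smt (verit) mult_nonneg_nonneg norm_ge_zero)+
  have "\<rho> * cmod d * cmod e = 2 * (\<rho> * cmod (u1 c))" "\<rho> * cmod d * cmod f = 2 * (\<rho> * cmod (u2 c))"
    unfolding ue by (simp_all add: norm_mult norm_divide)
  then have ef: "cmod e = 1" "cmod f = 1" unfolding n3 d(2) by simp_all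
  have ip: "u \<bullet> v = Re (u * cnj v)" for u v by (simp add: inner_complex_def)
  have "u1 c * cnj (u2 c) = d * cnj d * (e * cnj f) / 4" unfolding ue by (simp add: field_simps)
  also have "\<dots> = of_real ((cmod d)\<^sup>2 / 4) * (e * cnj f)" by (simp add: complex_norm_square[symmetric])
  finally have "Re (of_real ((cmod d)\<^sup>2 / 4) * (e * cnj f)) = 0" using n2 ip by metis
  moreover have "Re (of_real k * w) = k * Re w" for k w by simp
  ultimately have "(cmod d)\<^sup>2 / 4 * Re (e * cnj f) = 0" by metis
  then have "Re (e * cnj f) = 0" using d0 by (simp only: mult_eq_0_iff) simp
  then have ref: "Re (f * cnj e) = 0" by (simp add: mult.commute)
  have "cmod (f * cnj e) = 1" using ef by (simp add: norm_mult)
  then have "\<bar>Im (f * cnj e)\<bar> = 1" using cmod_eq_Im[OF ref] by simp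
  define s where "s = Im (f * cnj e)"
  have s: "s = 1 \<or> s = -1" using \<open>\<bar>Im (f * cnj e)\<bar> = 1\<close> by (auto simp: s_def abs_if split: if_splits)
  have "f * cnj e = of_real s * \<i>" using ref by (simp add: complex_eq_iff s_def)
  then have "f * cnj e * e = of_real s * \<i> * e" by (rule arg_cong)
  then have "f * (cnj e * e) = of_real s * \<i> * e" by (simp only: mult.assoc)
  moreover have "cnj e * e = 1" using ef(1) complex_norm_square[of e] by (simp add: mult.commute)
  ultimately have fe: "f = of_real s * \<i> * e" by simp
  show ?thesis
  proof (rule that[OF ef(1) s])
    fix c' d' assume c': "c' \<in> charts_at Y y" and d': "((\<lambda>w. coord c' (\<Phi> w)) has_field_derivative d') (at 0)"
    define k where "k = deriv (transition c c') (coord c y)"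
    have u: "u1 c' = k * u1 c" "u2 c' = k * u2 c"
      using o c c' unfolding orthonormal_basis_def tangent_vector_def k_def by blast+
    note t = transition_deriv[OF c c', folded k_def]
    have "((\<lambda>w. transition c c' (coord c (\<Phi> w))) has_field_derivative k * d) (at 0)"
      by (rule DERIV_chain2[OF _ d(1)]) (use t(1) \<Phi>(2) in simp)
    moreover have "0 \<in> ball (0::complex) 1" "c \<in> charts_at Y (\<Phi> 0)" using c \<Phi>(2) by simp_all
    then obtain \<epsilon> where \<epsilon>: "\<epsilon> > 0" "\<Phi> ` ball 0 \<epsilon> \<subseteq> chart_dom c"
      by (rule chart_nbhd[OF local_isometryD(1,3)[OF \<Phi>(1)]])
    ultimately have "((\<lambda>w. coord c' (\<Phi> w)) has_field_derivative k * d) (at 0)"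
      by (elim has_field_derivative_transform_within_open[OF _ open_ball[of 0 \<epsilon>]])
        (use \<epsilon> param_coord[OF charts_atD(1)[OF c]] in \<open>auto simp: transition_def image_subset_iff\<close>)
    then have "d' = k * d" using d' DERIV_unique by blast
    then show "u1 c' = d' * (e / 2) \<and> u2 c' = d' * (of_real s * \<i> * e / 2)"
      using u ue fe by (simp add: mult.assoc)
  qed
qed

text \<open>The halved radius comes from the halved vectors in
  \<open>orthonormal_directions\<close>: the velocity \<open>r * e / 2\<close> in the disc leads to
  \<open>tanh (r / 2)\<close>.\<close>

lemma geodesic_circle_eq:
  assumes \<Phi>: "local_isometry (ball 0 1) \<Phi>" "\<Phi> 0 = y" and o: "orthonormal_basis Y y u1 u2"
  obtains b s where "s = 1 \<or> s = -1"
    "\<And>\<theta>. geodesic_circle Y r y u1 u2 \<theta> = \<Phi> (of_real (tanh (r / 2)) * cis (b + s * (2 * pi * \<theta>)))"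
proof -
  obtain e s where e: "cmod e = 1" and s: "s = 1 \<or> s = -1" and u: "\<And>c d. c \<in> charts_at Y y \<Longrightarrow> ((\<lambda>w. coord c (\<Phi> w)) has_field_derivative d) (at 0) \<Longrightarrow>
      u1 c = d * (e / 2) \<and> u2 c = d * (of_real s * \<i> * e / 2)" using orthonormal_directions[OF \<Phi> o] by metis
  have "e \<noteq> 0" using e by auto
  then have eb: "e = cis (Arg e)" using e cis_Arg[of e] by (simp add: sgn_eq)
  show ?thesis
  proof (rule that[OF s, of "Arg e"])
    fix \<theta>
    let ?x = "2 * pi * \<theta>"
    have dir: "cis (Arg e + s * ?x) = e * (of_real (cos ?x) + of_real s * \<i> * of_real (sin ?x))"
    proof -
      have "cis (s * ?x) = of_real (cos ?x) + of_real s * \<i> * of_real (sin ?x)" using s by (auto simp: complex_eq_iff)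
      moreover have "cis (Arg e + s * ?x) = cis (Arg e) * cis (s * ?x)" by (simp add: cis_mult)
      ultimately show ?thesis using eb by simp
    qed
    show "geodesic_circle Y r y u1 u2 \<theta> = \<Phi> (of_real (tanh (r / 2)) * cis (Arg e + s * ?x))"
      unfolding geodesic_circle_def
    proof (rule exp_map_eq[OF \<Phi>])
      show "cmod (cis (Arg e + s * ?x)) = 1" by simp
      fix c d assume c: "c \<in> charts_at Y y" "((\<lambda>w. coord c (\<Phi> w)) has_field_derivative d) (at 0)"
      have u12: "u1 c = d * (e / 2)" "u2 c = d * (of_real s * \<i> * e / 2)" using u[OF c] by blast+
      show "complex_of_real r * (complex_of_real (cos ?x) * u1 c + complex_of_real (sin ?x) * u2 c) =
            d * (complex_of_real (r / 2) * cis (Arg e + s * ?x))"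
        unfolding dir u12 by (simp add: algebra_simps)
    qed
  qed
qed

text \<open>The lift is a Euclidean circle about 0 and the disc metric is rotation invariant, so the
  speed is constant. It is the expected \<open>2 * pi * sinh r\<close>, as 2 q / (1 - q^2) = sinh r
  for q = tanh (r / 2).\<close>

lemma line_integral_geodesic_circle:
  assumes \<Phi>: "local_isometry (ball 0 1) \<Phi>" "\<Phi> 0 = y" and o: "orthonormal_basis Y y u1 u2" and r: "r > 0"
    and f: "continuous_on UNIV f"
  shows "line_integral Y (geodesic_circle Y r y u1 u2) f =
    tanh (r / 2) * disc_density (of_real (tanh (r / 2))) * integral {0..2*pi} (\<lambda>y. f (\<Phi> (of_real (tanh (r / 2)) * cis y)))"
proof -
  obtain b s where s: "s = 1 \<or> s = -1" and gc: "\<And>\<theta>. geodesic_circle Y r y u1 u2 \<theta> = \<Phi> (of_real (tanh (r / 2)) * cis (b + s * (2 * pi * \<theta>)))"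
    using geodesic_circle_eq[OF \<Phi> o, of r] by metis
  define q where "q = tanh (r / 2)"
  have q: "0 < q" "q < 1" using r tanh_real_bounds[of "r/2"] by (auto simp: q_def)
  define \<tau> where "\<tau> t = of_real q * cis (b + s * (2 * pi * t))" for t
  define \<gamma> where "\<gamma> t = \<Phi> (\<tau> t)" for t
  have \<gamma>: "geodesic_circle Y r y u1 u2 = \<gamma>" by (simp add: fun_eq_iff gc \<gamma>_def \<tau>_def q_def)
  have \<tau>1: "\<tau> t \<in> ball 0 1" for t using q by (simp add: \<tau>_def norm_mult)
  have d\<tau>: "(\<tau> has_vector_derivative of_real (s * 2 * pi) * \<i> * \<tau> t) (at t)" for t
  proof -
    have "((\<lambda>z. of_real q * exp (\<i> * (of_real b + of_real (s * (2 * pi)) * z))) has_field_derivative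
        of_real (s * 2 * pi) * \<i> * (of_real q * exp (\<i> * (of_real b + of_real (s * (2 * pi)) * of_real t)))) (at (of_real t))"
      by (auto intro!: derivative_eq_intros)
    from has_vector_derivative_real_field[OF this] show ?thesis
      by (simp add: \<tau>_def[abs_def] cis_conv_exp mult.assoc)
  qed
  have sp: "speed Y \<gamma> t = 2 * pi * (q * disc_density (of_real q))" for t
  proof -
    define c where "c = some_chart Y (\<gamma> t)"
    have c: "c \<in> charts_at Y (\<gamma> t)" using some_chart by (simp add: c_def)
    obtain d where d: "((\<lambda>w. coord c (\<Phi> w)) has_field_derivative d) (at (\<tau> t))" "density Y c (coord c (\<Phi> (\<tau> t))) * cmod d = disc_density (\<tau> t)"
      using local_isometryD(4)[OF \<Phi>(1) \<tau>1, of c] c unfolding \<gamma>_def by blast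
    from field_vector_diff_chain_at[OF d\<tau> d(1)]
    have "vector_derivative (coord c \<circ> \<gamma>) (at t) = of_real (s * 2 * pi) * \<i> * \<tau> t * d"
      by (intro vector_derivative_at) (simp add: o_def \<gamma>_def)
    then have v: "velocity \<gamma> t c = of_real (s * 2 * pi) * \<i> * \<tau> t * d" by (simp add: velocity_def)
    have n: "cmod (velocity \<gamma> t c) = 2 * pi * q * cmod d" unfolding v using s q by (auto simp: norm_mult \<tau>_def)
    have "tangent_inner Y (\<gamma> t) (velocity \<gamma> t) (velocity \<gamma> t) = (density Y c (coord c (\<gamma> t)) * cmod (velocity \<gamma> t c))\<^sup>2"
      by (simp add: tangent_inner_def Let_def c_def[symmetric] power_mult_distrib power2_norm_eq_inner)
    moreover have "density Y c (coord c (\<gamma> t)) \<ge> 0"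
      using less_imp_le[OF density_pos[OF charts_atD(1)[OF c] imageI[OF charts_atD(2)[OF c]]]] .
    ultimately have "speed Y \<gamma> t = density Y c (coord c (\<gamma> t)) * cmod (velocity \<gamma> t c)" by (simp add: speed_def)
    also have "\<dots> = 2 * pi * q * (density Y c (coord c (\<Phi> (\<tau> t))) * cmod d)" by (simp add: n \<gamma>_def)
    also have "\<dots> = 2 * pi * (q * disc_density (of_real q))" unfolding d(2) by (simp add: disc_density_def \<tau>_def norm_mult)
    finally show ?thesis .
  qed
  define g where "g y = f (\<Phi> (of_real q * cis y))" for y
  have "continuous_on UNIV (\<lambda>y. \<Phi> (of_real q * cis y))"
    by (rule continuous_on_compose2[OF local_isometryD(3)[OF \<Phi>(1)]]) (use q in \<open>auto intro!: continuous_intros simp: norm_mult\<close>)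
  then have cg: "continuous_on UNIV g" unfolding g_def by (rule continuous_on_compose2[OF f]) auto
  have "line_integral Y \<gamma> f = integral {0..1} (\<lambda>t. g (b + s * (2 * pi * t)) * (2 * pi * (q * disc_density (of_real q))))"
    by (simp add: line_integral_def sp g_def \<gamma>_def \<tau>_def)
  also have "\<dots> = integral {0..1} (\<lambda>t. g (b + s * (2 * pi * t))) * (2 * pi * (q * disc_density (of_real q)))"
    by (rule integral_mult_left)
  also have "integral {0..1} (\<lambda>t. g (b + s * (2 * pi * t))) = integral {0..2*pi} g / (2 * pi)"
  proof (rule integral_full_period[OF cg _ s])
    have "cis (y + 2 * pi) = cis y" for y by (simp add: complex_eq_iff)
    then show "g (y + 2 * pi) = g y" for y by (simp add: g_def)
  qed
  finally show ?thesis unfolding \<gamma> by (simp add: g_def[abs_def] q_def)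
qed

end

section \<open>Comparison of measures under a local isometry\<close>

lemma emeasure_lborel_square:
  fixes u v :: complex
  assumes "s \<ge> 0" "Re v - Re u = s" "Im v - Im u = s"
  shows "emeasure lborel (cbox u v) = ennreal (s\<^sup>2)" "emeasure lborel (box u v) = ennreal (s\<^sup>2)"
proof -
  have "Re u \<le> Re v" "Im u \<le> Im v" using assms by auto
  then have le: "\<And>b. b \<in> Basis \<Longrightarrow> u \<bullet> b \<le> v \<bullet> b" by (auto simp: Basis_complex_def)
  have p: "(\<Prod>b\<in>Basis. (v - u) \<bullet> b) = s\<^sup>2" using assms by (simp add: Basis_complex_def power2_eq_square)
  show "emeasure lborel (cbox u v) = ennreal (s\<^sup>2)" "emeasure lborel (box u v) = ennreal (s\<^sup>2)"
    using emeasure_lborel_cbox[OF le] emeasure_lborel_box[OF le] unfolding p by blast+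
qed

text \<open>Dyadic squares with disjoint interiors cover \<open>T\<close> inside an open set of
  barely larger measure. The part of \<open>T\<close> in a square of side \<open>s\<close> has its
  image in a box of side \<open>4 * L * s\<close>, whence the 16. Stating the bound for a subset
  \<open>P\<close> of the image avoids the question whether the image is measurable; a non-Borel
  \<open>P\<close> has \<open>emeasure\<close> 0 by convention.\<close>

lemma lipschitz_image_emeasure:
  fixes f :: "complex \<Rightarrow> complex"
  assumes T: "T \<in> sets borel" "T \<subseteq> cbox a b" and sq: "side > 0" "Re b - Re a = side" "Im b - Im a = side"
    and L: "L \<ge> 0" and lip: "\<And>x y. x \<in> T \<Longrightarrow> y \<in> T \<Longrightarrow> cmod (f x - f y) \<le> L * cmod (x - y)"
    and P: "P \<subseteq> f ` T"
  shows "emeasure lborel P \<le> ennreal (16 * L\<^sup>2) * emeasure lborel T"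
proof (cases "P \<in> sets borel")
  case True
  show ?thesis
  proof (rule ennreal_le_epsilon)
    fix e :: real assume e: "0 < e"
    define e' where "e' = e / (16 * L\<^sup>2 + 1)"
    have e': "e' > 0" using e by (simp add: e'_def add_nonneg_pos)
    obtain U where U: "open U" "T \<subseteq> U" "emeasure lborel (U - T) \<le> e'" using outer_regular_lborel_le[OF T(1) e'] by metis
    \<comment> \<open>This gauge forces every square of the covering to stay inside
      \<open>U\<close>, since its tag belongs to \<open>T\<close>.\<close>
    define g where "g x = (if x \<in> U then U else UNIV)" for x
    have "gauge g" using U(1) by (auto simp: gauge_def g_def)
    have ne: "box a b \<noteq> {}"
    proof -
      have "\<forall>i\<in>Basis. a \<bullet> i < b \<bullet> i" using sq by (auto simp: Basis_complex_def)
      then show ?thesis by (simp add: box_ne_empty)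
    qed
    obtain \<D> where D: "countable \<D>" "\<And>K. K \<in> \<D> \<Longrightarrow> interior K \<noteq> {} \<and> (\<exists>c d. K = cbox c d)"
      "pairwise (\<lambda>A B. interior A \<inter> interior B = {}) \<D>" "\<And>K. K \<in> \<D> \<Longrightarrow> \<exists>x \<in> T \<inter> K. K \<subseteq> g x"
      "\<And>u v. cbox u v \<in> \<D> \<Longrightarrow> \<exists>n. \<forall>i \<in> Basis. v \<bullet> i - u \<bullet> i = (b \<bullet> i - a \<bullet> i) / 2^n" "T \<subseteq> \<Union>\<D>"
      using covering_lemma[OF T(2) ne \<open>gauge g\<close>] by (metis (no_types, lifting))
    have KU: "K \<subseteq> U" if K: "K \<in> \<D>" for K
    proof -
      obtain x where "x \<in> T" "K \<subseteq> g x" using D(4)[OF K] by blast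
      moreover from this have "x \<in> U" using U(2) by blast
      ultimately show ?thesis by (simp add: g_def)
    qed
    have "\<exists>S. S \<in> sets borel \<and> f ` (T \<inter> K) \<subseteq> S \<and> emeasure lborel S \<le> ennreal (16 * L\<^sup>2) * emeasure lborel (interior K)" if K: "K \<in> \<D>" for K
    proof -
      obtain u v where uv: "K = cbox u v" using D(2)[OF K] by blast
      obtain n where n: "\<forall>i \<in> Basis. v \<bullet> i - u \<bullet> i = (b \<bullet> i - a \<bullet> i) / 2^n" using D(5) K uv by blast
      define s where "s = side / 2 ^ n"
      have s: "s > 0" "Re v - Re u = s" "Im v - Im u = s" using n sq by (auto simp: s_def Basis_complex_def)
      have mK: "emeasure lborel (interior K) = ennreal (s\<^sup>2)"
        unfolding uv interior_cbox using emeasure_lborel_square(2)[of s v u] s by simp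
      obtain x where x: "x \<in> T" "x \<in> K" using D(4)[OF K] by blast
      define r where "r = L * (2 * s)"
      have r: "r \<ge> 0" using L s by (simp add: r_def)
      define S where "S = cbox (f x - Complex r r) (f x + Complex r r)"
      have "f ` (T \<inter> K) \<subseteq> S"
      proof
        fix w assume "w \<in> f ` (T \<inter> K)"
        then obtain y where y: "y \<in> T" "y \<in> K" "w = f y" by blast
        have "cmod (y - x) \<le> \<bar>Re (y - x)\<bar> + \<bar>Im (y - x)\<bar>" by (rule cmod_le)
        also have "\<dots> \<le> 2 * s" using x(2) y(2) s unfolding uv by (auto simp: in_cbox_complex_iff)
        finally have "cmod (w - f x) \<le> r" using lip[OF y(1) x(1)] L mult_left_mono[of "cmod (y - x)" "2 * s" L] y(3) by (simp add: r_def)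
        then have "\<bar>Re (w - f x)\<bar> \<le> r" "\<bar>Im (w - f x)\<bar> \<le> r" using abs_Re_le_cmod abs_Im_le_cmod order_trans by blast+
        then show "w \<in> S" by (auto simp: S_def in_cbox_complex_iff)
      qed
      moreover have "emeasure lborel S = ennreal ((2 * r)\<^sup>2)"
        unfolding S_def using r by (intro emeasure_lborel_square) auto
      moreover have "ennreal ((2 * r)\<^sup>2) = ennreal (16 * L\<^sup>2) * ennreal (s\<^sup>2)"
        by (simp add: r_def power_mult_distrib flip: ennreal_mult')
      ultimately show ?thesis using mK by (intro exI[of _ S]) (auto simp: S_def)
    qed
    then obtain S where S: "\<And>K. K \<in> \<D> \<Longrightarrow> S K \<in> sets borel" "\<And>K. K \<in> \<D> \<Longrightarrow> f ` (T \<inter> K) \<subseteq> S K"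
      "\<And>K. K \<in> \<D> \<Longrightarrow> emeasure lborel (S K) \<le> ennreal (16 * L\<^sup>2) * emeasure lborel (interior K)" by metis
    \<comment> \<open>The countable family, possibly finite, becomes a sequence padded with empty
      sets.\<close>
    define idx where "idx = to_nat_on \<D>"
    have inj: "inj_on idx \<D>" unfolding idx_def by (rule inj_on_to_nat_on[OF D(1)])
    define I where "I n = (if n \<in> idx ` \<D> then interior (inv_into \<D> idx n) else {})" for n
    define J where "J n = (if n \<in> idx ` \<D> then S (inv_into \<D> idx n) else {})" for n
    have inv: "inv_into \<D> idx n \<in> \<D>" if "n \<in> idx ` \<D>" for n using that by (rule inv_into_into)
    have Im: "I n \<in> sets borel" for n by (auto simp: I_def)
    have Jm: "J n \<in> sets borel" for n using S(1) inv by (auto simp: J_def)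
    have JI: "emeasure lborel (J n) \<le> ennreal (16 * L\<^sup>2) * emeasure lborel (I n)" for n
      using S(3)[OF inv, of n] by (auto simp: I_def J_def)
    have disj: "disjoint_family I"
      unfolding disjoint_family_on_def
    proof (intro ballI impI)
      fix m n :: nat assume "m \<noteq> n"
      show "I m \<inter> I n = {}"
      proof (cases "m \<in> idx ` \<D> \<and> n \<in> idx ` \<D>")
        case True
        then have "inv_into \<D> idx m \<noteq> inv_into \<D> idx n" using \<open>m \<noteq> n\<close> by (metis f_inv_into_f)
        then show ?thesis using D(3) inv True unfolding pairwise_def I_def by auto
      qed (auto simp: I_def)
    qed
    have "P \<subseteq> (\<Union>n. J n)"
    proof
      fix w assume "w \<in> P"
      then obtain y where y: "y \<in> T" "w = f y" using P by blast
      then obtain K where K: "K \<in> \<D>" "y \<in> K" using D(6) by blast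
      then have "w \<in> S K" using S(2)[OF K(1)] y by blast
      moreover have "J (idx K) = S K" using K inj by (simp add: J_def)
      ultimately show "w \<in> (\<Union>n. J n)" by blast
    qed
    then have "emeasure lborel P \<le> emeasure lborel (\<Union>n. J n)" using Jm by (intro emeasure_mono) auto
    also have "\<dots> \<le> (\<Sum>n. emeasure lborel (J n))" by (rule emeasure_subadditive_countably) (use Jm in auto)
    also have "\<dots> \<le> (\<Sum>n. ennreal (16 * L\<^sup>2) * emeasure lborel (I n))" by (intro suminf_le JI) auto
    also have "\<dots> = ennreal (16 * L\<^sup>2) * (\<Sum>n. emeasure lborel (I n))" by simp
    also have "(\<Sum>n. emeasure lborel (I n)) = emeasure lborel (\<Union>n. I n)" by (rule suminf_emeasure) (use Im disj in auto)
    also have "emeasure lborel (\<Union>n. I n) \<le> emeasure lborel U"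
    proof (rule emeasure_mono)
      have "I n \<subseteq> U" for n
        using KU[OF inv, of n] interior_subset[of "inv_into \<D> idx n"] by (auto simp: I_def)
      then show "(\<Union>n. I n) \<subseteq> U" by blast
    qed (use U(1) in simp)
    also have "emeasure lborel U = emeasure lborel T + emeasure lborel (U - T)"
      using plus_emeasure[of T lborel "U - T"] T(1) U by (simp add: Un_absorb1 borel_open)
    also have "\<dots> \<le> emeasure lborel T + e'" using U(3) by (intro add_left_mono)
    also have "ennreal (16 * L\<^sup>2) * (emeasure lborel T + e') = ennreal (16 * L\<^sup>2) * emeasure lborel T + ennreal (16 * L\<^sup>2 * e')"
      using e' by (simp add: distrib_left ennreal_mult)
    also have "\<dots> \<le> ennreal (16 * L\<^sup>2) * emeasure lborel T + ennreal e"
    proof -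
      have "16 * L\<^sup>2 * e' \<le> (16 * L\<^sup>2 + 1) * e'" using e' by (intro mult_right_mono) auto
      also have "\<dots> = e" using add_nonneg_pos[of "16 * L\<^sup>2" 1] by (simp add: e'_def)
      finally show ?thesis by (intro add_left_mono ennreal_leI)
    qed
    finally show "emeasure lborel P \<le> ennreal (16 * L\<^sup>2) * emeasure lborel T + ennreal e" by (simp add: mult_left_mono)
  qed
qed (simp add: emeasure_notin_sets)

lemma lborel_complex_eq: "lborel = distr (lborel :: (real \<times> real) measure) borel (\<lambda>(x, y). Complex x y)"
proof (rule lborel_eqI)
  have m: "(\<lambda>(x, y). Complex x y) \<in> borel_measurable borel"
    unfolding split_beta by (intro borel_measurable_continuous_onI continuous_intros)
  fix l u :: complex assume lu: "\<And>b. b \<in> Basis \<Longrightarrow> l \<bullet> b \<le> u \<bullet> b"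
  have le: "Re l \<le> Re u" "Im l \<le> Im u" using lu[of 1] lu[of \<i>] by (auto simp: Basis_complex_def)
  have "(\<lambda>(x, y). Complex x y) -` box l u \<inter> space borel = box (Re l, Im l) (Re u, Im u)"
    by (auto simp: in_box_complex_iff mem_box Basis_prod_def)
  then have "emeasure (distr lborel borel (\<lambda>(x, y). Complex x y)) (box l u) = emeasure lborel (box (Re l, Im l) (Re u, Im u))"
    using m by (subst emeasure_distr) auto
  also have "\<dots> = (\<Prod>b\<in>Basis. ((Re u, Im u) - (Re l, Im l)) \<bullet> b)"
    by (rule emeasure_lborel_box) (use le in \<open>auto simp: Basis_prod_def\<close>)
  also have "(\<Prod>b\<in>Basis. ((Re u, Im u) - (Re l, Im l)) \<bullet> b) = (\<Prod>b\<in>Basis. (u - l) \<bullet> b)"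
    by (simp add: Basis_prod_def Basis_complex_def prod.union_disjoint)
  finally show "emeasure (distr lborel borel (\<lambda>(x, y). Complex x y)) (box l u) = (\<Prod>b\<in>Basis. (u - l) \<bullet> b)" .
qed simp

text \<open>A bridge between the integral on the plane, in which volumes are expressed, and the
  iterated integrals over radius and angle of the Fourier argument.\<close>

lemma nn_integral_rectangle:
  fixes g :: "complex \<Rightarrow> real"
  assumes g: "continuous_on (cbox (Complex a c) (Complex b d)) g" "\<And>z. z \<in> cbox (Complex a c) (Complex b d) \<Longrightarrow> g z \<ge> 0"
  shows "(\<integral>\<^sup>+z. ennreal (g z) * indicator (cbox (Complex a c) (Complex b d)) z \<partial>lborel) =
    ennreal (integral {a..b} (\<lambda>x. integral {c..d} (\<lambda>y. g (Complex x y))))"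
proof -
  let ?K = "cbox (Complex a c) (Complex b d)"
  have m: "(\<lambda>(x, y). Complex x y) \<in> borel_measurable borel"
    unfolding split_beta by (intro borel_measurable_continuous_onI continuous_intros)
  have K: "Complex (fst p) (snd p) \<in> ?K \<longleftrightarrow> p \<in> cbox (a, c) (b, d)" for p
    by (cases p) (auto simp: in_cbox_complex_iff mem_box Basis_prod_def)
  have "(\<lambda>z. indicator ?K z *\<^sub>R g z) \<in> borel_measurable borel"
    using borel_measurable_continuous_on_indicator[of ?K g] g(1) by auto
  then have "(\<lambda>z. ennreal (indicator ?K z *\<^sub>R g z)) \<in> borel_measurable borel" by simp
  then have gm: "(\<lambda>z. ennreal (g z) * indicator ?K z) \<in> borel_measurable borel"
    by (rule measurable_cong[THEN iffD1, rotated]) (auto split: split_indicator)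
  have cg: "continuous_on (cbox (a, c) (b, d)) (\<lambda>p. g (Complex (fst p) (snd p)))"
  proof (rule continuous_on_compose2[OF g(1)])
    show "(\<lambda>p. Complex (fst p) (snd p)) ` cbox (a, c) (b, d) \<subseteq> ?K" using K by blast
  qed (intro continuous_intros)
  have "(\<integral>\<^sup>+z. ennreal (g z) * indicator ?K z \<partial>lborel) =
     (\<integral>\<^sup>+p. ennreal (g (Complex (fst p) (snd p))) * indicator ?K (Complex (fst p) (snd p)) \<partial>lborel)"
    by (subst lborel_complex_eq, subst nn_integral_distr) (use m gm in \<open>auto simp: split_beta\<close>)
  also have "\<dots> = (\<integral>\<^sup>+p. ennreal (g (Complex (fst p) (snd p))) * indicator (cbox (a, c) (b, d)) p \<partial>lborel)"
    by (intro nn_integral_cong) (simp add: K indicator_def)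
  also have "\<dots> = ennreal (integral (cbox (a, c) (b, d)) (\<lambda>p. g (Complex (fst p) (snd p))))"
    by (rule nn_integral_has_integral_lebesgue'[OF _ integrable_integral[OF integrable_continuous[OF cg]]]) (use g(2) K in auto)
  also have "integral (cbox (a, c) (b, d)) (\<lambda>p. g (Complex (fst p) (snd p))) = integral {a..b} (\<lambda>x. integral {c..d} (\<lambda>y. g (Complex x y)))"
    using integral_prod_continuous[OF cg] by simp
  finally show ?thesis .
qed

context compact_hyperbolic_surface
begin

section \<open>Lebesgue measure of preimages against the Riemannian volume\<close>

text \<open>In a chart \<Psi> is a local biholomorphism \<open>h\<close> with Lipschitz inverse
  \<open>k\<close>. The measure of a preimage is controlled by that of the coordinate image, and the
  latter by \<open>dv\<close> because the density is bounded below near \<open>p\<close>.\<close>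

lemma pullback_emeasure_local:
  assumes dv: "volume_measure Y dv" and H: "open H" "w0 \<in> H" and \<Psi>: "continuous_on H \<Psi>"
    and hol: "\<And>w c. w \<in> H \<Longrightarrow> c \<in> charts_at Y (\<Psi> w) \<Longrightarrow> \<exists>d. d \<noteq> 0 \<and> ((\<lambda>z. coord c (\<Psi> z)) has_field_derivative d) (at w)"
  shows "\<exists>\<epsilon>>0. \<exists>C. ball w0 \<epsilon> \<subseteq> H \<and> (\<forall>E\<in>sets borel. emeasure lborel (\<Psi> -` E \<inter> ball w0 \<epsilon>) \<le> ennreal C * emeasure dv E)"
proof -
  obtain c where c: "c \<in> charts_at Y (\<Psi> w0)" using charts_at_nonempty by blast
  note ca = charts_atD[OF c]
  define h where "h w = coord c (\<Psi> w)" for w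
  obtain e where e: "e > 0" "ball w0 e \<subseteq> H" "\<Psi> ` ball w0 e \<subseteq> chart_dom c" using chart_nbhd[OF H(1) \<Psi> H(2) c] by blast
  have dh: "\<exists>d. d \<noteq> 0 \<and> (h has_field_derivative d) (at w)" if "w \<in> ball w0 e" for w
    using hol[of w c] charts_atI[OF ca(1)] e that unfolding h_def by blast
  then have hh: "h holomorphic_on ball w0 e"
    by (meson holomorphic_on_def field_differentiable_def field_differentiable_at_within)
  have "deriv h w0 \<noteq> 0" using dh[of w0] e(1) DERIV_imp_deriv by force
  then obtain r where r: "r > 0" "ball w0 r \<subseteq> ball w0 e" "open (h ` ball w0 r)" "inj_on h (ball w0 r)"
    using has_complex_derivative_locally_invertible[OF hh _ open_ball] e(1) by (metis centre_in_ball)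
  have hr: "h holomorphic_on ball w0 r" using hh r(2) by (rule holomorphic_on_subset)
  obtain k where k: "k holomorphic_on h ` ball w0 r" "\<And>z. z \<in> ball w0 r \<Longrightarrow> k (h z) = z"
    using holomorphic_has_inverse[OF hr open_ball r(4)] by metis
  define p where "p = h w0"
  have p: "p \<in> h ` ball w0 r" using r(1) by (simp add: p_def)
  then obtain s where s: "s > 0" "cball p s \<subseteq> h ` ball w0 r" using r(3) open_contains_cball by blast
  have "continuous_on (cball p s) (deriv k)"
    using holomorphic_on_imp_continuous_on[OF holomorphic_deriv[OF k(1) r(3)]] s(2) continuous_on_subset by blast
  then have "bounded (deriv k ` cball p s)" by (intro compact_imp_bounded compact_continuous_image) auto
  then obtain L where L: "\<And>z. z \<in> cball p s \<Longrightarrow> cmod (deriv k z) \<le> L" unfolding bounded_iff ball_simps by blast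
  have "p \<in> cball p s" using s(1) by simp
  from order_trans[OF norm_ge_zero L[OF this]] have L0: "L \<ge> 0" .
  have lip: "cmod (k x - k y) \<le> L * cmod (x - y)" if "x \<in> cball p s" "y \<in> cball p s" for x y
  proof (rule field_differentiable_bound[OF convex_cball _ L that])
    fix z assume "z \<in> cball p s"
    then have "z \<in> h ` ball w0 r" using s(2) by blast
    then show "(k has_field_derivative deriv k z) (at z within cball p s)"
      by (rule has_field_derivative_at_within[OF holomorphic_derivI[OF k(1) r(3)]])
  qed
  define \<rho> where "\<rho> = density Y c"
  have "h ` ball w0 r \<subseteq> chart_im c" using r(2) e(3) unfolding h_def by blast
  then have ps: "cball p s \<subseteq> chart_im c" using s(2) by blast
  interpret hyperbolic_density "chart_im c" \<rho> unfolding \<rho>_def by (rule hyperbolic_density[OF ca(1)])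
  have c\<rho>: "continuous_on (chart_im c) \<rho>" using smooth Ck_on_imp_continuous by (auto simp: smooth_on_def)
  have pc: "p \<in> cball p s" using s(1) by simp
  then have \<rho>p: "\<rho> p > 0" using pos ps by blast
  obtain m where m: "m > 0" "\<And>z. z \<in> cball p s \<Longrightarrow> m \<le> \<rho> z"
  proof -
    have "continuous_on (cball p s) \<rho>" using c\<rho> ps continuous_on_subset by blast
    from continuous_attains_inf[OF compact_cball _ this] pc obtain z where "z \<in> cball p s" "\<forall>y\<in>cball p s. \<rho> z \<le> \<rho> y" by blast
    then show ?thesis using that[of "\<rho> z"] pos ps by blast
  qed
  have "open (ball w0 r \<inter> h -` ball p s)"
    by (rule continuous_open_preimage[OF holomorphic_on_imp_continuous_on[OF hr]]) auto
  moreover have "w0 \<in> ball w0 r \<inter> h -` ball p s" using r(1) s(1) by (simp add: p_def)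
  ultimately obtain \<epsilon> where \<epsilon>: "\<epsilon> > 0" "ball w0 \<epsilon> \<subseteq> ball w0 r \<inter> h -` ball p s" by (rule openE)
  define V where "V = h ` ball w0 \<epsilon>"
  have "V = h ` ball w0 r \<inter> k -` ball w0 \<epsilon>" using \<epsilon>(2) k(2) unfolding V_def by auto
  then have oV: "open V" using continuous_open_preimage[OF holomorphic_on_imp_continuous_on[OF k(1)] r(3) open_ball] by simp
  have Vs: "V \<subseteq> cball p s" using \<epsilon>(2) by (auto simp: V_def)
  have Vim: "V \<subseteq> chart_im c" using Vs ps by blast
  define N where "N = chart_dom c \<inter> coord c -` V"
  have oN: "open N" unfolding N_def by (rule continuous_open_preimage[OF continuous_coord[OF ca(1)] open_dom[OF ca(1)] oV])
  have sq: "T \<subseteq> cbox (p - Complex s s) (p + Complex s s)" if "T \<subseteq> cball p s" for T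
  proof
    fix z assume "z \<in> T"
    then have "cmod (z - p) \<le> s" using that by (auto simp: dist_norm norm_minus_commute)
    then have "\<bar>Re (z - p)\<bar> \<le> s" "\<bar>Im (z - p)\<bar> \<le> s" using abs_Re_le_cmod abs_Im_le_cmod order_trans by blast+
    then show "z \<in> cbox (p - Complex s s) (p + Complex s s)" by (auto simp: in_cbox_complex_iff)
  qed
  have main: "emeasure lborel (\<Psi> -` E \<inter> ball w0 \<epsilon>) \<le> ennreal (16 * L\<^sup>2 / m\<^sup>2) * emeasure dv E" if E: "E \<in> sets borel" for E
  proof -
    define T where "T = param c -` E \<inter> V"
    have "param c \<in> borel_measurable (restrict_space borel V)"
      by (intro borel_measurable_continuous_on_restrict continuous_on_subset[OF continuous_param[OF ca(1)] Vim])
    from measurable_sets[OF this E] have "T \<in> sets (restrict_space borel V)" by (simp add: T_def space_restrict_space)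
    then have Tb: "T \<in> sets borel" using oV by (simp add: sets_restrict_space_iff)
    have Ts: "T \<subseteq> cball p s" using Vs by (auto simp: T_def)
    have PT: "\<Psi> -` E \<inter> ball w0 \<epsilon> \<subseteq> k ` T"
    proof
      fix w assume w: "w \<in> \<Psi> -` E \<inter> ball w0 \<epsilon>"
      have wr: "w \<in> ball w0 r" using w \<epsilon>(2) by auto
      have "\<Psi> w \<in> chart_dom c" using wr r(2) e(3) by blast
      then have "param c (h w) = \<Psi> w" using param_coord[OF ca(1)] by (simp add: h_def)
      then have "h w \<in> T" using w by (auto simp: T_def V_def)
      then show "w \<in> k ` T" using k(2)[OF wr] by (metis imageI)
    qed
    have 1: "emeasure lborel (\<Psi> -` E \<inter> ball w0 \<epsilon>) \<le> ennreal (16 * L\<^sup>2) * emeasure lborel T"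
    proof -
      have lipT: "cmod (k x - k y) \<le> L * cmod (x - y)" if "x \<in> T" "y \<in> T" for x y using lip Ts that by blast
      show ?thesis
        by (rule lipschitz_image_emeasure[OF Tb sq[OF Ts], of "2 * s"]) (use s(1) L0 PT in \<open>auto intro: lipT\<close>)
    qed
    \<comment> \<open>\<open>volume_measure\<close> describes \<open>dv\<close> by the density only
      on Borel sets within one chart, hence the restriction to \<open>N\<close>.\<close>
    have EN: "E \<inter> N \<in> sets borel" using E oN by auto
    have img: "coord c ` (E \<inter> N) = T"
    proof (intro equalityI subsetI)
      fix z assume z: "z \<in> T"
      then have zi: "z \<in> chart_im c" using Vim by (auto simp: T_def)
      have "param c z \<in> E \<inter> N" using z zi param_in_dom[OF ca(1) zi] coord_param[OF ca(1) zi] by (auto simp: T_def N_def)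
      then show "z \<in> coord c ` (E \<inter> N)" using coord_param[OF ca(1) zi] by (metis imageI)
    qed (use param_coord[OF ca(1)] in \<open>auto simp: T_def N_def\<close>)
    have "ennreal (m\<^sup>2) * emeasure lborel T = (\<integral>\<^sup>+z. ennreal (m\<^sup>2) * indicator T z \<partial>lborel)"
      using Tb by (simp add: nn_integral_cmult_indicator)
    also have "\<dots> \<le> (\<integral>\<^sup>+z. ennreal ((density Y c z)\<^sup>2) * indicator (coord c ` (E \<inter> N)) z \<partial>lborel)"
      unfolding img
    proof (rule nn_integral_mono)
      fix z :: complex
      show "ennreal (m\<^sup>2) * indicator T z \<le> ennreal ((density Y c z)\<^sup>2) * indicator T z"
        using m Ts by (auto split: split_indicator intro!: ennreal_leI power_mono simp: \<rho>_def[symmetric])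
    qed
    also have "\<dots> = emeasure dv (E \<inter> N)"
    proof -
      have "\<forall>B\<in>sets borel. B \<subseteq> chart_dom c \<longrightarrow> emeasure dv B = (\<integral>\<^sup>+ z. ennreal ((density Y c z)\<^sup>2) * indicator (coord c ` B) z \<partial>lborel)"
        using dv ca(1) unfolding volume_measure_def by blast
      moreover have "E \<inter> N \<subseteq> chart_dom c" by (auto simp: N_def)
      ultimately have "emeasure dv (E \<inter> N) = (\<integral>\<^sup>+ z. ennreal ((density Y c z)\<^sup>2) * indicator (coord c ` (E \<inter> N)) z \<partial>lborel)"
        using EN by blast
      then show ?thesis by (rule sym)
    qed
    also have "\<dots> \<le> emeasure dv E" using E dv by (intro emeasure_mono) (auto simp: volume_measure_def)
    finally have 2: "ennreal (m\<^sup>2) * emeasure lborel T \<le> emeasure dv E" .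
    have "ennreal (16 * L\<^sup>2) * emeasure lborel T = ennreal (16 * L\<^sup>2 / m\<^sup>2) * (ennreal (m\<^sup>2) * emeasure lborel T)"
      using m(1) by (simp add: mult.assoc[symmetric] flip: ennreal_mult')
    also have "\<dots> \<le> ennreal (16 * L\<^sup>2 / m\<^sup>2) * emeasure dv E" using 2 by (intro mult_left_mono) auto
    finally show ?thesis using 1 by order
  qed
  have "ball w0 \<epsilon> \<subseteq> H" using \<epsilon>(2) r(2) e(2) by blast
  with main \<epsilon>(1) show ?thesis by blast
qed

text \<open>\<Psi> may hit a point of \<open>Y\<close> many times; summing the local bounds over a
  finite cover of \<open>K\<close> absorbs this multiplicity in the constant.\<close>

lemma pullback_emeasure_compact:
  assumes dv: "volume_measure Y dv" and H: "open H" "K \<subseteq> H" "compact K" and \<Psi>: "continuous_on H \<Psi>"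
    and hol: "\<And>w c. w \<in> H \<Longrightarrow> c \<in> charts_at Y (\<Psi> w) \<Longrightarrow> \<exists>d. d \<noteq> 0 \<and> ((\<lambda>z. coord c (\<Psi> z)) has_field_derivative d) (at w)"
  obtains C where "C > 0" "\<And>E. E \<in> sets borel \<Longrightarrow> emeasure lborel (\<Psi> -` E \<inter> K) \<le> ennreal C * emeasure dv E"
proof -
  have "\<forall>w\<in>K. \<exists>\<epsilon> C. \<epsilon> > 0 \<and> ball w \<epsilon> \<subseteq> H \<and> (\<forall>E\<in>sets borel. emeasure lborel (\<Psi> -` E \<inter> ball w \<epsilon>) \<le> ennreal C * emeasure dv E)"
    using pullback_emeasure_local[OF dv H(1) _ \<Psi> hol] H(2) by blast
  then obtain \<epsilon> C where \<epsilon>: "\<And>w. w \<in> K \<Longrightarrow> \<epsilon> w > 0" "\<And>w. w \<in> K \<Longrightarrow> ball w (\<epsilon> w) \<subseteq> H"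
    "\<And>w E. w \<in> K \<Longrightarrow> E \<in> sets borel \<Longrightarrow> emeasure lborel (\<Psi> -` E \<inter> ball w (\<epsilon> w)) \<le> ennreal (C w) * emeasure dv E" by metis
  have "K \<subseteq> (\<Union>w\<in>K. ball w (\<epsilon> w))" using \<epsilon>(1) by auto
  then obtain F where F: "F \<subseteq> K" "finite F" "K \<subseteq> (\<Union>w\<in>F. ball w (\<epsilon> w))"
    using compactE_image[OF H(3), of K "\<lambda>w. ball w (\<epsilon> w)"] by auto
  \<comment> \<open>The local constants are arbitrary reals; truncation at 0 and the added 1 make
    the total positive.\<close>
  define D where "D = (\<Sum>w\<in>F. max 0 (C w)) + 1"
  show ?thesis
  proof (rule that[of D])
    show "D > 0" unfolding D_def by (intro add_nonneg_pos sum_nonneg) auto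
    fix E :: "'a set" assume E: "E \<in> sets borel"
    have meas: "\<Psi> -` E \<inter> ball w (\<epsilon> w) \<in> sets lborel" if "w \<in> K" for w
    proof -
      have "\<Psi> \<in> borel_measurable (restrict_space borel (ball w (\<epsilon> w)))"
        by (intro borel_measurable_continuous_on_restrict continuous_on_subset[OF \<Psi> \<epsilon>(2)] that)
      from measurable_sets[OF this E] show ?thesis by (simp add: space_restrict_space sets_restrict_space_iff)
    qed
    have "emeasure lborel (\<Psi> -` E \<inter> K) \<le> emeasure lborel (\<Union>w\<in>F. \<Psi> -` E \<inter> ball w (\<epsilon> w))"
      using F meas by (intro emeasure_mono sets.finite_UN) auto
    also have "\<dots> \<le> (\<Sum>w\<in>F. emeasure lborel (\<Psi> -` E \<inter> ball w (\<epsilon> w)))"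
      using F meas by (intro emeasure_subadditive_finite) auto
    also have "\<dots> \<le> (\<Sum>w\<in>F. ennreal (max 0 (C w)) * emeasure dv E)"
      using F \<epsilon>(3)[OF _ E] by (intro sum_mono order_trans[OF \<epsilon>(3)[OF _ E] mult_right_mono]) (auto intro: ennreal_leI)
    also have "\<dots> = ennreal (\<Sum>w\<in>F. max 0 (C w)) * emeasure dv E"
      by (simp add: sum_distrib_right[symmetric] sum_ennreal)
    also have "\<dots> \<le> ennreal D * emeasure dv E" by (intro mult_right_mono ennreal_leI) (auto simp: D_def)
    finally show "emeasure lborel (\<Psi> -` E \<inter> K) \<le> ennreal D * emeasure dv E" .
  qed
qed

text \<open>The passage from sets to functions goes through the image under \<Psi> of Lebesgue
  measure on \<open>K\<close>, which is dominated by a multiple of \<open>dv\<close>.\<close>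

lemma pullback_nn_integral:
  assumes dv: "volume_measure Y dv" and H: "open H" "K \<subseteq> H" "compact K" and \<Psi>: "continuous_on H \<Psi>"
    and hol: "\<And>w c. w \<in> H \<Longrightarrow> c \<in> charts_at Y (\<Psi> w) \<Longrightarrow> \<exists>d. d \<noteq> 0 \<and> ((\<lambda>z. coord c (\<Psi> z)) has_field_derivative d) (at w)"
  obtains C where "C > 0" "\<And>g. g \<in> borel_measurable borel \<Longrightarrow>
    (\<integral>\<^sup>+w. g (\<Psi> w) * indicator K w \<partial>lborel) \<le> ennreal C * (\<integral>\<^sup>+q. g q \<partial>dv)"
proof -
  obtain C where C: "C > 0" "\<And>E. E \<in> sets borel \<Longrightarrow> emeasure lborel (\<Psi> -` E \<inter> K) \<le> ennreal C * emeasure dv E"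
    using pullback_emeasure_compact[OF assms] by blast
  have Kb: "K \<in> sets borel" using H(3) by (simp add: borel_compact)
  define M where "M = distr (restrict_space lborel K) borel \<Psi>"
  have \<Psi>m: "\<Psi> \<in> measurable (restrict_space lborel K) borel"
    using borel_measurable_continuous_on_restrict[OF continuous_on_subset[OF \<Psi> H(2)]]
    by (simp cong: measurable_cong_sets add: sets_restrict_space)
  have sdv: "sets dv = sets borel" using dv by (simp add: volume_measure_def)
  have "emeasure M E \<le> ennreal C * emeasure dv E" if E: "E \<in> sets borel" for E
    using emeasure_distr[OF \<Psi>m E] C(2)[OF E] Kb
    by (simp add: M_def space_restrict_space emeasure_restrict_space)
  then have "M \<le> scale_measure (ennreal C) dv"
    by (subst le_measure) (auto simp: M_def sdv)
  then have le: "(\<integral>\<^sup>+q. g q \<partial>M) \<le> (\<integral>\<^sup>+q. g q \<partial>scale_measure (ennreal C) dv)" for g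
    by (intro nn_integral_mono_measure) (auto simp: M_def sdv)
  show ?thesis
  proof (rule that[OF C(1)])
    fix g :: "'a \<Rightarrow> ennreal" assume g: "g \<in> borel_measurable borel"
    have "(\<integral>\<^sup>+w. g (\<Psi> w) * indicator K w \<partial>lborel) = (\<integral>\<^sup>+w. g (\<Psi> w) \<partial>restrict_space lborel K)"
      using Kb by (subst nn_integral_restrict_space) auto
    also have "\<dots> = (\<integral>\<^sup>+q. g q \<partial>M)" unfolding M_def using g \<Psi>m by (subst nn_integral_distr) auto
    also have "\<dots> \<le> (\<integral>\<^sup>+q. g q \<partial>scale_measure (ennreal C) dv)" by (rule le)
    also have "\<dots> = ennreal C * (\<integral>\<^sup>+q. g q \<partial>dv)"
      by (rule nn_integral_scale_measure) (use g sdv in \<open>simp cong: measurable_cong_sets\<close>)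
    finally show "(\<integral>\<^sup>+w. g (\<Psi> w) * indicator K w \<partial>lborel) \<le> ennreal C * (\<integral>\<^sup>+q. g q \<partial>dv)" .
  qed
qed

end

section \<open>A lower bound for the positive eigenvalues\<close>

lemma flat_laplacian_cong_open:
  assumes S: "open S" "z \<in> S" and eq: "\<And>w. w \<in> S \<Longrightarrow> f w = g w"
  shows "flat_laplacian f z = flat_laplacian g z"
  unfolding flat_laplacian_def
  using partial_cong_open(1)[OF S, of "partial_x f" "partial_x g", OF partial_cong_open(1)[OF S(1) _ eq]]
    partial_cong_open(2)[OF S, of "partial_y f" "partial_y g", OF partial_cong_open(2)[OF S(1) _ eq]] by simp

lemma flat_laplacian_linear:
  assumes S: "open S" "z \<in> S" and L: "bounded_linear L" and f: "Ck_on 2 S f"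
  shows "flat_laplacian (\<lambda>z. L (f z)) z = L (flat_laplacian f z)"
proof -
  have f2: "Ck_on (Suc (Suc 0)) S f" using f by (simp add: numeral_2_eq_2)
  have d: "\<And>w. w \<in> S \<Longrightarrow> f differentiable (at w)" "partial_x f differentiable (at z)" "partial_y f differentiable (at z)"
    using f2 S(2) by auto
  have "partial_x (partial_x (\<lambda>z. L (f z))) z = L (partial_x (partial_x f) z)"
    using partial_cong_open(1)[OF S, of "partial_x (\<lambda>z. L (f z))" "\<lambda>z. L (partial_x f z)", OF partial_linear(1)[OF L d(1)]]
      partial_linear(1)[OF L d(2)] by simp
  moreover have "partial_y (partial_y (\<lambda>z. L (f z))) z = L (partial_y (partial_y f) z)"
    using partial_cong_open(2)[OF S, of "partial_y (\<lambda>z. L (f z))" "\<lambda>z. L (partial_y f z)", OF partial_linear(2)[OF L d(1)]]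
      partial_linear(2)[OF L d(3)] by simp
  ultimately show ?thesis by (simp add: flat_laplacian_def linear_add[OF bounded_linear.linear[OF L]])
qed

lemma Ck_on_local:
  assumes "\<And>z. z \<in> S \<Longrightarrow> \<exists>V. open V \<and> z \<in> V \<and> Ck_on k V f"
  shows "Ck_on k S f"
  using assms
proof (induction k arbitrary: f)
  case 0
  have "isCont f z" if z: "z \<in> S" for z
  proof -
    obtain V where "open V" "z \<in> V" "continuous_on V f" using 0[OF z] by auto
    then show ?thesis by (simp add: continuous_on_eq_continuous_at)
  qed
  then show ?case by (simp add: continuous_at_imp_continuous_on)
next
  case (Suc k)
  have 1: "f differentiable (at z)" if z: "z \<in> S" for z using Suc.prems[OF z] by auto
  have 2: "Ck_on k S (partial_x f)" by (rule Suc.IH) (use Suc.prems in auto)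
  have 3: "Ck_on k S (partial_y f)" by (rule Suc.IH) (use Suc.prems in auto)
  show ?case using 1 2 3 by simp
qed

lemma cmod_cis_diff_le: "cmod (cis x - cis y) \<le> \<bar>x - y\<bar>"
proof -
  have "cmod (cis t - cis s) \<le> t - s" if "s \<le> t" for s t
  proof (rule norm_diff_le_of_deriv_le[OF that, of cis "\<lambda>x. \<i> * cis x" "\<lambda>x. x" "\<lambda>_. 1"])
    fix x :: real
    have "((\<lambda>z. exp (\<i> * z)) has_field_derivative \<i> * exp (\<i> * of_real x)) (at (of_real x))"
      by (auto intro!: derivative_eq_intros)
    from has_vector_derivative_real_field[OF this] show "(cis has_vector_derivative \<i> * cis x) (at x)"
      by (simp add: cis_conv_exp[symmetric])
  qed (auto simp: norm_mult)
  from this[of x y] this[of y x] show ?thesis by (cases "x \<le> y") (auto simp: norm_minus_commute)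
qed

lemma integral_Re_fourier_0:
  assumes "continuous_on {0..2*pi} g"
  shows "((\<lambda>y. Re (g y)) has_integral Re (fourier 0 g)) {0..2*pi}"
  unfolding fourier_def using integrable_integral[OF integrable_continuous_real[OF assms]] by (auto intro!: has_integral_Re)

text \<open>From a value of at least \<epsilon> at \<open>y0\<close> the function stays above
  \<epsilon>/2 on an interval of length \<open>h\<close> to one side; \<open>h \<le> pi\<close>
  guarantees that one side fits into the period.\<close>

lemma nonneg_Lipschitz_integral_lower:
  fixes g :: "real \<Rightarrow> real"
  assumes g: "continuous_on {0..2*pi} g" "\<And>y. y \<in> {0..2*pi} \<Longrightarrow> g y \<ge> 0"
    and lip: "\<And>x y. x \<in> {0..2*pi} \<Longrightarrow> y \<in> {0..2*pi} \<Longrightarrow> \<bar>g x - g y\<bar> \<le> \<Lambda> * \<bar>x - y\<bar>"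
    and y0: "y0 \<in> {0..2*pi}" "g y0 \<ge> \<epsilon>" and h: "0 < h" "h \<le> pi" "\<Lambda> * h \<le> \<epsilon> / 2" and \<Lambda>: "\<Lambda> \<ge> 0"
  shows "integral {0..2*pi} g \<ge> h * (\<epsilon> / 2)"
proof -
  define l where "l = (if y0 + h \<le> 2 * pi then y0 else y0 - h)"
  have l: "0 \<le> l" "l + h \<le> 2 * pi" "y0 \<in> {l..l+h}" using y0 h by (auto simp: l_def)
  have "h * (\<epsilon> / 2) = integral {l..l+h} (\<lambda>_. \<epsilon> / 2)" using h by simp
  also have "\<dots> \<le> integral {l..l+h} g"
  proof (rule integral_le)
    show "g integrable_on {l..l+h}" using g(1) l by (intro integrable_continuous_real) (auto intro: continuous_on_subset)
    fix y assume y: "y \<in> {l..l+h}"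
    have "\<bar>g y - g y0\<bar> \<le> \<Lambda> * \<bar>y - y0\<bar>" using y l y0 by (intro lip) auto
    also have "\<dots> \<le> \<Lambda> * h" using y l(3) \<Lambda> by (intro mult_left_mono) auto
    finally show "\<epsilon> / 2 \<le> g y" using y0(2) h(3) by linarith
  qed auto
  also have "\<dots> \<le> integral {0..2*pi} g"
    using l g by (intro integral_subset_le integrable_continuous_real) (auto intro: continuous_on_subset)
  finally show ?thesis .
qed

context compact_hyperbolic_surface
begin

section \<open>Eigenfunctions in charts and on the disc\<close>

text \<open>The equation is required in every chart, whereas \<open>laplace_beltrami\<close>
  evaluates it in one chosen chart per point. This form passes to multiples and to
  pullbacks.\<close>

definition chartwise_eigenfunction :: "('a \<Rightarrow> complex) \<Rightarrow> real \<Rightarrow> bool" where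
  "chartwise_eigenfunction \<phi> \<mu> \<longleftrightarrow> (\<forall>c\<in>atlas Y. Ck_on 2 (chart_im c) (\<lambda>z. \<phi> (param c z)) \<and>
    (\<forall>z\<in>chart_im c. flat_laplacian (\<lambda>z. \<phi> (param c z)) z = - of_real (\<mu> * (density Y c z)\<^sup>2) * \<phi> (param c z)))"

text \<open>The flat Laplacian and the squared density pick up the same factor under a transition
  map, so the equation in the chosen chart carries over to any other.\<close>

lemma eigenfunction_imp_chartwise:
  assumes "eigenfunction Y \<phi> \<mu>"
  shows "chartwise_eigenfunction \<phi> \<mu>"
  unfolding chartwise_eigenfunction_def
proof (intro ballI conjI)
  have sm: "Ck_on 2 (chart_im c) (\<lambda>z. \<phi> (param c z))" if "c \<in> atlas Y" for c
    using assms that by (auto simp: eigenfunction_def smooth_function_def smooth_on_def o_def)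
  fix c assume c: "c \<in> atlas Y"
  show "Ck_on 2 (chart_im c) (\<lambda>z. \<phi> (param c z))" by (rule sm[OF c])
  fix z assume z: "z \<in> chart_im c"
  define p where "p = param c z"
  have p: "p \<in> chart_dom c" "coord c p = z" using param_in_dom[OF c z] coord_param[OF c z] by (auto simp: p_def)
  have cp: "c \<in> charts_at Y p" using c p by (auto intro: charts_atI)
  define d where "d = some_chart Y p"
  have dp: "d \<in> charts_at Y p" using some_chart by (simp add: d_def)
  note da = charts_atD[OF dp]
  define T where "T = coord c ` (chart_dom c \<inter> chart_dom d)"
  have oT: "open T" unfolding T_def by (rule open_transition_dom[OF c da(1)])
  have zT: "z \<in> T" using p da(2) by (auto simp: T_def)
  have sub: "transition c d ` T \<subseteq> chart_im d"
    using param_coord[OF c] by (auto simp: T_def transition_def)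
  have hol: "transition c d holomorphic_on T" unfolding T_def by (rule holomorphic_transition[OF c da(1)])
  have eq: "\<phi> (param c w) = \<phi> (param d (transition c d w))" if "w \<in> T" for w
    using that param_coord[OF c] param_coord[OF da(1)] by (auto simp: T_def transition_def)
  have "flat_laplacian (\<lambda>z. \<phi> (param c z)) z = flat_laplacian (\<lambda>z. \<phi> (param d (transition c d z))) z"
    by (rule flat_laplacian_cong_open[OF oT zT eq])
  also have "\<dots> = of_real ((cmod (deriv (transition c d) z))\<^sup>2) * flat_laplacian (\<lambda>z. \<phi> (param d z)) (transition c d z)"
    by (rule flat_laplacian_compose_holomorphic[OF oT open_im[OF da(1)] hol sub sm[OF da(1)] zT])
  also have "transition c d z = coord d p" using transition_deriv(3)[OF cp dp] p by simp
  also have "flat_laplacian (\<lambda>z. \<phi> (param d z)) (coord d p) = - of_real (\<mu> * (density Y d (coord d p))\<^sup>2) * \<phi> p"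
  proof -
    have "laplace_beltrami Y \<phi> p = of_real \<mu> * \<phi> p" using assms by (simp add: eigenfunction_def)
    then have "- flat_laplacian (\<lambda>z. \<phi> (param d z)) (coord d p) / of_real ((density Y d (coord d p))\<^sup>2) = of_real \<mu> * \<phi> p"
      by (simp add: laplace_beltrami_def Let_def d_def[symmetric] o_def)
    moreover have "density Y d (coord d p) \<noteq> 0" using density_pos[OF da(1) imageI[OF da(2)]] by simp
    ultimately show ?thesis by (simp add: field_simps) (metis add.inverse_inverse mult_minus_left)
  qed
  also have "of_real ((cmod (deriv (transition c d) z))\<^sup>2) * (- of_real (\<mu> * (density Y d (coord d p))\<^sup>2) * \<phi> p) =
      - of_real (\<mu> * (density Y c z)\<^sup>2) * \<phi> (param c z)"
    using transition_deriv(2)[OF cp dp] p by (simp add: p_def[symmetric] power_mult_distrib mult_ac)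
  finally show "flat_laplacian (\<lambda>z. \<phi> (param c z)) z = - of_real (\<mu> * (density Y c z)\<^sup>2) * \<phi> (param c z)" .
qed

lemma chartwise_eigenfunction_cmult: "chartwise_eigenfunction \<phi> \<mu> \<Longrightarrow> chartwise_eigenfunction (\<lambda>p. k * \<phi> p) \<mu>"
  unfolding chartwise_eigenfunction_def
proof (intro ballI conjI)
  fix c assume l: "\<forall>c\<in>atlas Y. Ck_on 2 (chart_im c) (\<lambda>z. \<phi> (param c z)) \<and>
    (\<forall>z\<in>chart_im c. flat_laplacian (\<lambda>z. \<phi> (param c z)) z = - of_real (\<mu> * (density Y c z)\<^sup>2) * \<phi> (param c z))"
    and c: "c \<in> atlas Y"
  have f: "Ck_on 2 (chart_im c) (\<lambda>z. \<phi> (param c z))" using l c by blast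
  show "Ck_on 2 (chart_im c) (\<lambda>z. k * \<phi> (param c z))"
    by (rule Ck_on_linear[OF open_im[OF c] bounded_linear_mult_right f])
  fix z assume z: "z \<in> chart_im c"
  have "flat_laplacian (\<lambda>z. \<phi> (param c z)) z = - of_real (\<mu> * (density Y c z)\<^sup>2) * \<phi> (param c z)" using l c z by blast
  then show "flat_laplacian (\<lambda>z. k * \<phi> (param c z)) z = - of_real (\<mu> * (density Y c z)\<^sup>2) * (k * \<phi> (param c z))"
    unfolding flat_laplacian_linear[OF open_im[OF c] z bounded_linear_mult_right f] by simp
qed

lemma chartwise_eigenfunction_continuous:
  assumes "chartwise_eigenfunction \<phi> \<mu>"
  shows "continuous_on UNIV \<phi>"
proof (rule continuous_at_imp_continuous_on, intro ballI)
  fix p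
  obtain c where c: "c \<in> charts_at Y p" using charts_at_nonempty by blast
  note ca = charts_atD[OF c]
  have "continuous_on (chart_im c) (\<lambda>z. \<phi> (param c z))" using assms ca Ck_on_imp_continuous unfolding chartwise_eigenfunction_def by blast
  then have "continuous_on (chart_dom c) (\<lambda>q. \<phi> (param c (coord c q)))"
    by (rule continuous_on_compose2[OF _ continuous_coord[OF ca(1)]]) auto
  then have "continuous_on (chart_dom c) \<phi>" by (rule continuous_on_cong[THEN iffD1, rotated 2]) (auto simp: param_coord[OF ca(1)])
  then show "isCont \<phi> p" using open_dom[OF ca(1)] ca(2) by (simp add: continuous_on_eq_continuous_at)
qed

text \<open>The Jacobian factor of the Laplacian combines with the density of \<open>Y\<close> to
  \<open>disc_density\<close>, by the isometry condition.\<close>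

lemma chartwise_eigenfunction_pullback:
  assumes l: "chartwise_eigenfunction \<phi> \<mu>" and \<Phi>: "local_isometry (ball 0 1) \<Phi>"
  shows "Ck_on 2 (ball 0 1) (\<lambda>z. \<phi> (\<Phi> z))"
    "z \<in> ball 0 1 \<Longrightarrow> flat_laplacian (\<lambda>z. \<phi> (\<Phi> z)) z = - of_real (\<mu> * (disc_density z)\<^sup>2) * \<phi> (\<Phi> z)"
proof -
  have key: "\<exists>V. open V \<and> z \<in> V \<and> Ck_on 2 V (\<lambda>z. \<phi> (\<Phi> z)) \<and>
      flat_laplacian (\<lambda>z. \<phi> (\<Phi> z)) z = - of_real (\<mu> * (disc_density z)\<^sup>2) * \<phi> (\<Phi> z)" if z: "z \<in> ball 0 1" for z
  proof -
    obtain c where c: "c \<in> charts_at Y (\<Phi> z)" using charts_at_nonempty by blast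
    note ca = charts_atD[OF c]
    obtain e where e: "e > 0" "ball z e \<subseteq> ball 0 1" "\<Phi> ` ball z e \<subseteq> chart_dom c"
      using chart_nbhd[OF local_isometryD(1,3)[OF \<Phi>] z c] by blast
    have zb: "z \<in> ball z e" using e(1) by simp
    define h where "h w = coord c (\<Phi> w)" for w
    have hol: "h holomorphic_on ball z e" unfolding h_def by (rule local_isometry_holomorphic[OF \<Phi> e(2,3) ca(1)])
    have sub: "h ` ball z e \<subseteq> chart_im c" using e(3) by (auto simp: h_def)
    have eq: "\<phi> (param c (h w)) = \<phi> (\<Phi> w)" if "w \<in> ball z e" for w
      using that e(3) param_coord[OF ca(1)] by (auto simp: h_def image_subset_iff)
    have f: "Ck_on 2 (chart_im c) (\<lambda>z. \<phi> (param c z))" using l ca by (simp add: chartwise_eigenfunction_def)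
    have 1: "Ck_on 2 (ball z e) (\<lambda>z. \<phi> (\<Phi> z))"
      by (rule Ck_on_cong[OF open_ball eq Ck_on_compose_holomorphic[OF open_ball open_im[OF ca(1)] hol sub f]])
    have "flat_laplacian (\<lambda>z. \<phi> (\<Phi> z)) z = flat_laplacian (\<lambda>z. \<phi> (param c (h z))) z"
      by (rule flat_laplacian_cong_open[OF open_ball zb]) (simp add: eq)
    also have "\<dots> = of_real ((cmod (deriv h z))\<^sup>2) * flat_laplacian (\<lambda>z. \<phi> (param c z)) (h z)"
      by (rule flat_laplacian_compose_holomorphic[OF open_ball open_im[OF ca(1)] hol sub f zb])
    also have "flat_laplacian (\<lambda>z. \<phi> (param c z)) (h z) = - of_real (\<mu> * (density Y c (h z))\<^sup>2) * \<phi> (param c (h z))"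
      using l ca(1) sub zb unfolding chartwise_eigenfunction_def by blast
    also have "\<phi> (param c (h z)) = \<phi> (\<Phi> z)" by (rule eq[OF zb])
    also have "of_real ((cmod (deriv h z))\<^sup>2) * (- of_real (\<mu> * (density Y c (h z))\<^sup>2) * \<phi> (\<Phi> z)) =
        - of_real (\<mu> * (density Y c (h z) * cmod (deriv h z))\<^sup>2) * \<phi> (\<Phi> z)"
      by (simp add: power_mult_distrib mult_ac)
    also have "density Y c (h z) * cmod (deriv h z) = disc_density z"
      unfolding h_def by (rule local_isometry_second_order(3)[OF \<Phi> open_ball e(2,3) ca(1) zb])
    finally show ?thesis using 1 zb by blast
  qed
  show "Ck_on 2 (ball 0 1) (\<lambda>z. \<phi> (\<Phi> z))" by (rule Ck_on_local) (use key in blast)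
  show "z \<in> ball 0 1 \<Longrightarrow> flat_laplacian (\<lambda>z. \<phi> (\<Phi> z)) z = - of_real (\<mu> * (disc_density z)\<^sup>2) * \<phi> (\<Phi> z)"
    using key by blast
qed

section \<open>Harnack estimate and spectral gap\<close>

text \<open>The bounds on \<phi> and \<mu> bound the Laplacian in a compact part of a chart
  uniformly, so that all Harnack constants are independent of the eigenfunction.\<close>

definition normalized_eigenfunction :: "('a \<Rightarrow> complex) \<Rightarrow> real \<Rightarrow> bool" where
  "normalized_eigenfunction \<phi> \<mu> \<longleftrightarrow> chartwise_eigenfunction \<phi> \<mu> \<and> 0 < \<mu> \<and> \<mu> \<le> 1 \<and> (\<forall>p. cmod (\<phi> p) \<le> 1)"

text \<open>\<open>1 - Re \<phi>\<close> is nonnegative and nearly has the mean value property for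
  small \<mu>. On the circle around \<open>a\<close> through \<open>b\<close>, its mean is at most
  its value at \<open>a\<close> plus a multiple of \<mu>, while a uniform Lipschitz bound turns a
  value of at least \<epsilon> at \<open>b\<close> into a lower bound for the mean.\<close>

lemma local_harnack:
  "\<exists>U. open U \<and> q \<in> U \<and> (\<forall>\<epsilon>>0. \<exists>\<delta>>0. \<forall>\<phi> \<mu>. normalized_eigenfunction \<phi> \<mu> \<longrightarrow> (\<forall>a\<in>U. \<forall>b\<in>U.
    1 - Re (\<phi> a) < \<delta> \<and> \<mu> < \<delta> \<longrightarrow> 1 - Re (\<phi> b) < \<epsilon>))"
proof -
  obtain c where c: "c \<in> charts_at Y q" using charts_at_nonempty by blast
  note ca = charts_atD[OF c]
  define zq where "zq = coord c q"
  have zq: "zq \<in> chart_im c" using ca by (simp add: zq_def)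
  obtain s0 where s0: "s0 > 0" "cball zq s0 \<subseteq> chart_im c" using open_im[OF ca(1)] zq open_contains_cball by blast
  \<comment> \<open>Nested balls: \<open>a\<close> and \<open>b\<close> lie in radius
    \<open>s\<close>, the circle in radius \<open>3 * s\<close>, and gradient bounds on the latter
    consume a further \<open>s\<close>.\<close>
  define s where "s = s0 / 4"
  have s: "s > 0" "cball zq (4 * s) \<subseteq> chart_im c" using s0 by (auto simp: s_def)
  define \<rho> where "\<rho> = density Y c"
  have "Ck_on 0 (chart_im c) \<rho>" using density_smooth[OF ca(1)] unfolding smooth_on_def \<rho>_def by blast
  then have "continuous_on (cball zq (4 * s)) (\<lambda>z. (\<rho> z)\<^sup>2)" using s(2) by (auto intro!: continuous_intros intro: continuous_on_subset)
  then have "bounded ((\<lambda>z. (\<rho> z)\<^sup>2) ` cball zq (4 * s))" by (intro compact_imp_bounded compact_continuous_image) auto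
  then obtain M where M: "\<And>z. z \<in> cball zq (4 * s) \<Longrightarrow> (\<rho> z)\<^sup>2 \<le> M" unfolding bounded_iff ball_simps by fastforce
  have M0: "M \<ge> 0" by (rule order_trans[OF zero_le_power2 M[of zq]]) (use s(1) in simp)
  \<comment> \<open>The bounds of \<open>dz_bound\<close> and \<open>dzb_bound\<close> with
    \<open>B = 1\<close> and radius \<open>s / 2\<close>, added because both derivatives contribute
    to the Lipschitz constant.\<close>
  define \<Lambda> where "\<Lambda> = 2 * (1 / (s / 2) + M * (s / 2) / 3)"
  have \<Lambda>: "\<Lambda> > 0" using s(1) M0 by (auto simp: \<Lambda>_def intro!: add_pos_nonneg)
  define U where "U = chart_dom c \<inter> coord c -` ball zq s"
  have oU: "open U" unfolding U_def
    by (rule continuous_open_preimage[OF continuous_coord[OF ca(1)] open_dom[OF ca(1)] open_ball])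
  have qU: "q \<in> U" using ca(2) s(1) by (simp add: U_def zq_def)
  have sub: "ball z s \<subseteq> cball zq (4 * s)" if "z \<in> ball zq (3 * s)" for z
  proof
    fix w assume "w \<in> ball z s"
    then show "w \<in> cball zq (4 * s)" using that dist_triangle[of zq w z] by simp
  qed
  have "\<exists>\<delta>>0. \<forall>\<phi> \<mu>. normalized_eigenfunction \<phi> \<mu> \<longrightarrow> (\<forall>a\<in>U. \<forall>b\<in>U. 1 - Re (\<phi> a) < \<delta> \<and> \<mu> < \<delta> \<longrightarrow> 1 - Re (\<phi> b) < \<epsilon>)" if \<epsilon>: "\<epsilon> > 0" for \<epsilon>
  proof -
    \<comment> \<open>The circles have radius below \<open>2 * s\<close>, so as functions of the
      angle their values have Lipschitz constant \<open>\<Lambda> * (2 * s)\<close>.\<close>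
    define h where "h = min pi (\<epsilon> / (2 * (\<Lambda> * (2 * s))))"
    have h: "0 < h" "h \<le> pi" using \<epsilon> \<Lambda> s(1) by (auto simp: h_def)
    have "\<Lambda> * (2 * s) * h \<le> \<Lambda> * (2 * s) * (\<epsilon> / (2 * (\<Lambda> * (2 * s))))" using \<Lambda> s(1) by (intro mult_left_mono) (auto simp: h_def)
    also have "\<dots> = \<epsilon> / 2" using \<Lambda> s(1) by simp
    finally have h\<Lambda>: "\<Lambda> * (2 * s) * h \<le> \<epsilon> / 2" .
    define D where "D = 2 * pi * (1 + M * s\<^sup>2)"
    have D: "D > 0" using M0 by (auto simp: D_def intro!: mult_pos_pos add_pos_nonneg)
    \<comment> \<open>\<open>\<delta> \<le> \<epsilon>\<close> excludes a coincidence of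
      \<open>a\<close> and \<open>b\<close>; the other bound makes the upper estimate
      \<open>\<delta> * D\<close> of the integral at most the lower one.\<close>
    define \<delta> where "\<delta> = min \<epsilon> (h * (\<epsilon> / 2) / D)"
    have \<delta>: "\<delta> > 0" "\<delta> \<le> \<epsilon>" "\<delta> * D \<le> h * (\<epsilon> / 2)" using \<epsilon> h D by (auto simp: \<delta>_def min_def field_simps)
    have "1 - Re (\<phi> b) < \<epsilon>" if ad: "normalized_eigenfunction \<phi> \<mu>" and a: "a \<in> U" and b: "b \<in> U" and lt: "1 - Re (\<phi> a) < \<delta>" "\<mu> < \<delta>" for \<phi> \<mu> a b
    proof (rule ccontr)
      assume "\<not> 1 - Re (\<phi> b) < \<epsilon>"
      then have b\<epsilon>: "1 - Re (\<phi> b) \<ge> \<epsilon>" by simp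
      have l: "chartwise_eigenfunction \<phi> \<mu>" and \<mu>: "0 < \<mu>" "\<mu> \<le> 1" and \<phi>1: "\<And>p. cmod (\<phi> p) \<le> 1" using ad by (auto simp: normalized_eigenfunction_def)
      define f where "f z = \<phi> (param c z)" for z
      have fC: "Ck_on 2 (chart_im c) f" and fL: "\<And>z. z \<in> chart_im c \<Longrightarrow> flat_laplacian f z = - of_real (\<mu> * (\<rho> z)\<^sup>2) * f z"
        using l ca(1) unfolding chartwise_eigenfunction_def f_def \<rho>_def by auto
      have fb: "cmod (flat_laplacian f z) \<le> M" if z: "z \<in> cball zq (4 * s)" for z
      proof -
        have "cmod (flat_laplacian f z) = \<mu> * (\<rho> z)\<^sup>2 * cmod (f z)"
          using fL[of z] z s(2) \<mu> by (auto simp: norm_mult abs_mult simp del: of_real_mult of_real_power)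
        also have "\<dots> \<le> 1 * M * 1" using M0 \<mu> M[OF z] \<phi>1 by (intro mult_mono) (auto simp: f_def)
        finally show ?thesis by simp
      qed
      have grad: "cmod (dz f z) \<le> \<Lambda> / 2" "cmod (dzb f z) \<le> \<Lambda> / 2" if z: "z \<in> ball zq (3 * s)" for z
      proof -
        have fCz: "Ck_on 2 (ball z s) f" using Ck_on_subset[OF fC] sub[OF z] s(2) by blast
        have fbz: "\<And>w. w \<in> ball z s \<Longrightarrow> cmod (flat_laplacian f w) \<le> M" using fb sub[OF z] by blast
        have f1: "\<And>w. cmod (f w) \<le> 1" using \<phi>1 by (simp add: f_def)
        have s2: "0 < s / 2" "s / 2 < s" using s(1) by auto
        have L2: "\<Lambda> / 2 = 1 / (s / 2) + M * (s / 2) / 3" by (simp add: \<Lambda>_def)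
        show "cmod (dz f z) \<le> \<Lambda> / 2" "cmod (dzb f z) \<le> \<Lambda> / 2"
          unfolding L2 by (intro dz_bound[OF fCz s2] dzb_bound[OF fCz s2] f1 fbz; assumption)+
      qed
      have lip: "cmod (f x - f y) \<le> \<Lambda> * cmod (x - y)" if xy: "x \<in> ball zq (3 * s)" "y \<in> ball zq (3 * s)" for x y
      proof (rule differentiable_bound[where S = "ball zq (3 * s)" and f' = "\<lambda>z h. dz f z * h + dzb f z * cnj h"])
        fix z assume z: "z \<in> ball zq (3 * s)"
        have "z \<in> chart_im c" using z s by (auto intro!: subsetD[OF s(2)])
        then have "f differentiable (at z)" using Ck_on_differentiable[OF fC] by simp
        from has_wirtingerI[OF this] show "(f has_derivative (\<lambda>h. dz f z * h + dzb f z * cnj h)) (at z within ball zq (3 * s))"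
          unfolding has_wirtinger_def by (rule has_derivative_at_withinI)
        show "onorm (\<lambda>h. dz f z * h + dzb f z * cnj h) \<le> \<Lambda>"
        proof (rule onorm_le)
          fix h
          have "cmod (dz f z * h + dzb f z * cnj h) \<le> cmod (dz f z) * cmod h + cmod (dzb f z) * cmod h"
            by (rule order_trans[OF norm_triangle_ineq]) (simp add: norm_mult)
          also have "\<dots> \<le> \<Lambda> / 2 * cmod h + \<Lambda> / 2 * cmod h" using grad[OF z] by (intro add_mono mult_right_mono) auto
          finally show "cmod (dz f z * h + dzb f z * cnj h) \<le> \<Lambda> * cmod h" by simp
        qed
      qed (use xy in auto)
      define za zb where "za = coord c a" and "zb = coord c b"
      have zab: "za \<in> ball zq s" "zb \<in> ball zq s" "f za = \<phi> a" "f zb = \<phi> b"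
        using a b param_coord[OF ca(1)] by (auto simp: U_def za_def zb_def f_def)
      define R where "R = cmod (zb - za)"
      have ne: "za \<noteq> zb"
      proof
        assume "za = zb"
        then have "\<phi> a = \<phi> b" using zab by metis
        then show False using lt \<delta>(2) b\<epsilon> by simp
      qed
      have R: "R > 0" "R < 2 * s"
        using ne zab(1,2) dist_triangle3[of za zb zq] by (auto simp: R_def dist_norm norm_minus_commute)
      have sub2: "ball za (3 * s) \<subseteq> chart_im c"
      proof
        fix w assume "w \<in> ball za (3 * s)"
        then have "w \<in> cball zq (4 * s)" using zab(1) dist_triangle[of zq w za] by simp
        then show "w \<in> chart_im c" using s(2) by blast
      qed
      define g where "g y = 1 - Re (f (za + of_real R * cis y))" for y
      have circ: "za + of_real R * cis y \<in> ball zq (3 * s)" for y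
      proof -
        have "dist za (za + of_real R * cis y) = R" using R by (simp add: dist_norm norm_mult)
        then show ?thesis using zab(1) R dist_triangle[of zq "za + of_real R * cis y" za] by simp
      qed
      have fCa: "Ck_on 2 (ball za (3 * s)) f" using Ck_on_subset[OF fC sub2] .
      have cc: "continuous_on S (\<lambda>y. f (za + of_real R * cis y))" for S
        by (rule continuous_on_circle[OF Ck_on_imp_continuous[OF fCa]]) (use R in auto)
      \<comment> \<open>Mean value inequality for \<open>- f\<close>: the real part of its Laplacian
        is at most \<open>\<mu> * M\<close>, which corresponds to a negative \<kappa>.\<close>
      have mean: "Re (fourier 0 (\<lambda>y. - f (za + of_real R * cis y))) \<le> 2 * pi * (Re (- f za) - (- \<mu> * M / 4) * R\<^sup>2)"
      proof (rule circle_mean_le[where R = "3 * s"])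
        show "Ck_on 2 (ball za (3 * s)) (\<lambda>z. - f z)"
          by (rule Ck_on_linear[OF open_ball bounded_linear_minus[OF bounded_linear_ident] fCa])
        show "0 < R" "R < 3 * s" using R by auto
        fix z assume z: "z \<in> ball za (3 * s)"
        have z4: "z \<in> cball zq (4 * s)" using z zab(1) dist_triangle[of zq z za] by simp
        have "Re (flat_laplacian (\<lambda>z. - f z) z) = \<mu> * (\<rho> z)\<^sup>2 * Re (f z)"
          unfolding flat_laplacian_linear[OF open_ball z bounded_linear_minus[OF bounded_linear_ident] fCa]
          using fL[of z] z sub2 by auto
        also have "\<dots> \<le> \<mu> * M"
        proof -
          have "Re (f z) \<le> 1" using \<phi>1[of "param c z"] abs_Re_le_cmod[of "f z"] unfolding f_def by linarith
          then have "(\<rho> z)\<^sup>2 * Re (f z) \<le> (\<rho> z)\<^sup>2 * 1" by (rule mult_left_mono) simp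
          then have "(\<rho> z)\<^sup>2 * Re (f z) \<le> M" using M[OF z4] by linarith
          from mult_left_mono[OF this less_imp_le[OF \<mu>(1)]] show ?thesis by (simp add: mult.assoc)
        qed
        finally show "Re (flat_laplacian (\<lambda>z. - f z) z) \<le> - 4 * (- \<mu> * M / 4)" by simp
      qed
      have "((\<lambda>y. 1 + Re (- f (za + of_real R * cis y))) has_integral (2 * pi + Re (fourier 0 (\<lambda>y. - f (za + of_real R * cis y))))) {0..2*pi}"
        using has_integral_add[OF has_integral_const_real[of "1::real" 0 "2*pi"] integral_Re_fourier_0[of "\<lambda>y. - f (za + of_real R * cis y)"]]
          cc by (simp add: continuous_intros)
      then have "integral {0..2*pi} g = 2 * pi + Re (fourier 0 (\<lambda>y. - f (za + of_real R * cis y)))"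
        unfolding g_def by (simp add: integral_unique)
      also have "\<dots> \<le> 2 * pi * ((1 - Re (\<phi> a)) + \<mu> * M / 4 * R\<^sup>2)" using mean zab(3) by (simp add: algebra_simps)
      also have "\<dots> < 2 * pi * (\<delta> + \<delta> * M * s\<^sup>2)"
      proof -
        have "R\<^sup>2 \<le> (2 * s)\<^sup>2" using R by (intro power_mono) auto
        then have "\<mu> * M / 4 * R\<^sup>2 \<le> \<delta> * M / 4 * (2 * s)\<^sup>2" using lt(2) M0 \<mu>(1) by (intro mult_mono divide_right_mono mult_right_mono) auto
        then show ?thesis using lt(1) by (simp add: power_mult_distrib)
      qed
      also have "\<dots> = \<delta> * D" by (simp add: D_def algebra_simps)
      also have "\<dots> \<le> h * (\<epsilon> / 2)" by (rule \<delta>(3))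
      finally have up: "integral {0..2*pi} g < h * (\<epsilon> / 2)" .
      have "integral {0..2*pi} g \<ge> h * (\<epsilon> / 2)"
      proof (rule nonneg_Lipschitz_integral_lower[where \<Lambda> = "\<Lambda> * (2 * s)" and ?y0.0 = "Arg2pi (zb - za)"])
        show "continuous_on {0..2*pi} g" unfolding g_def by (intro continuous_intros cc)
        show "g y \<ge> 0" for y using \<phi>1[of "param c (za + of_real R * cis y)"] abs_Re_le_cmod[of "f (za + of_real R * cis y)"]
          unfolding g_def f_def by linarith
        fix x y
        have "\<bar>g x - g y\<bar> = \<bar>Re (f (za + of_real R * cis x) - f (za + of_real R * cis y))\<bar>" by (simp add: g_def)
        also have "\<dots> \<le> cmod (f (za + of_real R * cis x) - f (za + of_real R * cis y))" by (rule abs_Re_le_cmod)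
        also have "\<dots> \<le> \<Lambda> * cmod ((za + of_real R * cis x) - (za + of_real R * cis y))" by (rule lip[OF circ circ])
        also have "(za + of_real R * cis x) - (za + of_real R * cis y) = of_real R * (cis x - cis y)" by (simp add: algebra_simps)
        also have "\<Lambda> * cmod (of_real R * (cis x - cis y)) \<le> \<Lambda> * (2 * s * \<bar>x - y\<bar>)"
          using R \<Lambda> s(1) cmod_cis_diff_le[of x y] by (intro mult_left_mono) (auto simp: norm_mult intro!: mult_mono)
        finally show "\<bar>g x - g y\<bar> \<le> \<Lambda> * (2 * s) * \<bar>x - y\<bar>" by (simp add: mult.assoc)
      next
        show "Arg2pi (zb - za) \<in> {0..2*pi}" using Arg2pi_ge_0[of "zb - za"] Arg2pi_lt_2pi[of "zb - za"] by simp
        have "za + of_real R * cis (Arg2pi (zb - za)) = zb" using Arg2pi_eq[of "zb - za"] by (simp add: R_def cis_conv_exp)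
        then show "g (Arg2pi (zb - za)) \<ge> \<epsilon>" using b\<epsilon> zab(4) by (simp add: g_def)
        show "0 \<le> \<Lambda> * (2 * s)" using \<Lambda> s(1) by simp
      qed (fact h h\<Lambda>)+
      then show False using up by simp
    qed
    then show ?thesis using \<delta>(1) by blast
  qed
  with oU qU show ?thesis by blast
qed

text \<open>A chain of neighbourhoods: the property carried from point to point is quantified over
  all \<epsilon>, so the \<delta> of a later link can serve as the \<epsilon> of an earlier
  one.\<close>

lemma harnack_pair:
  assumes \<epsilon>: "\<epsilon> > 0"
  shows "\<exists>\<delta>>0. \<forall>\<phi> \<mu>. normalized_eigenfunction \<phi> \<mu> \<longrightarrow> 1 - Re (\<phi> a) < \<delta> \<and> \<mu> < \<delta> \<longrightarrow> 1 - Re (\<phi> b) < \<epsilon>"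
proof -
  define P where "P b \<longleftrightarrow> (\<forall>\<epsilon>>0. \<exists>\<delta>>0. \<forall>\<phi> \<mu>. normalized_eigenfunction \<phi> \<mu> \<longrightarrow> 1 - Re (\<phi> a) < \<delta> \<and> \<mu> < \<delta> \<longrightarrow> 1 - Re (\<phi> b) < \<epsilon>)" for b
  have "P b"
  proof (rule connected_induction_simple[OF connected UNIV_I UNIV_I])
    show "P a" unfolding P_def by blast
    fix q :: 'a
    obtain U where U: "open U" "q \<in> U" "\<And>\<epsilon>. \<epsilon> > 0 \<Longrightarrow> \<exists>\<delta>>0. \<forall>\<phi> \<mu>. normalized_eigenfunction \<phi> \<mu> \<longrightarrow> (\<forall>a\<in>U. \<forall>b\<in>U.
      1 - Re (\<phi> a) < \<delta> \<and> \<mu> < \<delta> \<longrightarrow> 1 - Re (\<phi> b) < \<epsilon>)" using local_harnack[of q] by blast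
    have PP: "P y" if x: "x \<in> U" "P x" and y: "y \<in> U" for x y
      unfolding P_def
    proof (intro allI impI)
      fix \<epsilon> :: real assume "\<epsilon> > 0"
      from U(3)[OF this] obtain d1 where d1: "d1 > 0" "\<And>\<phi> \<mu>. normalized_eigenfunction \<phi> \<mu> \<Longrightarrow> 1 - Re (\<phi> x) < d1 \<Longrightarrow> \<mu> < d1 \<Longrightarrow> 1 - Re (\<phi> y) < \<epsilon>"
        using x(1) y by blast
      from x(2) d1(1) have "\<exists>\<delta>>0. \<forall>\<phi> \<mu>. normalized_eigenfunction \<phi> \<mu> \<longrightarrow> 1 - Re (\<phi> a) < \<delta> \<and> \<mu> < \<delta> \<longrightarrow> 1 - Re (\<phi> x) < d1"
        unfolding P_def by metis
      then obtain d2 where d2: "d2 > 0" "\<And>\<phi> \<mu>. normalized_eigenfunction \<phi> \<mu> \<Longrightarrow> 1 - Re (\<phi> a) < d2 \<Longrightarrow> \<mu> < d2 \<Longrightarrow> 1 - Re (\<phi> x) < d1"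
        by metis
      show "\<exists>\<delta>>0. \<forall>\<phi> \<mu>. normalized_eigenfunction \<phi> \<mu> \<longrightarrow> 1 - Re (\<phi> a) < \<delta> \<and> \<mu> < \<delta> \<longrightarrow> 1 - Re (\<phi> y) < \<epsilon>"
      proof (intro exI[of _ "min d1 d2"] conjI allI impI)
        fix \<phi> \<mu> assume h: "normalized_eigenfunction \<phi> \<mu>" "1 - Re (\<phi> a) < min d1 d2 \<and> \<mu> < min d1 d2"
        have "1 - Re (\<phi> x) < d1" by (rule d2(2)[OF h(1)]) (use h(2) in auto)
        then show "1 - Re (\<phi> y) < \<epsilon>" by (rule d1(2)[OF h(1)]) (use h(2) in auto)
      qed (use d1(1) d2(1) in simp)
    qed
    have "openin (top_of_set UNIV) U" using U(1) by simp
    with U(2) PP show "\<exists>T. openin (top_of_set UNIV) T \<and> q \<in> T \<and> (\<forall>x\<in>T. \<forall>y\<in>T. P x \<longrightarrow> P y)"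
      by blast
  qed
  then show ?thesis using \<epsilon> unfolding P_def by blast
qed

text \<open>The \<delta> of \<open>harnack_pair\<close> depends on both points. With a base point in
  between, compactness removes the dependence on the target \<open>b\<close> and then, separately,
  that on the source \<open>a\<close>.\<close>

lemma harnack_uniform:
  obtains \<delta> where "\<delta> > 0" "\<And>\<phi> \<mu> a b. normalized_eigenfunction \<phi> \<mu> \<Longrightarrow> 1 - Re (\<phi> a) < \<delta> \<Longrightarrow> \<mu> < \<delta> \<Longrightarrow> 1 - Re (\<phi> b) < 1"
proof -
  fix base :: 'a
  have B: "\<exists>U \<delta>. open U \<and> b \<in> U \<and> \<delta> > 0 \<and> (\<forall>\<phi> \<mu>. normalized_eigenfunction \<phi> \<mu> \<longrightarrow> (\<forall>b'\<in>U. 1 - Re (\<phi> base) < \<delta> \<and> \<mu> < \<delta> \<longrightarrow> 1 - Re (\<phi> b') < 1))" for b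
  proof -
    obtain U where U: "open U" "b \<in> U" "\<And>\<epsilon>. \<epsilon> > 0 \<Longrightarrow> \<exists>\<delta>>0. \<forall>\<phi> \<mu>. normalized_eigenfunction \<phi> \<mu> \<longrightarrow> (\<forall>a\<in>U. \<forall>b\<in>U.
      1 - Re (\<phi> a) < \<delta> \<and> \<mu> < \<delta> \<longrightarrow> 1 - Re (\<phi> b) < \<epsilon>)" using local_harnack[of b] by blast
    obtain d1 where d1: "d1 > 0" "\<And>\<phi> \<mu> b'. normalized_eigenfunction \<phi> \<mu> \<Longrightarrow> b' \<in> U \<Longrightarrow> 1 - Re (\<phi> b) < d1 \<Longrightarrow> \<mu> < d1 \<Longrightarrow> 1 - Re (\<phi> b') < 1"
      using U(3)[of 1] U(2) by (metis zero_less_one)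
    obtain d2 where d2: "d2 > 0" "\<And>\<phi> \<mu>. normalized_eigenfunction \<phi> \<mu> \<Longrightarrow> 1 - Re (\<phi> base) < d2 \<Longrightarrow> \<mu> < d2 \<Longrightarrow> 1 - Re (\<phi> b) < d1"
      using harnack_pair[OF d1(1)] by metis
    show ?thesis using U(1,2) d1(1) d2(1)
      by (intro exI[of _ U] exI[of _ "min d1 d2"] conjI allI impI ballI d1(2) d2(2)) (assumption | simp)+
  qed
  then obtain U d where Ud: "\<And>b. open (U b)" "\<And>b. b \<in> U b" "\<And>b. d b > (0::real)"
    "\<And>b \<phi> \<mu> b'. normalized_eigenfunction \<phi> \<mu> \<Longrightarrow> b' \<in> U b \<Longrightarrow> 1 - Re (\<phi> base) < d b \<Longrightarrow> \<mu> < d b \<Longrightarrow> 1 - Re (\<phi> b') < 1" by metis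
  have "UNIV \<subseteq> \<Union>(range U)" using Ud(2) by blast
  then obtain F where F: "finite F" "UNIV \<subseteq> (\<Union>p\<in>F. U p)" using compactE_image[OF compact, of UNIV U] Ud(1) by metis
  define \<delta>B where "\<delta>B = Min (d ` F)"
  have Fne: "F \<noteq> {}" using F(2) by auto
  have \<delta>B: "\<delta>B > 0" "\<And>p. p \<in> F \<Longrightarrow> \<delta>B \<le> d p" unfolding \<delta>B_def using F Fne Ud(3) by auto
  have Bu: "1 - Re (\<phi> b') < 1" if "normalized_eigenfunction \<phi> \<mu>" "1 - Re (\<phi> base) < \<delta>B" "\<mu> < \<delta>B" for \<phi> \<mu> b'
  proof -
    obtain p where p: "p \<in> F" "b' \<in> U p" using F(2) by blast
    show ?thesis using Ud(4)[OF that(1) p(2)] \<delta>B(2)[OF p(1)] that by linarith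
  qed
  have A: "\<exists>U \<delta>. open U \<and> a \<in> U \<and> \<delta> > 0 \<and> (\<forall>\<phi> \<mu>. normalized_eigenfunction \<phi> \<mu> \<longrightarrow> (\<forall>a'\<in>U. 1 - Re (\<phi> a') < \<delta> \<and> \<mu> < \<delta> \<longrightarrow> 1 - Re (\<phi> base) < \<delta>B))" for a
  proof -
    obtain U where U: "open U" "a \<in> U" "\<And>\<epsilon>. \<epsilon> > 0 \<Longrightarrow> \<exists>\<delta>>0. \<forall>\<phi> \<mu>. normalized_eigenfunction \<phi> \<mu> \<longrightarrow> (\<forall>a\<in>U. \<forall>b\<in>U.
      1 - Re (\<phi> a) < \<delta> \<and> \<mu> < \<delta> \<longrightarrow> 1 - Re (\<phi> b) < \<epsilon>)" using local_harnack[of a] by blast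
    obtain d2 where d2: "d2 > 0" "\<And>\<phi> \<mu>. normalized_eigenfunction \<phi> \<mu> \<Longrightarrow> 1 - Re (\<phi> a) < d2 \<Longrightarrow> \<mu> < d2 \<Longrightarrow> 1 - Re (\<phi> base) < \<delta>B"
      using harnack_pair[OF \<delta>B(1)] by metis
    obtain d1 where d1: "d1 > 0" "\<And>\<phi> \<mu> a'. normalized_eigenfunction \<phi> \<mu> \<Longrightarrow> a' \<in> U \<Longrightarrow> 1 - Re (\<phi> a') < d1 \<Longrightarrow> \<mu> < d1 \<Longrightarrow> 1 - Re (\<phi> a) < d2"
      using U(3)[OF d2(1)] U(2) by metis
    show ?thesis using U(1,2) d1(1) d2(1)
      by (intro exI[of _ U] exI[of _ "min d1 d2"] conjI allI impI ballI d2(2) d1(2)) (assumption | simp)+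
  qed
  then obtain V e where Ve: "\<And>b. open (V b)" "\<And>b. b \<in> V b" "\<And>b. e b > (0::real)"
    "\<And>b \<phi> \<mu> b'. normalized_eigenfunction \<phi> \<mu> \<Longrightarrow> b' \<in> V b \<Longrightarrow> 1 - Re (\<phi> b') < e b \<Longrightarrow> \<mu> < e b \<Longrightarrow> 1 - Re (\<phi> base) < \<delta>B" by metis
  have "UNIV \<subseteq> \<Union>(range V)" using Ve(2) by blast
  then obtain F' where F': "finite F'" "UNIV \<subseteq> (\<Union>p\<in>F'. V p)" using compactE_image[OF compact, of UNIV V] Ve(1) by metis
  define \<delta>A where "\<delta>A = Min (e ` F')"
  have F'ne: "F' \<noteq> {}" using F'(2) by auto
  have \<delta>A: "\<delta>A > 0" "\<And>p. p \<in> F' \<Longrightarrow> \<delta>A \<le> e p" unfolding \<delta>A_def using F' F'ne Ve(3) by auto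
  show ?thesis
  proof (rule that[of "min \<delta>A \<delta>B"])
    show "min \<delta>A \<delta>B > 0" using \<delta>A(1) \<delta>B(1) by simp
    fix \<phi> \<mu> a b assume h: "normalized_eigenfunction \<phi> \<mu>" "1 - Re (\<phi> a) < min \<delta>A \<delta>B" "\<mu> < min \<delta>A \<delta>B"
    obtain p where p: "p \<in> F'" "a \<in> V p" using F'(2) by blast
    have "1 - Re (\<phi> base) < \<delta>B" using Ve(4)[OF h(1) p(2)] \<delta>A(2)[OF p(1)] h by simp
    then show "1 - Re (\<phi> b) < 1" using Bu[OF h(1)] h(3) by simp
  qed
qed

theorem spectral_gap:
  obtains m where "m > 0" "\<And>\<phi> \<mu>. eigenfunction Y \<phi> \<mu> \<Longrightarrow> \<mu> > 0 \<Longrightarrow> m \<le> \<mu>"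
proof -
  obtain \<delta> where \<delta>: "\<delta> > 0" "\<And>\<phi> \<mu> a b. normalized_eigenfunction \<phi> \<mu> \<Longrightarrow> 1 - Re (\<phi> a) < \<delta> \<Longrightarrow> \<mu> < \<delta> \<Longrightarrow> 1 - Re (\<phi> b) < 1"
    using harnack_uniform by blast
  show ?thesis
  proof (rule that[of "min \<delta> 1"])
    fix \<phi> \<mu> assume e: "eigenfunction Y \<phi> \<mu>" and \<mu>: "\<mu> > 0"
    show "min \<delta> 1 \<le> \<mu>"
    proof (rule ccontr)
      assume "\<not> min \<delta> 1 \<le> \<mu>"
      then have lt: "\<mu> < \<delta>" "\<mu> \<le> 1" by auto
      have l: "chartwise_eigenfunction \<phi> \<mu>" by (rule eigenfunction_imp_chartwise[OF e])
      have "continuous_on UNIV (\<lambda>p. cmod (\<phi> p))" by (intro continuous_intros chartwise_eigenfunction_continuous[OF l])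
      from continuous_attains_sup[OF compact _ this] obtain p where p: "\<And>q. cmod (\<phi> q) \<le> cmod (\<phi> p)" by auto
      obtain q where "\<phi> q \<noteq> 0" using e by (auto simp: eigenfunction_def)
      then have "cmod (\<phi> q) > 0" by simp
      then have p0: "\<phi> p \<noteq> 0" using p[of q] by auto
      \<comment> \<open>Division by the complex value at a maximum of the modulus makes \<psi> equal
        to 1 there, so that its real part is a usable real solution.\<close>
      define \<psi> where "\<psi> q = inverse (\<phi> p) * \<phi> q" for q
      have l\<psi>: "chartwise_eigenfunction \<psi> \<mu>" unfolding \<psi>_def[abs_def] by (rule chartwise_eigenfunction_cmult[OF l])
      have "cmod (\<psi> q) = cmod (\<phi> q) / cmod (\<phi> p)" for q by (simp add: \<psi>_def norm_mult norm_inverse divide_inverse mult.commute)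
      then have "cmod (\<psi> q) \<le> 1" for q using p[of q] p0 by simp
      then have ad: "normalized_eigenfunction \<psi> \<mu>" using l\<psi> \<mu> lt by (simp add: normalized_eigenfunction_def)
      have "\<psi> p = 1" using p0 by (simp add: \<psi>_def)
      then have pos: "Re (\<psi> b) > 0" for b using \<delta>(2)[OF ad, of p b] \<delta>(1) lt by simp
      have "continuous_on UNIV (\<lambda>p. Re (\<psi> p))" by (intro continuous_intros chartwise_eigenfunction_continuous[OF l\<psi>])
      from continuous_attains_inf[OF compact _ this] obtain b where b: "\<And>q. Re (\<psi> b) \<le> Re (\<psi> q)" by auto
      obtain c where c: "c \<in> charts_at Y b" using charts_at_nonempty by blast
      note ca = charts_atD[OF c]
      define zb where "zb = coord c b"
      have zb: "zb \<in> chart_im c" using ca by (simp add: zb_def)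
      obtain s where s: "s > 0" "cball zb s \<subseteq> chart_im c" using open_im[OF ca(1)] zb open_contains_cball by blast
      have "Ck_on 0 (chart_im c) (density Y c)" using density_smooth[OF ca(1)] unfolding smooth_on_def by blast
      then have "continuous_on (cball zb s) (density Y c)" using s(2) by (auto intro: continuous_on_subset)
      from continuous_attains_inf[OF compact_cball _ this] s(1) obtain z0 where z0: "z0 \<in> cball zb s" "\<And>z. z \<in> cball zb s \<Longrightarrow> density Y c z0 \<le> density Y c z"
        by force
      define \<rho>0 where "\<rho>0 = density Y c z0"
      have \<rho>0: "\<rho>0 > 0" using density_pos[OF ca(1)] z0(1) s(2) by (auto simp: \<rho>0_def)
      define f where "f z = \<psi> (param c z)" for z
      have fC: "Ck_on 2 (chart_im c) f" and fL: "\<And>z. z \<in> chart_im c \<Longrightarrow> flat_laplacian f z = - of_real (\<mu> * (density Y c z)\<^sup>2) * f z"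
        using l\<psi> ca(1) unfolding chartwise_eigenfunction_def f_def by auto
      \<comment> \<open>A quarter of a lower bound, valid on the whole ball, for minus the Laplacian
        of the real part. Its positivity puts the mean over a circle around \<open>b\<close>
        strictly below the minimal value.\<close>
      define \<kappa> where "\<kappa> = \<mu> * \<rho>0\<^sup>2 * Re (\<psi> b) / 4"
      have \<kappa>: "\<kappa> > 0" using \<mu> \<rho>0 pos by (simp add: \<kappa>_def)
      have fCs: "Ck_on 2 (ball zb s) f" using Ck_on_subset[OF fC] s(2) ball_subset_cball by blast
      have "Re (fourier 0 (\<lambda>y. f (zb + of_real (s/2) * cis y))) \<le> 2 * pi * (Re (f zb) - \<kappa> * (s/2)\<^sup>2)"
      proof (rule circle_mean_le[OF fCs])
        fix z assume z: "z \<in> ball zb s"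
        have zi: "z \<in> chart_im c" using z s(2) ball_subset_cball by blast
        have "\<rho>0 \<le> density Y c z" unfolding \<rho>0_def by (rule z0(2)) (use z in simp)
        then have "\<rho>0\<^sup>2 \<le> (density Y c z)\<^sup>2" using \<rho>0 by (intro power_mono) auto
        then have "\<rho>0\<^sup>2 * Re (\<psi> b) \<le> (density Y c z)\<^sup>2 * Re (f z)" using b[of "param c z"] pos[of b] by (intro mult_mono) (auto simp: f_def)
        then have "\<mu> * (\<rho>0\<^sup>2 * Re (\<psi> b)) \<le> \<mu> * ((density Y c z)\<^sup>2 * Re (f z))" using \<mu> by (intro mult_left_mono) auto
        moreover have "Re (flat_laplacian f z) = - (\<mu> * ((density Y c z)\<^sup>2 * Re (f z)))"
          unfolding fL[OF zi] by (simp add: mult.assoc flip: of_real_power)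
        ultimately show "Re (flat_laplacian f z) \<le> - 4 * \<kappa>" by (simp add: \<kappa>_def mult.assoc)
      qed (use s(1) in auto)
      also have "f zb = \<psi> b" using param_coord[OF ca(1) ca(2)] by (simp add: f_def zb_def)
      also have "2 * pi * (Re (\<psi> b) - \<kappa> * (s/2)\<^sup>2) < 2 * pi * Re (\<psi> b)" using \<kappa> s(1) by simp
      finally have 1: "Re (fourier 0 (\<lambda>y. f (zb + of_real (s/2) * cis y))) < 2 * pi * Re (\<psi> b)" .
      have cc: "continuous_on {0..2*pi} (\<lambda>y. f (zb + of_real (s/2) * cis y))"
        by (rule continuous_on_circle[OF Ck_on_imp_continuous[OF fCs]]) (use s(1) in auto)
      have "((\<lambda>y::real. Re (\<psi> b)) has_integral (2 * pi * Re (\<psi> b))) {0..2*pi}"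
        using has_integral_const_real[of "Re (\<psi> b)" 0 "2*pi"] by simp
      then have "2 * pi * Re (\<psi> b) \<le> Re (fourier 0 (\<lambda>y. f (zb + of_real (s/2) * cis y)))"
        by (rule has_integral_le[OF _ integral_Re_fourier_0[OF cc]]) (use b in \<open>simp add: f_def\<close>)
      with 1 show False by simp
    qed
  qed (use \<delta>(1) in simp)
qed

end

section \<open>The restriction estimate\<close>

text \<open>With \<open>e = exp x\<close>, the conformal factor 2 e / (1 - e^2) of the logarithmic
  coordinate is - 1 / sinh x.\<close>

lemma exp_disc_density:
  assumes "x < 0" "cmod z = exp x"
  shows "exp (2 * x) * (disc_density z)\<^sup>2 = hyp_weight x"
proof -
  define e where "e = exp x"
  have e: "0 < e" "e < 1" using assms(1) by (auto simp: e_def)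
  have e1: "e\<^sup>2 \<noteq> 1" using power_strict_mono[of e 1 2] e by simp
  have "sinh x = (e\<^sup>2 - 1) / (2 * e)"
    using e(1) by (simp add: sinh_def exp_minus flip: e_def) (simp add: field_simps power2_eq_square)
  then have "hyp_weight x = 4 * e\<^sup>2 / (e\<^sup>2 - 1)\<^sup>2"
    by (simp add: hyp_weight_def power_divide power_mult_distrib)
  moreover have "exp (2 * x) = e\<^sup>2" by (simp add: e_def flip: exp_double)
  moreover have "(disc_density z)\<^sup>2 = 4 / (e\<^sup>2 - 1)\<^sup>2"
    unfolding disc_density_def assms(2) e_def[symmetric] by (simp add: power_divide power2_commute)
  ultimately show ?thesis by simp
qed

text \<open>The radial bound with \<open>N = n^2\<close> is applied to each mode, and Bessel's
  inequality on every circle of the annulus adds the modes up again. The bound \<open>B\<close>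
  selects the solutions of the radial equation that are regular at the centre.\<close>

lemma circle_fourier_le_annulus:
  fixes x0 d m0 :: real
  assumes "d > 0" "x0 + 2 * d < 0" "m0 > 0"
  obtains C where "C > 0"
    "\<And>m F B I. m \<ge> m0 \<Longrightarrow> periodic_half_plane F 0 \<Longrightarrow>
      (\<And>w. Re w < 0 \<Longrightarrow> flat_laplacian F w = - of_real (m ^ 6 * hyp_weight (Re w)) * F w) \<Longrightarrow>
      (\<And>w. Re w < 0 \<Longrightarrow> cmod (F w) \<le> B) \<Longrightarrow> finite I \<Longrightarrow>
      (\<Sum>n\<in>I. (cmod (fourier n (\<lambda>y. F (Complex x0 y))))\<^sup>2)
        \<le> C * m * (2 * pi * integral {x0..x0 + 2 * d} (\<lambda>x. integral {0..2*pi} (\<lambda>y. (cmod (F (Complex x y)))\<^sup>2)))"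
proof -
  define x1 where "x1 = x0 + 2 * d"
  have x1: "x0 < x1" "x1 < 0" using assms by (auto simp: x1_def)
  obtain C where C: "C > 0"
    "\<And>m N a a' A. m \<ge> m0 \<Longrightarrow> (\<And>x. x < 0 \<Longrightarrow> (a has_real_derivative a' x) (at x)) \<Longrightarrow>
      (\<And>x. x < 0 \<Longrightarrow> (a' has_real_derivative (N - m ^ 6 * hyp_weight x) * a x) (at x)) \<Longrightarrow>
      (\<And>x. x \<le> x1 \<Longrightarrow> \<bar>a x\<bar> \<le> A) \<Longrightarrow> N \<ge> 0 \<Longrightarrow> (a x0)\<^sup>2 \<le> C * m * integral {x0..x1} (\<lambda>x. (a x)\<^sup>2)"
    using radial_amplitude_bound[OF assms] unfolding x1_def by metis
  show ?thesis
  proof (rule that[OF C(1)])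
    fix m B :: real and F :: "complex \<Rightarrow> complex" and I :: "int set"
    assume m: "m \<ge> m0" and F: "periodic_half_plane F 0" and lap: "\<And>w. Re w < 0 \<Longrightarrow> flat_laplacian F w = - of_real (m ^ 6 * hyp_weight (Re w)) * F w"
      and B: "\<And>w. Re w < 0 \<Longrightarrow> cmod (F w) \<le> B" and I: "finite I"
    interpret periodic_half_plane F 0 by (rule F)
    have cF: "continuous_on {0..2*pi} (\<lambda>y. F (Complex x y))" if "x < 0" for x
      by (rule continuous_on_compose2[OF conts(1)]) (use that in \<open>auto intro!: continuous_intros\<close>)
    have A2: "(A' n has_vector_derivative of_real (of_int (n\<^sup>2) - m ^ 6 * hyp_weight x) * A n x) (at x)" if x: "x < 0" for n x
    proof -
      have "fourier n (\<lambda>y. flat_laplacian F (Complex x y)) = fourier n (\<lambda>y. - of_real (m ^ 6 * hyp_weight x) * F (Complex x y))"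
        using lap x by simp
      also have "\<dots> = - of_real (m ^ 6 * hyp_weight x) * A n x" unfolding A_def by (rule fourier_cmult)
      finally show ?thesis using A'_deriv[OF x, of n] by (simp add: algebra_simps)
    qed
    have Ab: "cmod (A n x) \<le> 2 * pi * B" if "x < 0" for n x
      unfolding A_def by (rule fourier_norm_le[OF cF[OF that]]) (use B that in auto)
    have cA: "continuous_on {x0..x1} (A n)" for n
    proof (rule continuous_at_imp_continuous_on, rule ballI)
      fix x assume "x \<in> {x0..x1}"
      then have "x < 0" using x1 by simp
      then show "isCont (A n) x" using A_deriv has_vector_derivative_continuous by blast
    qed
    \<comment> \<open>The radial equation has real coefficients, so real and imaginary parts are
      solutions and are estimated separately.\<close>
    have one: "(cmod (A n x0))\<^sup>2 \<le> C * m * integral {x0..x1} (\<lambda>x. (cmod (A n x))\<^sup>2)" for n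
    proof -
      have 1: "(Re (A n x0))\<^sup>2 \<le> C * m * integral {x0..x1} (\<lambda>x. (Re (A n x))\<^sup>2)"
      proof (rule C(2)[OF m, of _ "\<lambda>x. Re (A' n x)" "of_int (n\<^sup>2)" "2 * pi * B"])
        fix x :: real assume "x < 0"
        show "((\<lambda>x. Re (A n x)) has_real_derivative Re (A' n x)) (at x)"
          by (rule has_real_derivative_Re[OF A_deriv[OF \<open>x < 0\<close>]])
        show "((\<lambda>x. Re (A' n x)) has_real_derivative (of_int (n\<^sup>2) - m ^ 6 * hyp_weight x) * Re (A n x)) (at x)"
          using has_real_derivative_Re[OF A2[OF \<open>x < 0\<close>, of n]] by simp
      next
        fix x assume "x \<le> x1"
        then show "\<bar>Re (A n x)\<bar> \<le> 2 * pi * B" using Ab[of x n] abs_Re_le_cmod[of "A n x"] x1 by linarith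
      qed simp
      have 2: "(Im (A n x0))\<^sup>2 \<le> C * m * integral {x0..x1} (\<lambda>x. (Im (A n x))\<^sup>2)"
      proof (rule C(2)[OF m, of _ "\<lambda>x. Im (A' n x)" "of_int (n\<^sup>2)" "2 * pi * B"])
        fix x :: real assume "x < 0"
        show "((\<lambda>x. Im (A n x)) has_real_derivative Im (A' n x)) (at x)"
          by (rule has_real_derivative_Im[OF A_deriv[OF \<open>x < 0\<close>]])
        show "((\<lambda>x. Im (A' n x)) has_real_derivative (of_int (n\<^sup>2) - m ^ 6 * hyp_weight x) * Im (A n x)) (at x)"
          using has_real_derivative_Im[OF A2[OF \<open>x < 0\<close>, of n]] by simp
      next
        fix x assume "x \<le> x1"
        then show "\<bar>Im (A n x)\<bar> \<le> 2 * pi * B" using Ab[of x n] abs_Im_le_cmod[of "A n x"] x1 by linarith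
      qed simp
      have "integral {x0..x1} (\<lambda>x. (cmod (A n x))\<^sup>2) = integral {x0..x1} (\<lambda>x. (Re (A n x))\<^sup>2) + integral {x0..x1} (\<lambda>x. (Im (A n x))\<^sup>2)"
        unfolding cmod_power2
        by (rule integral_add) (auto intro!: integrable_continuous_real continuous_intros cA)
      then show ?thesis using add_mono[OF 1 2] unfolding cmod_power2 by (simp add: algebra_simps)
    qed
    have cc: "continuous_on ({x0..x1} \<times> cbox 0 (2*pi)) (\<lambda>(x, y). (cmod (F (Complex x y)))\<^sup>2)"
      unfolding split_beta using x1
      by (intro continuous_intros continuous_on_compose2[OF conts(1)]) auto
    have cI: "continuous_on {x0..x1} (\<lambda>x. integral {0..2*pi} (\<lambda>y. (cmod (F (Complex x y)))\<^sup>2))"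
      using integral_continuous_on_param[OF cc] by simp
    have "(\<Sum>n\<in>I. (cmod (fourier n (\<lambda>y. F (Complex x0 y))))\<^sup>2) \<le> (\<Sum>n\<in>I. C * m * integral {x0..x1} (\<lambda>x. (cmod (A n x))\<^sup>2))"
      using one by (intro sum_mono) (simp add: A_def)
    also have "\<dots> = C * m * integral {x0..x1} (\<lambda>x. \<Sum>n\<in>I. (cmod (A n x))\<^sup>2)"
      by (subst integral_sum) (auto intro!: integrable_continuous_real continuous_intros cA I simp: sum_distrib_left)
    also have "\<dots> \<le> C * m * integral {x0..x1} (\<lambda>x. 2 * pi * integral {0..2*pi} (\<lambda>y. (cmod (F (Complex x y)))\<^sup>2))"
    proof (intro mult_left_mono integral_le)
      show "(\<lambda>x. \<Sum>n\<in>I. (cmod (A n x))\<^sup>2) integrable_on {x0..x1}"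
        by (intro integrable_continuous_real continuous_intros cA)
      show "(\<lambda>x. 2 * pi * integral {0..2*pi} (\<lambda>y. (cmod (F (Complex x y)))\<^sup>2)) integrable_on {x0..x1}"
        by (intro integrable_continuous_real continuous_intros cI)
      show "0 \<le> C * m" using C(1) m assms(3) by simp
      fix x assume "x \<in> {x0..x1}"
      then have "x < 0" using x1 by simp
      from bessel[OF cF[OF this] I] show "(\<Sum>n\<in>I. (cmod (A n x))\<^sup>2) \<le> 2 * pi * integral {0..2*pi} (\<lambda>y. (cmod (F (Complex x y)))\<^sup>2)"
        by (simp add: A_def)
    qed
    finally show "(\<Sum>n\<in>I. (cmod (fourier n (\<lambda>y. F (Complex x0 y))))\<^sup>2)
        \<le> C * m * (2 * pi * integral {x0..x0 + 2 * d} (\<lambda>x. integral {0..2*pi} (\<lambda>y. (cmod (F (Complex x y)))\<^sup>2)))"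
      by (simp add: x1_def)
  qed
qed

context compact_hyperbolic_surface
begin

lemma L2_norm_one_nn_integral:
  assumes "L2_norm_on dv \<phi> = 1"
  shows "(\<integral>\<^sup>+p. ennreal ((cmod (\<phi> p))\<^sup>2) \<partial>dv) = 1"
proof -
  have 1: "(\<integral>p. (cmod (\<phi> p))\<^sup>2 \<partial>dv) = 1" using assms by (simp add: L2_norm_on_def)
  \<comment> \<open>The Bochner integral of a non-integrable function is 0 by convention, so norm 1
    forces integrability.\<close>
  have "integrable dv (\<lambda>p. (cmod (\<phi> p))\<^sup>2)" by (rule ccontr) (use 1 in \<open>simp add: not_integrable_integral_eq\<close>)
  from nn_integral_eq_integral[OF this] show ?thesis by (simp add: 1)
qed

lemma eigenfunction_circle_bound:
  assumes dv: "volume_measure Y dv" and q: "0 < q" "q < 1" and \<Phi>: "local_isometry (ball 0 1) \<Phi>"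
  obtains C where "C > 0" "\<And>\<phi> \<mu>. eigenfunction Y \<phi> \<mu> \<Longrightarrow> L2_norm_on dv \<phi> = 1 \<Longrightarrow> \<mu> > 0 \<Longrightarrow>
    integral {0..2*pi} (\<lambda>y. (cmod (\<phi> (\<Phi> (of_real q * cis y))))\<^sup>2) \<le> C * \<mu> powr (1/6)"
proof -
  define x0 where "x0 = ln q"
  have x0: "x0 < 0" "exp x0 = q" using q by (auto simp: x0_def)
  \<comment> \<open>The annulus then reaches from radius \<open>q\<close> to \<open>sqrt q\<close>,
    at a distance from the boundary of the disc where the weight blows up.\<close>
  define d where "d = - x0 / 4"
  have d: "d > 0" "x0 + 2 * d < 0" using x0(1) by (auto simp: d_def)
  obtain \<mu>0 where \<mu>0: "\<mu>0 > 0" "\<And>\<phi> \<mu>. eigenfunction Y \<phi> \<mu> \<Longrightarrow> \<mu> > 0 \<Longrightarrow> \<mu>0 \<le> \<mu>" using spectral_gap by blast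
  have m0: "\<mu>0 powr (1/6) > 0" using \<mu>0(1) by simp
  obtain C1 where C1: "C1 > 0"
    "\<And>m F B I. m \<ge> \<mu>0 powr (1/6) \<Longrightarrow> periodic_half_plane F 0 \<Longrightarrow>
      (\<And>w. Re w < 0 \<Longrightarrow> flat_laplacian F w = - of_real (m ^ 6 * hyp_weight (Re w)) * F w) \<Longrightarrow>
      (\<And>w. Re w < 0 \<Longrightarrow> cmod (F w) \<le> B) \<Longrightarrow> finite I \<Longrightarrow>
      (\<Sum>n\<in>I. (cmod (fourier n (\<lambda>y. F (Complex x0 y))))\<^sup>2)
        \<le> C1 * m * (2 * pi * integral {x0..x0 + 2 * d} (\<lambda>x. integral {0..2*pi} (\<lambda>y. (cmod (F (Complex x y)))\<^sup>2)))"
    using circle_fourier_le_annulus[OF d m0] by metis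
  define H where "H = {w. Re w < 0}"
  \<comment> \<open>One period of the annulus in logarithmic coordinates; its compactness makes the
    measure comparison with \<open>dv\<close> uniform.\<close>
  define K where "K = cbox (Complex x0 0) (Complex (x0 + 2 * d) (2 * pi))"
  define \<Psi> where "\<Psi> w = \<Phi> (exp w)" for w
  have oH: "open H" unfolding H_def by (rule open_halfspace_Re_lt)
  have KH: "K \<subseteq> H" using d by (auto simp: K_def H_def in_cbox_complex_iff)
  have cK: "compact K" unfolding K_def by (rule compact_cbox)
  have eb: "exp w \<in> ball 0 1" if "w \<in> H" for w using that by (simp add: H_def)
  have c\<Psi>: "continuous_on H \<Psi>" unfolding \<Psi>_def
    by (rule continuous_on_compose2[OF local_isometryD(3)[OF \<Phi>]]) (use eb in \<open>auto intro!: continuous_intros\<close>)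
  have hol: "\<exists>d. d \<noteq> 0 \<and> ((\<lambda>z. coord c (\<Psi> z)) has_field_derivative d) (at w)" if w: "w \<in> H" and c: "c \<in> charts_at Y (\<Psi> w)" for w c
  proof -
    obtain D where D: "((\<lambda>w. coord c (\<Phi> w)) has_field_derivative D) (at (exp w))" "density Y c (coord c (\<Phi> (exp w))) * cmod D = disc_density (exp w)"
      using local_isometryD(4)[OF \<Phi> eb[OF w]] c unfolding \<Psi>_def by blast
    have "disc_density (exp w) > 0" using eb[OF w] by (intro disc_density_pos) simp
    then have "D \<noteq> 0" using D(2) by auto
    moreover have "((\<lambda>z. coord c (\<Psi> z)) has_field_derivative D * exp w) (at w)"
      unfolding \<Psi>_def by (rule DERIV_chain2[OF D(1) DERIV_exp])
    ultimately show ?thesis by (intro exI[of _ "D * exp w"]) simp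
  qed
  obtain C2 where C2: "C2 > 0" "\<And>g. g \<in> borel_measurable borel \<Longrightarrow>
    (\<integral>\<^sup>+w. g (\<Psi> w) * indicator K w \<partial>lborel) \<le> ennreal C2 * (\<integral>\<^sup>+q. g q \<partial>dv)"
    by (rule pullback_nn_integral[OF dv oH KH cK c\<Psi> hol]) blast+
  show ?thesis
  proof (rule that[of "C1 * C2"])
    show "C1 * C2 > 0" using C1(1) C2(1) by simp
    fix \<phi> \<mu> assume e: "eigenfunction Y \<phi> \<mu>" and nm: "L2_norm_on dv \<phi> = 1" and \<mu>: "\<mu> > 0"
    define m where "m = \<mu> powr (1/6)"
    have m6: "m ^ 6 = \<mu>" using \<mu> by (simp add: m_def powr_powr flip: powr_numeral)
    have mm: "m \<ge> \<mu>0 powr (1/6)" unfolding m_def using \<mu>0(1) \<mu>0(2)[OF e \<mu>] by (intro powr_mono2) auto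
    have mpos: "m > 0" using \<mu> by (simp add: m_def)
    have l: "chartwise_eigenfunction \<phi> \<mu>" by (rule eigenfunction_imp_chartwise[OF e])
    have c\<phi>: "continuous_on UNIV \<phi>" by (rule chartwise_eigenfunction_continuous[OF l])
    obtain B where B: "\<And>p. cmod (\<phi> p) \<le> B"
      using compact_imp_bounded[OF compact_continuous_image[OF c\<phi> compact]] unfolding bounded_iff by auto
    define F where "F w = \<phi> (\<Psi> w)" for w
    define f where "f z = \<phi> (\<Phi> z)" for z
    have f: "Ck_on 2 (ball 0 1) f" "\<And>z. z \<in> ball 0 1 \<Longrightarrow> flat_laplacian f z = - of_real (\<mu> * (disc_density z)\<^sup>2) * f z"
      using chartwise_eigenfunction_pullback[OF l \<Phi>] by (auto simp: f_def[abs_def])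
    have Ff: "F = (\<lambda>w. f (0 + exp w))" by (simp add: F_def f_def \<Psi>_def fun_eq_iff)
    have php: "periodic_half_plane F 0" using logpolar_half_plane(1)[OF f(1)] by (simp add: Ff)
    have lap: "flat_laplacian F w = - of_real (m ^ 6 * hyp_weight (Re w)) * F w" if w: "Re w < 0" for w
    proof -
      have "flat_laplacian F w = of_real (exp (2 * Re w)) * flat_laplacian f (exp w)"
        using logpolar_half_plane(2)[OF f(1), of w] w by (simp add: Ff)
      also have "\<dots> = - of_real (\<mu> * (exp (2 * Re w) * (disc_density (exp w))\<^sup>2)) * f (exp w)"
        using f(2)[of "exp w"] eb[of w] w by (simp add: H_def)
      also have "exp (2 * Re w) * (disc_density (exp w))\<^sup>2 = hyp_weight (Re w)"
        by (rule exp_disc_density[OF w]) simp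
      finally show ?thesis by (simp add: m6 Ff)
    qed
    have FB: "cmod (F w) \<le> B" for w using B by (simp add: F_def)
    define J where "J = integral {x0..x0 + 2 * d} (\<lambda>x. integral {0..2*pi} (\<lambda>y. (cmod (F (Complex x y)))\<^sup>2))"
    have cF: "continuous_on H F" unfolding F_def by (rule continuous_on_compose2[OF c\<phi> c\<Psi>]) auto
    have "ennreal J = (\<integral>\<^sup>+w. ennreal ((cmod (F w))\<^sup>2) * indicator K w \<partial>lborel)"
      unfolding J_def K_def
      by (rule nn_integral_rectangle[symmetric]) (auto intro!: continuous_intros continuous_on_subset[OF cF] KH[unfolded K_def, THEN subsetD])
    also have "\<dots> \<le> ennreal C2 * (\<integral>\<^sup>+p. ennreal ((cmod (\<phi> p))\<^sup>2) \<partial>dv)"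
      unfolding F_def by (rule C2(2)) (intro measurable_compose[OF _ measurable_ennreal] borel_measurable_continuous_onI continuous_intros c\<phi>)
    also have "\<dots> = ennreal C2" by (simp add: L2_norm_one_nn_integral[OF nm])
    finally have J: "J \<le> C2" using C2(1) by (simp add: ennreal_le_iff)
    \<comment> \<open>The bound is the same for every finite set of modes, so the error in
      \<open>parseval_approx\<close> can be sent to 0.\<close>
    have S: "(\<Sum>n\<in>I. (cmod (fourier n (\<lambda>y. F (Complex x0 y))))\<^sup>2) \<le> C1 * m * (2 * pi * C2)" if "finite I" for I
    proof -
      have "(\<Sum>n\<in>I. (cmod (fourier n (\<lambda>y. F (Complex x0 y))))\<^sup>2) \<le> C1 * m * (2 * pi * J)"
        unfolding J_def by (rule C1(2)[OF mm php lap FB that])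
      also have "\<dots> \<le> C1 * m * (2 * pi * C2)" using J C1(1) mpos by (intro mult_left_mono) auto
      finally show ?thesis .
    qed
    define G where "G z = f (of_real q * z)" for z
    have Gc: "G (cis y) = F (Complex x0 y)" for y by (simp add: G_def Ff exp_Complex x0(2))
    have cG: "continuous_on (sphere 0 1) G" unfolding G_def
      by (rule continuous_on_compose2[OF Ck_on_imp_continuous[OF f(1)]]) (use q in \<open>auto intro!: continuous_intros simp: norm_mult\<close>)
    have "integral {0..2*pi} (\<lambda>y. (cmod (G (cis y)))\<^sup>2) \<le> C1 * C2 * m"
    proof (rule field_le_epsilon)
      fix \<epsilon> :: real assume "\<epsilon> > 0"
      from parseval_approx[OF cG this] obtain I where I: "finite I"
        "integral {0..2*pi} (\<lambda>y. (cmod (G (cis y)))\<^sup>2) \<le> (\<Sum>n\<in>I. (cmod (fourier n (\<lambda>y. G (cis y))))\<^sup>2) / (2 * pi) + \<epsilon>" by blast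
      have "(\<Sum>n\<in>I. (cmod (fourier n (\<lambda>y. G (cis y))))\<^sup>2) / (2 * pi) \<le> C1 * m * (2 * pi * C2) / (2 * pi)"
        unfolding Gc by (intro divide_right_mono S I(1)) simp
      also have "\<dots> = C1 * C2 * m" by simp
      finally show "integral {0..2*pi} (\<lambda>y. (cmod (G (cis y)))\<^sup>2) \<le> C1 * C2 * m + \<epsilon>" using I(2) by linarith
    qed
    then show "integral {0..2*pi} (\<lambda>y. (cmod (\<phi> (\<Phi> (of_real q * cis y))))\<^sup>2) \<le> C1 * C2 * \<mu> powr (1/6)"
      by (simp add: G_def f_def m_def)
  qed
qed

end

theorem corollaryA:
  fixes Y :: "'a::t2_space surface" and dv :: "'a measure" and y :: 'a and r :: real
  assumes "compact_hyperbolic_surface Y"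
    and "volume_measure Y dv"
    and "r > 0"
  shows "\<exists>C>0. \<forall>u1 u2. orthonormal_basis Y y u1 u2 \<longrightarrow>
    (\<forall>(\<phi> :: 'a \<Rightarrow> complex) (\<mu> :: real).
       eigenfunction Y \<phi> \<mu> \<and> L2_norm_on dv \<phi> = 1 \<and> \<mu> > 0 \<longrightarrow>
       line_integral Y (geodesic_circle Y r y u1 u2) (\<lambda>p. (cmod (\<phi> p))\<^sup>2)
         \<le> C * \<mu> powr (1/6))"
proof -
  interpret compact_hyperbolic_surface Y by (rule assms(1))
  define q where "q = tanh (r / 2)"
  have q: "0 < q" "q < 1" using assms(3) tanh_real_bounds[of "r/2"] by (auto simp: q_def)
  \<comment> \<open>Chosen before any orthonormal basis, which makes the constant independent of
    \<open>u1\<close> and \<open>u2\<close>.\<close>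
  obtain \<Phi> where \<Phi>: "local_isometry (ball 0 1) \<Phi>" "\<Phi> 0 = y" using local_isometry_disc by blast
  obtain C where C: "C > 0" "\<And>\<phi> \<mu>. eigenfunction Y \<phi> \<mu> \<Longrightarrow> L2_norm_on dv \<phi> = 1 \<Longrightarrow> \<mu> > 0 \<Longrightarrow>
    integral {0..2*pi} (\<lambda>y. (cmod (\<phi> (\<Phi> (of_real q * cis y))))\<^sup>2) \<le> C * \<mu> powr (1/6)"
    using eigenfunction_circle_bound[OF assms(2) q \<Phi>(1)] by metis
  \<comment> \<open>This is \<open>sinh r\<close>, the ratio between length on \<sigma> and angle in
    the disc.\<close>
  define s where "s = q * disc_density (of_real q)"
  have s: "s > 0" using q disc_density_pos[of "of_real q"] by (simp add: s_def)
  show ?thesis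
  proof (intro exI[of _ "s * C"] conjI allI impI)
    show "s * C > 0" using s C(1) by simp
    fix u1 u2 \<phi> \<mu> assume o: "orthonormal_basis Y y u1 u2" and e: "eigenfunction Y \<phi> \<mu> \<and> L2_norm_on dv \<phi> = 1 \<and> \<mu> > 0"
    have "continuous_on UNIV (\<lambda>p. (cmod (\<phi> p))\<^sup>2)"
      using e by (intro continuous_intros chartwise_eigenfunction_continuous[OF eigenfunction_imp_chartwise]) auto
    from line_integral_geodesic_circle[OF \<Phi> o assms(3) this]
    have "line_integral Y (geodesic_circle Y r y u1 u2) (\<lambda>p. (cmod (\<phi> p))\<^sup>2) =
        s * integral {0..2*pi} (\<lambda>y. (cmod (\<phi> (\<Phi> (of_real q * cis y))))\<^sup>2)"
      by (simp add: s_def q_def)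
    also have "\<dots> \<le> s * (C * \<mu> powr (1/6))" using C(2)[of \<phi> \<mu>] e s by (intro mult_left_mono) auto
    finally show "line_integral Y (geodesic_circle Y r y u1 u2) (\<lambda>p. (cmod (\<phi> p))\<^sup>2) \<le> s * C * \<mu> powr (1/6)" by (simp add: mult.assoc)
  qed
qed

end
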